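(* Let $\Bbbk$ be a field and let $\Delta$ be a triangulation of a $\Bbbk$-orientable manifold. If the Stanley–Reisner ring $\Bbbk[\Delta]$ is Golod, then $\Delta$ is $2$-neighborly.
   Context: Here $\Delta$ is a simplicial complex. Let $V$ be its vertex set and $S=\Bbbk[X_v : v\in V]$. The Stanley–Reisner ideal of $\Delta$ is $I_\Delta=(\prod_{v\in M}X_v : M\subseteq V, M\notin\Delta)$, and the Stanley–Reisner ring is $\Bbbk[\Delta]=S/I_\Delta$. The complex $\Delta$ is $2$-neighborly if every two vertices are connected by an edge. Golod: let $R=S/\mathfrak{a}$, where $S$ is a polynomial ring in $n$ variables over $\Bbbk$ and $\mathfrak{a}\subset S$ is a monomial ideal, and let $K_R$ be the Koszul complex of $R$ (on the images of the variables). The ring $R$ is Golod if $$\sum_{j\ge 0}\dim_\Bbbk \operatorname{Tor}^R_j(\Bbbk,\Bbbk)\,t^j = \frac{(1+t)^n}{1-\sum_{j\ge 1}\dim_\Bbbk H_j(K_R)\,t^{j+1}}.$$ Equivalently (theorem of Golod), the product and all higher Massey products on $H_*(K_R)$ are trivial, where the product is trivial if the product of every two elements of positive homological degrees is zero, and the higher Massey products are trivial if they are all defined and contain only zero.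
   Formalization: The manifold is assumed connected (and without boundary, as usual); for disconnected manifolds the claim fails, e.g. for two points, where the ring k[x,y]/(xy) is Golod but the two vertices are not joined by an edge. *)

theory Defs
  imports
    "HOL-Analysis.Analysis"
    "HOL-Homology.Homology"
    "HOL-Algebra.QuotRing"
    "HOL-Library.Poly_Mapping"
    "HOL-Library.Countable_Set"
    "HOL-Computational_Algebra.Formal_Power_Series"
begin

section \<open>Simplicial complexes and their realizations\<close>

text \<open>The vertex set of a complex \<open>\<Delta>\<close> is \<open>\<Union>\<Delta>\<close>, so every vertex is a face. The empty set is a
  face as well, since \<open>\<Delta>\<close> is nonempty and closed under subsets.\<close>

definition abstract_simplicial_complex :: "'v set set \<Rightarrow> bool" where
  "abstract_simplicial_complex \<Delta> \<longleftrightarrow>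
     \<Delta> \<noteq> {} \<and> finite \<Delta> \<and> (\<forall>F\<in>\<Delta>. finite F) \<and> (\<forall>F\<in>\<Delta>. \<forall>G. G \<subseteq> F \<longrightarrow> G \<in> \<Delta>)"

definition two_neighborly :: "'v set set \<Rightarrow> bool" where
  "two_neighborly \<Delta> \<longleftrightarrow> (\<forall>u\<in>\<Union>\<Delta>. \<forall>v\<in>\<Union>\<Delta>. {u, v} \<in> \<Delta>)"

definition geometric_realization :: "'v set set \<Rightarrow> ('v \<Rightarrow> real) topology" where
  "geometric_realization \<Delta> =
     subtopology (powertop_real UNIV)
       {a. (\<forall>v. 0 \<le> a v) \<and> {v. a v \<noteq> 0} \<in> \<Delta> \<and> (\<Sum>v\<in>\<Union>\<Delta>. a v) = 1}"

definition triangulates :: "'v set set \<Rightarrow> 'a topology \<Rightarrow> bool" where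
  "triangulates \<Delta> M \<longleftrightarrow>
     abstract_simplicial_complex \<Delta> \<and> geometric_realization \<Delta> homeomorphic_space M"


section \<open>Manifolds and orientability over a field\<close>

definition topological_manifold :: "nat \<Rightarrow> 'a topology \<Rightarrow> bool" where
  "topological_manifold n M \<longleftrightarrow>
     Hausdorff_space M \<and> second_countable M \<and>
     (\<forall>x\<in>topspace M. \<exists>U W. openin M U \<and> x \<in> U \<and> openin (Euclidean_space n) W \<and>
        subtopology M U homeomorphic_space subtopology (Euclidean_space n) W)"

text \<open>The library develops singular homology with integer coefficients only. The following are the
  analogues, with coefficients in \<open>'k\<close>, of \<^const>\<open>singular_chain\<close>, \<^const>\<open>chain_boundary\<close>,
  \<^const>\<open>singular_relcycle\<close> and \<^const>\<open>singular_relboundary\<close>.\<close>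

type_synonym ('a, 'k) fchain = "((nat \<Rightarrow> real) \<Rightarrow> 'a) \<Rightarrow>\<^sub>0 'k"

definition fchains :: "nat \<Rightarrow> 'a topology \<Rightarrow> ('a, 'k::field) fchain set" where
  "fchains p X = {c. Poly_Mapping.keys c \<subseteq> singular_simplex_set p X}"

definition fscale :: "'k::field \<Rightarrow> ('a, 'k) fchain \<Rightarrow> ('a, 'k) fchain" where
  "fscale a c = Poly_Mapping.map ((*) a) c"

definition fboundary :: "nat \<Rightarrow> ('a, 'k::field) fchain \<Rightarrow> ('a, 'k) fchain" where
  "fboundary p c =
     (if p = 0 then 0 else
      \<Sum>f\<in>Poly_Mapping.keys c. \<Sum>i\<le>p.
        Poly_Mapping.single (singular_face p i f) ((- 1) ^ i * Poly_Mapping.lookup c f))"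

definition frelcycles :: "nat \<Rightarrow> 'a topology \<Rightarrow> 'a set \<Rightarrow> ('a, 'k::field) fchain set" where
  "frelcycles p X S = {c \<in> fchains p X. fboundary p c \<in> fchains (p - 1) (subtopology X S)}"

definition frelboundaries :: "nat \<Rightarrow> 'a topology \<Rightarrow> 'a set \<Rightarrow> ('a, 'k::field) fchain set" where
  "frelboundaries p X S =
     {c. \<exists>d\<in>fchains (Suc p) X. fboundary (Suc p) d - c \<in> fchains p (subtopology X S)}"

text \<open>A relative cycle whose class generates the local homology \<open>H\<^sub>n(M, M - {x}; 'k)\<close>.\<close>

definition local_orientation ::
  "nat \<Rightarrow> 'a topology \<Rightarrow> 'a \<Rightarrow> ('a, 'k::field) fchain \<Rightarrow> bool" where
  "local_orientation n M x \<mu> \<longleftrightarrow>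
     \<mu> \<in> frelcycles n M (topspace M - {x}) \<and>
     (\<forall>z\<in>frelcycles n M (topspace M - {x}).
        \<exists>a. z - fscale a \<mu> \<in> frelboundaries n M (topspace M - {x}))"

text \<open>An orientation is a family of local orientations that is locally consistent: near every point
  it is induced by a single class in \<open>H\<^sub>n(M, M - U; 'k)\<close> for some open neighbourhood \<open>U\<close>.
  The classes are given by representing cycles.\<close>

definition orientation ::
  "nat \<Rightarrow> 'a topology \<Rightarrow> ('a \<Rightarrow> ('a, 'k::field) fchain) \<Rightarrow> bool" where
  "orientation n M \<mu> \<longleftrightarrow>
     (\<forall>x\<in>topspace M. local_orientation n M x (\<mu> x)) \<and>
     (\<forall>x\<in>topspace M. \<exists>U. openin M U \<and> x \<in> U \<and>
        (\<exists>c\<in>frelcycles n M (topspace M - U).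
           \<forall>y\<in>U. c - \<mu> y \<in> frelboundaries n M (topspace M - {y})))"

definition orientable_over :: "'k::field itself \<Rightarrow> nat \<Rightarrow> 'a topology \<Rightarrow> bool" where
  "orientable_over _ n M \<longleftrightarrow> (\<exists>\<mu> :: 'a \<Rightarrow> ('a, 'k) fchain. orientation n M \<mu>)"


section \<open>Polynomial rings and Stanley--Reisner ideals\<close>

type_synonym ('v, 'k) mpoly = "('v \<Rightarrow>\<^sub>0 nat) \<Rightarrow>\<^sub>0 'k"

definition Var :: "'v \<Rightarrow> ('v, 'k::field) mpoly" where
  "Var v = Poly_Mapping.single (Poly_Mapping.single v 1) 1"

definition Const :: "'k::field \<Rightarrow> ('v, 'k) mpoly" where
  "Const c = Poly_Mapping.single 0 c"

text \<open>The ring \<open>'k[X\<^sub>v : v \<in> V]\<close>.\<close>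

definition poly_ring :: "'v set \<Rightarrow> ('v, 'k::field) mpoly ring" where
  "poly_ring V =
     \<lparr>carrier = {p. \<forall>m\<in>Poly_Mapping.keys p. Poly_Mapping.keys m \<subseteq> V},
      mult = (*), one = 1, zero = 0, add = (+)\<rparr>"

definition stanley_reisner_ideal :: "'v set set \<Rightarrow> ('v, 'k::field) mpoly set" where
  "stanley_reisner_ideal \<Delta> =
     Idl\<^bsub>poly_ring (\<Union>\<Delta>)\<^esub> {\<Prod>v\<in>M. Var v | M. M \<subseteq> \<Union>\<Delta> \<and> M \<notin> \<Delta>}"


section \<open>Complexes of free modules and their homology\<close>

text \<open>A complex of free \<open>R\<close>-modules of finite rank is given by finite sets \<open>B j\<close> (a basis in degree
  \<open>j\<close>) and matrices \<open>D j\<close> (the differential from degree \<open>j\<close> to degree \<open>j - 1\<close>, for \<open>j \<ge> 1\<close>): the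
  coefficient at \<open>c \<in> B (j - 1)\<close> of the differential of \<open>b \<in> B j\<close> is \<open>D j c b\<close>.\<close>

definition free_module :: "('r, 'm) ring_scheme \<Rightarrow> 'b set \<Rightarrow> ('b \<Rightarrow> 'r) set" where
  "free_module R B = B \<rightarrow>\<^sub>E carrier R"

definition matrix_map ::
  "('r, 'm) ring_scheme \<Rightarrow> 'b set \<Rightarrow> 'c set \<Rightarrow> ('c \<Rightarrow> 'b \<Rightarrow> 'r) \<Rightarrow> ('b \<Rightarrow> 'r) \<Rightarrow> ('c \<Rightarrow> 'r)" where
  "matrix_map R B C A f = (\<lambda>c\<in>C. \<Oplus>\<^bsub>R\<^esub>b\<in>B. A c b \<otimes>\<^bsub>R\<^esub> f b)"

definition cycles ::
  "('r, 'm) ring_scheme \<Rightarrow> (nat \<Rightarrow> 'b set) \<Rightarrow> (nat \<Rightarrow> 'b \<Rightarrow> 'b \<Rightarrow> 'r) \<Rightarrow> nat \<Rightarrow> ('b \<Rightarrow> 'r) set" where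
  "cycles R B D j =
     {f \<in> free_module R (B j).
        j = 0 \<or> matrix_map R (B j) (B (j - 1)) (D j) f = (\<lambda>c\<in>B (j - 1). \<zero>\<^bsub>R\<^esub>)}"

definition boundaries ::
  "('r, 'm) ring_scheme \<Rightarrow> (nat \<Rightarrow> 'b set) \<Rightarrow> (nat \<Rightarrow> 'b \<Rightarrow> 'b \<Rightarrow> 'r) \<Rightarrow> nat \<Rightarrow> ('b \<Rightarrow> 'r) set" where
  "boundaries R B D j =
     matrix_map R (B (Suc j)) (B j) (D (Suc j)) ` free_module R (B (Suc j))"

text \<open>\<open>has_homology_dim R \<kappa> B D j n\<close>: there are \<open>n\<close> cycles whose classes form a \<open>'k\<close>-basis of the
  homology in degree \<open>j\<close>, where \<open>'k\<close> acts on \<open>R\<close> through the ring homomorphism \<open>\<kappa> : 'k \<rightarrow> R\<close>.\<close>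

definition has_homology_dim ::
  "('r, 'm) ring_scheme \<Rightarrow> ('k::field \<Rightarrow> 'r) \<Rightarrow> (nat \<Rightarrow> 'b set) \<Rightarrow> (nat \<Rightarrow> 'b \<Rightarrow> 'b \<Rightarrow> 'r) \<Rightarrow>
   nat \<Rightarrow> nat \<Rightarrow> bool" where
  "has_homology_dim R \<kappa> B D j n \<longleftrightarrow>
     (\<exists>x \<in> {..<n} \<rightarrow> cycles R B D j. \<forall>z\<in>cycles R B D j. \<exists>!a. a \<in> {..<n} \<rightarrow>\<^sub>E UNIV \<and>
        (\<lambda>b\<in>B j. z b \<ominus>\<^bsub>R\<^esub> (\<Oplus>\<^bsub>R\<^esub>i\<in>{..<n}. \<kappa> (a i) \<otimes>\<^bsub>R\<^esub> x i b)) \<in> boundaries R B D j)"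

definition homology_dim ::
  "('r, 'm) ring_scheme \<Rightarrow> ('k::field \<Rightarrow> 'r) \<Rightarrow> (nat \<Rightarrow> 'b set) \<Rightarrow> (nat \<Rightarrow> 'b \<Rightarrow> 'b \<Rightarrow> 'r) \<Rightarrow>
   nat \<Rightarrow> nat" where
  "homology_dim R \<kappa> B D j = (THE n. has_homology_dim R \<kappa> B D j n)"


section \<open>Koszul homology, Tor and the Golod property\<close>

text \<open>The Koszul complex of \<open>R\<close> on the family \<open>(x v)\<close>, \<open>v \<in> V\<close>, has basis \<open>{F. F \<subseteq> V \<and> card F = j}\<close>
  in degree \<open>j\<close>, and the differential maps \<open>F\<close> to the sum over \<open>v \<in> F\<close> of \<open>\<plusminus> x v\<close> times \<open>F - {v}\<close>,
  the sign being given by the parity of the number of elements of \<open>F\<close> before \<open>v\<close>. The order on the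
  finite set \<open>V\<close> is the one of the enumeration \<open>to_nat_on V\<close>.\<close>

definition koszul_basis :: "'v set \<Rightarrow> nat \<Rightarrow> 'v set set" where
  "koszul_basis V j = {F. F \<subseteq> V \<and> card F = j}"

definition koszul_matrix ::
  "('r, 'm) ring_scheme \<Rightarrow> 'v set \<Rightarrow> ('v \<Rightarrow> 'r) \<Rightarrow> nat \<Rightarrow> 'v set \<Rightarrow> 'v set \<Rightarrow> 'r" where
  "koszul_matrix R V x j G F =
     (if \<exists>v\<in>F. G = F - {v} then
        (let v = (THE v. v \<in> F \<and> G = F - {v}) in
         if even (card {u\<in>F. to_nat_on V u < to_nat_on V v}) then x v else \<ominus>\<^bsub>R\<^esub> x v)
      else \<zero>\<^bsub>R\<^esub>)"

definition koszul_homology_dim ::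
  "('r, 'm) ring_scheme \<Rightarrow> ('k::field \<Rightarrow> 'r) \<Rightarrow> 'v set \<Rightarrow> ('v \<Rightarrow> 'r) \<Rightarrow> nat \<Rightarrow> nat" where
  "koszul_homology_dim R \<kappa> V x = homology_dim R \<kappa> (koszul_basis V) (koszul_matrix R V x)"

text \<open>A resolution of the \<open>R\<close>-module \<open>R/\<mm>\<close> by free \<open>R\<close>-modules with bases \<open>{..<\<beta> j}\<close>; the
  augmentation sends the \<open>b\<close>-th basis element in degree \<open>0\<close> to \<open>e b \<in> R/\<mm>\<close>.\<close>

definition augmentation ::
  "('r, 'm) ring_scheme \<Rightarrow> 'r set \<Rightarrow> nat \<Rightarrow> (nat \<Rightarrow> 'r set) \<Rightarrow> (nat \<Rightarrow> 'r) \<Rightarrow> 'r set" where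
  "augmentation R \<mm> n e f = (\<Oplus>\<^bsub>R Quot \<mm>\<^esub>b\<in>{..<n}. (\<mm> +>\<^bsub>R\<^esub> f b) \<otimes>\<^bsub>R Quot \<mm>\<^esub> e b)"

definition free_resolution ::
  "('r, 'm) ring_scheme \<Rightarrow> 'r set \<Rightarrow> (nat \<Rightarrow> nat) \<Rightarrow> (nat \<Rightarrow> nat \<Rightarrow> nat \<Rightarrow> 'r) \<Rightarrow>
   (nat \<Rightarrow> 'r set) \<Rightarrow> bool" where
  "free_resolution R \<mm> \<beta> D e \<longleftrightarrow>
     (\<forall>j\<ge>1. \<forall>c<\<beta> (j - 1). \<forall>b<\<beta> j. D j c b \<in> carrier R) \<and>
     (\<forall>b<\<beta> 0. e b \<in> carrier (R Quot \<mm>)) \<and>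
     augmentation R \<mm> (\<beta> 0) e ` free_module R {..<\<beta> 0} = carrier (R Quot \<mm>) \<and>
     {f \<in> free_module R {..<\<beta> 0}. augmentation R \<mm> (\<beta> 0) e f = \<zero>\<^bsub>R Quot \<mm>\<^esub>}
       = boundaries R (\<lambda>j. {..<\<beta> j}) D 0 \<and>
     (\<forall>j\<ge>1. cycles R (\<lambda>j. {..<\<beta> j}) D j = boundaries R (\<lambda>j. {..<\<beta> j}) D j)"

text \<open>\<open>tor_dims R \<kappa> \<mm> T\<close>: \<open>T j\<close> is the \<open>'k\<close>-dimension of \<open>Tor\<^sub>j\<^sup>R(R/\<mm>, R/\<mm>)\<close> for all \<open>j\<close>. Tensoring a
  complex of free modules with \<open>R/\<mm>\<close> amounts to reducing its matrices modulo \<open>\<mm>\<close>. The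
  homology does not depend on the resolution. Ranks are taken to be finite, which is no restriction
  for noetherian \<open>R\<close>.\<close>

definition tor_dims ::
  "('r, 'm) ring_scheme \<Rightarrow> ('k::field \<Rightarrow> 'r) \<Rightarrow> 'r set \<Rightarrow> (nat \<Rightarrow> nat) \<Rightarrow> bool" where
  "tor_dims R \<kappa> \<mm> T \<longleftrightarrow>
     (\<exists>\<beta> D e. free_resolution R \<mm> \<beta> D e \<and>
        (\<forall>j. T j = homology_dim (R Quot \<mm>) (\<lambda>c. \<mm> +>\<^bsub>R\<^esub> \<kappa> c) (\<lambda>j. {..<\<beta> j})
                     (\<lambda>j c b. \<mm> +>\<^bsub>R\<^esub> D j c b) j))"

text \<open>The Golod property of \<open>R = 'k[X\<^sub>v : v \<in> V]/\<aa>\<close>, with \<open>'k = R/\<mm>\<close> for the ideal \<open>\<mm>\<close> generated by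
  the images of the variables.\<close>

definition golod :: "'v set \<Rightarrow> ('v, 'k::field) mpoly set \<Rightarrow> bool" where
  "golod V \<aa> \<longleftrightarrow>
     (let S = poly_ring V;
          R = S Quot \<aa>;
          x = (\<lambda>v. \<aa> +>\<^bsub>S\<^esub> Var v);
          \<kappa> = (\<lambda>c. \<aa> +>\<^bsub>S\<^esub> Const c);
          \<mm> = Idl\<^bsub>R\<^esub> (x ` V)
      in \<exists>T. tor_dims R \<kappa> \<mm> T \<and>
           (Abs_fps (\<lambda>j. of_nat (T j)) :: rat fps) =
             (1 + fps_X) ^ card V /
             (1 - Abs_fps (\<lambda>i. if i \<ge> 2 then of_nat (koszul_homology_dim R \<kappa> V x (i - 1)) else 0)))"

end

theory Submission
  imports Defs "HOL-Library.Function_Algebras" "Jordan_Normal_Form.Determinant"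
begin

text \<open>Let \<open>K\<close> be the Koszul complex of \<open>R\<close> and \<open>F\<close> a free resolution of \<open>R/\<mm>\<close>. Filtering
  \<open>K \<otimes> F\<close> gives Serre's bound on the dimensions of \<open>Tor\<^sup>R(R/\<mm>, R/\<mm>)\<close> in terms of those of \<open>H(K)\<close>. A
  Golod ring attains the bound, hence every class of \<open>H(K)\<close> is hit by a transgression, and this
  forces the products of \<open>X\<^sub>u e\<^sub>v\<close>, where \<open>X\<^sub>u X\<^sub>v = 0\<close>, with Koszul cycles to be boundaries.

  Suppose that \<open>{u, v}\<close> is no edge of \<open>\<Delta>\<close>. An orientation gives a fundamental cycle \<open>z\<close> that does not
  vanish at some facet containing \<open>u\<close>, whereas a top-dimensional cycle vanishing on the star of \<open>v\<close> is
  zero. By duality, some cocycle of the subcomplex induced on the vertices other than \<open>u\<close> and \<open>v\<close>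
  takes the value \<open>1\<close> on the part of \<open>z\<close> at \<open>u\<close>. The product of \<open>X\<^sub>u e\<^sub>v\<close> with the
  corresponding Koszul cycle takes the value \<open>\<plusminus> 1\<close> on \<open>z\<close>, so it is no boundary. The only facts on local
  homology needed are that a facet represents a nonzero class at its interior points, which follows
  from Sperner's lemma, and that this class is locally constant in terms of the orientation.\<close>

section \<open>Dimension of subquotients\<close>

text \<open>From the Golod property only products with one class are needed, never Massey products.
  A Koszul cycle \<open>z\<close> with coefficients in the maximal ideal, placed in column 0 of the
  total complex, is a boundary \<open>Dt y\<close>, since the homology of that complex is detected
  by the augmentation. Because X_u X_v = 0, multiplying \<open>y\<close> by - X_u e_v gives a chain
  whose leading component is zero and whose total boundary is the product. So the product has died
  before the last transgression of its degree arrives, and the target of that transgression is one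
  dimension too small for Serre's bound to be attained.

  No pages of a spectral sequence are formed: \<open>Xt N q\<close> consists of representatives of
  the Tor classes that survive to page q, and only upper bounds for successive quotients are used.
  Likewise no global homology group of the manifold is computed. The coefficients of the fundamental
  cycle are the inverses of the scalars that compare each facet with the orientation; the size of
  the facets and the existence of two cofacets of a ridge come from invariance of domain.\<close>

lemma homogeneous_system_solution:
  fixes A :: "'i \<Rightarrow> 'j \<Rightarrow> 'k::field"
  assumes "finite J" "finite S" "card J < card S"
  shows "\<exists>b. (\<exists>i\<in>S. b i \<noteq> 0) \<and> (\<forall>j\<in>J. (\<Sum>i\<in>S. b i * A i j) = 0)"
  using assms
proof (induction J arbitrary: S A rule: finite_induct)
  case empty
  then have "S \<noteq> {}" by auto
  then show ?case by (intro exI[of _ "\<lambda>_. 1"]) auto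
next
  case (insert j J)
  show ?case
  proof (cases "\<forall>i\<in>S. A i j = 0")
    case True
    have "card J < card S" using insert by simp
    then obtain b where "\<exists>i\<in>S. b i \<noteq> 0" "\<forall>j\<in>J. (\<Sum>i\<in>S. b i * A i j) = 0"
      using insert.IH[OF insert.prems(1)] by blast
    then show ?thesis using True by (intro exI[of _ b]) auto
  next
    case False
    then obtain p where p: "p \<in> S" "A p j \<noteq> 0" by blast
    \<comment> \<open>Unknown \<open>p\<close> is eliminated: equation \<open>j\<close> expresses
      its value by the others, and \<open>B\<close> is the system left for the remaining
      unknowns.\<close>
    define B where "B i l = A i l - A i j / A p j * A p l" for i l
    have "card J < card (S - {p})" using insert p by simp
    then obtain b where b: "\<exists>i\<in>S-{p}. b i \<noteq> 0" "\<forall>l\<in>J. (\<Sum>i\<in>S-{p}. b i * B i l) = 0"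
      using insert.IH[of "S-{p}" B] insert.prems by blast
    define c where "c = b(p := - (\<Sum>i\<in>S-{p}. b i * (A i j / A p j)))"
    have sp: "(\<Sum>i\<in>S. c i * A i l) = c p * A p l + (\<Sum>i\<in>S-{p}. b i * A i l)" for l
      using p insert.prems by (simp add: sum.remove[of S p] c_def)
    have "(\<Sum>i\<in>S. c i * A i l) = 0" if "l \<in> insert j J" for l
    proof (cases "l = j")
      case True
      then show ?thesis using p unfolding sp
        by (simp add: c_def sum_distrib_right)
    next
      case False
      then have "0 = (\<Sum>i\<in>S-{p}. b i * B i l)" using b that by auto
      also have "\<dots> = (\<Sum>i\<in>S-{p}. b i * A i l) - (\<Sum>i\<in>S-{p}. b i * (A i j / A p j)) * A p l"
        by (simp add: B_def right_diff_distrib sum_subtractf sum_distrib_right mult.assoc)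
      finally show ?thesis unfolding sp by (simp add: c_def)
    qed
    moreover have "\<exists>i\<in>S. c i \<noteq> 0" using b by (auto simp: c_def)
    ultimately show ?thesis by blast
  qed
qed

locale field_space = vector_space scale
  for scale :: "'a::field \<Rightarrow> 'b::ab_group_add \<Rightarrow> 'b"
begin

text \<open>A bound in place of a dimension: subquotients are compared without forming quotient
  spaces.\<close>

definition generated_mod :: "'b set \<Rightarrow> 'b set \<Rightarrow> nat \<Rightarrow> bool" where
  "generated_mod X Y c \<longleftrightarrow>
     (\<exists>x. (\<forall>i<c. x i \<in> X) \<and> (\<forall>z\<in>X. \<exists>a. z - (\<Sum>i<c. scale (a i) (x i)) \<in> Y))"

definition basis_mod :: "'b set \<Rightarrow> 'b set \<Rightarrow> nat \<Rightarrow> (nat \<Rightarrow> 'b) \<Rightarrow> bool" where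
  "basis_mod X Y n x \<longleftrightarrow>
     (\<forall>i<n. x i \<in> X) \<and> (\<forall>z\<in>X. \<exists>a. z - (\<Sum>i<n. scale (a i) (x i)) \<in> Y) \<and>
     (\<forall>a. (\<Sum>i<n. scale (a i) (x i)) \<in> Y \<longrightarrow> (\<forall>i<n. a i = 0))"

lemma generated_mod_trans:
  assumes "subspace Y" "Z \<subseteq> Y" "Y \<subseteq> X" "generated_mod X Y c" "generated_mod Y Z m"
  shows "generated_mod X Z (c + m)"
proof -
  obtain x where x: "\<forall>i<c. x i \<in> X" "\<forall>z\<in>X. \<exists>a. z - (\<Sum>i<c. scale (a i) (x i)) \<in> Y"
    using assms unfolding generated_mod_def by blast
  obtain y where y: "\<forall>i<m . y i \<in> Y" "\<forall>z\<in>Y. \<exists>a. z - (\<Sum>i<m . scale (a i) (y i)) \<in> Z"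
    using assms unfolding generated_mod_def by blast
  define w where "w i = (if i < c then x i else y (i - c))" for i
  have split: "(\<Sum>i<c+m . scale (a i) (w i)) =
      (\<Sum>i<c. scale (a i) (x i)) + (\<Sum>i<m . scale (a (c + i)) (y i))" for a
  proof -
    have "(\<Sum>i<c+m . scale (a i) (w i)) =
      (\<Sum>i<c. scale (a i) (w i)) + (\<Sum>i=c..<c+m . scale (a i) (w i))"
      using sum.atLeastLessThan_concat[of 0 c "c+m" "\<lambda>i. scale (a i) (w i)"]
      by (simp add: lessThan_atLeast0)
    also have "(\<Sum>i=c..<c+m . scale (a i) (w i)) = (\<Sum>i<m . scale (a (c + i)) (w (c + i)))"
      using sum.shift_bounds_nat_ivl[of "\<lambda>i. scale (a i) (w i)" 0 c m] 
      by (simp add: lessThan_atLeast0 add.commute)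
    finally show ?thesis by (simp add: w_def)
  qed
  have "w i \<in> X" if "i < c + m" for i
    using that x(1) y(1) assms(3) by (auto simp: w_def)
  moreover have "\<exists>a. z - (\<Sum>i<c+m . scale (a i) (w i)) \<in> Z" if z: "z \<in> X" for z
  proof -
    obtain a where a: "z - (\<Sum>i<c. scale (a i) (x i)) \<in> Y" using x z by blast
    then obtain b where b: "z - (\<Sum>i<c. scale (a i) (x i)) - (\<Sum>i<m . scale (b i) (y i)) \<in> Z"
      using y by blast
    show ?thesis
      by (rule exI[of _ "\<lambda>i. if i < c then a i else b (i - c)"])
         (use b in \<open>simp add: split diff_diff_eq\<close>)
  qed
  ultimately show ?thesis unfolding generated_mod_def by blast
qed

lemma sum_scale_fun_upd:
  fixes a :: "nat \<Rightarrow> 'a"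
  shows "(\<Sum>i<Suc n. scale (a i) ((x(n := y)) i)) = (\<Sum>i<n. scale (a i) (x i)) + scale (a n) y"
proof -
  have "(\<Sum>i<n. scale (a i) ((x(n := y)) i)) = (\<Sum>i<n. scale (a i) (x i))"
    by (rule sum.cong) auto
  then show ?thesis by (simp only: sum.lessThan_Suc fun_upd_same)
qed

text \<open>The linear relation \<open>\<rho>\<close> stands for the converse of a surjection from a subspace of \<open>A \<rightarrow> 'a\<close>
  onto \<open>X/Y\<close>.\<close>

lemma generated_mod_relation:
  fixes \<rho> :: "('b \<times> ('i \<Rightarrow> 'a)) set"
  assumes "finite A" "subspace X"
    and "\<And>x a y b. (x, a) \<in> \<rho> \<Longrightarrow> (y, b) \<in> \<rho> \<Longrightarrow> (x + y, \<lambda>i. a i + b i) \<in> \<rho>"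
    and "\<And>r x a. (x, a) \<in> \<rho> \<Longrightarrow> (scale r x, \<lambda>i. r * a i) \<in> \<rho>"
    and "\<And>x. x \<in> X \<Longrightarrow> \<exists>a. (x, a) \<in> \<rho>"
    and "\<And>x a. (x, a) \<in> \<rho> \<Longrightarrow> x \<in> X \<Longrightarrow> (\<forall>i\<in>A. a i = 0) \<Longrightarrow> x \<in> Y"
  shows "generated_mod X Y (card A)"
  using assms
proof (induction A arbitrary: X \<rho> rule: finite_induct)
  case empty
  then have "X \<subseteq> Y" by fastforce
  then show ?case unfolding generated_mod_def by auto
next
  case (insert j A)
  \<comment> \<open>Wherever coordinate \<open>j\<close> can be made zero, the subrelation of the
    pairs with \<open>a j = 0\<close> satisfies the hypotheses for \<open>A\<close>.\<close>
  have gA: "generated_mod X' Y (card A)"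
    if "subspace X'" "X' \<subseteq> X" "\<And>x. x \<in> X' \<Longrightarrow> \<exists>a. (x, a) \<in> \<rho> \<and> a j = 0" for X'
    apply (rule insert.IH[of X' "{(x, a) \<in> \<rho>. a j = 0}"])
    subgoal using that by blast
    subgoal using insert.prems(2) by auto
    subgoal using insert.prems(3) by auto
    subgoal using that by auto
    subgoal using that insert.prems(5) by auto
    done
  show ?case
  proof (cases "\<forall>x\<in>X. \<exists>a. (x, a) \<in> \<rho> \<and> a j = 0")
    case True
    then have "generated_mod X Y (card A)" using gA insert.prems(1) by blast
    then obtain x where x: "\<forall>i<card A. x i \<in> X"
        "\<forall>z\<in>X. \<exists>a. z - (\<Sum>i<card A. scale (a i) (x i)) \<in> Y"
      unfolding generated_mod_def by blast
    have c: "card (insert j A) = Suc (card A)" using insert.hyps by simp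
    have "0 \<in> X" using insert.prems(1) by (rule subspace_0)
    moreover have "\<exists>a. z - (\<Sum>i<Suc (card A). scale (a i) ((x(card A := 0)) i)) \<in> Y" if z: "z \<in> X" for z
    proof -
      obtain a where a: "z - (\<Sum>i<card A. scale (a i) (x i)) \<in> Y"
        using x(2) z by blast
      show ?thesis unfolding sum_scale_fun_upd scale_zero_right add_0_right by (rule exI) (rule a)
    qed
    moreover have "(x(card A := 0)) i \<in> X" if "i < Suc (card A)" for i
      using that x(1) \<open>0 \<in> X\<close> by (auto simp: less_Suc_eq)
    ultimately show ?thesis unfolding c generated_mod_def by blast
  next
    case False
    \<comment> \<open>\<open>x0\<close> is the one generator that coordinate \<open>j\<close>
      accounts for: adding a multiple of it moves any element of \<open>X\<close> into the subspace
      \<open>X'\<close> of elements that admit coordinate \<open>j\<close> equal to zero.\<close>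
    then obtain x0 where x0: "x0 \<in> X" "\<nexists>a. (x0, a) \<in> \<rho> \<and> a j = 0" by blast
    then obtain a0 where a0: "(x0, a0) \<in> \<rho>" using insert.prems(4) by blast
    have nz: "a0 j \<noteq> 0" using a0 x0 by blast
    define X' where "X' = {x \<in> X. \<exists>a. (x, a) \<in> \<rho> \<and> a j = 0}"
    have "subspace X'"
    proof (rule subspaceI)
      have "(scale 0 x0, \<lambda>i. 0 * a0 i) \<in> \<rho>" using insert.prems(3)[OF a0] .
      then show "0 \<in> X'" using insert.prems(1) by (auto simp: X'_def subspace_0)
    next
      fix x y assume "x \<in> X'" "y \<in> X'"
      then obtain a b where "x \<in> X" "y \<in> X" "(x, a) \<in> \<rho>" "a j = 0" "(y, b) \<in> \<rho>" "b j = 0"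
        by (auto simp: X'_def)
      then show "x + y \<in> X'" using insert.prems(1) insert.prems(2)[of x a y b]
        by (auto simp: X'_def subspace_add intro!: exI[of _ "\<lambda>i. a i + b i"])
    next
      fix r x assume "x \<in> X'"
      then obtain a where "x \<in> X" "(x, a) \<in> \<rho>" "a j = 0" by (auto simp: X'_def)
      then show "scale r x \<in> X'" using insert.prems(1) insert.prems(3)[of x a r]
        by (auto simp: X'_def subspace_scale intro!: exI[of _ "\<lambda>i. r * a i"])
    qed
    then have "generated_mod X' Y (card A)"
      by (rule gA) (auto simp only: X'_def mem_Collect_eq)
    then obtain x where x: "\<forall>i<card A. x i \<in> X'"
        "\<forall>z\<in>X'. \<exists>a. z - (\<Sum>i<card A. scale (a i) (x i)) \<in> Y"
      unfolding generated_mod_def by blast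
    have c: "card (insert j A) = Suc (card A)" using insert.hyps by simp
    have "\<exists>a. z - (\<Sum>i<Suc (card A). scale (a i) ((x(card A := x0)) i)) \<in> Y" if z: "z \<in> X" for z
    proof -
      obtain a where a: "(z, a) \<in> \<rho>" using insert.prems(4) z by blast
      define r where "r = - a j / a0 j"
      have "(z + scale r x0, \<lambda>i. a i + r * a0 i) \<in> \<rho>"
        using insert.prems(2)[OF a insert.prems(3)[OF a0]] .
      moreover have "a j + r * a0 j = 0" using nz by (simp add: r_def)
      moreover have "z + scale r x0 \<in> X" using z x0 insert.prems(1)
        by (simp add: subspace_add subspace_scale)
      ultimately have "z + scale r x0 \<in> X'" unfolding X'_def by blast
      then obtain b where b: "z + scale r x0 - (\<Sum>i<card A. scale (b i) (x i)) \<in> Y" using x by blast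
      show ?thesis
      proof (rule exI[of _ "b(card A := - r)"])
        have "(\<Sum>i<card A. scale ((b(card A := - r)) i) (x i)) = (\<Sum>i<card A. scale (b i) (x i))"
          by (rule sum.cong) auto
        then show "z - (\<Sum>i<Suc (card A). scale ((b(card A := - r)) i) ((x(card A := x0)) i)) \<in> Y"
          using b unfolding sum_scale_fun_upd by (simp add: algebra_simps)
      qed
    qed
    moreover have "(x(card A := x0)) i \<in> X" if "i < Suc (card A)" for i
      using that x(1) x0(1) by (auto simp: X'_def less_Suc_eq)
    ultimately show ?thesis unfolding c generated_mod_def by blast
  qed
qed

text \<open>The pair \<open>(0, e)\<close> lies in the kernel of the surjection that the relation
  encodes: a multiple of \<open>e\<close> clears coordinate \<open>j\<close> without changing the
  element. The strictness of Serre's bound comes from here.\<close>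

lemma generated_mod_relation_strict:
  fixes \<rho> :: "('b \<times> ('i \<Rightarrow> 'a)) set"
  assumes A: "finite A" and X: "subspace X"
    and add: "\<And>x a y b. (x, a) \<in> \<rho> \<Longrightarrow> (y, b) \<in> \<rho> \<Longrightarrow> (x + y, \<lambda>i. a i + b i) \<in> \<rho>"
    and scl: "\<And>r x a. (x, a) \<in> \<rho> \<Longrightarrow> (scale r x, \<lambda>i. r * a i) \<in> \<rho>"
    and tot: "\<And>x. x \<in> X \<Longrightarrow> \<exists>a. (x, a) \<in> \<rho>"
    and zero: "\<And>x a. (x, a) \<in> \<rho> \<Longrightarrow> x \<in> X \<Longrightarrow> (\<forall>i\<in>A. a i = 0) \<Longrightarrow> x \<in> Y"
    and nz: "(0, e) \<in> \<rho>" "j \<in> A" "e j \<noteq> 0"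
  shows "generated_mod X Y (card A - 1)"
proof -
  have "generated_mod X Y (card (A - {j}))"
  proof (rule generated_mod_relation[of _ _ "{(x, a) \<in> \<rho>. a j = 0}"])
    show "finite (A - {j})" using A by simp
    show "subspace X" by fact
    show "\<exists>a. (x, a) \<in> {(x, a) \<in> \<rho>. a j = 0}" if x: "x \<in> X" for x
    proof -
      obtain a where a: "(x, a) \<in> \<rho>" using tot x by blast
      have "(x + scale (- a j / e j) 0, \<lambda>i. a i + (- a j / e j) * e i) \<in> \<rho>"
        using add[OF a scl[OF nz(1)]] .
      then show ?thesis using nz(3) by (intro exI[of _ "\<lambda>i. a i + (- a j / e j) * e i"]) simp
    qed
    show "x \<in> Y" if "(x, a) \<in> {(x, a) \<in> \<rho>. a j = 0}" "x \<in> X" "\<forall>i\<in>A - {j}. a i = 0" for x a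
      using that zero[of x a] by auto
  qed (use add scl in auto)
  then show ?thesis using A nz by simp
qed

text \<open>If there were more independent classes than generators, their coordinates in the
  generators would satisfy a nontrivial linear relation. The set \<open>X'\<close> may be smaller
  than \<open>X\<close>: the application is to \<open>Zt N\<close> inside
  \<open>Xt N 2\<close>.\<close>

lemma basis_mod_le_generated:
  assumes Y: "subspace Y" and b: "basis_mod X' Y n x" and g: "generated_mod X Y c" and "X' \<subseteq> X"
  shows "n \<le> c"
proof (rule ccontr)
  assume "\<not> n \<le> c"
  then have lt: "card {..<c} < card {..<n}" by simp
  obtain s where s: "\<forall>i<c. s i \<in> X" "\<forall>z\<in>X. \<exists>a. z - (\<Sum>i<c. scale (a i) (s i)) \<in> Y"
    using g unfolding generated_mod_def by blast
  have "\<exists>a. i < n \<longrightarrow> x i - (\<Sum>j<c. scale (a j) (s j)) \<in> Y" for i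
  proof (cases "i < n")
    case True
    then have "x i \<in> X" using b \<open>X' \<subseteq> X\<close> by (auto simp: basis_mod_def)
    then show ?thesis using s(2) by blast
  qed simp
  then obtain A where A: "\<And>i. i < n \<Longrightarrow> x i - (\<Sum>j<c. scale (A i j) (s j)) \<in> Y" by metis
  obtain b' where b': "\<exists>i\<in>{..<n}. b' i \<noteq> 0" "\<forall>j\<in>{..<c}. (\<Sum>i<n. b' i * A i j) = 0"
    using homogeneous_system_solution[OF finite_lessThan finite_lessThan lt, of A] by blast
  have "(\<Sum>i<n. scale (b' i) (x i - (\<Sum>j<c. scale (A i j) (s j)))) \<in> Y"
    using A Y by (intro subspace_sum subspace_scale) auto
  also have "(\<Sum>i<n. scale (b' i) (x i - (\<Sum>j<c. scale (A i j) (s j)))) =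
      (\<Sum>i<n. scale (b' i) (x i)) - (\<Sum>i<n. \<Sum>j<c. scale (b' i * A i j) (s j))"
    by (simp add: scale_right_diff_distrib sum_subtractf scale_sum_right)
  also have "(\<Sum>i<n. \<Sum>j<c. scale (b' i * A i j) (s j)) = (\<Sum>j<c. scale (\<Sum>i<n. b' i * A i j) (s j))"
    by (subst sum.swap) (simp add: scale_sum_left)
  also have "\<dots> = 0" using b' by simp
  finally have "\<forall>i<n. b' i = 0" using b unfolding basis_mod_def by simp
  then show False using b' by auto
qed

lemma basis_mod_imp_generated_mod: "basis_mod X Y n x \<Longrightarrow> generated_mod X Y n"
  unfolding basis_mod_def generated_mod_def by blast

lemma basis_mod_unique:
  assumes "subspace Y" "basis_mod X Y n x" "basis_mod X Y m y"
  shows "n = m"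
  using assms basis_mod_le_generated basis_mod_imp_generated_mod by (meson le_antisym order_refl)

text \<open>A generating family of least size is independent, since a dependency is a pair
  \<open>(0, e)\<close> as in \<open>generated_mod_relation_strict\<close>.\<close>

lemma ex_basis_mod:
  assumes X: "subspace X" and Y: "subspace Y" and g: "generated_mod X Y c"
  shows "\<exists>n x. basis_mod X Y n x"
proof -
  define n where "n = (LEAST c. generated_mod X Y c)"
  have "generated_mod X Y n" unfolding n_def using g by (rule LeastI)
  then obtain x where x: "\<forall>i<n. x i \<in> X" "\<forall>z\<in>X. \<exists>a. z - (\<Sum>i<n. scale (a i) (x i)) \<in> Y"
    unfolding generated_mod_def by blast
  have "\<forall>i<n. e i = 0" if e: "(\<Sum>i<n. scale (e i) (x i)) \<in> Y" for e
  proof (rule ccontr)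
    assume "\<not> (\<forall>i<n. e i = 0)"
    then obtain j where j: "j < n" "e j \<noteq> 0" by blast
    have "generated_mod X Y (card {..<n} - 1)"
    proof (rule generated_mod_relation_strict[of _ _ "{(z, a). z - (\<Sum>i<n. scale (a i) (x i)) \<in> Y}" _ e j])
      fix z a w b
      assume "(z, a) \<in> {(z, a). z - (\<Sum>i<n. scale (a i) (x i)) \<in> Y}"
        "(w, b) \<in> {(z, a). z - (\<Sum>i<n. scale (a i) (x i)) \<in> Y}"
      then have "(z - (\<Sum>i<n. scale (a i) (x i))) + (w - (\<Sum>i<n. scale (b i) (x i))) \<in> Y"
        using Y by (auto intro: subspace_add)
      then show "(z + w, \<lambda>i. a i + b i) \<in> {(z, a). z - (\<Sum>i<n. scale (a i) (x i)) \<in> Y}"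
        by (simp add: scale_left_distrib sum.distrib algebra_simps)
    next
      fix r z a
      assume "(z, a) \<in> {(z, a). z - (\<Sum>i<n. scale (a i) (x i)) \<in> Y}"
      then have "scale r (z - (\<Sum>i<n. scale (a i) (x i))) \<in> Y"
        using Y by (auto intro: subspace_scale)
      then show "(scale r z, \<lambda>i. r * a i) \<in> {(z, a). z - (\<Sum>i<n. scale (a i) (x i)) \<in> Y}"
        by (simp add: scale_right_diff_distrib scale_sum_right)
    next
      show "(0, e) \<in> {(z, a). z - (\<Sum>i<n. scale (a i) (x i)) \<in> Y}"
        using subspace_neg[OF Y e] by simp
    qed (use X x j in auto)
    then have "generated_mod X Y (n - 1)" by simp
    then have "n \<le> n - 1" unfolding n_def by (rule Least_le)
    then show False using j by simp
  qed
  then have "basis_mod X Y n x" unfolding basis_mod_def using x by blast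
  then show ?thesis by blast
qed

end

section \<open>Serre's bound for the Betti numbers of the residue field\<close>

text \<open>For the square of the Koszul differential: the two orders of inserting two elements form
  a cancelling pair.\<close>

lemma sum_antisymmetric_pairs:
  fixes f :: "'x \<Rightarrow> 'x \<Rightarrow> 'p::ab_group_add"
  assumes "finite A" "\<And>x y. x \<in> A \<Longrightarrow> y \<in> A \<Longrightarrow> x \<noteq> y \<Longrightarrow> f x y + f y x = 0"
  shows "(\<Sum>x\<in>A. \<Sum>y\<in>A - {x}. f x y) = 0"
  using assms
proof (induction A rule: finite_induct)
  case (insert a A)
  have "(\<Sum>x\<in>insert a A. \<Sum>y\<in>insert a A - {x}. f x y)
      = (\<Sum>y\<in>A. f a y) + (\<Sum>x\<in>A. \<Sum>y\<in>insert a A - {x}. f x y)"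
    using insert.hyps by (simp add: Diff_insert_absorb)
  also have "(\<Sum>x\<in>A. \<Sum>y\<in>insert a A - {x}. f x y) = (\<Sum>x\<in>A. f x a + (\<Sum>y\<in>A - {x}. f x y))"
  proof (rule sum.cong[OF refl])
    fix x assume "x \<in> A"
    then have "insert a A - {x} = insert a (A - {x})" using insert.hyps by auto
    then show "(\<Sum>y\<in>insert a A - {x}. f x y) = f x a + (\<Sum>y\<in>A - {x}. f x y)"
      using insert.hyps by simp
  qed
  also have "(\<Sum>y\<in>A. f a y) + \<dots> = (\<Sum>x\<in>A. f a x + f x a) + (\<Sum>x\<in>A. \<Sum>y\<in>A - {x}. f x y)"
    by (simp add: sum.distrib add.assoc)
  also have "(\<Sum>x\<in>A. f a x + f x a) = 0"
    using insert by (intro sum.neutral) auto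
  finally show ?case using insert by simp
qed auto

text \<open>The values lie in any commutative ring, so that one sign serves polynomials, field
  elements and simplicial chains alike.\<close>

definition koszul_sign :: "('v \<Rightarrow> nat) \<Rightarrow> 'v \<Rightarrow> 'v set \<Rightarrow> 'p::comm_ring_1" where
  "koszul_sign r v F = (- 1) ^ card {u \<in> F. r u < r v}"

lemma koszul_sign_square [simp]:
  "koszul_sign r v F * koszul_sign r v F = 1"
  "koszul_sign r v F * (koszul_sign r v F * y) = y"
  by (simp_all add: koszul_sign_def power_mult_distrib[symmetric] mult.assoc[symmetric])

lemma koszul_sign_insert:
  assumes "finite F" "x \<notin> F"
  shows "koszul_sign r v (insert x F) = (if r x < r v then - koszul_sign r v F else koszul_sign r v F)"
proof -
  have "{u \<in> insert x F. r u < r v} =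
      (if r x < r v then insert x {u \<in> F. r u < r v} else {u \<in> F. r u < r v})"
    by auto
  then show ?thesis using assms by (auto simp: koszul_sign_def)
qed

lemma koszul_sign_insert_self:
  assumes "finite F" shows "koszul_sign r v (insert v F) = koszul_sign r v F"
  using assms by (cases "v \<in> F") (auto simp: koszul_sign_insert insert_absorb)

text \<open>The ring of interest is \<open>'p\<close> modulo \<open>I\<close>, but everything is
  written in \<open>'p\<close> with congruences modulo \<open>I\<close>. The map \<open>cst\<close>
  is the residue map; \<open>D\<close> and \<open>e\<close> are lifts of the matrices of a free
  resolution of the residue field and of its augmentation. Exactness is an equivalence, so it
  contains both that composites vanish and that cycles bound.\<close>

locale koszul_resolution =
  fixes V :: "'v set" and r :: "'v \<Rightarrow> nat" and I :: "'p::comm_ring_1 set" and X :: "'v \<Rightarrow> 'p"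
    and K :: "'k::field \<Rightarrow> 'p" and cst :: "'p \<Rightarrow> 'k"
    and \<beta> :: "nat \<Rightarrow> nat" and D :: "nat \<Rightarrow> nat \<Rightarrow> nat \<Rightarrow> 'p" and e :: "nat \<Rightarrow> 'k"
  assumes finV: "finite V" and injr: "inj_on r V"
    and I0: "0 \<in> I" and I_add: "\<And>a b. a \<in> I \<Longrightarrow> b \<in> I \<Longrightarrow> a + b \<in> I"
    and I_mult: "\<And>a p. a \<in> I \<Longrightarrow> p * a \<in> I"
    and K1: "K 1 = 1" and K_add: "\<And>a b. K (a + b) = K a + K b"
    and K_mult: "\<And>a b. K (a * b) = K a * K b"
    and cst_add: "\<And>p q. cst (p + q) = cst p + cst q"
    and cst_mult: "\<And>p q. cst (p * q) = cst p * cst q"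
    and cst_K: "\<And>a. cst (K a) = a"
    and cst_X: "\<And>v. v \<in> V \<Longrightarrow> cst (X v) = 0"
    and cst_I: "\<And>p. p \<in> I \<Longrightarrow> cst p = 0"
    and cst_zero: "\<And>p. cst p = 0 \<Longrightarrow> \<exists>g. p - (\<Sum>v\<in>V. X v * g v) \<in> I"
    and aug_onto: "\<exists>b<\<beta> 0. e b \<noteq> 0"
    and aug_exact: "\<And>f. (\<Sum>b<\<beta> 0. e b * cst (f b)) = 0 \<longleftrightarrow>
          (\<exists>g. \<forall>c<\<beta> 0. f c - (\<Sum>b<\<beta> 1. D 1 c b * g b) \<in> I)"
    and res_exact: "\<And>j f. (\<forall>c<\<beta> j. (\<Sum>b<\<beta> (Suc j). D (Suc j) c b * f b) \<in> I) \<longleftrightarrow>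
          (\<exists>g. \<forall>c<\<beta> (Suc j). f c - (\<Sum>b<\<beta> (Suc (Suc j)). D (Suc (Suc j)) c b * g b) \<in> I)"
begin

abbreviation sg :: "'v \<Rightarrow> 'v set \<Rightarrow> 'p" where "sg \<equiv> koszul_sign r"

lemma I_uminus: "a \<in> I \<Longrightarrow> - a \<in> I"
  using I_mult[of a "-1"] by simp

lemma I_diff: "a \<in> I \<Longrightarrow> b \<in> I \<Longrightarrow> a - b \<in> I"
  using I_add[of a "-b"] I_uminus by simp

lemma I_mult2: "a \<in> I \<Longrightarrow> a * p \<in> I"
  using I_mult[of a p] by (simp add: mult.commute)

lemma I_sum: "(\<And>x. x \<in> A \<Longrightarrow> f x \<in> I) \<Longrightarrow> sum f A \<in> I"
  by (induction A rule: infinite_finite_induct) (auto simp: I0 I_add)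

lemma K0: "K 0 = 0" using K_add[of 0 0] by simp
lemma K_sum: "K (sum f A) = (\<Sum>x\<in>A. K (f x))"
  by (induction A rule: infinite_finite_induct) (auto simp: K0 K_add)
lemma cst0: "cst 0 = 0" using cst_add[of 0 0] by (metis add.right_neutral add_left_cancel)
lemma cst1: "cst 1 = 1" using cst_K[of 1] by (simp add: K1)
lemma cst_uminus: "cst (- a) = - cst a"
  using cst_add[of a "-a"] by (simp add: cst0 add_eq_0_iff)
lemma cst_diff: "cst (a - b) = cst a - cst b"
  using cst_add[of a "-b"] by (simp add: cst_uminus)
lemma cst_sum: "cst (sum f A) = (\<Sum>x\<in>A. cst (f x))"
  by (induction A rule: infinite_finite_induct) (auto simp: cst0 cst_add)

subsection \<open>The Koszul complex\<close>

text \<open>One family \<open>c\<close> holds coefficients of all degrees at once,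
  \<open>c F\<close> being the coefficient of the basis element e_F. The value at \<open>F\<close>
  collects the contributions of the sets with one element more.\<close>

definition kd :: "('v set \<Rightarrow> 'p) \<Rightarrow> 'v set \<Rightarrow> 'p" where
  "kd c F = (\<Sum>x\<in>V - F. sg x F * X x * c (insert x F))"

lemma kd_add: "kd (\<lambda>F. c F + c' F) F = kd c F + kd c' F"
  by (simp add: kd_def distrib_left sum.distrib)
lemma kd_diff: "kd (\<lambda>F. c F - c' F) F = kd c F - kd c' F"
  by (simp add: kd_def right_diff_distrib sum_subtractf)
lemma kd_mult: "kd (\<lambda>F. p * c F) F = p * kd c F"
  by (simp add: kd_def sum_distrib_left mult_ac)
lemma kd_zero: "kd (\<lambda>F. 0) F = 0"
  by (simp add: kd_def)
lemma kd_sum: "kd (\<lambda>F. \<Sum>i\<in>A. c i F) F = (\<Sum>i\<in>A. kd (c i) F)"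
  by (induction A rule: infinite_finite_induct) (auto simp: kd_zero kd_add)
lemma kd_I: "F \<subseteq> V \<Longrightarrow> (\<And>G. G \<subseteq> V \<Longrightarrow> card G = Suc (card F) \<Longrightarrow> c G \<in> I) \<Longrightarrow> kd c F \<in> I"
  unfolding kd_def using finV by (auto intro!: I_sum I_mult simp: finite_subset)
lemma cst_kd: "cst (kd c F) = 0"
  by (simp add: kd_def cst_sum cst_mult cst_X)

lemma finite_sub: "F \<subseteq> V \<Longrightarrow> finite F"
  using finV finite_subset by blast

lemma r_neq: "x \<in> V \<Longrightarrow> y \<in> V \<Longrightarrow> x \<noteq> y \<Longrightarrow> r x < r y \<or> r y < r x"
  using inj_onD[OF injr, of x y] by (cases "r x" "r y" rule: linorder_cases) auto

lemma kd_kd: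
  assumes F: "F \<subseteq> V" shows "kd (kd c) F = 0"
proof -
  define f where "f x y = sg x F * X x * (sg y (insert x F) * X y * c (insert y (insert x F)))" for x y
  have d: "V - insert x F = V - F - {x}" for x by auto
  have "kd (kd c) F = (\<Sum>x\<in>V - F. \<Sum>y\<in>V - F - {x}. f x y)"
    unfolding kd_def f_def by (simp only: sum_distrib_left d)
  also have "\<dots> = 0"
  proof (rule sum_antisymmetric_pairs)
    fix x y assume xy: "x \<in> V - F" "y \<in> V - F" "x \<noteq> y"
    have fin: "finite F" using F finite_sub by blast
    have ins: "insert x (insert y F) = insert y (insert x F)" by auto
    have e: "sg y (insert x F) = (if r x < r y then - sg y F else sg y F)"
      "sg x (insert y F) = (if r y < r x then - sg x F else sg x F)"
      using fin xy by (simp_all add: koszul_sign_insert)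
    show "f x y + f y x = 0"
      using xy r_neq[of x y] unfolding f_def e ins by (auto simp: mult_ac)
  qed (use finV in simp)
  finally show ?thesis .
qed

text \<open>Exterior multiplication by e_v from the left.\<close>

definition wedge :: "'v \<Rightarrow> ('v set \<Rightarrow> 'p) \<Rightarrow> 'v set \<Rightarrow> 'p" where
  "wedge v c F = (if v \<in> F then sg v F * c (F - {v}) else 0)"

text \<open>The Leibniz rule for e_v times \<open>c\<close>. Read as a homotopy, it says that
  multiplication by X_v is homotopic to zero on the Koszul complex.\<close>

lemma kd_wedge:
  assumes v: "v \<in> V" and F: "F \<subseteq> V"
  shows "kd (wedge v c) F + wedge v (kd c) F = X v * c F"
proof (cases "v \<in> F")
  case False
  have fin: "finite F" using F finite_sub by blast
  have "kd (wedge v c) F = (\<Sum>x\<in>V - F. if x = v then X v * c F else 0)"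
    unfolding kd_def
  proof (rule sum.cong[OF refl])
    fix x assume "x \<in> V - F"
    then show "sg x F * X x * wedge v c (insert x F) = (if x = v then X v * c F else 0)"
      using False fin by (auto simp: wedge_def koszul_sign_insert_self mult_ac)
  qed
  then show ?thesis using False v finV by (simp add: wedge_def)
next
  case True
  define G where "G = F - {v}"
  have G: "F = insert v G" "v \<notin> G" "finite G" "G \<subseteq> V"
    using True F finite_sub[of F] by (auto simp: G_def)
  have VG: "V - G = insert v (V - F)" "v \<notin> V - F" using v G by auto
  have "wedge v (kd c) F = sg v F * kd c G"
    using True by (simp add: wedge_def G_def)
  also have "kd c G = sg v G * X v * c F + (\<Sum>x\<in>V - F. sg x G * X x * c (insert x G))"
    unfolding kd_def VG(1) using finV VG(2) G by simp
  finally have 1: "wedge v (kd c) F = X v * c F + (\<Sum>x\<in>V - F. sg v F * (sg x G * X x * c (insert x G)))"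
    using G by (simp add: koszul_sign_insert_self distrib_left sum_distrib_left mult.assoc)
  have "kd (wedge v c) F = (\<Sum>x\<in>V - F. - (sg v F * (sg x G * X x * c (insert x G))))"
    unfolding kd_def
  proof (rule sum.cong[OF refl])
    fix x assume x: "x \<in> V - F"
    then have xv: "x \<noteq> v" "x \<notin> G" "x \<in> V" using G by auto
    have e1: "insert x F - {v} = insert x G" using G xv by auto
    have e2: "sg v (insert x F) = (if r x < r v then - sg v F else sg v F)"
      using x F finite_sub by (simp add: koszul_sign_insert)
    have e3: "sg x F = (if r v < r x then - sg x G else sg x G)"
      using G by (simp add: koszul_sign_insert)
    show "sg x F * X x * wedge v c (insert x F) = - (sg v F * (sg x G * X x * c (insert x G)))"
      using r_neq[OF xv(3) v xv(1)] True unfolding wedge_def e1 e2 e3 by (auto simp: mult_ac)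
  qed
  then show ?thesis unfolding 1 by (simp add: sum_negf)
qed

text \<open>The differential is tested in degree \<open>i - 1\<close>; writing this as
  \<open>Suc (card F) = i\<close> leaves no condition for \<open>i = 0\<close>.\<close>

definition Zk :: "nat \<Rightarrow> ('v set \<Rightarrow> 'p) set" where
  "Zk i = {c. \<forall>F\<subseteq>V. Suc (card F) = i \<longrightarrow> kd c F \<in> I}"

definition Bk :: "nat \<Rightarrow> ('v set \<Rightarrow> 'p) set" where
  "Bk i = {c. \<exists>t. \<forall>F\<subseteq>V. card F = i \<longrightarrow> c F - kd t F \<in> I}"

lemma Bk_I: "(\<And>F. F \<subseteq> V \<Longrightarrow> card F = i \<Longrightarrow> c F \<in> I) \<Longrightarrow> c \<in> Bk i"
  unfolding Bk_def by (auto simp: kd_zero intro!: exI[of _ "\<lambda>_. 0"])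

lemma Bk_add: "c \<in> Bk i \<Longrightarrow> c' \<in> Bk i \<Longrightarrow> (\<lambda>F. c F + c' F) \<in> Bk i"
proof -
  assume "c \<in> Bk i" "c' \<in> Bk i"
  then obtain t t' where "\<And>F. F \<subseteq> V \<Longrightarrow> card F = i \<Longrightarrow> c F - kd t F \<in> I"
     "\<And>F. F \<subseteq> V \<Longrightarrow> card F = i \<Longrightarrow> c' F - kd t' F \<in> I" unfolding Bk_def by blast
  then have "\<And>F. F \<subseteq> V \<Longrightarrow> card F = i \<Longrightarrow> (c F - kd t F) + (c' F - kd t' F) \<in> I"
    by (simp add: I_add)
  then show ?thesis unfolding Bk_def
    by (auto intro!: exI[of _ "\<lambda>F. t F + t' F"] simp: kd_add algebra_simps)
qed

lemma Bk_mult: "c \<in> Bk i \<Longrightarrow> (\<lambda>F. p * c F) \<in> Bk i"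
proof -
  assume "c \<in> Bk i"
  then obtain t where "\<And>F. F \<subseteq> V \<Longrightarrow> card F = i \<Longrightarrow> c F - kd t F \<in> I"
    unfolding Bk_def by blast
  then have "\<And>F. F \<subseteq> V \<Longrightarrow> card F = i \<Longrightarrow> p * (c F - kd t F) \<in> I"
    by (simp add: I_mult)
  then show ?thesis unfolding Bk_def
    by (auto intro!: exI[of _ "\<lambda>F. p * t F"] simp: kd_mult right_diff_distrib)
qed

lemma Bk_sum: "(\<And>j. j \<in> A \<Longrightarrow> c j \<in> Bk i) \<Longrightarrow> (\<lambda>F. \<Sum>j\<in>A. c j F) \<in> Bk i"
  by (induction A rule: infinite_finite_induct) (auto simp: I0 intro: Bk_I Bk_add)

lemma Bk_diff: "c \<in> Bk i \<Longrightarrow> c' \<in> Bk i \<Longrightarrow> (\<lambda>F. c F - c' F) \<in> Bk i"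
  using Bk_add[of c i "\<lambda>F. -1 * c' F"] Bk_mult[of c' i "-1"] by simp

lemma Bk_cong: "c \<in> Bk i \<Longrightarrow> (\<And>F. F \<subseteq> V \<Longrightarrow> card F = i \<Longrightarrow> c' F - c F \<in> I) \<Longrightarrow> c' \<in> Bk i"
  using Bk_add[of c i "\<lambda>F. c' F - c F"] Bk_I[of i "\<lambda>F. c' F - c F"] by simp

lemma X_Zk_Bk:
  assumes v: "v \<in> V" and c: "c \<in> Zk i"
  shows "(\<lambda>F. X v * c F) \<in> Bk i"
proof -
  have "X v * c F - kd (wedge v c) F \<in> I" if F: "F \<subseteq> V" "card F = i" for F
  proof -
    have "X v * c F - kd (wedge v c) F = wedge v (kd c) F"
      using kd_wedge[OF v F(1), of c] by (simp add: algebra_simps)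
    also have "\<dots> \<in> I"
    proof (cases "v \<in> F")
      case True
      have "finite F" using F finite_sub by blast
      then have "Suc (card (F - {v})) = i" using True F by (metis card_Suc_Diff1)
      moreover have "F - {v} \<subseteq> V" using F by auto
      ultimately have "kd c (F - {v}) \<in> I" using c unfolding Zk_def by blast
      then show ?thesis using True by (simp add: wedge_def I_mult)
    qed (simp add: wedge_def I0)
    finally show ?thesis .
  qed
  then show ?thesis unfolding Bk_def by blast
qed

text \<open>An element with \<open>cst p = 0\<close> is a combination of the variables modulo
  \<open>I\<close>, and each variable acts as zero on Koszul homology.\<close>

lemma max_Zk_Bk:
  assumes p: "cst p = 0" and c: "c \<in> Zk i"
  shows "(\<lambda>F. p * c F) \<in> Bk i"
proof -
  obtain g where g: "p - (\<Sum>v\<in>V. X v * g v) \<in> I" using cst_zero[OF p] by blast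
  have "(\<lambda>F. \<Sum>v\<in>V. g v * (X v * c F)) \<in> Bk i"
    by (rule Bk_sum, rule Bk_mult, rule X_Zk_Bk[OF _ c])
  then show ?thesis
  proof (rule Bk_cong)
    fix F
    have "p * c F - (\<Sum>v\<in>V. g v * (X v * c F)) = (p - (\<Sum>v\<in>V. X v * g v)) * c F"
      by (simp add: right_diff_distrib left_diff_distrib sum_distrib_left mult_ac)
    also have "\<dots> \<in> I" using g by (rule I_mult2)
    finally show "p * c F - (\<Sum>v\<in>V. g v * (X v * c F)) \<in> I" .
  qed
qed

subsection \<open>The total complex\<close>

definition dm :: "nat \<Rightarrow> (nat \<Rightarrow> 'p) \<Rightarrow> nat \<Rightarrow> 'p" where
  "dm j f c = (\<Sum>b<\<beta> j. D j c b * f b)"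

lemma dm_add: "dm j (\<lambda>b. f b + g b) c = dm j f c + dm j g c"
  by (simp add: dm_def distrib_left sum.distrib)
lemma dm_diff: "dm j (\<lambda>b. f b - g b) c = dm j f c - dm j g c"
  by (simp add: dm_def right_diff_distrib sum_subtractf)
lemma dm_mult: "dm j (\<lambda>b. p * f b) c = p * dm j f c"
  by (simp add: dm_def sum_distrib_left mult_ac)
lemma dm_mult2: "dm j (\<lambda>b. f b * p) c = dm j f c * p"
  by (simp add: dm_def sum_distrib_left mult_ac)
lemma dm_zero: "dm j (\<lambda>b. 0) c = 0"
  by (simp add: dm_def)
lemma dm_sum: "dm j (\<lambda>b. \<Sum>i\<in>A. f i b) c = (\<Sum>i\<in>A. dm j (f i) c)"
  by (induction A rule: infinite_finite_induct) (auto simp: dm_zero dm_add)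
lemma dm_I: "(\<And>b. b < \<beta> j \<Longrightarrow> f b \<in> I) \<Longrightarrow> dm j f c \<in> I"
  unfolding dm_def by (auto intro!: I_sum I_mult)

lemma dm_dm: "c < \<beta> j \<Longrightarrow> dm (Suc j) (dm (Suc (Suc j)) g) c \<in> I"
  using res_exact[of j "dm (Suc (Suc j)) g"] unfolding dm_def
  by (auto simp: I0 intro!: exI[of _ g])

lemma aug_dm: "(\<Sum>b<\<beta> 0. e b * cst (dm 1 g b)) = 0"
  using aug_exact[of "dm 1 g"] unfolding dm_def by (auto simp: I0 intro!: exI[of _ g])

lemma kd_dm: "kd (\<lambda>F. dm j (f F) c) F = dm j (\<lambda>b. kd (\<lambda>F. f F b) F) c"
  unfolding dm_def kd_def
  by (simp add: sum_distrib_left, subst sum.swap) (simp add: mult_ac)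

text \<open>The total differential of the Koszul complex tensored with the resolution. Here
  \<open>w s F b\<close> is the coefficient of e_F tensor the basis element \<open>b\<close> in
  resolution degree \<open>s\<close>, of total degree \<open>s + card F\<close>; \<open>s\<close> is
  called the column. The sign makes the two differentials anticommute.\<close>

definition Dt :: "(nat \<Rightarrow> 'v set \<Rightarrow> nat \<Rightarrow> 'p) \<Rightarrow> nat \<Rightarrow> 'v set \<Rightarrow> nat \<Rightarrow> 'p" where
  "Dt w s F b = kd (\<lambda>G. w s G b) F + (- 1) ^ card F * dm (Suc s) (w (Suc s) F) b"

lemma Dt_add: "Dt (\<lambda>s F b. w s F b + w' s F b) s F b = Dt w s F b + Dt w' s F b"
  by (simp add: Dt_def kd_add dm_add algebra_simps)
lemma Dt_diff: "Dt (\<lambda>s F b. w s F b - w' s F b) s F b = Dt w s F b - Dt w' s F b"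
  by (simp add: Dt_def kd_diff dm_diff algebra_simps)
lemma Dt_mult: "Dt (\<lambda>s F b. p * w s F b) s F b = p * Dt w s F b"
  by (simp add: Dt_def kd_mult dm_mult algebra_simps)

lemma Dt_Dt:
  assumes F: "F \<subseteq> V" and b: "b < \<beta> s"
  shows "Dt (Dt w) s F b \<in> I"
proof -
  have fin: "finite F" using F finite_sub by blast
  have 1: "kd (\<lambda>G. (- 1) ^ card G * dm (Suc s) (w (Suc s) G) b) F
      = - ((- 1) ^ card F * dm (Suc s) (\<lambda>b. kd (\<lambda>G. w (Suc s) G b) F) b)"
    unfolding kd_dm[symmetric] unfolding kd_def using fin
    by (simp add: sum_distrib_left sum_negf[symmetric] mult_ac)
  have "Dt (Dt w) s F b = kd (kd (\<lambda>G. w s G b)) F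
      + kd (\<lambda>G. (- 1) ^ card G * dm (Suc s) (w (Suc s) G) b) F
      + (- 1) ^ card F * dm (Suc s) (\<lambda>b. kd (\<lambda>G. w (Suc s) G b) F) b
      + (- 1) ^ card F * ((- 1) ^ card F * dm (Suc s) (dm (Suc (Suc s)) (w (Suc (Suc s)) F)) b)"
    unfolding Dt_def by (simp add: kd_add dm_add dm_mult algebra_simps)
  also have "\<dots> = (- 1) ^ card F * ((- 1) ^ card F * dm (Suc s) (dm (Suc (Suc s)) (w (Suc (Suc s)) F)) b)"
    by (simp add: 1 kd_kd[OF F])
  also have "\<dots> \<in> I" using dm_dm[OF b] by (intro I_mult)
  finally show ?thesis .
qed

text \<open>For fixed Koszul degree the resolution is exact up to the residue field tensored with a
  free Koszul module, and on these residues the Koszul differential is zero (\<open>cst_kd\<close>).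
  So a total cycle bounds as soon as its augmentation in column 0 vanishes. The proof is the
  staircase argument, correcting the columns one by one for increasing \<open>s\<close>.\<close>

lemma total_exact:
  assumes cyc: "\<And>s F b. F \<subseteq> V \<Longrightarrow> Suc (s + card F) = N \<Longrightarrow> b < \<beta> s \<Longrightarrow> Dt w s F b \<in> I"
    and aug: "\<And>F. F \<subseteq> V \<Longrightarrow> card F = N \<Longrightarrow> (\<Sum>b<\<beta> 0. e b * cst (w 0 F b)) = 0"
  shows "\<exists>u. \<forall>s F b. F \<subseteq> V \<longrightarrow> s + card F = N \<longrightarrow> b < \<beta> s \<longrightarrow> w s F b - Dt u s F b \<in> I"
proof -
  have "\<exists>u. \<forall>s<k. \<forall>F b. F \<subseteq> V \<longrightarrow> s + card F = N \<longrightarrow> b < \<beta> s \<longrightarrow> w s F b - Dt u s F b \<in> I" for k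
  proof (induction k)
    case (Suc k)
    then obtain u where u: "\<And>s F b. s < k \<Longrightarrow> F \<subseteq> V \<Longrightarrow> s + card F = N \<Longrightarrow> b < \<beta> s \<Longrightarrow>
      w s F b - Dt u s F b \<in> I" by blast
    define w' where "w' = (\<lambda>s F b. w s F b - Dt u s F b)"
    have cyc': "Dt w' s F b \<in> I" if "F \<subseteq> V" "Suc (s + card F) = N" "b < \<beta> s" for s F b
      unfolding w'_def Dt_diff using cyc[OF that] Dt_Dt[of F b s u] that by (intro I_diff) auto
    have "\<exists>g. \<forall>c<\<beta> k. w' k F c - dm (Suc k) g c \<in> I" if F: "F \<subseteq> V" "k + card F = N" for F
    proof (cases k)
      case 0
      have "(\<Sum>b<\<beta> 0. e b * cst (Dt u 0 F b)) = (- 1) ^ card F * (\<Sum>b<\<beta> 0. e b * cst (dm 1 (u 1 F) b))"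
      proof -
        have "cst ((- 1) ^ n) = (- 1) ^ n" for n
          by (induction n) (auto simp: cst1 cst_mult cst_uminus)
        then show ?thesis
          by (simp add: Dt_def cst_add cst_kd cst_mult sum_distrib_left mult_ac)
      qed
      also have "\<dots> = 0" by (simp only: aug_dm mult_zero_right)
      finally have "(\<Sum>b<\<beta> 0. e b * cst (w' 0 F b)) = 0"
        using aug[of F] F 0 by (simp add: w'_def cst_diff right_diff_distrib sum_subtractf)
      then show ?thesis using aug_exact 0 unfolding dm_def by auto
    next
      case (Suc l)
      have "dm k (w' k F) c \<in> I" if c: "c < \<beta> l" for c
      proof -
        have "Dt w' l F c \<in> I" using cyc' F c Suc by simp
        moreover have "kd (\<lambda>G. w' l G c) F \<in> I"
          using u[of l _ c] F c Suc by (intro kd_I) (auto simp: w'_def)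
        ultimately have "(- 1) ^ card F * dm k (w' k F) c \<in> I"
          unfolding Dt_def Suc using I_diff by fastforce
        then have "(- 1) ^ card F * ((- 1) ^ card F * dm k (w' k F) c) \<in> I" by (rule I_mult)
        then show ?thesis by (simp add: mult.assoc[symmetric] power_mult_distrib[symmetric])
      qed
      then show ?thesis using res_exact[of l "w' k F"] Suc unfolding dm_def by auto
    qed
    then obtain g where g: "\<And>F c. F \<subseteq> V \<Longrightarrow> k + card F = N \<Longrightarrow> c < \<beta> k \<Longrightarrow> w' k F c - dm (Suc k) (g F) c \<in> I"
      by metis
    \<comment> \<open>Only column \<open>k + 1\<close> is filled, which changes \<open>Dt u\<close>
      in columns \<open>k\<close> and \<open>k + 1\<close>; the congruences obtained in smaller
      columns persist.\<close>
    define u' where "u' = (\<lambda>s F b. if s = Suc k then (- 1) ^ card F * g F b else 0)"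
    have u'1: "Dt u' s F b = 0" if "s < k" for s F b
      using that by (simp add: Dt_def u'_def kd_zero dm_zero)
    have u'2: "Dt u' k F b = dm (Suc k) (g F) b" for F b
      by (simp add: Dt_def u'_def kd_zero dm_mult mult.assoc[symmetric] power_mult_distrib[symmetric])
    have "w s F b - Dt (\<lambda>s F b. u s F b + u' s F b) s F b \<in> I"
      if "s < Suc k" "F \<subseteq> V" "s + card F = N" "b < \<beta> s" for s F b
    proof (cases "s < k")
      case True
      then show ?thesis using u that by (simp add: Dt_add u'1)
    next
      case False
      then have "s = k" using that by simp
      then show ?thesis using g that by (simp add: Dt_add u'2 w'_def diff_diff_eq)
    qed
    then show ?case by blast
  qed auto
  from this[of "Suc N"] obtain u where "\<And>s F b. s < Suc N \<Longrightarrow> F \<subseteq> V \<Longrightarrow> s + card F = N \<Longrightarrow> b < \<beta> s \<Longrightarrow>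
      w s F b - Dt u s F b \<in> I" by blast
  then show ?thesis by (intro exI[of _ u]) auto
qed

end

lemma sum_fun_apply: "(sum f A) x = (\<Sum>i\<in>A. f i x)"
  by (induction A rule: infinite_finite_induct) auto

context koszul_resolution
begin

section \<open>Koszul homology and Tor as vector spaces over the field\<close>

sublocale kos: field_space "\<lambda>a (c :: 'v set \<Rightarrow> 'p) F. K a * c F"
  by unfold_locales (auto simp: K_add K_mult K1 algebra_simps)

sublocale tor: field_space "\<lambda>a (x :: nat \<Rightarrow> 'k) b. a * x b"
  by unfold_locales (auto simp: algebra_simps)

text \<open>Cycles of the resolution reduced modulo the maximal ideal; modulo \<open>Bt s\<close>
  they give Tor in degree \<open>s\<close>. The quantifier over \<open>q\<close> makes every vector
  a cycle for \<open>s = 0\<close>.\<close>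

definition Zt :: "nat \<Rightarrow> (nat \<Rightarrow> 'k) set" where
  "Zt s = {x. \<forall>q. s = Suc q \<longrightarrow> (\<forall>c<\<beta> q. (\<Sum>b<\<beta> s. cst (D s c b) * x b) = 0)}"

definition Bt :: "nat \<Rightarrow> (nat \<Rightarrow> 'k) set" where
  "Bt s = {x. \<exists>y. \<forall>c<\<beta> s. x c = (\<Sum>b<\<beta> (Suc s). cst (D (Suc s) c b) * y b)}"

lemma subspace_Bk: "kos.subspace (Bk i)"
  unfolding kos.subspace_def plus_fun_def zero_fun_def
  by (auto intro: Bk_I I0 Bk_add Bk_mult)

lemma subspace_Zk: "kos.subspace (Zk i)"
  unfolding kos.subspace_def plus_fun_def zero_fun_def Zk_def
  by (auto simp: kd_zero kd_add kd_mult I0 I_add I_mult)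

lemma subspace_Zt: "tor.subspace (Zt s)"
  unfolding tor.subspace_def Zt_def
  by (auto simp: distrib_left sum.distrib mult.left_commute sum_distrib_left[symmetric])

lemma subspace_Bt: "tor.subspace (Bt s)"
proof (rule tor.subspaceI)
  show "0 \<in> Bt s" unfolding Bt_def by (auto intro!: exI[of _ "\<lambda>_. 0"])
next
  fix x y assume "x \<in> Bt s" "y \<in> Bt s"
  then obtain x' y' where
    "\<forall>c<\<beta> s. x c = (\<Sum>b<\<beta> (Suc s). cst (D (Suc s) c b) * x' b)"
    "\<forall>c<\<beta> s. y c = (\<Sum>b<\<beta> (Suc s). cst (D (Suc s) c b) * y' b)"
    unfolding Bt_def by blast
  then show "x + y \<in> Bt s" unfolding Bt_def
    by (auto intro!: exI[of _ "\<lambda>b. x' b + y' b"] simp: distrib_left sum.distrib)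
next
  fix a x assume "x \<in> Bt s"
  then obtain x' where "\<forall>c<\<beta> s. x c = (\<Sum>b<\<beta> (Suc s). cst (D (Suc s) c b) * x' b)"
    unfolding Bt_def by blast
  then show "(\<lambda>b. a * x b) \<in> Bt s" unfolding Bt_def
    by (auto intro!: exI[of _ "\<lambda>b. a * x' b"] simp: mult.left_commute sum_distrib_left)
qed

lemma kos_basis_modD:
  assumes "kos.basis_mod (Zk i) (Bk i) h \<zeta>"
  shows "\<And>j. j < h \<Longrightarrow> \<zeta> j \<in> Zk i"
    and "\<And>z. z \<in> Zk i \<Longrightarrow> \<exists>a. (\<lambda>F. z F - (\<Sum>j<h. K (a j) * \<zeta> j F)) \<in> Bk i"
    and "\<And>a j. (\<lambda>F. \<Sum>j<h. K (a j) * \<zeta> j F) \<in> Bk i \<Longrightarrow> j < h \<Longrightarrow> a j = 0"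
  using assms unfolding kos.basis_mod_def by (auto simp: fun_diff_def sum_fun_apply[abs_def])

lemma tor_basis_modD:
  assumes "tor.basis_mod (Zt s) (Bt s) n \<xi>"
  shows "\<And>z. z \<in> Zt s \<Longrightarrow> \<exists>a \<psi>. \<forall>b<\<beta> s. z b - (\<Sum>l<n. a l * \<xi> l b)
           = (\<Sum>b'<\<beta> (Suc s). cst (D (Suc s) b b') * \<psi> b')"
proof -
  fix z assume "z \<in> Zt s"
  then obtain a where "z - (\<Sum>l<n. (\<lambda>b. a l * \<xi> l b)) \<in> Bt s"
    using assms unfolding tor.basis_mod_def by blast
  then show "\<exists>a \<psi>. \<forall>b<\<beta> s. z b - (\<Sum>l<n. a l * \<xi> l b)
           = (\<Sum>b'<\<beta> (Suc s). cst (D (Suc s) b b') * \<psi> b')"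
    unfolding Bt_def by (auto simp: sum_fun_apply)
qed

definition tens :: "nat \<Rightarrow> nat \<Rightarrow> (nat \<Rightarrow> 'v set \<Rightarrow> 'p) \<Rightarrow> (nat \<Rightarrow> nat \<Rightarrow> 'k) \<Rightarrow> (nat \<times> nat \<Rightarrow> 'k) \<Rightarrow> nat \<Rightarrow> 'v set \<Rightarrow> 'p" where
  "tens h n \<zeta> \<xi> a b F = (\<Sum>j<h. (\<Sum>l<n. K (a (j, l) * \<xi> l b)) * \<zeta> j F)"

text \<open>A cycle of the complex \<open>H\<^sub>i(K) \<otimes> F\<^sub>s\<close> is, modulo boundaries, a combination of the classes
  \<open>\<zeta>\<^sub>j \<otimes> \<xi>\<^sub>l\<close>: the Koszul homology is annihilated by the maximal ideal.\<close>

lemma koszul_tensor_decomposition: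
  assumes zeta: "kos.basis_mod (Zk i) (Bk i) h \<zeta>" and xi: "tor.basis_mod (Zt s) (Bt s) n \<xi>"
    and y: "\<And>b. b < \<beta> s \<Longrightarrow> (\<lambda>F. y F b) \<in> Zk i"
    and dy: "\<And>q c. s = Suc q \<Longrightarrow> c < \<beta> q \<Longrightarrow> (\<lambda>F. dm s (y F) c) \<in> Bk i"
  shows "\<exists>a \<psi>. \<forall>b<\<beta> s. (\<lambda>F. y F b - tens h n \<zeta> \<xi> a b F
           - (\<Sum>j<h. dm (Suc s) (\<lambda>b'. K (\<psi> j b')) b * \<zeta> j F)) \<in> Bk i"
proof -
  note z = kos_basis_modD[OF zeta]
  \<comment> \<open>At each basis element \<open>b\<close> the family \<open>y\<close> is a Koszul
    cycle; \<open>cc b j\<close> are the coordinates of its class in the basis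
    \<open>\<zeta>\<close>.\<close>
  have "\<forall>b\<in>{..<\<beta> s}. \<exists>c. (\<lambda>F. y F b - (\<Sum>j<h. K (c j) * \<zeta> j F)) \<in> Bk i"
    using z(2)[OF y] by blast
  from bchoice[OF this] obtain cc
    where cc: "\<And>b. b < \<beta> s \<Longrightarrow> (\<lambda>F. y F b - (\<Sum>j<h. K (cc b j) * \<zeta> j F)) \<in> Bk i" by blast
  \<comment> \<open>The matrix entries act on Koszul homology through \<open>cst\<close>.
    Independence of the \<open>\<zeta> j\<close> therefore turns \<open>dy\<close> into a cycle
    condition on each coordinate vector over the field.\<close>
  have ccZ: "(\<lambda>b. cc b j) \<in> Zt s" if j: "j < h" for j
    unfolding Zt_def
  proof (clarify)
    fix q c assume q: "s = Suc q" "c < \<beta> q"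
    define p where "p j = (\<Sum>b<\<beta> s. D s c b * K (cc b j))" for j
    have "(\<lambda>F. dm s (y F) c - (\<Sum>b<\<beta> s. D s c b * (y F b - (\<Sum>j<h. K (cc b j) * \<zeta> j F)))) \<in> Bk i"
      by (rule Bk_diff[OF dy[OF q] Bk_sum[OF Bk_mult[OF cc]]]) simp
    also have "(\<lambda>F. dm s (y F) c - (\<Sum>b<\<beta> s. D s c b * (y F b - (\<Sum>j<h. K (cc b j) * \<zeta> j F))))
        = (\<lambda>F. \<Sum>j<h. p j * \<zeta> j F)"
    proof
      fix F
      have "(\<Sum>b<\<beta> s. D s c b * (\<Sum>j<h. K (cc b j) * \<zeta> j F)) = (\<Sum>j<h. p j * \<zeta> j F)"
        unfolding p_def sum_distrib_left sum_distrib_right by (subst sum.swap) (simp add: mult.assoc)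
      then show "dm s (y F) c - (\<Sum>b<\<beta> s. D s c b * (y F b - (\<Sum>j<h. K (cc b j) * \<zeta> j F)))
        = (\<Sum>j<h. p j * \<zeta> j F)"
        by (simp add: dm_def right_diff_distrib sum_subtractf)
    qed
    finally have 1: "(\<lambda>F. \<Sum>j<h. p j * \<zeta> j F) \<in> Bk i" .
    have "(\<lambda>F. (\<Sum>j<h. p j * \<zeta> j F) - (\<Sum>j<h. (p j - K (cst (p j))) * \<zeta> j F)) \<in> Bk i"
      by (intro Bk_diff[OF 1] Bk_sum max_Zk_Bk z(1)) (auto simp: cst_diff cst_K)
    then have "(\<lambda>F. \<Sum>j<h. K (cst (p j)) * \<zeta> j F) \<in> Bk i"
      by (simp add: left_diff_distrib sum_subtractf)
    then have "cst (p j) = 0" using z(3)[of "\<lambda>j. cst (p j)" j] j by blast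
    then show "(\<Sum>b<\<beta> (Suc q). cst (D (Suc q) c b) * cc b j) = 0"
      unfolding p_def q by (simp add: cst_sum cst_mult cst_K)
  qed
  have "\<forall>j\<in>{..<h}. \<exists>p. \<forall>b<\<beta> s. cc b j - (\<Sum>l<n. fst p l * \<xi> l b)
           = (\<Sum>b'<\<beta> (Suc s). cst (D (Suc s) b b') * snd p b')"
    using tor_basis_modD[OF xi ccZ] by simp
  from bchoice[OF this] obtain p where p: "\<And>j b. j < h \<Longrightarrow> b < \<beta> s \<Longrightarrow>
      cc b j - (\<Sum>l<n. fst (p j) l * \<xi> l b) = (\<Sum>b'<\<beta> (Suc s). cst (D (Suc s) b b') * snd (p j) b')"
    by blast
  define a \<psi> where "a = (\<lambda>j. fst (p j))" and "\<psi> = (\<lambda>j. snd (p j))"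
  have a: "cc b j - (\<Sum>l<n. a j l * \<xi> l b) = (\<Sum>b'<\<beta> (Suc s). cst (D (Suc s) b b') * \<psi> j b')"
    if "j < h" "b < \<beta> s" for j b
    using p[OF that] by (simp add: a_def \<psi>_def)
  have "(\<lambda>F. y F b - tens h n \<zeta> \<xi> (\<lambda>(j, l). a j l) b F
           - (\<Sum>j<h. dm (Suc s) (\<lambda>b'. K (\<psi> j b')) b * \<zeta> j F)) \<in> Bk i" if b: "b < \<beta> s" for b
  proof -
    \<comment> \<open>By the choice of \<open>a\<close> and \<open>\<psi>\<close> the residue of
      \<open>p j\<close> is zero, so \<open>p j\<close> times \<open>\<zeta> j\<close> is a
      boundary.\<close>
    define p where "p j = K (cc b j) - (\<Sum>l<n. K (a j l * \<xi> l b)) - dm (Suc s) (\<lambda>b'. K (\<psi> j b')) b" for j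
    have "cst (p j) = 0" if "j < h" for j
      using a[OF that b] by (simp add: p_def dm_def cst_diff cst_K cst_sum cst_mult)
    then have "(\<lambda>F. (y F b - (\<Sum>j<h. K (cc b j) * \<zeta> j F)) + (\<Sum>j<h. p j * \<zeta> j F)) \<in> Bk i"
      by (intro Bk_add[OF cc[OF b]] Bk_sum max_Zk_Bk z(1)) auto
    then show ?thesis
      by (simp add: tens_def p_def left_diff_distrib sum_subtractf sum.distrib algebra_simps)
  qed
  then show ?thesis by (intro exI[of _ "\<lambda>(j, l). a j l"] exI[of _ \<psi>]) blast
qed

text \<open>For \<open>w\<close> in total degree \<open>N\<close>, the boundary may be nonzero only
  in columns with \<open>s + q \<le> N\<close>, that is, in Koszul degree at least
  \<open>q - 1\<close>. For \<open>q = N + 1\<close> this says that \<open>w\<close> is a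
  cycle.\<close>

definition cyc_above :: "nat \<Rightarrow> nat \<Rightarrow> (nat \<Rightarrow> 'v set \<Rightarrow> nat \<Rightarrow> 'p) \<Rightarrow> bool" where
  "cyc_above N q w \<longleftrightarrow> (\<forall>s F b. F \<subseteq> V \<longrightarrow> Suc (s + card F) = N \<longrightarrow> N < s + q \<longrightarrow> b < \<beta> s \<longrightarrow> Dt w s F b \<in> I)"

lemma cyc_aboveD: "cyc_above N q w \<Longrightarrow> F \<subseteq> V \<Longrightarrow> Suc (s + card F) = N \<Longrightarrow> N < s + q \<Longrightarrow> b < \<beta> s \<Longrightarrow> Dt w s F b \<in> I"
  unfolding cyc_above_def by blast

text \<open>Representatives of the classes in Tor of degree \<open>N\<close> that survive to page
  \<open>q\<close> of the spectral sequence of the filtration by columns: the leading component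
  \<open>w N {}\<close> reduces to \<open>x\<close>.\<close>

definition Xt :: "nat \<Rightarrow> nat \<Rightarrow> (nat \<Rightarrow> 'k) set" where
  "Xt N q = {x. \<exists>w. (\<forall>b<\<beta> N. cst (w N {} b) = x b) \<and> cyc_above N q w}"

lemma cyc_above_add: "cyc_above N q w \<Longrightarrow> cyc_above N q w' \<Longrightarrow> cyc_above N q (\<lambda>s F b. w s F b + w' s F b)"
  unfolding cyc_above_def Dt_add by (blast intro: I_add)
lemma cyc_above_diff: "cyc_above N q w \<Longrightarrow> cyc_above N q w' \<Longrightarrow> cyc_above N q (\<lambda>s F b. w s F b - w' s F b)"
  unfolding cyc_above_def Dt_diff by (blast intro: I_diff)
lemma cyc_above_mult: "cyc_above N q w \<Longrightarrow> cyc_above N q (\<lambda>s F b. p * w s F b)"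
  unfolding cyc_above_def Dt_mult by (blast intro: I_mult)
lemma cyc_above_zero: "cyc_above N q (\<lambda>s F b. 0)"
  unfolding cyc_above_def by (simp add: Dt_def kd_zero dm_zero I0)

lemma subspace_Xt: "tor.subspace (Xt N q)"
proof (rule tor.subspaceI)
  show "0 \<in> Xt N q" unfolding Xt_def using cyc_above_zero cst0
    by (auto intro!: exI[of _ "\<lambda>s F b. 0"])
next
  fix x y assume "x \<in> Xt N q" "y \<in> Xt N q"
  then obtain w w' where "\<forall>b<\<beta> N. cst (w N {} b) = x b" "cyc_above N q w"
      "\<forall>b<\<beta> N. cst (w' N {} b) = y b" "cyc_above N q w'" unfolding Xt_def by blast
  then show "x + y \<in> Xt N q" unfolding Xt_def
    by (auto intro!: exI[of _ "\<lambda>s F b. w s F b + w' s F b"] simp: cst_add cyc_above_add)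
next
  fix a x assume "x \<in> Xt N q"
  then obtain w where "\<forall>b<\<beta> N. cst (w N {} b) = x b" "cyc_above N q w" unfolding Xt_def by blast
  then show "(\<lambda>b. a * x b) \<in> Xt N q" unfolding Xt_def
    by (auto intro!: exI[of _ "\<lambda>s F b. K a * w s F b"] simp: cst_mult cst_K cyc_above_mult)
qed

lemma Xt_antimono: "q \<le> q' \<Longrightarrow> Xt N q' \<subseteq> Xt N q"
proof -
  assume "q \<le> q'"
  then have "cyc_above N q w"
    if c: "cyc_above N q' w" for w unfolding cyc_above_def
    by (intro allI impI cyc_aboveD[OF c]) auto
  then show ?thesis unfolding Xt_def by blast
qed

text \<open>In column \<open>N - q\<close> the boundary of \<open>w\<close> represents the
  transgression of its leading class. Changing \<open>w\<close> in columns \<open>N - q\<close> and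
  \<open>N - q + 1\<close> turns it into a literal combination of the \<open>\<zeta> j\<close>
  tensor \<open>\<xi> l\<close>. The last conclusion compares this combination with the boundary of
  the uncorrected \<open>w\<close>.\<close>

lemma obstruction_normal_form:
  assumes r: "2 \<le> q" "q \<le> N"
    and zeta: "kos.basis_mod (Zk (q - 1)) (Bk (q - 1)) h \<zeta>"
    and xi: "tor.basis_mod (Zt (N - q)) (Bt (N - q)) n \<xi>"
    and w: "cyc_above N q w"
  obtains w' a \<psi> where "\<And>b. w' N {} b = w N {} b" "cyc_above N q w'"
     "\<And>F b. F \<subseteq> V \<Longrightarrow> card F = q - 1 \<Longrightarrow> b < \<beta> (N - q) \<Longrightarrow>
        Dt w' (N - q) F b - tens h n \<zeta> \<xi> a b F \<in> I"
     "\<And>b. b < \<beta> (N - q) \<Longrightarrow> (\<lambda>F. Dt w (N - q) F b - tens h n \<zeta> \<xi> a b F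
           - (\<Sum>j<h. dm (Suc (N - q)) (\<lambda>b'. K (\<psi> j b')) b * \<zeta> j F)) \<in> Bk (q - 1)"
proof -
  define s i where "s = N - q" and "i = q - 1"
  have Ni: "N = Suc (s + i)" using r by (simp add: s_def i_def)
  define y where "y F b = Dt w s F b" for F b
  have y1: "(\<lambda>F. y F b) \<in> Zk i" if b: "b < \<beta> s" for b
    unfolding Zk_def
  proof (intro CollectI allI impI)
    fix F assume F: "F \<subseteq> V" "Suc (card F) = i"
    have "Dt (Dt w) s F b \<in> I" using Dt_Dt F b by blast
    moreover have "(- 1) ^ card F * dm (Suc s) (Dt w (Suc s) F) b \<in> I"
      using F r Ni by (intro I_mult dm_I cyc_aboveD[OF w]) (auto simp: i_def)
    ultimately have "Dt (Dt w) s F b - (- 1) ^ card F * dm (Suc s) (Dt w (Suc s) F) b \<in> I" by (rule I_diff)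
    then show "kd (\<lambda>F. y F b) F \<in> I" by (simp add: Dt_def[of "Dt w"] y_def)
  qed
  \<comment> \<open>\<open>Dt_Dt\<close> in column \<open>t\<close> says that this is, up to sign,
    the Koszul differential of the component of \<open>Dt w\<close> in that column.\<close>
  have y2: "(\<lambda>F. dm s (y F) c) \<in> Bk i" if q: "s = Suc t" "c < \<beta> t" for t c
  proof -
    have "dm s (y F) c - kd (\<lambda>G. - ((- 1) ^ i) * Dt w t G c) F \<in> I" if F: "F \<subseteq> V" "card F = i" for F
    proof -
      have "(- 1) ^ i * Dt (Dt w) t F c \<in> I" using Dt_Dt F q by (intro I_mult) blast
      also have "(- 1) ^ i * Dt (Dt w) t F c = dm s (y F) c - kd (\<lambda>G. - ((- 1) ^ i) * Dt w t G c) F"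
        unfolding Dt_def[of "Dt w"] kd_mult using F q
        by (simp add: y_def[abs_def] distrib_left mult.assoc[symmetric] power_mult_distrib[symmetric])
      finally show ?thesis .
    qed
    then show ?thesis unfolding Bk_def by blast
  qed
  obtain a \<psi> where a: "\<And>b. b < \<beta> s \<Longrightarrow> (\<lambda>F. y F b - tens h n \<zeta> \<xi> a b F
           - (\<Sum>j<h. dm (Suc s) (\<lambda>b'. K (\<psi> j b')) b * \<zeta> j F)) \<in> Bk i"
    using koszul_tensor_decomposition[of i h \<zeta> s n \<xi> y] zeta xi y1 y2 unfolding s_def i_def by blast
  then have "\<forall>b\<in>{..<\<beta> s}. \<exists>t. (\<forall>F\<subseteq>V. card F = i \<longrightarrow> y F b - tens h n \<zeta> \<xi> a b F
           - (\<Sum>j<h. dm (Suc s) (\<lambda>b'. K (\<psi> j b')) b * \<zeta> j F) - kd t F \<in> I)"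
    unfolding Bk_def by blast
  from bchoice[OF this] obtain t where t: "\<And>F b. F \<subseteq> V \<Longrightarrow> card F = i \<Longrightarrow> b < \<beta> s \<Longrightarrow>
      y F b - tens h n \<zeta> \<xi> a b F
           - (\<Sum>j<h. dm (Suc s) (\<lambda>b'. K (\<psi> j b')) b * \<zeta> j F) - kd (t b) F \<in> I"
    by blast
  define w2 where "w2 = (\<lambda>s' F b. if s' = s then t b F else
      if s' = Suc s then (- 1) ^ i * (\<Sum>j<h. K (\<psi> j b) * \<zeta> j F) else 0)"
  \<comment> \<open>Here \<open>2 \<le> q\<close> enters: both changed columns lie strictly below
    \<open>N\<close>, so the leading component is kept.\<close>
  have w2N: "w2 N F b = 0" for F b using Ni r by (auto simp: w2_def i_def)
  have w2s: "Dt w2 s F b = kd (t b) F + (\<Sum>j<h. dm (Suc s) (\<lambda>b'. K (\<psi> j b')) b * \<zeta> j F)"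
    if "card F = i" for F b
    using that by (simp add: Dt_def w2_def dm_mult dm_sum dm_mult2 mult.assoc[symmetric] power_mult_distrib[symmetric])
  have w2c: "cyc_above N q w2"
    unfolding cyc_above_def
  proof (intro allI impI)
    fix s' F b assume F: "F \<subseteq> V" "Suc (s' + card F) = N" "N < s' + q" "b < \<beta> s'"
    have s': "s < s'" using F r by (simp add: s_def)
    show "Dt w2 s' F b \<in> I"
    proof (cases "s' = Suc s")
      case True
      then have "Suc (card F) = i" using F Ni by simp
      then have "kd (\<zeta> j) F \<in> I" if "j < h" for j
        using kos_basis_modD(1)[OF zeta that] F by (auto simp: Zk_def i_def)
      then have "(- 1) ^ i * (\<Sum>j<h. K (\<psi> j b) * kd (\<zeta> j) F) \<in> I"
        by (intro I_mult I_sum) auto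
      then show ?thesis using True by (simp add: Dt_def w2_def kd_mult kd_sum dm_zero)
    next
      case False
      then show ?thesis using s' by (simp add: Dt_def w2_def kd_zero dm_zero I0)
    qed
  qed
  define w' where "w' = (\<lambda>s F b. w s F b - w2 s F b)"
  have "\<And>b. w' N {} b = w N {} b" by (simp add: w'_def w2N)
  moreover have "cyc_above N q w'" unfolding w'_def by (rule cyc_above_diff[OF w w2c])
  moreover have "Dt w' s F b - tens h n \<zeta> \<xi> a b F \<in> I"
    if "F \<subseteq> V" "card F = i" "b < \<beta> s" for F b
    using t[OF that] that by (simp add: w'_def Dt_diff w2s y_def algebra_simps)
  ultimately show thesis using that a unfolding y_def s_def i_def by blast
qed

text \<open>The transgression embeds the quotient of the two sets into a subquotient of Koszul
  homology in degree \<open>q - 1\<close> tensor Tor in degree \<open>N - q\<close>; the relation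
  \<open>\<rho>\<close> avoids naming the subquotient. In the second part, a chain with leading
  component 0 has boundary \<open>\<eta>\<close> in column 0: this nonzero class is already zero in
  the subquotient, which lowers the bound by one.\<close>

lemma Xt_step:
  assumes r: "2 \<le> q" "q \<le> N"
    and zeta: "kos.basis_mod (Zk (q - 1)) (Bk (q - 1)) h \<zeta>"
    and xi: "tor.basis_mod (Zt (N - q)) (Bt (N - q)) n \<xi>"
  shows "tor.generated_mod (Xt N q) (Xt N (Suc q)) (h * n)"
    and "q = N \<Longrightarrow> cyc_above N N w \<Longrightarrow> (\<And>b. w N {} b = 0) \<Longrightarrow> \<eta> \<in> Zk (N - 1) \<Longrightarrow> \<eta> \<notin> Bk (N - 1) \<Longrightarrow>
       (\<And>F b. F \<subseteq> V \<Longrightarrow> card F = N - 1 \<Longrightarrow> b < \<beta> 0 \<Longrightarrow> Dt w 0 F b - K (f0 b) * \<eta> F \<in> I) \<Longrightarrow>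
       (\<Sum>b<\<beta> 0. e b * f0 b) = 1 \<Longrightarrow>
       0 < h * n \<and> tor.generated_mod (Xt N q) (Xt N (Suc q)) (h * n - 1)"
proof -
  define A where "A = {..<h} \<times> {..<n}"
  have cardA: "card A = h * n" and finA: "finite A" by (simp_all add: A_def)
  let ?\<Phi> = "tens h n \<zeta> \<xi>"
  define \<rho> where "\<rho> = {(x, a). \<exists>w. (\<forall>b<\<beta> N. cst (w N {} b) = x b) \<and> cyc_above N q w \<and>
      (\<forall>F\<subseteq>V. card F = q - 1 \<longrightarrow> (\<forall>b<\<beta> (N - q). Dt w (N - q) F b - ?\<Phi> a b F \<in> I))}"
  have add: "(x + y, \<lambda>i. a i + b i) \<in> \<rho>" if xa: "(x, a) \<in> \<rho>" and yb: "(y, b) \<in> \<rho>" for x y a b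
  proof -
    obtain w where w: "\<forall>b<\<beta> N. cst (w N {} b) = x b" "cyc_above N q w"
      "\<And>F b. F \<subseteq> V \<Longrightarrow> card F = q - 1 \<Longrightarrow> b < \<beta> (N - q) \<Longrightarrow> Dt w (N - q) F b - ?\<Phi> a b F \<in> I"
      using xa unfolding \<rho>_def by blast
    obtain w' where w': "\<forall>b<\<beta> N. cst (w' N {} b) = y b" "cyc_above N q w'"
      "\<And>F c. F \<subseteq> V \<Longrightarrow> card F = q - 1 \<Longrightarrow> c < \<beta> (N - q) \<Longrightarrow> Dt w' (N - q) F c - ?\<Phi> b c F \<in> I"
      using yb unfolding \<rho>_def by blast
    have "Dt (\<lambda>s F b. w s F b + w' s F b) (N - q) F c - ?\<Phi> (\<lambda>i. a i + b i) c F \<in> I"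
      if "F \<subseteq> V" "card F = q - 1" "c < \<beta> (N - q)" for F c
    proof -
      have "?\<Phi> (\<lambda>i. a i + b i) c F = ?\<Phi> a c F + ?\<Phi> b c F"
        by (simp add: tens_def distrib_right K_add sum.distrib)
      then have "Dt (\<lambda>s F b. w s F b + w' s F b) (N - q) F c - ?\<Phi> (\<lambda>i. a i + b i) c F
        = (Dt w (N - q) F c - ?\<Phi> a c F) + (Dt w' (N - q) F c - ?\<Phi> b c F)"
        by (simp add: Dt_add)
      then show ?thesis using w(3)[OF that] w'(3)[OF that] I_add by simp
    qed
    then show ?thesis unfolding \<rho>_def using w(1,2) w'(1,2)
      by (auto intro!: exI[of _ "\<lambda>s F b. w s F b + w' s F b"] cyc_above_add simp: cst_add)
  qed
  have scl: "(\<lambda>b. k * x b, \<lambda>i. k * a i) \<in> \<rho>" if xa: "(x, a) \<in> \<rho>" for x a k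
  proof -
    obtain w where w: "\<forall>b<\<beta> N. cst (w N {} b) = x b" "cyc_above N q w"
      "\<And>F b. F \<subseteq> V \<Longrightarrow> card F = q - 1 \<Longrightarrow> b < \<beta> (N - q) \<Longrightarrow> Dt w (N - q) F b - ?\<Phi> a b F \<in> I"
      using xa unfolding \<rho>_def by blast
    have "Dt (\<lambda>s F b. K k * w s F b) (N - q) F c - ?\<Phi> (\<lambda>i. k * a i) c F \<in> I"
      if "F \<subseteq> V" "card F = q - 1" "c < \<beta> (N - q)" for F c
    proof -
      have "?\<Phi> (\<lambda>i. k * a i) c F = K k * ?\<Phi> a c F"
        by (simp add: tens_def K_mult sum_distrib_left sum_distrib_right mult.assoc)
      then have "Dt (\<lambda>s F b. K k * w s F b) (N - q) F c - ?\<Phi> (\<lambda>i. k * a i) c F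
        = K k * (Dt w (N - q) F c - ?\<Phi> a c F)"
        by (simp add: Dt_mult right_diff_distrib)
      then show ?thesis using w(3)[OF that] I_mult by simp
    qed
    then show ?thesis unfolding \<rho>_def using w(1,2)
      by (auto intro!: exI[of _ "\<lambda>s F b. K k * w s F b"] cyc_above_mult simp: cst_mult cst_K)
  qed
  have tot: "\<exists>a. (x, a) \<in> \<rho>" if "x \<in> Xt N q" for x
  proof -
    obtain w where w: "\<forall>b<\<beta> N. cst (w N {} b) = x b" "cyc_above N q w"
      using \<open>x \<in> Xt N q\<close> unfolding Xt_def by blast
    obtain w' a where "\<And>b. w' N {} b = w N {} b" "cyc_above N q w'"
      "\<And>F b. F \<subseteq> V \<Longrightarrow> card F = q - 1 \<Longrightarrow> b < \<beta> (N - q) \<Longrightarrow> Dt w' (N - q) F b - ?\<Phi> a b F \<in> I"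
      by (rule obstruction_normal_form[OF r zeta xi w(2)]) blast
    then have "(x, a) \<in> \<rho>" unfolding \<rho>_def using w(1)
      by (intro CollectI case_prodI exI[of _ w'] conjI) simp_all
    then show ?thesis by blast
  qed
  have zero: "x \<in> Xt N (Suc q)" if xa: "(x, a) \<in> \<rho>" and a: "\<forall>i\<in>A. a i = 0" for x a
  proof -
    obtain w where w: "\<forall>b<\<beta> N. cst (w N {} b) = x b" "cyc_above N q w"
      "\<And>F b. F \<subseteq> V \<Longrightarrow> card F = q - 1 \<Longrightarrow> b < \<beta> (N - q) \<Longrightarrow> Dt w (N - q) F b - ?\<Phi> a b F \<in> I"
      using xa unfolding \<rho>_def by blast
    have "?\<Phi> a b F = 0" for b F using a by (simp add: tens_def A_def K0)
    then have w3: "\<And>F b. F \<subseteq> V \<Longrightarrow> card F = q - 1 \<Longrightarrow> b < \<beta> (N - q) \<Longrightarrow> Dt w (N - q) F b \<in> I"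
      using w(3) by simp
    have "cyc_above N (Suc q) w"
      unfolding cyc_above_def
    proof (intro allI impI)
      fix s F b assume *: "F \<subseteq> V" "Suc (s + card F) = N" "N < s + Suc q" "b < \<beta> s"
      show "Dt w s F b \<in> I"
      proof (cases "N < s + q")
        case True
        then show ?thesis using cyc_aboveD[OF w(2)] * by blast
      next
        case False
        then have "s = N - q" "card F = q - 1" using * r by auto
        then show ?thesis using w3 * by blast
      qed
    qed
    then show ?thesis unfolding Xt_def using w(1) by blast
  qed
  show "tor.generated_mod (Xt N q) (Xt N (Suc q)) (h * n)"
    unfolding cardA[symmetric]
    by (rule tor.generated_mod_relation[OF finA subspace_Xt, of \<rho>]) (blast intro: add scl tot zero)+
  assume N: "q = N" and w: "cyc_above N N w" and wN: "\<And>b. w N {} b = 0"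
    and eta: "\<eta> \<in> Zk (N - 1)" "\<eta> \<notin> Bk (N - 1)"
    and w0: "\<And>F b. F \<subseteq> V \<Longrightarrow> card F = N - 1 \<Longrightarrow> b < \<beta> 0 \<Longrightarrow> Dt w 0 F b - K (f0 b) * \<eta> F \<in> I"
    and f0: "(\<Sum>b<\<beta> 0. e b * f0 b) = 1"
  have wq: "cyc_above N q w" using w N by simp
  obtain w' a \<psi> where w': "\<And>b. w' N {} b = w N {} b" "cyc_above N q w'"
     "\<And>F b. F \<subseteq> V \<Longrightarrow> card F = q - 1 \<Longrightarrow> b < \<beta> (N - q) \<Longrightarrow> Dt w' (N - q) F b - ?\<Phi> a b F \<in> I"
     "\<And>b. b < \<beta> (N - q) \<Longrightarrow> (\<lambda>F. Dt w (N - q) F b - ?\<Phi> a b F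
           - (\<Sum>j<h. dm (Suc (N - q)) (\<lambda>b'. K (\<psi> j b')) b * \<zeta> j F)) \<in> Bk (q - 1)"
    by (rule obstruction_normal_form[OF r zeta xi wq]) blast
  have "(0, a) \<in> \<rho>" unfolding \<rho>_def using w'(1-3) wN
    by (intro CollectI case_prodI exI[of _ w'] conjI) (simp_all add: cst0)
  \<comment> \<open>Otherwise, summing the identities for all \<open>b\<close> with weights
    \<open>e b\<close> would give \<open>\<eta>\<close> as a sum of \<open>p j * \<zeta> j\<close>
    modulo boundaries. The differential of the resolution has augmentation zero, so each
    \<open>p j\<close> has residue zero and \<open>\<eta>\<close> would bound.\<close>
  moreover have "\<exists>i\<in>A. a i \<noteq> 0"
  proof (rule ccontr)
    assume "\<not> (\<exists>i\<in>A. a i \<noteq> 0)"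
    then have P0: "?\<Phi> a b F = 0" for b F by (simp add: tens_def A_def K0)
    define p where "p j = (\<Sum>b<\<beta> 0. K (e b) * dm 1 (\<lambda>b'. K (\<psi> j b')) b)" for j
    have p0: "cst (p j) = 0" for j
      using aug_dm[of "\<lambda>b'. K (\<psi> j b')"] by (simp add: p_def cst_sum cst_mult cst_K)
    have 1: "(\<lambda>F. Dt w 0 F b - (\<Sum>j<h. dm 1 (\<lambda>b'. K (\<psi> j b')) b * \<zeta> j F)) \<in> Bk (N - 1)"
      if "b < \<beta> 0" for b
      using w'(4) that N by (simp add: P0)
    have "(\<lambda>F. K (f0 b) * \<eta> F - (\<Sum>j<h. dm 1 (\<lambda>b'. K (\<psi> j b')) b * \<zeta> j F)) \<in> Bk (N - 1)"
      if b: "b < \<beta> 0" for b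
    proof (rule Bk_cong[OF 1[OF b]])
      fix F assume "F \<subseteq> V" "card F = N - 1"
      then have "- (Dt w 0 F b - K (f0 b) * \<eta> F) \<in> I" using w0 b by (intro I_uminus) blast
      then show "K (f0 b) * \<eta> F - (\<Sum>j<h. dm 1 (\<lambda>b'. K (\<psi> j b')) b * \<zeta> j F) -
         (Dt w 0 F b - (\<Sum>j<h. dm 1 (\<lambda>b'. K (\<psi> j b')) b * \<zeta> j F)) \<in> I" by simp
    qed
    then have "(\<lambda>F. (\<Sum>b<\<beta> 0. K (e b) * (K (f0 b) * \<eta> F - (\<Sum>j<h. dm 1 (\<lambda>b'. K (\<psi> j b')) b * \<zeta> j F)))
        + (\<Sum>j<h. p j * \<zeta> j F)) \<in> Bk (N - 1)"
      using kos_basis_modD(1)[OF zeta] N by (intro Bk_add Bk_sum Bk_mult max_Zk_Bk p0) auto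
    also have "(\<lambda>F. (\<Sum>b<\<beta> 0. K (e b) * (K (f0 b) * \<eta> F - (\<Sum>j<h. dm 1 (\<lambda>b'. K (\<psi> j b')) b * \<zeta> j F)))
        + (\<Sum>j<h. p j * \<zeta> j F)) = \<eta>"
    proof
      fix F
      have "(\<Sum>j<h. p j * \<zeta> j F) = (\<Sum>b<\<beta> 0. K (e b) * (\<Sum>j<h. dm 1 (\<lambda>b'. K (\<psi> j b')) b * \<zeta> j F))"
        unfolding p_def sum_distrib_left sum_distrib_right by (subst sum.swap) (simp add: mult.assoc)
      moreover have "(\<Sum>b<\<beta> 0. K (e b) * (K (f0 b) * \<eta> F)) = K (\<Sum>b<\<beta> 0. e b * f0 b) * \<eta> F"
        by (simp add: K_sum K_mult sum_distrib_right mult.assoc)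
      ultimately show "(\<Sum>b<\<beta> 0. K (e b) * (K (f0 b) * \<eta> F - (\<Sum>j<h. dm 1 (\<lambda>b'. K (\<psi> j b')) b * \<zeta> j F)))
        + (\<Sum>j<h. p j * \<zeta> j F) = \<eta> F"
        by (simp add: right_diff_distrib sum_subtractf f0 K1)
    qed
    finally show False using eta by blast
  qed
  ultimately obtain i where nz: "(0, a) \<in> \<rho>" "i \<in> A" "a i \<noteq> 0" by blast
  have "tor.generated_mod (Xt N q) (Xt N (Suc q)) (card A - 1)"
    by (rule tor.generated_mod_relation_strict[OF finA subspace_Xt, of \<rho>]) (rule add scl tot zero nz; assumption?)+
  moreover have "0 < card A" using finA nz by (auto simp: card_gt_0_iff)
  ultimately show "0 < h * n \<and> tor.generated_mod (Xt N q) (Xt N (Suc q)) (h * n - 1)"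
    by (simp add: cardA)
qed

text \<open>The differential of a lift of \<open>x\<close> has coefficients in the maximal ideal.
  Written as combinations of the variables, they form the Koszul differential of a chain of Koszul
  degree 1, supported on singletons, from which \<open>the_elem\<close> reads off the
  vertex.\<close>

lemma Zt_subset_Xt: "N \<ge> 1 \<Longrightarrow> Zt N \<subseteq> Xt N 2"
proof
  fix x assume N: "N \<ge> 1" and x: "x \<in> Zt N"
  then obtain q where q: "N = Suc q" by (cases N) auto
  have "\<exists>g. dm N (\<lambda>b. K (x b)) c - (\<Sum>v\<in>V. X v * g v) \<in> I" if "c < \<beta> q" for c
  proof (rule cst_zero)
    show "cst (dm N (\<lambda>b. K (x b)) c) = 0"
      using x q that by (simp add: dm_def cst_sum cst_mult cst_K Zt_def)
  qed
  then obtain g where g: "\<And>c. c < \<beta> q \<Longrightarrow> dm N (\<lambda>b. K (x b)) c - (\<Sum>v\<in>V. X v * g c v) \<in> I" by metis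
  define w where "w = (\<lambda>s F b. if s = N then K (x b) else if s = q then - g b (the_elem F) else 0)"
  have "cyc_above N 2 w" unfolding cyc_above_def
  proof (intro allI impI)
    fix s F b assume F: "F \<subseteq> V" "Suc (s + card F) = N" "N < s + 2" "b < \<beta> s"
    then have s: "s = q" "card F = 0" using q by auto
    then have F0: "F = {}" using F finite_sub by auto
    have "kd (\<lambda>G. w q G b) {} = - (\<Sum>v\<in>V. X v * g b v)"
      by (simp add: kd_def w_def q koszul_sign_def sum_negf)
    then have "Dt w q {} b = dm N (\<lambda>b. K (x b)) b - (\<Sum>v\<in>V. X v * g b v)"
      by (simp add: Dt_def w_def q)
    then show "Dt w s F b \<in> I" using g F s F0 by simp
  qed
  then show "x \<in> Xt N 2" unfolding Xt_def by (auto intro!: exI[of _ w] simp: w_def cst_K)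
qed

text \<open>Now \<open>w\<close> is a cycle of the total complex. If its augmentation vanishes at
  all \<open>F\<close> of size \<open>N\<close>, then it is a boundary by
  \<open>total_exact\<close>, and so is its leading component in the reduced resolution. The
  binomial coefficient counts these \<open>F\<close>.\<close>

lemma Xt_last:
  assumes "N \<ge> 1"
  shows "tor.generated_mod (Xt N (Suc N)) (Bt N) (card V choose N)"
proof -
  define A where "A = {F. F \<subseteq> V \<and> card F = N}"
  define \<rho> where "\<rho> = {(x, a). \<exists>w. (\<forall>b<\<beta> N. cst (w N {} b) = x b) \<and> cyc_above N (Suc N) w \<and>
      (\<forall>F\<in>A. a F = (\<Sum>b<\<beta> 0. e b * cst (w 0 F b)))}"
  have "tor.generated_mod (Xt N (Suc N)) (Bt N) (card A)"
  proof (rule tor.generated_mod_relation[of _ _ \<rho>])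
    show "finite A" unfolding A_def using finV by simp
    show "tor.subspace (Xt N (Suc N))" by (rule subspace_Xt)
  next
    fix x a y b assume "(x, a) \<in> \<rho>" "(y, b) \<in> \<rho>"
    then obtain w w' where "\<forall>b<\<beta> N. cst (w N {} b) = x b" "cyc_above N (Suc N) w"
      "\<forall>F\<in>A. a F = (\<Sum>b<\<beta> 0. e b * cst (w 0 F b))"
      "\<forall>b<\<beta> N. cst (w' N {} b) = y b" "cyc_above N (Suc N) w'"
      "\<forall>F\<in>A. b F = (\<Sum>b<\<beta> 0. e b * cst (w' 0 F b))" unfolding \<rho>_def by blast
    then show "(x + y, \<lambda>i. a i + b i) \<in> \<rho>" unfolding \<rho>_def
      by (auto intro!: exI[of _ "\<lambda>s F b. w s F b + w' s F b"] cyc_above_add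
          simp: cst_add distrib_left sum.distrib)
  next
    fix k x a assume "(x, a) \<in> \<rho>"
    then obtain w where "\<forall>b<\<beta> N. cst (w N {} b) = x b" "cyc_above N (Suc N) w"
      "\<forall>F\<in>A. a F = (\<Sum>b<\<beta> 0. e b * cst (w 0 F b))" unfolding \<rho>_def by blast
    then show "(\<lambda>b. k * x b, \<lambda>i. k * a i) \<in> \<rho>" unfolding \<rho>_def
      by (auto intro!: exI[of _ "\<lambda>s F b. K k * w s F b"] cyc_above_mult
          simp: cst_mult cst_K sum_distrib_left mult_ac)
  next
    fix x assume "x \<in> Xt N (Suc N)"
    then obtain w where "\<forall>b<\<beta> N. cst (w N {} b) = x b" "cyc_above N (Suc N) w" unfolding Xt_def by blast
    then show "\<exists>a. (x, a) \<in> \<rho>" unfolding \<rho>_def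
      by (auto intro!: exI[of _ "\<lambda>F. (\<Sum>b<\<beta> 0. e b * cst (w 0 F b))"] exI[of _ w])
  next
    fix x a assume "(x, a) \<in> \<rho>" and a: "\<forall>i\<in>A. a i = 0"
    then obtain w where w: "\<forall>b<\<beta> N. cst (w N {} b) = x b" "cyc_above N (Suc N) w"
      "\<forall>F\<in>A. a F = (\<Sum>b<\<beta> 0. e b * cst (w 0 F b))" unfolding \<rho>_def by blast
    have "\<exists>u. \<forall>s F b. F \<subseteq> V \<longrightarrow> s + card F = N \<longrightarrow> b < \<beta> s \<longrightarrow> w s F b - Dt u s F b \<in> I"
      using cyc_aboveD[OF w(2)] w(3) a by (intro total_exact) (auto simp: A_def)
    then obtain u where u: "\<And>s F b. F \<subseteq> V \<Longrightarrow> s + card F = N \<Longrightarrow> b < \<beta> s \<Longrightarrow> w s F b - Dt u s F b \<in> I"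
      by blast
    have "x b = (\<Sum>c<\<beta> (Suc N). cst (D (Suc N) b c) * cst (u (Suc N) {} c))" if b: "b < \<beta> N" for b
    proof -
      have "cst (w N {} b - Dt u N {} b) = 0" using u[of "{}" N b] b by (intro cst_I) auto
      then show ?thesis using w(1) b
        by (simp add: cst_diff Dt_def cst_add cst_kd dm_def cst_sum cst_mult)
    qed
    then show "x \<in> Bt N" unfolding Bt_def by (auto intro!: exI[of _ "\<lambda>c. cst (u (Suc N) {} c)"])
  qed
  then show ?thesis using n_subsets[OF finV, of N] by (simp add: A_def)
qed

lemma Bt_subset_Xt: "N \<ge> 1 \<Longrightarrow> Bt N \<subseteq> Xt N q"
proof
  fix x assume "x \<in> Bt N"
  then obtain y where y: "\<And>c. c < \<beta> N \<Longrightarrow> x c = (\<Sum>b<\<beta> (Suc N). cst (D (Suc N) c b) * y b)"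
    unfolding Bt_def by blast
  define u where "u = (\<lambda>s (F :: 'v set) b. if s = Suc N then K (y b) else 0)"
  have "cyc_above N q (Dt u)" unfolding cyc_above_def using Dt_Dt by blast
  moreover have "cst (Dt u N {} b) = x b" if "b < \<beta> N" for b
    using y[OF that] by (simp add: Dt_def cst_add cst_kd u_def dm_def cst_sum cst_mult cst_K)
  ultimately show "x \<in> Xt N q" unfolding Xt_def by blast
qed

end

section \<open>Serre's bound, and its strictness for a product that does not bound\<close>

context koszul_resolution
begin

lemma generated_mod_Xt_chain:
  assumes "\<And>q. 2 \<le> q \<Longrightarrow> q \<le> M \<Longrightarrow> tor.generated_mod (Xt N q) (Xt N (Suc q)) (g q)" "M \<ge> 1"
  shows "tor.generated_mod (Xt N 2) (Xt N (Suc M)) (\<Sum>q=2..M. g q)"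
  using assms(2,1)
proof (induction M rule: dec_induct)
  case base
  have "tor.generated_mod (Xt N 2) (Xt N 2) 0"
    using tor.subspace_0[OF subspace_Xt, of N 2] unfolding tor.generated_mod_def by simp
  then show ?case by (simp add: numeral_2_eq_2)
next
  case (step M)
  have "tor.generated_mod (Xt N 2) (Xt N (Suc (Suc M))) ((\<Sum>q=2..M. g q) + g (Suc M))"
    using step by (intro tor.generated_mod_trans[OF subspace_Xt Xt_antimono Xt_antimono]) auto
  then show ?case using step.hyps by simp
qed

text \<open>If the product \<open>\<eta>\<close> of \<open>x\<^sub>u e\<^sub>v\<close> with a Koszul cycle \<open>z\<close> is no boundary, then the last transgression
  misses the class \<open>\<eta>\<close>, which makes Serre's bound strict in homological degree \<open>q + 2\<close>.\<close>

theorem golod_imp_product_boundary: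
  assumes h: "\<And>i. 1 \<le> i \<Longrightarrow> kos.basis_mod (Zk i) (Bk i) (h i) (\<zeta> i)"
    and T: "\<And>s. tor.basis_mod (Zt s) (Bt s) (T s) (\<xi> s)"
    and eq: "\<And>N. T N = (card V choose N) + (\<Sum>q=2..N. h (q - 1) * T (N - q))"
    and uv: "v \<in> V" "X u * X v \<in> I"
    and z: "z \<in> Zk q" "\<And>F. F \<subseteq> V \<Longrightarrow> card F = q \<Longrightarrow> cst (z F) = 0"
  shows "(\<lambda>F. X u * wedge v z F) \<in> Bk (q + 1)"
proof (rule ccontr)
  define \<eta> where "\<eta> F = X u * wedge v z F" for F
  \<comment> \<open>The product has Koszul degree \<open>q + 1\<close>, so the last transgression
    that can hit it starts from Tor in degree \<open>q + 2\<close>.\<close>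
  define N where "N = q + 2"
  assume "\<not> ?thesis"
  then have etaB: "\<eta> \<notin> Bk (N - 1)" by (simp add: N_def \<eta>_def[abs_def])
  have wI: "wedge v c F \<in> I" if "v \<in> F \<Longrightarrow> c (F - {v}) \<in> I" for c F
    using that by (simp add: wedge_def I_mult I0)
  have card_diff: "Suc (card (F - {v})) = card F" if "F \<subseteq> V" "v \<in> F" for F
    using card_Suc_Diff1[OF finite_sub[OF that(1)] that(2)] .
  have etaZ: "\<eta> \<in> Zk (N - 1)"
    unfolding Zk_def
  proof (intro CollectI allI impI)
    fix F assume F: "F \<subseteq> V" "Suc (card F) = N - 1"
    have "kd \<eta> F = X u * X v * z F - X u * wedge v (kd z) F"
      unfolding \<eta>_def kd_mult mult.assoc kd_wedge[OF uv(1) F(1), of z, symmetric]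
      by (simp add: distrib_left)
    moreover have "wedge v (kd z) F \<in> I"
    proof (rule wI)
      assume "v \<in> F"
      then have "Suc (card (F - {v})) = q" using card_diff[of F] F by (simp add: N_def)
      moreover have "F - {v} \<subseteq> V" using F by auto
      ultimately show "kd z (F - {v}) \<in> I" using z(1) unfolding Zk_def by blast
    qed
    ultimately show "kd \<eta> F \<in> I" using uv(2) by (simp add: I_diff I_mult I_mult2)
  qed
  obtain b0 where b0: "b0 < \<beta> 0" "e b0 \<noteq> 0" using aug_onto by blast
  \<comment> \<open>An element of the free module in degree 0 with augmentation 1.\<close>
  define f0 where "f0 b = (if b = b0 then inverse (e b0) else 0)" for b
  have f0: "(\<Sum>b<\<beta> 0. e b * f0 b) = 1"
    using b0 by (simp add: f0_def if_distrib[of "(*) _"] cong: if_cong)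
  define W where "W = (\<lambda>s F b. if s = (0::nat) then K (f0 b) * z F else 0)"
  \<comment> \<open>In column 0 the cycle \<open>z\<close> becomes a total cycle, and its
    augmentation is zero because its coefficients have residue zero.\<close>
  have "\<exists>y. \<forall>s F b. F \<subseteq> V \<longrightarrow> s + card F = q \<longrightarrow> b < \<beta> s \<longrightarrow> W s F b - Dt y s F b \<in> I"
  proof (rule total_exact)
    fix s F b assume F: "F \<subseteq> V" "Suc (s + card F) = q"
    show "Dt W s F b \<in> I"
    proof (cases "s = 0")
      case True
      then have "kd z F \<in> I" using z(1) F by (simp add: Zk_def)
      then show ?thesis using True by (simp add: Dt_def W_def kd_mult dm_zero I_mult)
    qed (simp add: Dt_def W_def kd_zero dm_zero I0)
  next
    fix F assume "F \<subseteq> V" "card F = q"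
    then show "(\<Sum>b<\<beta> 0. e b * cst (W 0 F b)) = 0" using z(2) by (simp add: W_def cst_mult)
  qed
  then obtain y where y: "\<And>s F b. F \<subseteq> V \<Longrightarrow> s + card F = q \<Longrightarrow> b < \<beta> s \<Longrightarrow> W s F b - Dt y s F b \<in> I"
    by blast
  \<comment> \<open>Multiplication by e_v anticommutes with the total differential up to a term with
    factor X_v, which X_u kills. Hence the boundary of \<open>w\<close> is X_u e_v applied to
    \<open>Dt y\<close>, which is \<open>f0 b\<close> times \<open>\<eta>\<close> in column 0 and
    zero elsewhere.\<close>
  define w where "w = (\<lambda>s F b. (- X u) * wedge v (\<lambda>G. y s G b) F)"
  have key: "Dt w s F b - X u * wedge v (\<lambda>G. W s G b) F \<in> I"
    if F: "F \<subseteq> V" "Suc (s + card F) = N" "b < \<beta> s" for s F b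
  proof -
    define c where "c = (\<lambda>G. y s G b)"
    have kw: "kd (wedge v c) F = X v * c F - wedge v (kd c) F"
      using kd_wedge[OF uv(1) F(1), of c] by (simp add: algebra_simps)
    have 1: "kd (\<lambda>G. w s G b) F = - X u * X v * c F + X u * wedge v (kd c) F"
      unfolding w_def c_def[symmetric] kd_mult kw by (simp add: algebra_simps)
    have I1: "- X u * X v * c F \<in> I" using I_mult2[OF I_uminus[OF uv(2)]] by simp
    show ?thesis
    proof (cases "v \<in> F")
      case False
      then show ?thesis using I1 1 by (simp add: Dt_def w_def wedge_def dm_zero)
    next
      case True
      have 2: "(- 1) ^ card F * dm (Suc s) (w (Suc s) F) b
        = X u * sg v F * ((- 1) ^ card (F - {v}) * dm (Suc s) (y (Suc s) (F - {v})) b)"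
      proof -
        have "dm (Suc s) (w (Suc s) F) b = - X u * (sg v F * dm (Suc s) (y (Suc s) (F - {v})) b)"
          unfolding w_def wedge_def dm_mult using True by (simp add: dm_mult)
        moreover have "(- 1 :: 'p) ^ card F = - ((- 1) ^ card (F - {v}))"
          by (simp only: card_diff[OF F(1) True, symmetric] power_Suc mult_minus1)
        ultimately show ?thesis by (simp add: mult_ac)
      qed
      have "Dt w s F b - X u * wedge v (\<lambda>G. W s G b) F =
         - X u * X v * c F - X u * sg v F * (W s (F - {v}) b - Dt y s (F - {v}) b)"
        unfolding Dt_def 1 2 using True by (simp add: wedge_def c_def algebra_simps)
      also have "\<dots> \<in> I"
        using card_diff[OF F(1) True] F by (intro I_diff[OF I1] I_mult[OF y]) (auto simp: N_def)
      finally show ?thesis .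
    qed
  qed
  have wN: "w N {} b = 0" for b by (simp add: w_def wedge_def)
  have wc: "cyc_above N N w"
    unfolding cyc_above_def
  proof (intro allI impI)
    fix s F b assume F: "F \<subseteq> V" "Suc (s + card F) = N" "N < s + N" "b < \<beta> s"
    then show "Dt w s F b \<in> I"
      using key[of F s b] by (simp add: W_def wedge_def cong: if_cong)
  qed
  have w0: "Dt w 0 F b - K (f0 b) * \<eta> F \<in> I" if "F \<subseteq> V" "card F = N - 1" "b < \<beta> 0" for F b
  proof -
    have "X u * wedge v (\<lambda>G. W 0 G b) F = K (f0 b) * \<eta> F"
      by (simp add: W_def wedge_def \<eta>_def mult_ac)
    then show ?thesis using key[of F 0 b] that by (simp add: N_def)
  qed
  define g where "g p = h (p - 1) * T (N - p) - (if p = N then 1 else 0)" for p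
  have step: "tor.generated_mod (Xt N p) (Xt N (Suc p)) (g p)" if p: "2 \<le> p" "p \<le> N" for p
  proof (cases "p = N")
    case True
    then show ?thesis
      using Xt_step(2)[OF p h T True wc wN etaZ etaB w0 f0] p by (simp add: g_def)
  next
    case False
    then show ?thesis using Xt_step(1)[OF p h T] p by (simp add: g_def)
  qed
  have N1: "1 \<le> N" "2 \<le> N" by (simp_all add: N_def)
  \<comment> \<open>Without this, the truncated subtraction in \<open>g N\<close> could leave the
    bound unchanged.\<close>
  have pos: "0 < h (N - 1) * T (N - N)"
    using Xt_step(2)[OF N1(2) order_refl h T refl wc wN etaZ etaB w0 f0] N1 by simp
  have "tor.generated_mod (Xt N 2) (Bt N) ((\<Sum>p=2..N. g p) + (card V choose N))"
    by (rule tor.generated_mod_trans[OF subspace_Xt Bt_subset_Xt Xt_antimono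
          generated_mod_Xt_chain[OF step N1(1)] Xt_last[OF N1(1)]]) (use N1 in auto)
  then have "T N \<le> (\<Sum>p=2..N. g p) + (card V choose N)"
    using tor.basis_mod_le_generated[OF subspace_Bt T _ Zt_subset_Xt[OF N1(1)]] by blast
  moreover have "(\<Sum>p=2..N. g p) < (\<Sum>p=2..N. h (p - 1) * T (N - p))"
    by (rule sum_strict_mono_ex1) (use N1 pos in \<open>auto simp: g_def intro!: bexI[of _ N]\<close>)
  ultimately show False using eq[of N] by simp
qed

end

section \<open>Quotient rings presented by congruences\<close>

lemma field_space_fun:
  fixes K :: "'k::field \<Rightarrow> 'p::comm_ring_1"
  assumes "K 1 = 1" "\<And>a b. K (a + b) = K a + K b" "\<And>a b. K (a * b) = K a * K b"
  shows "field_space (\<lambda>a (f :: 'b \<Rightarrow> 'p) b. K a * f b)"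
  by unfold_locales (auto simp: assms algebra_simps)

definition cycles_mod ::
  "'p::comm_ring_1 set \<Rightarrow> (nat \<Rightarrow> 'b set) \<Rightarrow> (nat \<Rightarrow> 'b \<Rightarrow> 'b \<Rightarrow> 'p) \<Rightarrow> nat \<Rightarrow> ('b \<Rightarrow> 'p) set" where
  "cycles_mod I B A j = {f. j = 0 \<or> (\<forall>c\<in>B (j - 1). (\<Sum>b\<in>B j. A j c b * f b) \<in> I)}"

definition boundaries_mod ::
  "'p::comm_ring_1 set \<Rightarrow> (nat \<Rightarrow> 'b set) \<Rightarrow> (nat \<Rightarrow> 'b \<Rightarrow> 'b \<Rightarrow> 'p) \<Rightarrow> nat \<Rightarrow> ('b \<Rightarrow> 'p) set" where
  "boundaries_mod I B A j = {f. \<exists>g. \<forall>c\<in>B j. f c - (\<Sum>b\<in>B (Suc j). A (Suc j) c b * g b) \<in> I}"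

text \<open>A bridge between rings given by records of cosets and congruences in a ring type:
  \<open>R\<close> is the image of \<open>Q\<close> with kernel \<open>I\<close>. It is used for the
  Stanley--Reisner ring and, in two ways, for its residue ring.\<close>

locale quotient_presentation = cring R for R (structure) +
  fixes Q :: "'p::comm_ring_1 \<Rightarrow> 'a" and I :: "'p set"
  assumes Q_onto: "range Q = carrier R"
    and Q_add: "Q (p + q) = Q p \<oplus> Q q"
    and Q_mult: "Q (p * q) = Q p \<otimes> Q q"
    and Q_one: "Q 1 = \<one>"
    and Q_eq: "Q p = Q q \<longleftrightarrow> p - q \<in> I"
begin

lemma Q_closed [simp]: "Q p \<in> carrier R" using Q_onto by blast

lemma Q_zero: "Q 0 = \<zero>"
  using Q_add[of 0 0] by (metis Q_closed add.r_cancel_one' add_0)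

lemma Q_uminus: "Q (- p) = \<ominus> Q p"
  using Q_add[of "- p" p] by (simp add: Q_zero minus_equality)

lemma Q_diff: "Q (p - q) = Q p \<ominus> Q q"
  using Q_add[of p "- q"] by (simp add: Q_uminus a_minus_def)

lemma Q_eq_zero: "Q p = \<zero> \<longleftrightarrow> p \<in> I"
  using Q_eq[of p 0] by (simp add: Q_zero)

lemma Q_finsum: "finite A \<Longrightarrow> (\<Oplus>i\<in>A. Q (f i)) = Q (\<Sum>i\<in>A. f i)"
  by (induction A rule: finite_induct) (auto simp: Q_zero Q_add)

lemma lift:
  assumes "f \<in> free_module R B"
  obtains f' where "f = (\<lambda>b\<in>B. Q (f' b))"
proof -
  have "\<forall>b. \<exists>p. b \<in> B \<longrightarrow> f b = Q p"
    using assms Q_onto unfolding free_module_def by (metis PiE_mem image_iff)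
  then obtain f' where "\<And>b. b \<in> B \<Longrightarrow> f b = Q (f' b)" by metis
  then have "f = (\<lambda>b\<in>B. Q (f' b))"
    using assms unfolding free_module_def by (auto simp: fun_eq_iff PiE_def extensional_def)
  then show thesis by (rule that)
qed

lemma restrict_in_free_module: "(\<lambda>b\<in>B. Q (f b)) \<in> free_module R B"
  by (simp add: free_module_def)

lemma matrix_map_lift:
  assumes "finite B" "\<And>c b. c \<in> C \<Longrightarrow> b \<in> B \<Longrightarrow> A c b = Q (A' c b)"
  shows "matrix_map R B C A (\<lambda>b\<in>B. Q (f b)) = (\<lambda>c\<in>C. Q (\<Sum>b\<in>B. A' c b * f b))"
  unfolding matrix_map_def
proof (rule restrict_ext)
  fix c assume c: "c \<in> C"
  have "(\<Oplus>b\<in>B. A c b \<otimes> (\<lambda>b\<in>B. Q (f b)) b) = (\<Oplus>b\<in>B. Q (A' c b * f b))"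
    using c assms(2) by (intro finsum_cong') (auto simp: Q_mult)
  also have "\<dots> = Q (\<Sum>b\<in>B. A' c b * f b)" using assms(1) by (rule Q_finsum)
  finally show "(\<Oplus>b\<in>B. A c b \<otimes> (\<lambda>b\<in>B. Q (f b)) b) = Q (\<Sum>b\<in>B. A' c b * f b)" .
qed

lemma restrict_Q_eq: "(\<lambda>b\<in>B. Q (f b)) = (\<lambda>b\<in>B. Q (g b)) \<longleftrightarrow> (\<forall>b\<in>B. f b - g b \<in> I)"
  by (auto simp: fun_eq_iff Q_eq)

context
  fixes B :: "nat \<Rightarrow> 'i set" and A :: "nat \<Rightarrow> 'i \<Rightarrow> 'i \<Rightarrow> 'a" and A' :: "nat \<Rightarrow> 'i \<Rightarrow> 'i \<Rightarrow> 'p"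
  assumes finB: "\<And>j. finite (B j)"
    and A: "\<And>j c b. c \<in> B j \<Longrightarrow> b \<in> B (Suc j) \<Longrightarrow> A (Suc j) c b = Q (A' (Suc j) c b)"
begin

lemma cycles_iff: "(\<lambda>b\<in>B j. Q (f b)) \<in> cycles R B A j \<longleftrightarrow> f \<in> cycles_mod I B A' j"
proof (cases j)
  case 0
  then show ?thesis by (simp add: cycles_def cycles_mod_def restrict_in_free_module)
next
  case (Suc l)
  have "(\<lambda>b\<in>B j. Q (f b)) \<in> cycles R B A j \<longleftrightarrow>
     matrix_map R (B j) (B l) (A j) (\<lambda>b\<in>B j. Q (f b)) = (\<lambda>c\<in>B l. \<zero>)"
    by (simp add: cycles_def restrict_in_free_module Suc)
  also have "\<dots> \<longleftrightarrow> (\<lambda>c\<in>B l. Q (\<Sum>b\<in>B j. A' j c b * f b)) = (\<lambda>c\<in>B l. Q 0)"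
    using matrix_map_lift[of "B j" "B l" "A j" "A' j" f, OF finB] A Suc by (simp add: Q_zero)
  finally show ?thesis unfolding restrict_Q_eq by (simp add: cycles_mod_def Suc)
qed

lemma boundaries_iff: "(\<lambda>b\<in>B j. Q (f b)) \<in> boundaries R B A j \<longleftrightarrow> f \<in> boundaries_mod I B A' j"
proof -
  have *: "matrix_map R (B (Suc j)) (B j) (A (Suc j)) (\<lambda>b\<in>B (Suc j). Q (g b))
      = (\<lambda>c\<in>B j. Q (\<Sum>b\<in>B (Suc j). A' (Suc j) c b * g b))" for g
    by (rule matrix_map_lift) (auto simp: finB A)
  show ?thesis
  proof
    assume "(\<lambda>b\<in>B j. Q (f b)) \<in> boundaries R B A j"
    then obtain h where h: "h \<in> free_module R (B (Suc j))"
        "(\<lambda>b\<in>B j. Q (f b)) = matrix_map R (B (Suc j)) (B j) (A (Suc j)) h"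
      unfolding boundaries_def by blast
    obtain g where g: "h = (\<lambda>b\<in>B (Suc j). Q (g b))" using lift[OF h(1)] by blast
    show "f \<in> boundaries_mod I B A' j"
      using h(2) unfolding g * restrict_Q_eq boundaries_mod_def by blast
  next
    assume "f \<in> boundaries_mod I B A' j"
    then obtain g where "\<forall>c\<in>B j. f c - (\<Sum>b\<in>B (Suc j). A' (Suc j) c b * g b) \<in> I"
      unfolding boundaries_mod_def by blast
    then have "(\<lambda>b\<in>B j. Q (f b)) = matrix_map R (B (Suc j)) (B j) (A (Suc j)) (\<lambda>b\<in>B (Suc j). Q (g b))"
      unfolding * restrict_Q_eq .
    then show "(\<lambda>b\<in>B j. Q (f b)) \<in> boundaries R B A j"
      unfolding boundaries_def using restrict_in_free_module by blast
  qed
qed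

lemma cycles_lift:
  assumes "z \<in> cycles R B A j"
  obtains z' where "z = (\<lambda>b\<in>B j. Q (z' b))" "z' \<in> cycles_mod I B A' j"
proof -
  have "z \<in> free_module R (B j)" using assms by (simp add: cycles_def)
  then obtain z' where "z = (\<lambda>b\<in>B j. Q (z' b))" using lift by blast
  then show thesis using that cycles_iff assms by blast
qed

text \<open>Unique existence of coefficients amounts to generation and independence: uniqueness at
  the cycle 0 gives independence, and the difference of two solutions is a relation. Coefficient
  functions are restricted to the index set, which does not affect the sums.\<close>

lemma has_homology_dim_iff:
  fixes K :: "'k::field \<Rightarrow> 'p"
  assumes K: "K 1 = 1" "\<And>a b. K (a + b) = K a + K b" "\<And>a b. K (a * b) = K a * K b"
    and I: "0 \<in> I" "\<And>a b. a \<in> I \<Longrightarrow> b \<in> I \<Longrightarrow> a + b \<in> I" "\<And>a p. a \<in> I \<Longrightarrow> p * a \<in> I"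
    and \<kappa>: "\<And>c. \<kappa> c = Q (K c)"
  shows "has_homology_dim R \<kappa> B A j n \<longleftrightarrow>
    (\<exists>x. field_space.basis_mod (\<lambda>a (f :: 'i \<Rightarrow> 'p) b. K a * f b) (cycles_mod I B A' j) (boundaries_mod I B A' j) n x)"
proof -
  interpret W: field_space "\<lambda>a (f :: 'i \<Rightarrow> 'p) b. K a * f b"
    by (rule field_space_fun[OF K])
  let ?Z = "cycles_mod I B A' j" and ?B = "boundaries_mod I B A' j"
  have subB: "W.subspace ?B"
  proof (rule W.subspaceI)
    show "0 \<in> ?B" unfolding boundaries_mod_def using I by (auto intro!: exI[of _ "\<lambda>_. 0"])
  next
    fix f f' assume "f \<in> ?B" "f' \<in> ?B"
    then obtain g g' where g: "\<And>c. c \<in> B j \<Longrightarrow> f c - (\<Sum>b\<in>B (Suc j). A' (Suc j) c b * g b) \<in> I"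
      "\<And>c. c \<in> B j \<Longrightarrow> f' c - (\<Sum>b\<in>B (Suc j). A' (Suc j) c b * g' b) \<in> I"
      unfolding boundaries_mod_def by blast
    have "(f + f') c - (\<Sum>b\<in>B (Suc j). A' (Suc j) c b * (g b + g' b)) \<in> I" if "c \<in> B j" for c
      using I(2)[OF g[OF that]] by (simp add: distrib_left sum.distrib algebra_simps)
    then show "f + f' \<in> ?B" unfolding boundaries_mod_def
      by (intro CollectI exI[of _ "\<lambda>b. g b + g' b"]) blast
  next
    fix a f assume "f \<in> ?B"
    then obtain g where g: "\<And>c. c \<in> B j \<Longrightarrow> f c - (\<Sum>b\<in>B (Suc j). A' (Suc j) c b * g b) \<in> I"
      unfolding boundaries_mod_def by blast
    have "K a * f c - (\<Sum>b\<in>B (Suc j). A' (Suc j) c b * (K a * g b)) \<in> I" if "c \<in> B j" for c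
      using I(3)[OF g[OF that], of "K a"] by (simp add: right_diff_distrib sum_distrib_left mult_ac)
    then show "(\<lambda>b. K a * f b) \<in> ?B" unfolding boundaries_mod_def
      by (intro CollectI exI[of _ "\<lambda>b. K a * g b"]) blast
  qed
  have zeroZ: "0 \<in> ?Z" by (simp add: cycles_mod_def I)
  have comb: "(\<lambda>b\<in>B j. (\<lambda>b\<in>B j. Q (z b)) b \<ominus> (\<Oplus>i\<in>{..<n}. \<kappa> (a i) \<otimes> x i b)) \<in> boundaries R B A j
     \<longleftrightarrow> z - (\<Sum>i<n. (\<lambda>b. K (a i) * x' i b)) \<in> ?B"
    if x: "\<And>i. i < n \<Longrightarrow> x i = (\<lambda>b\<in>B j. Q (x' i b))" for z x x' a
  proof -
    have "(\<lambda>b\<in>B j. (\<lambda>b\<in>B j. Q (z b)) b \<ominus> (\<Oplus>i\<in>{..<n}. \<kappa> (a i) \<otimes> x i b))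
       = (\<lambda>b\<in>B j. Q ((z - (\<Sum>i<n. (\<lambda>b. K (a i) * x' i b))) b))"
    proof (rule restrict_ext)
      fix b assume b: "b \<in> B j"
      have "(\<Oplus>i\<in>{..<n}. \<kappa> (a i) \<otimes> x i b) = (\<Oplus>i\<in>{..<n}. Q (K (a i) * x' i b))"
        using x b by (intro finsum_cong') (auto simp: \<kappa> Q_mult)
      then show "(\<lambda>b\<in>B j. Q (z b)) b \<ominus> (\<Oplus>i\<in>{..<n}. \<kappa> (a i) \<otimes> x i b)
         = Q ((z - (\<Sum>i<n. (\<lambda>b. K (a i) * x' i b))) b)"
        using b by (simp add: Q_finsum Q_diff sum_fun_apply)
    qed
    then show ?thesis by (simp only: boundaries_iff)
  qed
  have restr: "(\<Sum>i<n. (\<lambda>b. K ((restrict a {..<n}) i) * y i b)) = (\<Sum>i<n. (\<lambda>b. K (a i) * y i b))"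
    for a :: "nat \<Rightarrow> 'k" and y :: "nat \<Rightarrow> 'i \<Rightarrow> 'p"
    by (rule sum.cong) auto
  show ?thesis
  proof
    assume "has_homology_dim R \<kappa> B A j n"
    then obtain x where x: "x \<in> {..<n} \<rightarrow> cycles R B A j"
      and ex: "\<forall>z\<in>cycles R B A j. \<exists>!a. a \<in> {..<n} \<rightarrow>\<^sub>E UNIV \<and>
        (\<lambda>b\<in>B j. z b \<ominus> (\<Oplus>i\<in>{..<n}. \<kappa> (a i) \<otimes> x i b)) \<in> boundaries R B A j"
      unfolding has_homology_dim_def by blast
    have "\<forall>i\<in>{..<n}. \<exists>x'. x i = (\<lambda>b\<in>B j. Q (x' b)) \<and> x' \<in> ?Z"
    proof
      fix i assume "i \<in> {..<n}"
      then have "x i \<in> cycles R B A j" using x by auto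
      then show "\<exists>x'. x i = (\<lambda>b\<in>B j. Q (x' b)) \<and> x' \<in> ?Z" by (rule cycles_lift) blast
    qed
    from bchoice[OF this] obtain x' where x': "\<And>i. i < n \<Longrightarrow> x i = (\<lambda>b\<in>B j. Q (x' i b))"
        "\<And>i. i < n \<Longrightarrow> x' i \<in> ?Z" by blast
    have ex': "\<exists>!a. a \<in> {..<n} \<rightarrow>\<^sub>E UNIV \<and> z - (\<Sum>i<n. (\<lambda>b. K (a i) * x' i b)) \<in> ?B"
      if z: "z \<in> ?Z" for z
    proof -
      have "(\<lambda>b\<in>B j. Q (z b)) \<in> cycles R B A j" using z cycles_iff by blast
      from bspec[OF ex this] show ?thesis by (simp only: comb[OF x'(1)])
    qed
    have "W.basis_mod ?Z ?B n x'"
      unfolding W.basis_mod_def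
    proof (intro conjI allI impI ballI)
      fix z assume "z \<in> ?Z"
      then show "\<exists>a. z - (\<Sum>i<n. (\<lambda>b. K (a i) * x' i b)) \<in> ?B" using ex' by blast
    next
      fix a i assume a: "(\<Sum>i<n. (\<lambda>b. K (a i) * x' i b)) \<in> ?B" and i: "i < n"
      have uniq: "a = a'" if "a \<in> {..<n} \<rightarrow>\<^sub>E UNIV" "0 - (\<Sum>i<n. (\<lambda>b. K (a i) * x' i b)) \<in> ?B"
        "a' \<in> {..<n} \<rightarrow>\<^sub>E UNIV" "0 - (\<Sum>i<n. (\<lambda>b. K (a' i) * x' i b)) \<in> ?B" for a a'
        using ex'[OF zeroZ] that by blast
      have "0 - (\<Sum>i<n. (\<lambda>b. K ((restrict a {..<n}) i) * x' i b)) \<in> ?B"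
        using W.subspace_neg[OF subB a] unfolding restr by simp
      moreover have "K 0 = 0" using K(2)[of 0 0] by simp
      then have "0 - (\<Sum>i<n. (\<lambda>b. K ((restrict (\<lambda>_. 0) {..<n}) i) * x' i b)) \<in> ?B"
        using W.subspace_0[OF subB] unfolding restr by (simp add: zero_fun_def[symmetric])
      ultimately have "restrict a {..<n} = restrict (\<lambda>_. 0) {..<n}"
        by (intro uniq) simp_all
      then show "a i = 0" using i by (metis lessThan_iff restrict_apply')
    qed (use x' in auto)
    then show "\<exists>x. W.basis_mod ?Z ?B n x" by blast
  next
    assume "\<exists>x. W.basis_mod ?Z ?B n x"
    then obtain x' where x': "\<And>i. i < n \<Longrightarrow> x' i \<in> ?Z"
       "\<And>z. z \<in> ?Z \<Longrightarrow> \<exists>a. z - (\<Sum>i<n. (\<lambda>b. K (a i) * x' i b)) \<in> ?B"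
       "\<And>a i. (\<Sum>i<n. (\<lambda>b. K (a i) * x' i b)) \<in> ?B \<Longrightarrow> i < n \<Longrightarrow> a i = 0"
      unfolding W.basis_mod_def by blast
    define x where "x i = (\<lambda>b\<in>B j. Q (x' i b))" for i
    show "has_homology_dim R \<kappa> B A j n"
      unfolding has_homology_dim_def
    proof (intro bexI[of _ x] ballI)
      show "x \<in> {..<n} \<rightarrow> cycles R B A j" using x' cycles_iff by (auto simp: x_def)
    next
      fix z assume "z \<in> cycles R B A j"
      then obtain z' where z': "z = (\<lambda>b\<in>B j. Q (z' b))" "z' \<in> ?Z" by (rule cycles_lift)
      show "\<exists>!a. a \<in> {..<n} \<rightarrow>\<^sub>E UNIV \<and>
        (\<lambda>b\<in>B j. z b \<ominus> (\<Oplus>i\<in>{..<n}. \<kappa> (a i) \<otimes> x i b)) \<in> boundaries R B A j"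
        unfolding z'(1) comb[OF x_def]
      proof (rule ex_ex1I)
        obtain a where "z' - (\<Sum>i<n. (\<lambda>b. K (a i) * x' i b)) \<in> ?B" using x'(2)[OF z'(2)] by blast
        then have "z' - (\<Sum>i<n. (\<lambda>b. K ((restrict a {..<n}) i) * x' i b)) \<in> ?B" unfolding restr .
        then show "\<exists>a. a \<in> {..<n} \<rightarrow>\<^sub>E UNIV \<and> z' - (\<Sum>i<n. (\<lambda>b. K (a i) * x' i b)) \<in> ?B"
          by (intro exI[of _ "restrict a {..<n}"]) simp
      next
        fix a a' assume a: "a \<in> {..<n} \<rightarrow>\<^sub>E UNIV \<and> z' - (\<Sum>i<n. (\<lambda>b. K (a i) * x' i b)) \<in> ?B"
          and a': "a' \<in> {..<n} \<rightarrow>\<^sub>E UNIV \<and> z' - (\<Sum>i<n. (\<lambda>b. K (a' i) * x' i b)) \<in> ?B"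
        have "(z' - (\<Sum>i<n. (\<lambda>b. K (a' i) * x' i b))) - (z' - (\<Sum>i<n. (\<lambda>b. K (a i) * x' i b))) \<in> ?B"
          using a a' W.subspace_diff[OF subB] by blast
        also have "(z' - (\<Sum>i<n. (\<lambda>b. K (a' i) * x' i b))) - (z' - (\<Sum>i<n. (\<lambda>b. K (a i) * x' i b)))
          = (\<Sum>i<n. (\<lambda>b. K (a i - a' i) * x' i b))"
          by (simp only: W.scale_left_diff_distrib sum_subtractf) (simp add: algebra_simps)
        finally have "a i = a' i" if "i < n" for i
          using x'(3)[of "\<lambda>i. a i - a' i" i] that by auto
        then show "a = a'" using a a' by (intro PiE_ext[of a "{..<n}" "\<lambda>_. UNIV" a']) auto
      qed
    qed
  qed
qed

end
end

section \<open>Stanley--Reisner rings\<close>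

lemma keys_add_nat: "Poly_Mapping.keys (m + m' :: 'v \<Rightarrow>\<^sub>0 nat) = Poly_Mapping.keys m \<union> Poly_Mapping.keys m'"
  by (auto simp: in_keys_iff lookup_add)

lemma poly_mapping_sum_single:
  "(\<Sum>m\<in>Poly_Mapping.keys p. Poly_Mapping.single m (Poly_Mapping.lookup p m)) = p"
proof (rule poly_mapping_eqI)
  fix k
  have "Poly_Mapping.lookup (\<Sum>m\<in>Poly_Mapping.keys p. Poly_Mapping.single m (Poly_Mapping.lookup p m)) k
    = (\<Sum>m\<in>Poly_Mapping.keys p. if m = k then Poly_Mapping.lookup p k else 0)"
    unfolding lookup_sum by (rule sum.cong) (auto simp: lookup_single when_def)
  also have "\<dots> = Poly_Mapping.lookup p k" by (simp add: in_keys_iff)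
  finally show "Poly_Mapping.lookup (\<Sum>m\<in>Poly_Mapping.keys p. Poly_Mapping.single m (Poly_Mapping.lookup p m)) k
    = Poly_Mapping.lookup p k" .
qed

definition polys_in :: "'v set \<Rightarrow> ('v, 'k::field) mpoly set" where
  "polys_in V = {p. \<forall>m\<in>Poly_Mapping.keys p. Poly_Mapping.keys m \<subseteq> V}"

lemma poly_ring_simps [simp]:
  "carrier (poly_ring V) = polys_in V" "mult (poly_ring V) = (*)" "one (poly_ring V) = 1"
  "zero (poly_ring V) = 0" "add (poly_ring V) = (+)"
  by (simp_all add: poly_ring_def polys_in_def)

lemma polys_in_simps:
  "0 \<in> polys_in V" "1 \<in> polys_in V" "p \<in> polys_in V \<Longrightarrow> - p \<in> polys_in V"
  by (auto simp: polys_in_def in_keys_iff lookup_one when_def)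

lemma polys_in_add: "p \<in> polys_in V \<Longrightarrow> q \<in> polys_in V \<Longrightarrow> p + q \<in> polys_in V"
  using keys_add[of p q] by (auto simp: polys_in_def)

lemma polys_in_diff: "p \<in> polys_in V \<Longrightarrow> q \<in> polys_in V \<Longrightarrow> p - q \<in> polys_in V"
  using polys_in_add[of p V "- q"] polys_in_simps(3)[of q V] by simp

lemma polys_in_mult: "p \<in> polys_in V \<Longrightarrow> q \<in> polys_in V \<Longrightarrow> p * q \<in> polys_in V"
  using keys_mult[of p q] by (fastforce simp: polys_in_def keys_add_nat)

lemma polys_in_sum: "(\<And>i. i \<in> A \<Longrightarrow> f i \<in> polys_in V) \<Longrightarrow> sum f A \<in> polys_in V"
  by (induction A rule: infinite_finite_induct) (auto simp: polys_in_simps polys_in_add)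

lemma polys_in_single: "c = 0 \<or> Poly_Mapping.keys m \<subseteq> V \<Longrightarrow> Poly_Mapping.single m c \<in> polys_in V"
  by (auto simp: polys_in_def)

lemma cring_poly_ring: "cring (poly_ring V :: ('v, 'k::field) mpoly ring)"
proof (rule cringI)
  show "abelian_group (poly_ring V :: ('v, 'k) mpoly ring)"
  proof (rule abelian_groupI)
    fix x :: "('v, 'k) mpoly" assume "x \<in> carrier (poly_ring V)"
    then show "\<exists>y\<in>carrier (poly_ring V). y \<oplus>\<^bsub>poly_ring V\<^esub> x = \<zero>\<^bsub>poly_ring V\<^esub>"
      by (intro bexI[of _ "- x"]) (auto simp: polys_in_simps)
  qed (auto simp: polys_in_add polys_in_simps add_ac)
  show "Group.comm_monoid (poly_ring V :: ('v, 'k) mpoly ring)"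
    by (rule comm_monoidI) (auto simp: polys_in_mult polys_in_simps mult_ac)
qed (auto simp: distrib_right)

lemma poly_ring_minus:
  assumes "p \<in> polys_in V" "q \<in> polys_in V"
  shows "p \<ominus>\<^bsub>poly_ring V\<^esub> q = p - q"
proof -
  interpret S: cring "poly_ring V" by (rule cring_poly_ring)
  have "\<ominus>\<^bsub>poly_ring V\<^esub> q = - q"
    using assms polys_in_simps(3)[OF assms(2)] by (intro S.minus_equality) auto
  then show ?thesis by (simp add: a_minus_def)
qed

lemma ideal_sum_single:
  assumes J: "ideal J (poly_ring V)"
    and "\<And>m. m \<in> Poly_Mapping.keys p \<Longrightarrow> Poly_Mapping.single m (Poly_Mapping.lookup p m) \<in> J"
  shows "p \<in> J"
proof -
  have add: "additive_subgroup J (poly_ring V)" using J by (rule ideal.axioms)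
  have "(\<Sum>m\<in>A. Poly_Mapping.single m (Poly_Mapping.lookup p m)) \<in> J" if "finite A" "A \<subseteq> Poly_Mapping.keys p" for A
    using that
  proof (induction A rule: finite_induct)
    case empty
    then show ?case using additive_subgroup.zero_closed[OF add] by simp
  next
    case (insert x F)
    then show ?case using assms(2)[of x] additive_subgroup.a_closed[OF add] by simp
  qed
  then show ?thesis using poly_mapping_sum_single[of p] by (metis finite_keys order_refl)
qed

lemma prod_Var:
  "finite M \<Longrightarrow> (\<Prod>v\<in>M. Var v :: ('v, 'k::field) mpoly)
    = Poly_Mapping.single (\<Sum>v\<in>M. Poly_Mapping.single v (Suc 0)) 1"
  by (induction M rule: finite_induct) (auto simp: Var_def mult_single)

lemma lookup_sum_single:
  "finite M \<Longrightarrow> Poly_Mapping.lookup (\<Sum>v\<in>M. Poly_Mapping.single v (Suc 0)) x = (if x \<in> M then 1 else 0)"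
  by (induction M rule: finite_induct) (auto simp: lookup_add lookup_single when_def)

lemma keys_sum_single:
  "finite M \<Longrightarrow> Poly_Mapping.keys (\<Sum>v\<in>M. Poly_Mapping.single v (Suc 0)) = M"
proof -
  assume M: "finite M"
  have "x \<in> Poly_Mapping.keys (\<Sum>v\<in>M. Poly_Mapping.single v (Suc 0)) \<longleftrightarrow> x \<in> M" for x
    by (simp add: in_keys_iff lookup_sum_single[OF M])
  then show ?thesis by blast
qed

text \<open>The Stanley--Reisner ideal extended to the polynomial ring in all elements of the type.
  An element outside \<open>V\<close> lies in no face, so its variable belongs to the extended ideal
  and the quotient ring stays the same.\<close>

definition nonfaces :: "'v set set \<Rightarrow> ('v, 'k::field) mpoly set" where
  "nonfaces \<Delta> = {p. \<forall>m\<in>Poly_Mapping.keys p. Poly_Mapping.keys m \<notin> \<Delta>}"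

locale simplicial_complex =
  fixes \<Delta> :: "'v set set"
  assumes complex: "abstract_simplicial_complex \<Delta>"
begin

abbreviation "V \<equiv> \<Union>\<Delta>"

lemma face_subset: "F \<in> \<Delta> \<Longrightarrow> G \<subseteq> F \<Longrightarrow> G \<in> \<Delta>"
  and finite_face: "F \<in> \<Delta> \<Longrightarrow> finite F"
  and finite_complex: "finite \<Delta>"
  using complex unfolding abstract_simplicial_complex_def by auto

lemma empty_face: "{} \<in> \<Delta>"
  using complex unfolding abstract_simplicial_complex_def by auto

lemma finite_V: "finite V"
  using complex unfolding abstract_simplicial_complex_def by auto

lemma vertex_face: "v \<in> V \<Longrightarrow> {v} \<in> \<Delta>"
  using face_subset by (metis UnionE empty_subsetI insert_subset)

lemma face_V: "F \<in> \<Delta> \<Longrightarrow> F \<subseteq> V" by blast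

lemma nonfaces_0: "0 \<in> nonfaces \<Delta>" by (simp add: nonfaces_def)

lemma nonfaces_add: "p \<in> nonfaces \<Delta> \<Longrightarrow> q \<in> nonfaces \<Delta> \<Longrightarrow> p + q \<in> nonfaces \<Delta>"
  using keys_add[of p q] by (auto simp: nonfaces_def)

lemma nonfaces_uminus: "p \<in> nonfaces \<Delta> \<Longrightarrow> - p \<in> nonfaces \<Delta>"
  by (auto simp: nonfaces_def in_keys_iff)

lemma nonfaces_diff: "p \<in> nonfaces \<Delta> \<Longrightarrow> q \<in> nonfaces \<Delta> \<Longrightarrow> p - q \<in> nonfaces \<Delta>"
  by (metis nonfaces_add nonfaces_uminus diff_conv_add_uminus)

lemma nonfaces_mult: "q \<in> nonfaces \<Delta> \<Longrightarrow> p * q \<in> nonfaces \<Delta>"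
proof -
  assume q: "q \<in> nonfaces \<Delta>"
  have "Poly_Mapping.keys m \<notin> \<Delta>" if m: "m \<in> Poly_Mapping.keys (p * q)" for m
  proof -
    obtain a b where ab: "m = a + b" "b \<in> Poly_Mapping.keys q" using keys_mult[of p q] m by blast
    then have "Poly_Mapping.keys b \<notin> \<Delta>" using q by (simp add: nonfaces_def)
    then show ?thesis using face_subset[of "Poly_Mapping.keys m" "Poly_Mapping.keys b"] ab
      by (auto simp: keys_add_nat)
  qed
  then show ?thesis by (simp add: nonfaces_def)
qed

lemma nonfaces_mult2: "q \<in> nonfaces \<Delta> \<Longrightarrow> q * p \<in> nonfaces \<Delta>"
  using nonfaces_mult[of q p] by (simp add: mult.commute)

lemma nonfaces_sum: "(\<And>i. i \<in> A \<Longrightarrow> f i \<in> nonfaces \<Delta>) \<Longrightarrow> sum f A \<in> nonfaces \<Delta>"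
  by (induction A rule: infinite_finite_induct) (auto simp: nonfaces_0 nonfaces_add)

lemma nonfaces_lookup: "p \<in> nonfaces \<Delta> \<Longrightarrow> Poly_Mapping.keys m \<in> \<Delta> \<Longrightarrow> Poly_Mapping.lookup p m = 0"
  by (auto simp: nonfaces_def in_keys_iff)

lemma ideal_nonfaces:
  "ideal (nonfaces \<Delta> \<inter> polys_in V) (poly_ring V :: ('v, 'k::field) mpoly ring)"
proof -
  interpret S: cring "poly_ring V :: ('v, 'k) mpoly ring" by (rule cring_poly_ring)
  show ?thesis
  proof (rule idealI)
    show "ring (poly_ring V :: ('v, 'k) mpoly ring)" by (rule S.ring_axioms)
    show "subgroup (nonfaces \<Delta> \<inter> polys_in V) (add_monoid (poly_ring V :: ('v, 'k) mpoly ring))"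
    proof (rule S.add.subgroupI)
      fix p :: "('v, 'k) mpoly" assume p: "p \<in> nonfaces \<Delta> \<inter> polys_in V"
      then have "\<ominus>\<^bsub>poly_ring V\<^esub> p = - p"
        using polys_in_simps(3)[of p V] by (intro S.minus_equality) auto
      then show "\<ominus>\<^bsub>poly_ring V\<^esub> p \<in> nonfaces \<Delta> \<inter> polys_in V"
        using p polys_in_simps(3)[of p V] nonfaces_uminus[of p] by auto
    qed (use nonfaces_0 polys_in_simps(1) in \<open>auto simp: nonfaces_add polys_in_add\<close>)
  qed (auto simp: nonfaces_mult nonfaces_mult2 polys_in_mult)
qed

text \<open>A monomial whose support is no face is a multiple of the generator of that support.
  Conversely, supports grow under multiplication and faces are closed under subsets.\<close>

lemma stanley_reisner_ideal_eq:
  "(stanley_reisner_ideal \<Delta> :: ('v, 'k::field) mpoly set) = nonfaces \<Delta> \<inter> polys_in V"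
proof -
  interpret S: cring "poly_ring V :: ('v, 'k) mpoly ring" by (rule cring_poly_ring)
  let ?G = "{\<Prod>v\<in>M. Var v | M. M \<subseteq> V \<and> M \<notin> \<Delta>} :: ('v, 'k) mpoly set"
  have fin: "finite M" if "M \<subseteq> V" for M using that finite_V finite_subset by blast
  have G: "?G \<subseteq> nonfaces \<Delta> \<inter> polys_in V"
  proof
    fix p assume "p \<in> ?G"
    then obtain M where M: "p = (\<Prod>v\<in>M. Var v)" "M \<subseteq> V" "M \<notin> \<Delta>" by blast
    then have "Poly_Mapping.keys p = {\<Sum>v\<in>M. Poly_Mapping.single v (Suc 0)}"
      by (simp add: prod_Var fin)
    then show "p \<in> nonfaces \<Delta> \<inter> polys_in V"
      using M keys_sum_single[OF fin[OF M(2)]] by (simp add: nonfaces_def polys_in_def)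
  qed
  have Gc: "?G \<subseteq> carrier (poly_ring V)" using G by auto
  show ?thesis
  proof
    show "(stanley_reisner_ideal \<Delta> :: ('v, 'k) mpoly set) \<subseteq> nonfaces \<Delta> \<inter> polys_in V"
      unfolding stanley_reisner_ideal_def using S.genideal_minimal[OF ideal_nonfaces G] .
    have J: "ideal (stanley_reisner_ideal \<Delta> :: ('v, 'k) mpoly set) (poly_ring V)"
      unfolding stanley_reisner_ideal_def using S.genideal_ideal[OF Gc] .
    interpret J: ideal "stanley_reisner_ideal \<Delta> :: ('v, 'k) mpoly set" "poly_ring V" by (rule J)
    show "nonfaces \<Delta> \<inter> polys_in V \<subseteq> (stanley_reisner_ideal \<Delta> :: ('v, 'k) mpoly set)"
    proof
      fix p :: "('v, 'k) mpoly" assume p: "p \<in> nonfaces \<Delta> \<inter> polys_in V"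
      show "p \<in> stanley_reisner_ideal \<Delta>"
      proof (rule ideal_sum_single[OF J])
        fix m assume "m \<in> Poly_Mapping.keys p"
        then have m: "Poly_Mapping.keys m \<notin> \<Delta>" "Poly_Mapping.keys m \<subseteq> V"
          using p by (auto simp: nonfaces_def polys_in_def)
        define M where "M = Poly_Mapping.keys m"
        have g: "(\<Prod>v\<in>M. Var v) \<in> (stanley_reisner_ideal \<Delta> :: ('v, 'k) mpoly set)"
          unfolding stanley_reisner_ideal_def using S.genideal_self[OF Gc] m by (auto simp: M_def)
        have finM: "finite M" by (simp add: M_def)
        have "m = (m - (\<Sum>v\<in>M. Poly_Mapping.single v (Suc 0))) + (\<Sum>v\<in>M. Poly_Mapping.single v (Suc 0))"
        proof (rule poly_mapping_eqI)
          fix k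
          have "k \<in> M \<Longrightarrow> 0 < Poly_Mapping.lookup m k" by (simp add: M_def in_keys_iff)
          then show "Poly_Mapping.lookup m k = Poly_Mapping.lookup ((m - (\<Sum>v\<in>M. Poly_Mapping.single v (Suc 0)))
              + (\<Sum>v\<in>M. Poly_Mapping.single v (Suc 0))) k"
            by (cases "k \<in> M") (simp_all add: lookup_add lookup_minus lookup_sum_single[OF finM])
        qed
        then have e: "Poly_Mapping.single m (Poly_Mapping.lookup p m) =
           Poly_Mapping.single (m - (\<Sum>v\<in>M. Poly_Mapping.single v (Suc 0))) (Poly_Mapping.lookup p m) * (\<Prod>v\<in>M. Var v)"
          by (simp add: prod_Var[OF finM] mult_single)
        have "Poly_Mapping.keys (m - (\<Sum>v\<in>M. Poly_Mapping.single v (Suc 0))) \<subseteq> V"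
          using m(2) by (auto simp: in_keys_iff lookup_minus)
        then have "Poly_Mapping.single (m - (\<Sum>v\<in>M. Poly_Mapping.single v (Suc 0))) (Poly_Mapping.lookup p m)
            \<in> carrier (poly_ring V)"
          unfolding poly_ring_simps by (intro polys_in_single disjI2)
        then show "Poly_Mapping.single m (Poly_Mapping.lookup p m) \<in> stanley_reisner_ideal \<Delta>"
          unfolding e using J.I_l_closed[OF g] by simp
      qed
    qed
  qed
qed

text \<open>The dropped monomials lie in \<open>nonfaces \<Delta>\<close>. Truncation thus extends
  the passage to cosets from \<open>polys_in V\<close> to all polynomials of the type.\<close>

definition trunc :: "('v, 'k::field) mpoly \<Rightarrow> ('v, 'k) mpoly" where
  "trunc p = (\<Sum>m\<in>{m \<in> Poly_Mapping.keys p. Poly_Mapping.keys m \<subseteq> V}.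
      Poly_Mapping.single m (Poly_Mapping.lookup p m))"

lemma trunc:
  fixes p :: "('v, 'k::field) mpoly"
  shows "trunc p \<in> polys_in V" "p - trunc p \<in> nonfaces \<Delta>"
proof -
  show "trunc p \<in> polys_in V"
    unfolding trunc_def by (intro polys_in_sum polys_in_single) auto
  have "p - trunc p = (\<Sum>m\<in>{m \<in> Poly_Mapping.keys p. \<not> Poly_Mapping.keys m \<subseteq> V}.
      Poly_Mapping.single m (Poly_Mapping.lookup p m))"
  proof -
    have *: "sum f (Poly_Mapping.keys p) = sum f {m \<in> Poly_Mapping.keys p. Poly_Mapping.keys m \<subseteq> V} +
       sum f {m \<in> Poly_Mapping.keys p. \<not> Poly_Mapping.keys m \<subseteq> V}" for f :: "_ \<Rightarrow> ('v, 'k) mpoly"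
      by (subst sum.union_disjoint[symmetric]) (auto intro: sum.cong)
    show ?thesis unfolding trunc_def
      using *[of "\<lambda>m. Poly_Mapping.single m (Poly_Mapping.lookup p m)"] unfolding poly_mapping_sum_single
      by (simp add: algebra_simps)
  qed
  also have "\<dots> \<in> nonfaces \<Delta>"
  proof (rule nonfaces_sum)
    fix m assume "m \<in> {m \<in> Poly_Mapping.keys p. \<not> Poly_Mapping.keys m \<subseteq> V}"
    then show "Poly_Mapping.single m (Poly_Mapping.lookup p m) \<in> nonfaces \<Delta>"
      using face_V[of "Poly_Mapping.keys m"] by (auto simp: nonfaces_def)
  qed
  finally show "p - trunc p \<in> nonfaces \<Delta>" .
qed

definition sr_ring :: "('v, 'k::field) mpoly set ring" where
  "sr_ring = poly_ring V Quot stanley_reisner_ideal \<Delta>"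

definition sr_class :: "('v, 'k::field) mpoly \<Rightarrow> ('v, 'k) mpoly set" where
  "sr_class p = stanley_reisner_ideal \<Delta> +>\<^bsub>poly_ring V\<^esub> trunc p"

lemma sr_class_eq:
  assumes "p' \<in> polys_in V" "p - p' \<in> nonfaces \<Delta>"
  shows "sr_class p = stanley_reisner_ideal \<Delta> +>\<^bsub>poly_ring V\<^esub> (p' :: ('v, 'k::field) mpoly)"
proof -
  interpret S: cring "poly_ring V :: ('v, 'k) mpoly ring" by (rule cring_poly_ring)
  have "trunc p - p' = (p - p') - (p - trunc p)" by simp
  then have "trunc p - p' \<in> nonfaces \<Delta>" using nonfaces_diff assms(2) trunc(2) by metis
  then have "trunc p \<ominus>\<^bsub>poly_ring V\<^esub> p' \<in> stanley_reisner_ideal \<Delta>"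
    using assms(1) trunc(1)[of p] by (simp add: poly_ring_minus stanley_reisner_ideal_eq polys_in_diff)
  then show ?thesis
    using S.quotient_eq_iff_same_a_r_cos[OF ideal_nonfaces, of "trunc p" p'] assms(1) trunc(1)[of p]
    unfolding sr_class_def stanley_reisner_ideal_eq by simp
qed

lemma quotient_presentation_sr:
  "quotient_presentation (sr_ring :: ('v, 'k::field) mpoly set ring) sr_class (nonfaces \<Delta>)"
proof -
  interpret S: cring "poly_ring V :: ('v, 'k) mpoly ring" by (rule cring_poly_ring)
  define A where "A = (stanley_reisner_ideal \<Delta> :: ('v, 'k) mpoly set)"
  have A: "ideal A (poly_ring V)" unfolding A_def stanley_reisner_ideal_eq by (rule ideal_nonfaces)
  interpret A: ideal A "poly_ring V" by (rule A)
  interpret R: cring "poly_ring V Quot A" using A.quotient_is_cring[OF cring_poly_ring] .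
  note hom = A.rcos_ring_hom
  have q: "sr_class p = A +>\<^bsub>poly_ring V\<^esub> p'" if "p' \<in> polys_in V" "p - p' \<in> nonfaces \<Delta>" for p p' :: "('v, 'k) mpoly"
    using sr_class_eq[OF that] by (simp add: A_def)
  have t: "sr_class p = A +>\<^bsub>poly_ring V\<^esub> trunc p" for p :: "('v, 'k) mpoly"
    by (simp add: sr_class_def A_def)
  show ?thesis
    unfolding sr_ring_def A_def[symmetric]
  proof (unfold_locales)
    show "range sr_class = carrier (poly_ring V Quot A)"
    proof (intro equalityI subsetI)
      fix x :: "('v, 'k) mpoly set" assume "x \<in> range sr_class"
      then show "x \<in> carrier (poly_ring V Quot A)"
        using trunc(1) ring_hom_closed[OF hom] by (auto simp: t)
    next
      fix x :: "('v, 'k) mpoly set" assume "x \<in> carrier (poly_ring V Quot A)"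
      then obtain p where p: "p \<in> polys_in V" "x = A +>\<^bsub>poly_ring V\<^esub> p"
        unfolding FactRing_def A_RCOSETS_def' by auto
      then have "x = sr_class p" using q[of p p] by (simp add: nonfaces_0)
      then show "x \<in> range sr_class" by blast
    qed
  next
    fix p p' :: "('v, 'k) mpoly"
    have "(p + p') - (trunc p + trunc p') = (p - trunc p) + (p' - trunc p')" by simp
    then have "(p + p') - (trunc p + trunc p') \<in> nonfaces \<Delta>"
      using nonfaces_add trunc(2) by metis
    then have "sr_class (p + p') = A +>\<^bsub>poly_ring V\<^esub> (trunc p + trunc p')"
      by (intro q polys_in_add trunc)
    then show "sr_class (p + p') = sr_class p \<oplus>\<^bsub>poly_ring V Quot A\<^esub> sr_class p'"
      using ring_hom_add[OF hom, of "trunc p" "trunc p'"] by (simp add: t trunc(1))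
  next
    fix p p' :: "('v, 'k) mpoly"
    have "p * p' - trunc p * trunc p' = p' * (p - trunc p) + trunc p * (p' - trunc p')"
      by (simp add: algebra_simps)
    then have "p * p' - trunc p * trunc p' \<in> nonfaces \<Delta>"
      using nonfaces_add nonfaces_mult trunc(2) by metis
    then have "sr_class (p * p') = A +>\<^bsub>poly_ring V\<^esub> (trunc p * trunc p')"
      by (intro q polys_in_mult trunc)
    then show "sr_class (p * p') = sr_class p \<otimes>\<^bsub>poly_ring V Quot A\<^esub> sr_class p'"
      using ring_hom_mult[OF hom, of "trunc p" "trunc p'"] by (simp add: t trunc(1))
  next
    show "sr_class 1 = \<one>\<^bsub>poly_ring V Quot A\<^esub>"
      using q[of 1 1] ring_hom_one[OF hom] by (simp add: nonfaces_0 polys_in_simps)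
  next
    fix p p' :: "('v, 'k) mpoly"
    have "sr_class p = sr_class p' \<longleftrightarrow> trunc p - trunc p' \<in> A"
      using S.quotient_eq_iff_same_a_r_cos[OF A, of "trunc p" "trunc p'"]
      by (simp add: t poly_ring_minus trunc(1))
    also have "\<dots> \<longleftrightarrow> trunc p - trunc p' \<in> nonfaces \<Delta>"
      by (simp add: A_def stanley_reisner_ideal_eq trunc(1) polys_in_diff)
    also have "\<dots> \<longleftrightarrow> p - p' \<in> nonfaces \<Delta>"
    proof -
      have e: "p - p' = (trunc p - trunc p') + ((p - trunc p) - (p' - trunc p'))" by simp
      have i: "(p - trunc p) - (p' - trunc p') \<in> nonfaces \<Delta>" using trunc(2) nonfaces_diff by blast
      show ?thesis
      proof
        show "trunc p - trunc p' \<in> nonfaces \<Delta> \<Longrightarrow> p - p' \<in> nonfaces \<Delta>"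
          unfolding e using nonfaces_add i by blast
        have "trunc p - trunc p' = (p - p') - ((p - trunc p) - (p' - trunc p'))" by simp
        then show "p - p' \<in> nonfaces \<Delta> \<Longrightarrow> trunc p - trunc p' \<in> nonfaces \<Delta>"
          using nonfaces_diff i by metis
      qed
    qed
    finally show "sr_class p = sr_class p' \<longleftrightarrow> p - p' \<in> nonfaces \<Delta>" .
  qed
qed

end

section \<open>Constant coefficients and products with constants and variables\<close>

definition const_coeff :: "('v, 'k::field) mpoly \<Rightarrow> 'k" where
  "const_coeff p = Poly_Mapping.lookup p 0"

lemma const_coeff_add: "const_coeff (p + q) = const_coeff p + const_coeff q"
  by (simp add: const_coeff_def lookup_add)

lemma const_coeff_sum: "const_coeff (sum f A) = (\<Sum>i\<in>A. const_coeff (f i))"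
  by (simp add: const_coeff_def lookup_sum)

lemma add_eq_zero_nat: "(m + n :: 'v \<Rightarrow>\<^sub>0 nat) = 0 \<longleftrightarrow> m = 0 \<and> n = 0"
  by (auto simp: poly_mapping_eq_iff lookup_add fun_eq_iff)

lemma const_coeff_mult: "const_coeff (p * q) = const_coeff p * const_coeff (q :: ('v, 'k::field) mpoly)"
proof -
  have s: "const_coeff (Poly_Mapping.single m a * Poly_Mapping.single n b)
      = const_coeff (Poly_Mapping.single m a) * const_coeff (Poly_Mapping.single n b)"
    for m n :: "'v \<Rightarrow>\<^sub>0 nat" and a b :: 'k
    by (auto simp: mult_single const_coeff_def lookup_single when_def add_eq_zero_nat)
  have "const_coeff (p * q) = const_coeff ((\<Sum>m\<in>Poly_Mapping.keys p. Poly_Mapping.single m (Poly_Mapping.lookup p m))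
      * (\<Sum>m\<in>Poly_Mapping.keys q. Poly_Mapping.single m (Poly_Mapping.lookup q m)))"
    by (simp only: poly_mapping_sum_single)
  also have "\<dots> = const_coeff (\<Sum>m\<in>Poly_Mapping.keys p. Poly_Mapping.single m (Poly_Mapping.lookup p m))
      * const_coeff (\<Sum>m\<in>Poly_Mapping.keys q. Poly_Mapping.single m (Poly_Mapping.lookup q m))"
    by (simp only: sum_product const_coeff_sum s)
  finally show ?thesis by (simp only: poly_mapping_sum_single)
qed

lemma const_coeff_Const: "const_coeff (Const c) = c"
  by (simp add: const_coeff_def Const_def)

lemma const_coeff_Var: "const_coeff (Var v :: ('v, 'k::field) mpoly) = 0"
proof -
  have "Poly_Mapping.single v (Suc 0) \<noteq> 0"
    by (metis lookup_single_eq lookup_zero nat.distinct(1))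
  then show ?thesis by (simp add: const_coeff_def Var_def lookup_single when_def)
qed

lemma Const_one: "Const 1 = 1" by (simp add: Const_def)
lemma Const_add: "Const (a + b) = Const a + Const b" by (simp add: Const_def single_add)
lemma Const_mult: "Const (a * b) = Const a * Const b" by (simp add: Const_def mult_single)

lemma lookup_Const_mult: "Poly_Mapping.lookup (Const a * p) m = a * Poly_Mapping.lookup p m"
proof -
  have "Const a * p = Poly_Mapping.map ((*) a) p"
    by (simp add: Const_def mult_map_scale_conv_mult)
  then show ?thesis by (simp add: Poly_Mapping.map.rep_eq when_def)
qed

lemma lookup_Var_mult:
  "Poly_Mapping.lookup (Var v * p) m =
     (if 0 < Poly_Mapping.lookup m v then Poly_Mapping.lookup p (m - Poly_Mapping.single v 1) else 0)"
proof -
  let ?s = "Poly_Mapping.single v (1::nat)"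
  have iff: "?s + n = m \<longleftrightarrow> 0 < Poly_Mapping.lookup m v \<and> n = m - ?s" for n
  proof
    assume "?s + n = m"
    then show "0 < Poly_Mapping.lookup m v \<and> n = m - ?s" by (auto simp: lookup_add)
  next
    assume a: "0 < Poly_Mapping.lookup m v \<and> n = m - ?s"
    show "?s + n = m"
      by (rule poly_mapping_eqI) (use a in \<open>auto simp: lookup_add lookup_minus lookup_single when_def\<close>)
  qed
  have "Poly_Mapping.lookup (Var v * p) m = Poly_Mapping.lookup
      (Var v * (\<Sum>n\<in>Poly_Mapping.keys p. Poly_Mapping.single n (Poly_Mapping.lookup p n))) m"
    by (simp only: poly_mapping_sum_single)
  also have "\<dots> = (\<Sum>n\<in>Poly_Mapping.keys p. if ?s + n = m then Poly_Mapping.lookup p n else 0)"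
    by (simp only: sum_distrib_left lookup_sum Var_def mult_single lookup_single when_def mult_1)
  also have "\<dots> = (\<Sum>n\<in>Poly_Mapping.keys p. if n = m - ?s then
      (if 0 < Poly_Mapping.lookup m v then Poly_Mapping.lookup p (m - ?s) else 0) else 0)"
    by (rule sum.cong) (auto simp only: iff split: if_splits)
  also have "\<dots> = (if 0 < Poly_Mapping.lookup m v then Poly_Mapping.lookup p (m - ?s) else 0)"
    by (simp add: in_keys_iff)
  finally show ?thesis .
qed

section \<open>The maximal ideal and its residue field\<close>

context quotient_presentation
begin

lemma quotient_presentation_Quot:
  assumes J: "ideal J R" and I': "\<And>p. Q p \<in> J \<longleftrightarrow> p \<in> I'"
  shows "quotient_presentation (R Quot J) (\<lambda>p. J +> Q p) I'"
proof -
  interpret J: ideal J R by fact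
  interpret RJ: cring "R Quot J" by (rule J.quotient_is_cring[OF is_cring])
  note hom = J.rcos_ring_hom
  show ?thesis
  proof (unfold_locales)
    have "carrier (R Quot J) = (+>) J ` carrier R" unfolding FactRing_def A_RCOSETS_def' by auto
    also have "\<dots> = range (\<lambda>p. J +> Q p)"
      unfolding Q_onto[symmetric] by (simp only: image_image)
    finally show "range (\<lambda>p. J +> Q p) = carrier (R Quot J)" ..
  next
    fix p q
    show "J +> Q p = J +> Q q \<longleftrightarrow> p - q \<in> I'"
      using quotient_eq_iff_same_a_r_cos[OF J, of "Q p" "Q q"] I'[of "p - q"] by (simp add: Q_diff)
  qed (use ring_hom_add[OF hom] ring_hom_mult[OF hom] ring_hom_one[OF hom] in \<open>auto simp: Q_add Q_mult Q_one\<close>)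
qed

text \<open>If the kernel is the zero set of a map \<open>c\<close> with section \<open>K\<close>,
  the elements \<open>K a\<close> represent every class exactly once. For the residue ring this
  gives a presentation by the field itself.\<close>

lemma quotient_presentation_section:
  fixes c :: "'p \<Rightarrow> 'k::comm_ring_1" and K :: "'k \<Rightarrow> 'p"
  assumes I: "I = {p. c p = 0}" and add: "\<And>p q. c (p + q) = c p + c q"
    and K: "K 1 = 1" "\<And>a b. K (a + b) = K a + K b" "\<And>a b. K (a * b) = K a * K b" "\<And>a. c (K a) = a"
  shows "quotient_presentation R (\<lambda>a. Q (K a)) {0}" and "Q p = Q (K (c p))"
proof -
  have diff: "c (p - q) = c p - c q" for p q using add[of "p - q" q] by simp
  have e: "Q p = Q (K (c p))" for p unfolding Q_eq I by (simp add: diff K)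
  then show "Q p = Q (K (c p))" .
  show "quotient_presentation R (\<lambda>a. Q (K a)) {0}"
  proof (unfold_locales)
    show "range (\<lambda>a. Q (K a)) = carrier R"
    proof (intro equalityI subsetI)
      fix x assume "x \<in> carrier R"
      then obtain p where "x = Q p" using Q_onto by (metis imageE)
      then have "x = Q (K (c p))" using e[of p] by simp
      then show "x \<in> range (\<lambda>a. Q (K a))" by (rule image_eqI) simp
    qed auto
    show "Q (K a) = Q (K b) \<longleftrightarrow> a - b \<in> {0}" for a b unfolding Q_eq I by (simp add: diff K)
  qed (auto simp: K Q_add Q_mult Q_one)
qed

end

context simplicial_complex
begin

lemma const_coeff_nonfaces: "p \<in> nonfaces \<Delta> \<Longrightarrow> const_coeff p = 0"
  unfolding const_coeff_def using nonfaces_lookup[of p 0] empty_face by simp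

text \<open>A monomial other than 1 either involves an element outside \<open>V\<close>, and then
  lies in the ideal, or is divisible by the variable of a vertex.\<close>

lemma const_coeff_zero:
  fixes p :: "('v, 'k::field) mpoly"
  assumes "const_coeff p = 0"
  shows "\<exists>g. p - (\<Sum>v\<in>V. Var v * g v) \<in> nonfaces \<Delta>"
proof -
  have single: "\<exists>g. Poly_Mapping.single m c - (\<Sum>v\<in>V. Var v * g v) \<in> nonfaces \<Delta>"
    if "m \<noteq> 0" for m and c :: 'k
  proof (cases "Poly_Mapping.keys m \<subseteq> V")
    case False
    then have "Poly_Mapping.single m c \<in> nonfaces \<Delta>" using face_V by (auto simp: nonfaces_def)
    then show ?thesis by (intro exI[of _ "\<lambda>_. 0"]) simp
  next
    case True
    from \<open>m \<noteq> 0\<close> obtain v where v: "v \<in> Poly_Mapping.keys m" by (metis keys_eq_empty ex_in_conv)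
    define n where "n = m - Poly_Mapping.single v 1"
    have m: "m = Poly_Mapping.single v 1 + n"
      unfolding n_def by (rule poly_mapping_eqI)
        (use v in \<open>auto simp: in_keys_iff lookup_add lookup_minus lookup_single when_def\<close>)
    have "(\<Sum>w\<in>V. Var w * (if w = v then Poly_Mapping.single n c else 0))
        = (\<Sum>w\<in>V. if w = v then Var v * Poly_Mapping.single n c else 0)"
      by (rule sum.cong) auto
    also have "\<dots> = Var v * Poly_Mapping.single n c"
      using v True finite_V by (simp add: subset_iff)
    also have "\<dots> = Poly_Mapping.single m c" unfolding m by (simp add: Var_def mult_single)
    finally show ?thesis using nonfaces_0
      by (intro exI[of _ "\<lambda>w. if w = v then Poly_Mapping.single n c else 0"]) simp
  qed
  have main: "\<exists>g. (\<Sum>m\<in>A. Poly_Mapping.single m (Poly_Mapping.lookup p m)) - (\<Sum>v\<in>V. Var v * g v) \<in> nonfaces \<Delta>"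
    if "finite A" "0 \<notin> A" for A
    using that
  proof (induction A rule: finite_induct)
    case empty
    then show ?case using nonfaces_0 by (intro exI[of _ "\<lambda>_. 0"]) simp
  next
    case (insert m A)
    then obtain g where g: "(\<Sum>m\<in>A. Poly_Mapping.single m (Poly_Mapping.lookup p m)) - (\<Sum>v\<in>V. Var v * g v)
        \<in> nonfaces \<Delta>" by auto
    obtain g' where g': "Poly_Mapping.single m (Poly_Mapping.lookup p m) - (\<Sum>v\<in>V. Var v * g' v) \<in> nonfaces \<Delta>"
      using single[of m "Poly_Mapping.lookup p m"] insert.prems by auto
    show ?case
      using nonfaces_add[OF g' g] insert.hyps
      by (intro exI[of _ "\<lambda>v. g' v + g v"]) (simp add: distrib_left sum.distrib algebra_simps)
  qed
  have "0 \<notin> Poly_Mapping.keys p" using assms by (simp add: const_coeff_def in_keys_iff)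
  from main[OF finite_keys this] show ?thesis unfolding poly_mapping_sum_single .
qed

definition sr_maximal :: "('v, 'k::field) mpoly set set" where
  "sr_maximal = Idl\<^bsub>sr_ring\<^esub> ((\<lambda>v. sr_class (Var v)) ` V)"

text \<open>The classes of polynomials with zero constant coefficient form an ideal containing the
  generators; the reverse inclusion is \<open>const_coeff_zero\<close>.\<close>

lemma sr_maximal:
  shows "ideal (sr_maximal :: ('v, 'k::field) mpoly set set) sr_ring"
    and "sr_class p \<in> (sr_maximal :: ('v, 'k::field) mpoly set set) \<longleftrightarrow> const_coeff p = 0"
proof -
  interpret R: quotient_presentation "sr_ring :: ('v, 'k) mpoly set ring" sr_class "nonfaces \<Delta>"
    by (rule quotient_presentation_sr)
  have sub: "(\<lambda>v. sr_class (Var v)) ` V \<subseteq> carrier (sr_ring :: ('v, 'k) mpoly set ring)"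
    using R.Q_closed by blast
  show M: "ideal (sr_maximal :: ('v, 'k) mpoly set set) sr_ring"
    unfolding sr_maximal_def by (rule R.genideal_ideal[OF sub])
  interpret M: ideal "sr_maximal :: ('v, 'k) mpoly set set" sr_ring by (rule M)
  define J where "J = sr_class ` {p :: ('v, 'k) mpoly. const_coeff p = 0}"
  have J: "ideal J sr_ring"
  proof (rule idealI)
    show "ring (sr_ring :: ('v, 'k) mpoly set ring)" by (rule R.ring_axioms)
    show "subgroup J (add_monoid sr_ring)"
    proof (rule R.add.subgroupI)
      have "sr_class 0 \<in> J" unfolding J_def
        by (intro imageI CollectI) (simp add: const_coeff_def)
      then show "J \<noteq> {}" by blast
    next
      fix x assume "x \<in> J"
      then obtain p where p: "x = sr_class p" "const_coeff p = 0" by (auto simp: J_def)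
      have "const_coeff (- p) = 0" using p const_coeff_add[of p "- p"] by (simp add: const_coeff_def)
      moreover have "\<ominus>\<^bsub>sr_ring\<^esub> x = sr_class (- p)" by (simp add: p R.Q_uminus)
      ultimately show "\<ominus>\<^bsub>sr_ring\<^esub> x \<in> J" by (auto simp: J_def)
    next
      fix x y assume "x \<in> J" "y \<in> J"
      then obtain p q where "x = sr_class p" "const_coeff p = 0" "y = sr_class q" "const_coeff q = 0"
        by (auto simp: J_def)
      then have "x \<oplus>\<^bsub>sr_ring\<^esub> y = sr_class (p + q)" "const_coeff (p + q) = 0"
        by (simp_all add: R.Q_add const_coeff_add)
      then show "x \<oplus>\<^bsub>sr_ring\<^esub> y \<in> J" unfolding J_def by blast
    next
      show "J \<subseteq> carrier sr_ring" unfolding J_def using R.Q_closed by blast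
    qed
  next
    fix x y assume "x \<in> J" "y \<in> carrier (sr_ring :: ('v, 'k) mpoly set ring)"
    then have "x \<in> J" "y \<in> range sr_class" by (simp_all only: R.Q_onto)
    then obtain p q where pq: "x = sr_class p" "const_coeff p = 0" "y = sr_class q"
      unfolding J_def by blast
    then have "y \<otimes>\<^bsub>sr_ring\<^esub> x = sr_class (q * p)" "const_coeff (q * p) = 0"
      "x \<otimes>\<^bsub>sr_ring\<^esub> y = sr_class (p * q)" "const_coeff (p * q) = 0"
      by (simp_all add: R.Q_mult const_coeff_mult)
    then show "y \<otimes>\<^bsub>sr_ring\<^esub> x \<in> J" "x \<otimes>\<^bsub>sr_ring\<^esub> y \<in> J"
      unfolding J_def by blast+
  qed
  have "(\<lambda>v. sr_class (Var v)) ` V \<subseteq> J" unfolding J_def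
    by (intro image_subsetI imageI CollectI const_coeff_Var)
  then have MJ: "sr_maximal \<subseteq> J" unfolding sr_maximal_def by (rule R.genideal_minimal[OF J])
  show "sr_class p \<in> (sr_maximal :: ('v, 'k) mpoly set set) \<longleftrightarrow> const_coeff p = 0" for p
  proof
    assume "sr_class p \<in> (sr_maximal :: ('v, 'k) mpoly set set)"
    then obtain q where q: "sr_class p = sr_class q" "const_coeff q = 0" using MJ by (auto simp: J_def)
    then have "const_coeff (p - q) = 0" using const_coeff_nonfaces R.Q_eq by blast
    then show "const_coeff p = 0" using q(2) const_coeff_add[of "p - q" q] by simp
  next
    assume "const_coeff p = 0"
    then obtain g where g: "p - (\<Sum>v\<in>V. Var v * g v) \<in> nonfaces \<Delta>" using const_coeff_zero by blast
    have gens: "sr_class (Var v) \<in> (sr_maximal :: ('v, 'k) mpoly set set)" if "v \<in> V" for v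
      unfolding sr_maximal_def using R.genideal_self[OF sub] that by blast
    have "sr_class (\<Sum>v\<in>A. Var v * g v) \<in> (sr_maximal :: ('v, 'k) mpoly set set)"
      if "finite A" "A \<subseteq> V" for A
      using that
    proof (induction A rule: finite_induct)
      case empty
      then show ?case using additive_subgroup.zero_closed[OF M.is_additive_subgroup] by (simp add: R.Q_zero)
    next
      case (insert v A)
      have "sr_class (Var v) \<otimes>\<^bsub>sr_ring\<^esub> sr_class (g v) \<in> (sr_maximal :: ('v, 'k) mpoly set set)"
        using gens insert.prems by (intro M.I_r_closed) auto
      then show ?case
        using insert additive_subgroup.a_closed[OF M.is_additive_subgroup] by (simp add: R.Q_add R.Q_mult)
    qed
    then have "sr_class (\<Sum>v\<in>V. Var v * g v) \<in> (sr_maximal :: ('v, 'k) mpoly set set)"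
      using finite_V by blast
    then show "sr_class p \<in> (sr_maximal :: ('v, 'k) mpoly set set)" using g R.Q_eq by metis
  qed
qed

end

subsection \<open>Finiteness of Koszul homology\<close>

definition mon_filter :: "(('v \<Rightarrow>\<^sub>0 nat) \<Rightarrow> bool) \<Rightarrow> ('v, 'k::field) mpoly \<Rightarrow> ('v, 'k) mpoly" where
  "mon_filter P p = Poly_Mapping.Abs_poly_mapping (\<lambda>m. if P m then Poly_Mapping.lookup p m else 0)"

lemma lookup_mon_filter:
  "Poly_Mapping.lookup (mon_filter P p) m = (if P m then Poly_Mapping.lookup p m else 0)"
proof -
  have "finite {m. (if P m then Poly_Mapping.lookup p m else 0) \<noteq> 0}"
    by (rule finite_subset[OF _ finite_keys[of p]]) (auto simp: in_keys_iff)
  then show ?thesis unfolding mon_filter_def by (subst lookup_Abs_poly_mapping) auto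
qed

text \<open>Division by \<open>X\<^sub>v\<close> of the part of degree at least \<open>2\<close> in \<open>X\<^sub>v\<close>; this does not change the support
  of a monomial.\<close>

definition mon_div :: "'v \<Rightarrow> ('v, 'k::field) mpoly \<Rightarrow> ('v, 'k) mpoly" where
  "mon_div v p = Poly_Mapping.Abs_poly_mapping (\<lambda>m. if 0 < Poly_Mapping.lookup m v
      then Poly_Mapping.lookup p (m + Poly_Mapping.single v 1) else 0)"

lemma lookup_mon_div:
  "Poly_Mapping.lookup (mon_div v p) m = (if 0 < Poly_Mapping.lookup m v
      then Poly_Mapping.lookup p (m + Poly_Mapping.single v 1) else 0)"
proof -
  have "finite {m. (if 0 < Poly_Mapping.lookup m v
      then Poly_Mapping.lookup p (m + Poly_Mapping.single v 1) else 0) \<noteq> 0}"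
  proof (rule finite_subset)
    show "{m. (if 0 < Poly_Mapping.lookup m v
      then Poly_Mapping.lookup p (m + Poly_Mapping.single v 1) else 0) \<noteq> 0}
       \<subseteq> (\<lambda>n. n - Poly_Mapping.single v 1) ` Poly_Mapping.keys p"
    proof
      fix m assume "m \<in> {m. (if 0 < Poly_Mapping.lookup m v
        then Poly_Mapping.lookup p (m + Poly_Mapping.single v 1) else 0) \<noteq> 0}"
      then have "m + Poly_Mapping.single v 1 \<in> Poly_Mapping.keys p" by (auto simp: in_keys_iff split: if_splits)
      moreover have "m = (m + Poly_Mapping.single v 1) - Poly_Mapping.single v 1" by simp
      ultimately show "m \<in> (\<lambda>n. n - Poly_Mapping.single v 1) ` Poly_Mapping.keys p" by blast
    qed
  qed simp
  then show ?thesis unfolding mon_div_def by (subst lookup_Abs_poly_mapping) auto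
qed

locale sr_resolution = simplicial_complex \<Delta> +
  koszul_resolution "\<Union>\<Delta>" r "nonfaces \<Delta>" Var Const const_coeff \<beta> D e
  for \<Delta> :: "'v set set" and r :: "'v \<Rightarrow> nat" and \<beta> D and e :: "nat \<Rightarrow> 'k::field"
begin

lemma mon_div_nonfaces:
  assumes "p \<in> nonfaces \<Delta>" shows "mon_div v p \<in> nonfaces \<Delta>"
proof -
  have "Poly_Mapping.lookup (mon_div v p) m = 0" if m: "Poly_Mapping.keys m \<in> \<Delta>" for m
  proof (cases "0 < Poly_Mapping.lookup m v")
    case True
    then have "Poly_Mapping.keys (m + Poly_Mapping.single v (Suc 0)) = Poly_Mapping.keys m"
      by (auto simp: keys_add_nat in_keys_iff)
    then show ?thesis using nonfaces_lookup[OF assms] m by (simp add: lookup_mon_div)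
  qed (simp add: lookup_mon_div)
  then show ?thesis by (auto simp: nonfaces_def in_keys_iff)
qed

lemma mon_div_linear:
  fixes p :: "('v, 'k) mpoly" and f :: "'i \<Rightarrow> ('v, 'k) mpoly"
  shows "mon_div v (sum f A) = (\<Sum>i\<in>A. mon_div v (f i))"
  "mon_div v (koszul_sign r x F * p) = koszul_sign r x F * mon_div v p"
proof -
  show "mon_div v (sum f A) = (\<Sum>i\<in>A. mon_div v (f i))"
    by (rule poly_mapping_eqI) (auto simp: lookup_mon_div lookup_sum)
  have "koszul_sign r x F = (1 :: ('v, 'k) mpoly) \<or> koszul_sign r x F = (- 1 :: ('v, 'k) mpoly)"
    by (simp add: koszul_sign_def minus_one_power_iff)
  then show "mon_div v (koszul_sign r x F * p) = koszul_sign r x F * mon_div v p"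
    by (auto intro!: poly_mapping_eqI simp: lookup_mon_div)
qed

lemma mon_div_Var_neq: "x \<noteq> v \<Longrightarrow> mon_div v (Var x * p) = Var x * mon_div v p"
proof (rule poly_mapping_eqI)
  fix m assume "x \<noteq> v"
  moreover have "(m + Poly_Mapping.single v (Suc 0)) - Poly_Mapping.single x (Suc 0)
     = (m - Poly_Mapping.single x (Suc 0)) + Poly_Mapping.single v (Suc 0)" if "0 < Poly_Mapping.lookup m x"
    by (rule poly_mapping_eqI) (use that \<open>x \<noteq> v\<close> in \<open>auto simp: lookup_add lookup_minus lookup_single when_def\<close>)
  ultimately show "Poly_Mapping.lookup (mon_div v (Var x * p)) m = Poly_Mapping.lookup (Var x * mon_div v p) m"
    by (auto simp: lookup_mon_div lookup_Var_mult lookup_add lookup_minus lookup_single when_def)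
qed

lemma mon_div_Var_self: "mon_div v (Var v * p) = mon_filter (\<lambda>m. 1 \<le> Poly_Mapping.lookup m v) p"
  by (rule poly_mapping_eqI) (auto simp: lookup_mon_div lookup_Var_mult lookup_mon_filter lookup_add)

lemma Var_mon_div: "Var v * mon_div v p = mon_filter (\<lambda>m. 2 \<le> Poly_Mapping.lookup m v) p"
proof (rule poly_mapping_eqI)
  fix m
  have "0 < Poly_Mapping.lookup m v \<Longrightarrow> m - Poly_Mapping.single v (Suc 0) + Poly_Mapping.single v (Suc 0) = m"
    by (rule poly_mapping_eqI) (auto simp: lookup_add lookup_minus lookup_single when_def)
  then show "Poly_Mapping.lookup (Var v * mon_div v p) m
      = Poly_Mapping.lookup (mon_filter (\<lambda>m. 2 \<le> Poly_Mapping.lookup m v) p) m"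
    by (auto simp: lookup_mon_div lookup_Var_mult lookup_mon_filter lookup_minus)
qed

text \<open>The contraction of the Koszul complex in direction \<open>v\<close>: divide by X_v and
  multiply by e_v.\<close>

definition mon_homotopy :: "'v \<Rightarrow> ('v set \<Rightarrow> ('v, 'k) mpoly) \<Rightarrow> 'v set \<Rightarrow> ('v, 'k) mpoly" where
  "mon_homotopy v c = wedge v (\<lambda>G. mon_div v (c G))"

text \<open>The degree of a term in direction \<open>v\<close> is its exponent plus one if
  \<open>v\<close> is in \<open>F\<close>. What is contracted is the part of degree at least 2, not
  1: the division has to keep X_v in the support, so that the homotopy preserves
  \<open>nonfaces \<Delta>\<close>.\<close>

lemma kd_mon_homotopy:
  assumes v: "v \<in> V" and F: "F \<subseteq> V"
  shows "kd (mon_homotopy v c) F + mon_homotopy v (kd c) F =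
     mon_filter (\<lambda>m. 2 \<le> Poly_Mapping.lookup m v + (if v \<in> F then 1 else 0)) (c F)"
proof -
  define c' where "c' G = mon_div v (c G)" for G
  have 1: "kd (mon_homotopy v c) F = Var v * c' F - wedge v (kd c') F"
    using kd_wedge[OF v F, of c'] by (simp add: mon_homotopy_def c'_def[abs_def] algebra_simps)
  show ?thesis
  proof (cases "v \<in> F")
    case False
    then show ?thesis unfolding 1 by (simp add: mon_homotopy_def wedge_def c'_def Var_mon_div)
  next
    case True
    define G where "G = F - {v}"
    have G: "F = insert v G" "v \<notin> G" "finite G" using True F finite_sub[of F] by (auto simp: G_def)
    have vG: "v \<in> V - G" using v G by auto
    have "mon_div v (kd c G) = (\<Sum>x\<in>V - G. sg x G * mon_div v (Var x * c (insert x G)))"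
      unfolding kd_def mon_div_linear by (simp only: mult.assoc mon_div_linear)
    also have "\<dots> = sg v G * mon_div v (Var v * c F) + (\<Sum>x\<in>V - G - {v}. sg x G * mon_div v (Var x * c (insert x G)))"
      by (subst sum.remove[of _ v]) (use vG finite_V in \<open>simp_all add: G(1)[symmetric]\<close>)
    also have "(\<Sum>x\<in>V - G - {v}. sg x G * mon_div v (Var x * c (insert x G)))
        = (\<Sum>x\<in>V - G - {v}. sg x G * (Var x * c' (insert x G)))"
      by (rule sum.cong) (auto simp: mon_div_Var_neq c'_def)
    finally have 2: "mon_div v (kd c G) = sg v G * mon_div v (Var v * c F)
       + (\<Sum>x\<in>V - G - {v}. sg x G * (Var x * c' (insert x G)))" .
    have 3: "kd c' G = sg v G * (Var v * c' F) + (\<Sum>x\<in>V - G - {v}. sg x G * (Var x * c' (insert x G)))"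
      unfolding kd_def
      by (subst sum.remove[of _ v]) (use vG finite_V in \<open>simp_all add: G(1)[symmetric] mult.assoc\<close>)
    have "sg v F = sg v G" using G by (simp add: koszul_sign_insert_self)
    then have "kd (mon_homotopy v c) F + mon_homotopy v (kd c) F
       = Var v * c' F + (sg v G * mon_div v (kd c G) - sg v G * kd c' G)"
      unfolding 1 using True by (simp add: mon_homotopy_def wedge_def G_def)
    also have "\<dots> = mon_div v (Var v * c F)"
      unfolding 2 3 by (simp add: distrib_left)
    finally show ?thesis using True by (simp add: mon_div_Var_self)
  qed
qed

lemma Bk_subset_Zk: "Bk i \<subseteq> Zk i"
proof
  fix c assume "c \<in> Bk i"
  then obtain t where t: "\<And>F. F \<subseteq> V \<Longrightarrow> card F = i \<Longrightarrow> c F - kd t F \<in> nonfaces \<Delta>" unfolding Bk_def by blast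
  have "kd c F \<in> nonfaces \<Delta>" if F: "F \<subseteq> V" "Suc (card F) = i" for F
  proof -
    have "kd (\<lambda>G. c G - kd t G) F \<in> nonfaces \<Delta>" using t F by (intro kd_I) auto
    then show ?thesis by (simp add: kd_diff kd_kd[OF F(1)])
  qed
  then show "c \<in> Zk i" unfolding Zk_def by blast
qed

text \<open>The vertices in \<open>W\<close> are treated in turn. On a cycle the second term of the
  homotopy formula lies in the ideal, so the part of degree at least 2 in direction \<open>v\<close>
  is a boundary.\<close>

lemma squarefree_part:
  assumes c: "c \<in> Zk i" and W: "W \<subseteq> V"
  shows "(\<lambda>F. c F - mon_filter (\<lambda>m. \<forall>v\<in>W. Poly_Mapping.lookup m v + (if v \<in> F then 1 else 0) \<le> 1) (c F)) \<in> Bk i"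
proof -
  have "finite W" using W finite_V finite_subset by blast
  then show ?thesis using W
  proof (induction W rule: finite_induct)
    case empty
    have "mon_filter (\<lambda>m. True) p = p" for p :: "('v, 'k) mpoly"
      by (rule poly_mapping_eqI) (simp add: lookup_mon_filter)
    then show ?case by (simp add: Bk_I nonfaces_0)
  next
    case (insert v W)
    define f where "f W F = mon_filter (\<lambda>m. \<forall>v\<in>W. Poly_Mapping.lookup m v + (if v \<in> F then 1 else 0) \<le> 1) (c F)"
      for W F
    have B: "(\<lambda>F. c F - f W F) \<in> Bk i" using insert by (simp add: f_def)
    have "(\<lambda>F. c F + (-1) * (c F - f W F)) \<in> Zk i"
      using kos.subspace_add[OF subspace_Zk c subsetD[OF Bk_subset_Zk Bk_mult[OF B, of "-1"]]]
      by (simp only: plus_fun_def)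
    then have fZ: "f W \<in> Zk i" by simp
    have "f W F - f (insert v W) F - kd (mon_homotopy v (f W)) F \<in> nonfaces \<Delta>"
      if F: "F \<subseteq> V" "card F = i" for F
    proof -
      have "mon_filter (\<lambda>m. 2 \<le> Poly_Mapping.lookup m v + (if v \<in> F then 1 else 0)) (f W F)
         = f W F - f (insert v W) F"
        by (rule poly_mapping_eqI) (auto simp: f_def lookup_mon_filter lookup_minus)
      then have "f W F - f (insert v W) F - kd (mon_homotopy v (f W)) F = mon_homotopy v (kd (f W)) F"
        using kd_mon_homotopy[of v F "f W"] insert.prems F by (simp add: algebra_simps)
      also have "\<dots> \<in> nonfaces \<Delta>"
      proof (cases "v \<in> F")
        case True
        have "finite F" using F finite_sub by blast
        then have "Suc (card (F - {v})) = i" using True F by (metis card_Suc_Diff1)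
        then have "kd (f W) (F - {v}) \<in> nonfaces \<Delta>" using fZ F unfolding Zk_def by blast
        then show ?thesis using True by (auto simp: mon_homotopy_def wedge_def intro!: nonfaces_mult mon_div_nonfaces)
      qed (simp add: mon_homotopy_def wedge_def nonfaces_0)
      finally show ?thesis .
    qed
    then have "(\<lambda>F. f W F - f (insert v W) F) \<in> Bk i" unfolding Bk_def by blast
    from Bk_add[OF B this] show ?case by (simp add: f_def)
  qed
qed

text \<open>Koszul homology is concentrated in squarefree multidegrees. A class is therefore
  determined by the coefficients at squarefree monomials, which are indexed by pairs of subsets of
  \<open>V\<close>.\<close>

lemma koszul_homology_finite: "\<exists>c. kos.generated_mod (Zk i) (Bk i) c"
proof -
  define A where "A = Pow V \<times> Pow V"
  define \<rho> where "\<rho> = {(c :: 'v set \<Rightarrow> ('v, 'k) mpoly, a). c \<in> Zk i \<and>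
     (\<forall>F G. a (F, G) = Poly_Mapping.lookup (c F) (\<Sum>v\<in>G. Poly_Mapping.single v (Suc 0)))}"
  have "kos.generated_mod (Zk i) (Bk i) (card A)"
  proof (rule kos.generated_mod_relation[of A "Zk i" \<rho>])
    show "finite A" using finite_V by (simp add: A_def)
    show "kos.subspace (Zk i)" by (rule subspace_Zk)
  next
    fix x a y b assume "(x, a) \<in> \<rho>" "(y, b) \<in> \<rho>"
    then show "(x + y, \<lambda>i. a i + b i) \<in> \<rho>"
      using kos.subspace_add[OF subspace_Zk] by (auto simp: \<rho>_def lookup_add)
  next
    fix k x a assume "(x, a) \<in> \<rho>"
    then show "(\<lambda>F. Const k * x F, \<lambda>i. k * a i) \<in> \<rho>"
      using kos.subspace_scale[OF subspace_Zk] by (auto simp: \<rho>_def lookup_Const_mult)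
  next
    fix x assume "x \<in> Zk i"
    then show "\<exists>a. (x, a) \<in> \<rho>" unfolding \<rho>_def
      by (intro exI[of _ "\<lambda>(F, G). Poly_Mapping.lookup (x F) (\<Sum>v\<in>G. Poly_Mapping.single v (Suc 0))"]) simp
  next
    fix c a assume c: "(c, a) \<in> \<rho>" "c \<in> Zk i" and a: "\<forall>x\<in>A. a x = 0"
    have "(\<lambda>F. c F - mon_filter (\<lambda>m. \<forall>v\<in>V. Poly_Mapping.lookup m v + (if v \<in> F then 1 else 0) \<le> 1) (c F)) \<in> Bk i"
      by (rule squarefree_part[OF c(2)]) simp
    then show "c \<in> Bk i"
    proof (rule Bk_cong)
      fix F assume F: "F \<subseteq> V" "card F = i"
      define g where "g = mon_filter (\<lambda>m. \<forall>v\<in>V. Poly_Mapping.lookup m v + (if v \<in> F then 1 else 0) \<le> 1) (c F)"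
      have "Poly_Mapping.lookup g m = 0" if m: "Poly_Mapping.keys m \<in> \<Delta>" for m
      proof (cases "\<forall>v\<in>V. Poly_Mapping.lookup m v + (if v \<in> F then 1 else 0) \<le> 1")
        case True
        have "m = (\<Sum>v\<in>Poly_Mapping.keys m. Poly_Mapping.single v (Suc 0))"
        proof (rule poly_mapping_eqI)
          fix v
          show "Poly_Mapping.lookup m v
             = Poly_Mapping.lookup (\<Sum>v\<in>Poly_Mapping.keys m. Poly_Mapping.single v (Suc 0)) v"
          proof (cases "v \<in> Poly_Mapping.keys m")
            case vm: True
            then have "Poly_Mapping.lookup m v + (if v \<in> F then 1 else 0) \<le> 1" using True m by blast
            then show ?thesis using vm by (auto simp: lookup_sum_single in_keys_iff split: if_splits)
          qed (simp add: lookup_sum_single in_keys_iff)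
        qed
        moreover have "a (F, Poly_Mapping.keys m) = 0" using a F m by (auto simp: A_def)
        ultimately have "Poly_Mapping.lookup (c F) m = 0" using c(1) by (auto simp: \<rho>_def)
        then show ?thesis by (simp add: g_def lookup_mon_filter)
      next
        case False
        then show ?thesis unfolding g_def lookup_mon_filter by (simp only: if_False)
      qed
      then have "g \<in> nonfaces \<Delta>" by (auto simp: nonfaces_def in_keys_iff)
      then show "c F - (c F - mon_filter (\<lambda>m. \<forall>v\<in>V. Poly_Mapping.lookup m v + (if v \<in> F then 1 else 0) \<le> 1) (c F))
         \<in> nonfaces \<Delta>" by (simp add: g_def)
    qed
  qed
  then show ?thesis by blast
qed

end

subsection \<open>Unfolding the Golod property\<close>

text \<open>A lift of \<open>koszul_matrix\<close> along \<open>sr_class\<close>.\<close>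

definition koszul_entry :: "'v set \<Rightarrow> 'v set \<Rightarrow> 'v set \<Rightarrow> ('v, 'k::field) mpoly" where
  "koszul_entry V G F =
     (if \<exists>v\<in>F. G = F - {v} then
        (let v = (THE v. v \<in> F \<and> G = F - {v}) in
         if even (card {u\<in>F. to_nat_on V u < to_nat_on V v}) then Var v else - Var v)
      else 0)"

lemma koszul_entry_insert:
  assumes "finite G" "x \<notin> G"
  shows "koszul_entry V G (insert x G) = koszul_sign (to_nat_on V) x G * Var x"
proof -
  have ex: "\<exists>v\<in>insert x G. G = insert x G - {v}" using assms by (intro bexI[of _ x]) auto
  have the: "(THE v. v \<in> insert x G \<and> G = insert x G - {v}) = x"
    using assms by (intro the_equality) auto
  have "koszul_entry V G (insert x G) = koszul_sign (to_nat_on V) x (insert x G) * Var x"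
    unfolding koszul_entry_def the koszul_sign_def Let_def
    using ex by (simp add: minus_one_power_iff)
  then show ?thesis using assms by (simp add: koszul_sign_insert_self)
qed

lemma koszul_entry_neq: "\<nexists>x. x \<notin> G \<and> F = insert x G \<Longrightarrow> koszul_entry V G F = 0"
  unfolding koszul_entry_def by (metis Diff_iff insert_Diff singletonI)

lemma koszul_entry_sum:
  assumes V: "finite V" and G: "G \<subseteq> V"
  shows "(\<Sum>F\<in>koszul_basis V (Suc (card G)). koszul_entry V G F * f F)
    = (\<Sum>x\<in>V - G. koszul_sign (to_nat_on V) x G * Var x * f (insert x G))"
proof -
  have finG: "finite G" using G V finite_subset by blast
  have inj: "inj_on (\<lambda>x. insert x G) (V - G)" by (auto simp: inj_on_def)
  have finB: "finite (koszul_basis V (Suc (card G)))"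
    using V by (simp add: koszul_basis_def)
  have sub: "(\<lambda>x. insert x G) ` (V - G) \<subseteq> koszul_basis V (Suc (card G))"
    using G finG by (auto simp: koszul_basis_def)
  have "(\<Sum>F\<in>koszul_basis V (Suc (card G)). koszul_entry V G F * f F)
     = (\<Sum>F\<in>(\<lambda>x. insert x G) ` (V - G). koszul_entry V G F * f F)"
  proof (rule sum.mono_neutral_right[OF finB sub], rule ballI)
    fix F assume F: "F \<in> koszul_basis V (Suc (card G)) - (\<lambda>x. insert x G) ` (V - G)"
    have "\<nexists>x. x \<notin> G \<and> F = insert x G"
    proof
      assume "\<exists>x. x \<notin> G \<and> F = insert x G"
      then obtain x where "x \<notin> G" "F = insert x G" by blast
      then show False using F by (auto simp: koszul_basis_def)
    qed
    then show "koszul_entry V G F * f F = 0" by (simp add: koszul_entry_neq)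
  qed
  also have "\<dots> = (\<Sum>x\<in>V - G. koszul_entry V G (insert x G) * f (insert x G))"
    by (simp add: sum.reindex[OF inj])
  also have "\<dots> = (\<Sum>x\<in>V - G. koszul_sign (to_nat_on V) x G * Var x * f (insert x G))"
    by (rule sum.cong) (use finG in \<open>auto simp: koszul_entry_insert\<close>)
  finally show ?thesis .
qed

lemma has_homology_dim_The:
  assumes "has_homology_dim R \<kappa> B D j n" "\<And>m. has_homology_dim R \<kappa> B D j m \<Longrightarrow> m = n"
  shows "homology_dim R \<kappa> B D j = n"
  unfolding homology_dim_def using assms by (rule the_equality)

text \<open>\<open>koszul_homology_dim\<close> is a definite description; finiteness of Koszul
  homology and uniqueness of the size of a basis are what gives it its meaning.\<close>

lemma (in sr_resolution) Koszul_homology_dim: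
  fixes x :: "'v \<Rightarrow> ('v, 'k) mpoly set"
  assumes r: "r = to_nat_on V" and x: "\<And>v. v \<in> V \<Longrightarrow> x v = sr_class (Var v)"
  shows "\<exists>\<zeta>. kos.basis_mod (Zk i) (Bk i) (koszul_homology_dim sr_ring (\<lambda>c. sr_class (Const c)) V x i) \<zeta>"
proof -
  interpret Q: quotient_presentation "sr_ring :: ('v, 'k) mpoly set ring" sr_class "nonfaces \<Delta>"
    by (rule quotient_presentation_sr)
  have finB: "finite (koszul_basis V j)" for j using finite_V by (simp add: koszul_basis_def)
  have mat: "koszul_matrix sr_ring V x (Suc j) G F = sr_class (koszul_entry V G F)"
    if F: "F \<in> koszul_basis V (Suc j)" for j G F
  proof (cases "\<exists>v\<in>F. G = F - {v}")
    case True
    then obtain v where v: "v \<in> F" "G = F - {v}" by blast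
    then have "(THE v. v \<in> F \<and> G = F - {v}) = v" by (intro the_equality) auto
    moreover have "x v = sr_class (Var v)" using F v by (intro x) (auto simp: koszul_basis_def)
    ultimately show ?thesis using True by (simp add: koszul_matrix_def koszul_entry_def Let_def Q.Q_uminus)
  next
    case False
    then show ?thesis unfolding koszul_matrix_def koszul_entry_def by (simp only: if_False Q.Q_zero)
  qed
  have ks: "(\<Sum>F\<in>koszul_basis V (Suc l). koszul_entry V G F * f F) = kd f G"
    if "G \<in> koszul_basis V l" for f G l
  proof -
    have "G \<subseteq> V" "card G = l" using that by (auto simp: koszul_basis_def)
    then show ?thesis unfolding kd_def unfolding r using koszul_entry_sum[OF finite_V, of G f] by simp
  qed
  have Z: "cycles_mod (nonfaces \<Delta>) (koszul_basis V) (\<lambda>j G F. koszul_entry V G F) j = Zk j" for j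
  proof (cases j)
    case (Suc l)
    have "f \<in> cycles_mod (nonfaces \<Delta>) (koszul_basis V) (\<lambda>j G F. koszul_entry V G F) j \<longleftrightarrow>
        (\<forall>G\<in>koszul_basis V l. kd f G \<in> nonfaces \<Delta>)" for f
      by (simp add: cycles_mod_def Suc ks cong: ball_cong)
    then show ?thesis by (auto simp: Zk_def koszul_basis_def Suc)
  qed (simp add: cycles_mod_def Zk_def)
  have B: "boundaries_mod (nonfaces \<Delta>) (koszul_basis V) (\<lambda>j G F. koszul_entry V G F) j = Bk j" for j
  proof -
    have "boundaries_mod (nonfaces \<Delta>) (koszul_basis V) (\<lambda>j G F. koszul_entry V G F) j =
       {f. \<exists>g. \<forall>G\<in>koszul_basis V j. f G - kd g G \<in> nonfaces \<Delta>}"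
      by (simp add: boundaries_mod_def ks cong: ball_cong)
    then show ?thesis by (simp add: Bk_def koszul_basis_def Ball_def imp_conjL)
  qed
  have iff: "has_homology_dim sr_ring (\<lambda>c. sr_class (Const c)) (koszul_basis V) (koszul_matrix sr_ring V x) i n
      \<longleftrightarrow> (\<exists>y. kos.basis_mod (Zk i) (Bk i) n y)" for n
    unfolding Z[symmetric] B[symmetric]
    by (rule Q.has_homology_dim_iff)
       (auto simp: finB mat Const_one Const_add Const_mult nonfaces_0 nonfaces_add nonfaces_mult)
  obtain n y where y: "kos.basis_mod (Zk i) (Bk i) n y"
    using koszul_homology_finite kos.ex_basis_mod[OF subspace_Zk subspace_Bk] by blast
  have "koszul_homology_dim sr_ring (\<lambda>c. sr_class (Const c)) V x i = n"
    unfolding koszul_homology_dim_def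
    by (rule has_homology_dim_The) (use iff y kos.basis_mod_unique[OF subspace_Bk] in blast)+
  then show ?thesis using y by blast
qed

lemma (in koszul_resolution) tor_finite: "tor.generated_mod (Zt s) (Bt s) (\<beta> s)"
proof -
  have "tor.generated_mod (Zt s) (Bt s) (card {..<\<beta> s})"
  proof (rule tor.generated_mod_relation[of _ _ "{(x, a). \<forall>b. a b = x b}"])
    fix x a :: "nat \<Rightarrow> 'k" assume "(x, a) \<in> {(x, a). \<forall>b. a b = x b}" "\<forall>i\<in>{..<\<beta> s}. a i = 0"
    then show "x \<in> Bt s" unfolding Bt_def by (auto intro!: exI[of _ "\<lambda>_. 0"])
  qed (auto intro: subspace_Zt)
  then show ?thesis by simp
qed

section \<open>Coefficients of the Golod identity\<close>

lemma fps_one_plus_X_power_nth: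
  "fps_nth ((1 + fps_X) ^ n :: 'a::comm_semiring_1 fps) N = of_nat (n choose N)"
proof (induction n arbitrary: N)
  case 0
  then show ?case by (cases N) simp_all
next
  case (Suc n)
  then show ?case
    by (cases N) (simp_all add: fps_mult_fps_X_plus_1_nth add.commute[of "of_nat (n choose Suc _)"])
qed

text \<open>The denominator has constant term 1, so it can be multiplied out. Comparing coefficients
  then gives Serre's bound with equality.\<close>

lemma fps_golod_coeff:
  fixes T h :: "nat \<Rightarrow> nat"
  assumes "(Abs_fps (\<lambda>j. of_nat (T j)) :: rat fps) =
     (1 + fps_X) ^ n / (1 - Abs_fps (\<lambda>i. if i \<ge> 2 then of_nat (h (i - 1)) else 0))"
  shows "T N = (n choose N) + (\<Sum>q=2..N. h (q - 1) * T (N - q))"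
proof -
  define H :: "rat fps" where "H = Abs_fps (\<lambda>i. if i \<ge> 2 then of_nat (h (i - 1)) else 0)"
  define P :: "rat fps" where "P = Abs_fps (\<lambda>j. of_nat (T j))"
  have "fps_nth (1 - H) 0 \<noteq> 0" by (simp add: H_def)
  then have "P * (1 - H) = (1 + fps_X) ^ n"
    using assms unfolding P_def[symmetric] H_def[symmetric]
    by (simp add: fps_divide_unit mult.assoc inverse_mult_eq_1)
  then have eq: "P = (1 + fps_X) ^ n + H * P" by (simp add: algebra_simps)
  have "fps_nth (H * P) N = (\<Sum>q=0..N. fps_nth H q * fps_nth P (N - q))" by (simp add: fps_mult_nth)
  also have "\<dots> = (\<Sum>q=2..N. fps_nth H q * fps_nth P (N - q))"
    by (rule sum.mono_neutral_right) (auto simp: H_def)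
  also have "\<dots> = (\<Sum>q=2..N. of_nat (h (q - 1) * T (N - q)))"
    by (rule sum.cong) (auto simp: H_def P_def)
  finally have HP: "fps_nth (H * P) N = of_nat (\<Sum>q=2..N. h (q - 1) * T (N - q))" by simp
  have "fps_nth ((1 + fps_X) ^ n :: rat fps) N = of_nat (n choose N)"
    by (rule fps_one_plus_X_power_nth)
  then have "(of_nat (T N) :: rat) = of_nat ((n choose N) + (\<Sum>q=2..N. h (q - 1) * T (N - q)))"
    using arg_cong[OF eq, of "\<lambda>p. fps_nth p N"] HP by (simp add: P_def)
  then show ?thesis by (simp only: of_nat_eq_iff)
qed

context simplicial_complex
begin

text \<open>The matrices and the augmentation of the given resolution are lifted to polynomials and
  field elements, which yields an instance of \<open>sr_resolution\<close>. The numbers in the Golod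
  identity become sizes of bases there.\<close>

lemma golod_data:
  assumes g: "golod V (stanley_reisner_ideal \<Delta> :: ('v, 'k::field) mpoly set)"
  shows "\<exists>\<beta> D (e :: nat \<Rightarrow> 'k) T \<xi> h \<zeta>. sr_resolution \<Delta> (to_nat_on V) \<beta> D e \<and>
     (\<forall>s. field_space.basis_mod (\<lambda>a (x :: nat \<Rightarrow> 'k) b. a * x b)
        (koszul_resolution.Zt const_coeff \<beta> D s) (koszul_resolution.Bt const_coeff \<beta> D s) (T s) (\<xi> s)) \<and>
     (\<forall>i. field_space.basis_mod (\<lambda>a (c :: 'v set \<Rightarrow> ('v, 'k) mpoly) F. Const a * c F)
        (koszul_resolution.Zk V (to_nat_on V) (nonfaces \<Delta>) Var i)
        (koszul_resolution.Bk V (to_nat_on V) (nonfaces \<Delta>) Var i) (h i) (\<zeta> i)) \<and>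
     (\<forall>N. T N = (card V choose N) + (\<Sum>q=2..N. h (q - 1) * T (N - q)))"
proof -
  define A where "A = (stanley_reisner_ideal \<Delta> :: ('v, 'k) mpoly set)"
  interpret P1: quotient_presentation "sr_ring :: ('v, 'k) mpoly set ring" sr_class "nonfaces \<Delta>"
    by (rule quotient_presentation_sr)
  define M where "M = (sr_maximal :: ('v, 'k) mpoly set set)"
  have M: "ideal M sr_ring" "\<And>p. sr_class p \<in> M \<longleftrightarrow> p \<in> {p. const_coeff p = 0}"
    using sr_maximal by (auto simp: M_def)
  interpret P2: quotient_presentation "sr_ring Quot M" "\<lambda>p. M +>\<^bsub>sr_ring\<^esub> sr_class p" "{p. const_coeff p = 0}"
    by (rule P1.quotient_presentation_Quot[OF M])
  define Q3 where "Q3 a = M +>\<^bsub>sr_ring\<^esub> sr_class (Const a)" for a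
  interpret P3: quotient_presentation "sr_ring Quot M" Q3 "{0}"
    unfolding Q3_def
    by (rule P2.quotient_presentation_section[where c = const_coeff])
       (auto simp: const_coeff_add Const_one Const_add Const_mult const_coeff_Const)
  have Q23: "M +>\<^bsub>sr_ring\<^esub> sr_class p = Q3 (const_coeff p)" for p
    unfolding Q3_def
    by (rule P2.quotient_presentation_section(2)[where c = const_coeff])
       (auto simp: const_coeff_add Const_one Const_add Const_mult const_coeff_Const)
  have cls: "A +>\<^bsub>poly_ring V\<^esub> p = sr_class p" if "p \<in> polys_in V" for p
    using sr_class_eq[OF that, of p] by (simp add: nonfaces_0 A_def)
  have x: "A +>\<^bsub>poly_ring V\<^esub> Var v = sr_class (Var v)" if "v \<in> V" for v
    using that by (intro cls) (auto simp: Var_def intro!: polys_in_single)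
  have \<kappa>: "A +>\<^bsub>poly_ring V\<^esub> Const c = sr_class (Const c)" for c
    by (intro cls) (auto simp: Const_def intro!: polys_in_single)
  define xx where "xx = (\<lambda>v. A +>\<^bsub>poly_ring V\<^esub> Var v)"
  have R: "poly_ring V Quot A = sr_ring" by (simp add: sr_ring_def A_def)
  have Mx: "Idl\<^bsub>sr_ring\<^esub> (xx ` V) = M"
  proof -
    have "xx ` V = (\<lambda>v. sr_class (Var v)) ` V" by (rule image_cong) (simp_all only: xx_def x)
    then show ?thesis unfolding M_def sr_maximal_def by simp
  qed
  obtain T where T: "tor_dims sr_ring (\<lambda>c. sr_class (Const c :: ('v, 'k) mpoly)) M T"
    and ser: "(Abs_fps (\<lambda>j. of_nat (T j)) :: rat fps) = (1 + fps_X) ^ card V /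
       (1 - Abs_fps (\<lambda>i. if i \<ge> 2 then of_nat (koszul_homology_dim sr_ring (\<lambda>c. sr_class (Const c :: ('v, 'k) mpoly)) V xx (i - 1)) else 0))"
    using g unfolding golod_def Let_def A_def[symmetric] R xx_def[symmetric] Mx \<kappa> by blast
  obtain \<beta> Dm em where fr: "free_resolution sr_ring M \<beta> Dm em"
    and Tj: "\<And>j. T j = homology_dim (sr_ring Quot M) Q3 (\<lambda>j. {..<\<beta> j})
       (\<lambda>j c b. M +>\<^bsub>sr_ring\<^esub> Dm j c b) j"
    using T unfolding tor_dims_def Q3_def[abs_def, symmetric] by blast
  have "\<forall>j c b. \<exists>p. c < \<beta> j \<longrightarrow> b < \<beta> (Suc j) \<longrightarrow> Dm (Suc j) c b = sr_class p"
  proof (intro allI)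
    fix j c b
    show "\<exists>p. c < \<beta> j \<longrightarrow> b < \<beta> (Suc j) \<longrightarrow> Dm (Suc j) c b = sr_class p"
    proof (cases "c < \<beta> j \<and> b < \<beta> (Suc j)")
      case True
      then have "Dm (Suc j) c b \<in> carrier sr_ring" using fr unfolding free_resolution_def by auto
      then show ?thesis using P1.Q_onto by (metis imageE)
    qed auto
  qed
  then obtain D0 where D0: "\<And>j c b. c < \<beta> j \<Longrightarrow> b < \<beta> (Suc j) \<Longrightarrow> Dm (Suc j) c b = sr_class (D0 j c b)"
    by metis
  \<comment> \<open>An index shift: \<open>D0 j\<close> lifts the matrix of the differential from
    degree \<open>j + 1\<close>.\<close>
  define D where "D j = D0 (j - 1)" for j
  have D: "Dm (Suc j) c b = sr_class (D (Suc j) c b)" if "c \<in> {..<\<beta> j}" "b \<in> {..<\<beta> (Suc j)}" for j c b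
    using D0 that by (simp add: D_def)
  have "\<forall>b. \<exists>a. b < \<beta> 0 \<longrightarrow> em b = Q3 a"
  proof
    fix b
    show "\<exists>a. b < \<beta> 0 \<longrightarrow> em b = Q3 a"
    proof (cases "b < \<beta> 0")
      case True
      then have "em b \<in> carrier (sr_ring Quot M)" using fr unfolding free_resolution_def by auto
      then show ?thesis using P3.Q_onto by (metis imageE)
    qed auto
  qed
  then obtain e where e: "\<And>b. b < \<beta> 0 \<Longrightarrow> em b = Q3 (e b)" by metis
  have finB: "finite {..<\<beta> j}" for j by simp
  note cyc = P1.cycles_iff[of "\<lambda>j. {..<\<beta> j}" Dm D, OF finB D]
  note bou = P1.boundaries_iff[of "\<lambda>j. {..<\<beta> j}" Dm D, OF finB D]
  have aug: "augmentation sr_ring M (\<beta> 0) em (\<lambda>b\<in>{..<\<beta> 0}. sr_class (f b))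
      = Q3 (\<Sum>b<\<beta> 0. e b * const_coeff (f b))" for f
  proof -
    have "augmentation sr_ring M (\<beta> 0) em (\<lambda>b\<in>{..<\<beta> 0}. sr_class (f b))
       = (\<Oplus>\<^bsub>sr_ring Quot M\<^esub>b\<in>{..<\<beta> 0}. Q3 (e b * const_coeff (f b)))"
      unfolding augmentation_def
      by (intro P2.finsum_cong') (auto simp: e Q23 P3.Q_mult[symmetric] mult.commute)
    then show ?thesis by (simp add: P3.Q_finsum)
  qed
  have K: "koszul_resolution V (to_nat_on V) (nonfaces \<Delta>) Var Const const_coeff \<beta> D e"
  proof (rule koszul_resolution.intro)
    show "inj_on (to_nat_on V) V" by (rule inj_on_to_nat_on) (simp add: finite_V countable_finite)
    have "Q3 1 \<in> augmentation sr_ring M (\<beta> 0) em ` free_module sr_ring {..<\<beta> 0}"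
      using fr P3.Q_closed unfolding free_resolution_def by simp
    then obtain f where f: "f \<in> free_module sr_ring {..<\<beta> 0}" "Q3 1 = augmentation sr_ring M (\<beta> 0) em f"
      by blast
    obtain f' where "f = (\<lambda>b\<in>{..<\<beta> 0}. sr_class (f' b))" using P1.lift[OF f(1)] by blast
    then have one: "(\<Sum>b<\<beta> 0. e b * const_coeff (f' b)) = 1" using f(2) by (simp add: aug P3.Q_eq)
    show "\<exists>b<\<beta> 0. e b \<noteq> 0"
    proof (rule ccontr)
      assume "\<not> (\<exists>b<\<beta> 0. e b \<noteq> 0)"
      then have "(\<Sum>b<\<beta> 0. e b * const_coeff (f' b)) = 0" by (intro sum.neutral) auto
      then show False using one by simp
    qed
  next
    fix f :: "nat \<Rightarrow> ('v, 'k) mpoly"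
    have eq: "{f \<in> free_module sr_ring {..<\<beta> 0}. augmentation sr_ring M (\<beta> 0) em f = \<zero>\<^bsub>sr_ring Quot M\<^esub>}
       = boundaries sr_ring (\<lambda>j. {..<\<beta> j}) Dm 0"
      using fr unfolding free_resolution_def by blast
    have "(\<Sum>b<\<beta> 0. e b * const_coeff (f b)) = 0 \<longleftrightarrow>
        augmentation sr_ring M (\<beta> 0) em (\<lambda>b\<in>{..<\<beta> 0}. sr_class (f b)) = \<zero>\<^bsub>sr_ring Quot M\<^esub>"
      unfolding aug P3.Q_eq_zero by simp
    also have "\<dots> \<longleftrightarrow> (\<lambda>b\<in>{..<\<beta> 0}. sr_class (f b)) \<in> boundaries sr_ring (\<lambda>j. {..<\<beta> j}) Dm 0"
      unfolding eq[symmetric] by (simp add: P1.restrict_in_free_module)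
    also have "\<dots> \<longleftrightarrow> f \<in> boundaries_mod (nonfaces \<Delta>) (\<lambda>j. {..<\<beta> j}) D 0"
      using bou[of f 0] by simp
    finally show "(\<Sum>b<\<beta> 0. e b * const_coeff (f b)) = 0 \<longleftrightarrow>
          (\<exists>g. \<forall>c<\<beta> 0. f c - (\<Sum>b<\<beta> 1. D 1 c b * g b) \<in> nonfaces \<Delta>)"
      by (simp add: boundaries_mod_def Ball_def)
  next
    fix j and f :: "nat \<Rightarrow> ('v, 'k) mpoly"
    have "cycles sr_ring (\<lambda>j. {..<\<beta> j}) Dm (Suc j) = boundaries sr_ring (\<lambda>j. {..<\<beta> j}) Dm (Suc j)"
      using fr unfolding free_resolution_def by auto
    then have "f \<in> cycles_mod (nonfaces \<Delta>) (\<lambda>j. {..<\<beta> j}) D (Suc j) \<longleftrightarrow>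
       f \<in> boundaries_mod (nonfaces \<Delta>) (\<lambda>j. {..<\<beta> j}) D (Suc j)"
      using cyc[of f "Suc j"] bou[of f "Suc j"] by simp
    then show "(\<forall>c<\<beta> j. (\<Sum>b<\<beta> (Suc j). D (Suc j) c b * f b) \<in> nonfaces \<Delta>) \<longleftrightarrow>
       (\<exists>g. \<forall>c<\<beta> (Suc j). f c - (\<Sum>b<\<beta> (Suc (Suc j)). D (Suc (Suc j)) c b * g b) \<in> nonfaces \<Delta>)"
      by (simp add: cycles_mod_def boundaries_mod_def Ball_def)
  qed (simp_all add: finite_V nonfaces_0 nonfaces_add nonfaces_mult Const_one Const_add Const_mult
      const_coeff_add const_coeff_mult const_coeff_Const const_coeff_Var const_coeff_nonfaces const_coeff_zero)
  interpret S: sr_resolution \<Delta> "to_nat_on V" \<beta> D e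
    by (intro sr_resolution.intro K simplicial_complex_axioms)
  have iff: "has_homology_dim (sr_ring Quot M) Q3 (\<lambda>j. {..<\<beta> j}) (\<lambda>j c b. M +>\<^bsub>sr_ring\<^esub> Dm j c b) s n
      \<longleftrightarrow> (\<exists>x. S.tor.basis_mod (S.Zt s) (S.Bt s) n x)" for s n
  proof -
    have Z: "cycles_mod {0} (\<lambda>j. {..<\<beta> j}) (\<lambda>j c b. const_coeff (D j c b)) s = S.Zt s"
      by (cases s) (auto simp: cycles_mod_def S.Zt_def)
    have B: "boundaries_mod {0} (\<lambda>j. {..<\<beta> j}) (\<lambda>j c b. const_coeff (D j c b)) s = S.Bt s"
      by (auto simp: boundaries_mod_def S.Bt_def)
    show ?thesis unfolding Z[symmetric] B[symmetric]
      by (rule P3.has_homology_dim_iff[where K = "\<lambda>a. a"]) (auto simp: D Q23)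
  qed
  have "\<exists>\<xi>. S.tor.basis_mod (S.Zt s) (S.Bt s) (T s) \<xi>" for s
  proof -
    obtain n y where y: "S.tor.basis_mod (S.Zt s) (S.Bt s) n y"
      using S.tor_finite S.tor.ex_basis_mod[OF S.subspace_Zt S.subspace_Bt] by blast
    have "T s = n" unfolding Tj
      by (rule has_homology_dim_The) (use iff y S.tor.basis_mod_unique[OF S.subspace_Bt] in blast)+
    then show ?thesis using y by blast
  qed
  then obtain \<xi> where xi: "\<And>s. S.tor.basis_mod (S.Zt s) (S.Bt s) (T s) (\<xi> s)" by metis
  define h where "h i = koszul_homology_dim sr_ring (\<lambda>c. sr_class (Const c :: ('v, 'k) mpoly)) V xx i" for i
  have "\<exists>\<zeta>. S.kos.basis_mod (S.Zk i) (S.Bk i) (h i) \<zeta>" for i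
    unfolding h_def by (rule S.Koszul_homology_dim) (simp_all only: xx_def x)
  then obtain \<zeta> where zeta: "\<And>i. S.kos.basis_mod (S.Zk i) (S.Bk i) (h i) (\<zeta> i)" by metis
  have "T N = (card V choose N) + (\<Sum>q=2..N. h (q - 1) * T (N - q))" for N
    by (rule fps_golod_coeff[OF ser[folded h_def]])
  then show ?thesis using S.sr_resolution_axioms xi zeta by blast
qed

end

section \<open>Golod complexes and top-dimensional cycles\<close>

text \<open>The form of duality used to find a cocycle: a vector outside the image of
  \<open>M\<close> is detected by a functional that kills the image. The columns are added one at a
  time.\<close>

lemma fredholm_alternative:
  fixes M :: "'a \<Rightarrow> 'p \<Rightarrow> 'k::field" and y :: "'a \<Rightarrow> 'k"
  assumes "finite P" and A: "finite A"
  shows "(\<exists>w. \<forall>a\<in>A. y a = (\<Sum>p\<in>P. M a p * w p)) \<or>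
    (\<exists>\<alpha>. (\<forall>p\<in>P. (\<Sum>a\<in>A. \<alpha> a * M a p) = 0) \<and> (\<Sum>a\<in>A. \<alpha> a * y a) = 1)"
  using assms(1)
proof (induction P arbitrary: y rule: finite_induct)
  case empty
  show ?case
  proof (cases "\<forall>a\<in>A. y a = 0")
    case False
    then obtain a where a: "a \<in> A" "y a \<noteq> 0" by blast
    have "(\<Sum>b\<in>A. (if b = a then inverse (y a) else 0) * y b) = (\<Sum>b\<in>A. if b = a then 1 else 0)"
      by (rule sum.cong) (use a in auto)
    then show ?thesis using a A by (intro disjI2 exI[of _ "\<lambda>b. if b = a then inverse (y a) else 0"]) simp
  qed auto
next
  case (insert p P)
  show ?case
  proof (cases "\<exists>w. \<forall>a\<in>A. y a = (\<Sum>q\<in>P. M a q * w q)")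
    case True
    then obtain w where "\<forall>a\<in>A. y a = (\<Sum>q\<in>P. M a q * w q)" by blast
    moreover have "(\<Sum>q\<in>P. M a q * (w(p := 0)) q) = (\<Sum>q\<in>P. M a q * w q)" for a
      by (rule sum.cong) (use insert.hyps in auto)
    ultimately show ?thesis using insert.hyps by (intro disjI1 exI[of _ "w(p := 0)"]) simp
  next
    case False
    then obtain \<alpha> where \<alpha>: "\<And>q. q \<in> P \<Longrightarrow> (\<Sum>a\<in>A. \<alpha> a * M a q) = 0" "(\<Sum>a\<in>A. \<alpha> a * y a) = 1"
      using insert.IH[of y] by blast
    define c where "c = (\<Sum>a\<in>A. \<alpha> a * M a p)"
    show ?thesis
    proof (cases "c = 0")
      case True
      then show ?thesis using \<alpha> by (intro disjI2 exI[of _ \<alpha>]) (auto simp: c_def)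
    next
      case c: False
      \<comment> \<open>Evaluating \<open>\<alpha>\<close> shows that \<open>1 / c\<close> is the
        only possible coefficient of column \<open>p\<close> in a representation of
        \<open>y\<close>.\<close>
      define y' where "y' a = y a - M a p / c" for a
      show ?thesis
      proof (cases "\<exists>w. \<forall>a\<in>A. y' a = (\<Sum>q\<in>P. M a q * w q)")
        case True
        then obtain w where w: "\<And>a. a \<in> A \<Longrightarrow> y' a = (\<Sum>q\<in>P. M a q * w q)" by blast
        have "(\<Sum>q\<in>P. M a q * (w(p := 1 / c)) q) = (\<Sum>q\<in>P. M a q * w q)" for a
          by (rule sum.cong) (use insert.hyps in auto)
        then show ?thesis using w insert.hyps
          by (intro disjI1 exI[of _ "w(p := 1 / c)"]) (auto simp: y'_def algebra_simps)
      next
        case False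
        then obtain \<alpha>' where \<alpha>': "\<And>q. q \<in> P \<Longrightarrow> (\<Sum>a\<in>A. \<alpha>' a * M a q) = 0" "(\<Sum>a\<in>A. \<alpha>' a * y' a) = 1"
          using insert.IH[of y'] by blast
        define s where "s = (\<Sum>a\<in>A. \<alpha>' a * M a p) / c"
        \<comment> \<open>The correction by \<open>s\<close> makes the functional kill column
          \<open>p\<close> too; its value on \<open>y\<close> is that of \<open>\<alpha>'\<close> on
          \<open>y'\<close>.\<close>
        define \<gamma> where "\<gamma> a = \<alpha>' a - s * \<alpha> a" for a
        have \<gamma>: "(\<Sum>a\<in>A. \<gamma> a * f a) = (\<Sum>a\<in>A. \<alpha>' a * f a) - s * (\<Sum>a\<in>A. \<alpha> a * f a)" for f
          by (simp add: \<gamma>_def left_diff_distrib sum_subtractf sum_distrib_left mult.assoc)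
        have "(\<Sum>a\<in>A. \<alpha>' a * y' a) = (\<Sum>a\<in>A. \<alpha>' a * y a) - s"
          by (simp add: y'_def s_def right_diff_distrib sum_subtractf sum_divide_distrib)
        then have "(\<Sum>a\<in>A. \<gamma> a * y a) = 1" using \<alpha>' \<alpha> by (simp add: \<gamma>)
        moreover have "(\<Sum>a\<in>A. \<gamma> a * M a q) = 0" if "q \<in> insert p P" for q
          using that \<alpha> \<alpha>' c by (auto simp: \<gamma> s_def c_def[symmetric])
        ultimately show ?thesis by blast
      qed
    qed
  qed
qed

section \<open>Signs of complements and squarefree monomials\<close>

lemma koszul_sign_prod:
  "finite F \<Longrightarrow> koszul_sign r x F = (\<Prod>y\<in>F. if r y < r x then - 1 else (1 :: 'p::comm_ring_1))"
  by (induction F rule: finite_induct) (auto simp: koszul_sign_insert, simp add: koszul_sign_def)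

text \<open>The sign is a product over the elements of the set, and each factor is its own
  inverse.\<close>

lemma koszul_sign_Diff:
  assumes "finite A" "B \<subseteq> A"
  shows "koszul_sign r x (A - B) = koszul_sign r x A * (koszul_sign r x B :: 'p::comm_ring_1)"
proof -
  have fin: "finite B" "finite (A - B)" using assms finite_subset by auto
  have "A = (A - B) \<union> B" using assms by auto
  then have "koszul_sign r x A = koszul_sign r x (A - B) * (koszul_sign r x B :: 'p)"
    using prod.union_disjoint[of "A - B" B "\<lambda>y. if r y < r x then - 1 else (1 :: 'p)"] fin assms(1)
    by (simp add: koszul_sign_prod Int_commute[of "A - B"])
  then show ?thesis by (simp add: mult.assoc)
qed

lemma Const_koszul_sign: "Const (koszul_sign r x F :: 'k::field) = (koszul_sign r x F :: ('w, 'k) mpoly)"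
proof -
  have "Const (- 1 :: 'k::field) = (- 1 :: ('w, 'k) mpoly)" by (simp add: Const_def single_uminus)
  then show ?thesis by (simp add: koszul_sign_def minus_one_power_iff Const_one)
qed

lemma lookup_koszul_sign_mult:
  "Poly_Mapping.lookup (koszul_sign r x F * p) m = koszul_sign r x F * Poly_Mapping.lookup (p :: ('v, 'k::field) mpoly) m"
  using lookup_Const_mult[of "koszul_sign r x F" p m] by (simp only: Const_koszul_sign)

definition sqfree_mono :: "'v set \<Rightarrow> ('v, 'k::field) mpoly" where
  "sqfree_mono F = Poly_Mapping.single (\<Sum>v\<in>F. Poly_Mapping.single v (Suc 0)) 1"

lemma Var_mono: "finite F \<Longrightarrow> x \<notin> F \<Longrightarrow> Var x * sqfree_mono F = sqfree_mono (insert x F)"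
  by (simp add: Var_def sqfree_mono_def mult_single)

lemma lookup_Var_mult_mono:
  assumes "finite F" "x \<in> F"
  shows "Poly_Mapping.lookup (Var x * p) (\<Sum>v\<in>F. Poly_Mapping.single v (Suc 0))
    = Poly_Mapping.lookup p (\<Sum>v\<in>F - {x}. Poly_Mapping.single v (Suc 0))"
proof -
  have "(\<Sum>v\<in>F. Poly_Mapping.single v (Suc 0)) - Poly_Mapping.single x (Suc 0)
    = (\<Sum>v\<in>F - {x}. Poly_Mapping.single v (Suc 0))"
    using assms by (simp add: sum.remove[of F x])
  then show ?thesis using assms by (simp add: lookup_Var_mult lookup_sum_single)
qed

lemma const_coeff_mono: "finite F \<Longrightarrow> F \<noteq> {} \<Longrightarrow> const_coeff (sqfree_mono F) = 0"
  using keys_sum_single[of F] by (auto simp: const_coeff_def sqfree_mono_def lookup_single when_def)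

text \<open>The coefficient at \<open>F\<close> of the boundary of the simplicial chain
  \<open>z\<close>, faces being oriented by the order \<open>r\<close>.\<close>

definition simplicial_bd :: "('v \<Rightarrow> nat) \<Rightarrow> 'v set \<Rightarrow> ('v set \<Rightarrow> 'k::field) \<Rightarrow> 'v set \<Rightarrow> 'k" where
  "simplicial_bd r V z F = (\<Sum>x\<in>V - F. koszul_sign r x F * z (insert x F))"

context simplicial_complex
begin

definition simplicial_chains :: "nat \<Rightarrow> ('v set \<Rightarrow> 'k::field) set" where
  "simplicial_chains d = {z. \<forall>F. z F \<noteq> 0 \<longrightarrow> F \<in> \<Delta> \<and> card F = Suc d}"

lemma mono_nonfaces: "finite F \<Longrightarrow> F \<notin> \<Delta> \<Longrightarrow> sqfree_mono F \<in> nonfaces \<Delta>"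
  by (simp add: nonfaces_def sqfree_mono_def keys_sum_single)

text \<open>If \<open>{u, v}\<close> is no edge, the part of a cycle \<open>z\<close> at \<open>u\<close> bounds in the complement of \<open>{u, v}\<close> only
  if coning off gives a cycle which agrees with \<open>z\<close> at \<open>u\<close> and vanishes at \<open>v\<close>.\<close>

lemma link_cocycle:
  fixes z :: "'v set \<Rightarrow> 'k::field"
  assumes inj: "inj_on r V" and uv: "u \<in> V" "v \<in> V" "{u, v} \<notin> \<Delta>"
    and z: "z \<in> simplicial_chains d" "\<And>F. F \<subseteq> V \<Longrightarrow> card F = d \<Longrightarrow> simplicial_bd r V z F = 0"
    and zu: "u \<in> F0" "z F0 \<noteq> 0"
    and uniq: "\<And>c :: 'v set \<Rightarrow> 'k. c \<in> simplicial_chains d \<Longrightarrow> (\<And>F. F \<subseteq> V \<Longrightarrow> card F = d \<Longrightarrow> simplicial_bd r V c F = 0)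
        \<Longrightarrow> (\<And>F. v \<in> F \<Longrightarrow> c F = 0) \<Longrightarrow> c F0 = 0"
  shows "\<exists>\<alpha> :: 'v set \<Rightarrow> 'k. (\<forall>S. \<alpha> S \<noteq> 0 \<longrightarrow> S \<subseteq> V - {u, v} \<and> card S = d) \<and>
    (\<forall>F\<in>\<Delta>. F \<subseteq> V - {u, v} \<longrightarrow> card F = Suc d \<longrightarrow> (\<Sum>x\<in>F. koszul_sign r x (F - {x}) * \<alpha> (F - {x})) = 0) \<and>
    (\<Sum>S | S \<subseteq> V - {u, v} \<and> card S = d. koszul_sign r u S * z (insert u S) * \<alpha> S) = 1"
proof -
  define J where "J = V - {u, v}"
  define E where "E = {S. S \<subseteq> J \<and> card S = d}"
  define P where "P = {F \<in> \<Delta>. F \<subseteq> J \<and> card F = Suc d}"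
  have finJ: "finite J" using finite_V by (simp add: J_def)
  have finE: "finite E" unfolding E_def using finJ by simp
  have finP: "finite P" unfolding P_def using finite_complex by simp
  have neq: "u \<noteq> v" using uv vertex_face[of u] by auto
  have nouv: "F \<notin> \<Delta>" if "u \<in> F" "v \<in> F" for F using that uv(3) face_subset[of F "{u, v}"] by auto
  \<comment> \<open>The incidence matrix of the subcomplex induced on \<open>J\<close>: combinations
    of columns are boundaries, and functionals that kill all columns are cocycles.\<close>
  define M :: "'v set \<Rightarrow> 'v set \<Rightarrow> 'k"
    where "M S F = (if \<exists>x\<in>J - S. F = insert x S then koszul_sign r (THE x. x \<notin> S \<and> F = insert x S) S else 0)" for S F
  have M_ins: "M S (insert x S) = koszul_sign r x S" if "x \<in> J - S" for x S
  proof -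
    have "(THE y. y \<notin> S \<and> insert x S = insert y S) = x" using that by (intro the_equality) auto
    moreover have "\<exists>y\<in>J - S. insert x S = insert y S" using that by blast
    ultimately show ?thesis by (simp add: M_def)
  qed
  define y where "y S = koszul_sign r u S * z (insert u S)" for S
  have Mw: "(\<Sum>F\<in>P. M S F * w F) = (\<Sum>x\<in>J - S. koszul_sign r x S * (if insert x S \<in> P then w (insert x S) else 0))"
    if "S \<in> E" for S and w :: "'v set \<Rightarrow> 'k"
  proof -
    have "(\<Sum>x\<in>J - S. koszul_sign r x S * (if insert x S \<in> P then w (insert x S) else 0))
      = (\<Sum>x\<in>{x \<in> J - S. insert x S \<in> P}. koszul_sign r x S * w (insert x S))"
      by (rule sum.mono_neutral_cong_right) (use finJ in auto)
    also have "\<dots> = (\<Sum>F\<in>(\<lambda>x. insert x S) ` {x \<in> J - S. insert x S \<in> P}. M S F * w F)"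
      by (subst sum.reindex) (auto simp: inj_on_def M_ins)
    also have "\<dots> = (\<Sum>F\<in>P. M S F * w F)"
      by (rule sum.mono_neutral_left) (use finP in \<open>auto simp: M_def\<close>)
    finally show ?thesis ..
  qed
  have "\<nexists>w. \<forall>S\<in>E. y S = (\<Sum>F\<in>P. M S F * w F)"
  proof
    assume "\<exists>w. \<forall>S\<in>E. y S = (\<Sum>F\<in>P. M S F * w F)"
    then obtain w where w0: "\<And>S. S \<in> E \<Longrightarrow> y S = (\<Sum>F\<in>P. M S F * w F)" by blast
    have w: "y S = (\<Sum>x\<in>J - S. koszul_sign r x S * (if insert x S \<in> P then w (insert x S) else 0))"
      if "S \<in> E" for S
      using w0[OF that] Mw[OF that, of w] by simp
    \<comment> \<open>If the part of \<open>z\<close> at \<open>u\<close> had the boundary of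
      \<open>w\<close> as its rim, then \<open>- w\<close> would close it up inside
      \<open>J\<close>. The result is a cycle that avoids \<open>v\<close> and agrees with
      \<open>z\<close> at \<open>F0\<close>.\<close>
    define c where "c F = (if u \<in> F then z F else if F \<in> P then - w F else 0)" for F
    have "c F0 = 0"
    proof (rule uniq)
      show "c \<in> simplicial_chains d" using z(1) by (auto simp: simplicial_chains_def c_def P_def)
      show "c F = 0" if "v \<in> F" for F
        using that z(1) nouv[of F] by (auto simp: c_def P_def J_def simplicial_chains_def)
    next
      fix S assume S: "S \<subseteq> V" "card S = d"
      show "simplicial_bd r V c S = 0"
      proof (cases "u \<in> S")
        case True
        then have "simplicial_bd r V c S = simplicial_bd r V z S" by (simp add: simplicial_bd_def c_def)
        then show ?thesis using z(2) S by simp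
      next
        case uS: False
        show ?thesis
        proof (cases "v \<in> S")
          case True
          have "c (insert x S) = 0" for x
          proof (cases "u \<in> insert x S")
            case True
            then have "insert x S \<notin> \<Delta>" using nouv[of "insert x S"] \<open>v \<in> S\<close> by simp
            then show ?thesis using True z(1) by (auto simp: c_def simplicial_chains_def)
          next
            case False
            then show ?thesis using \<open>v \<in> S\<close> by (auto simp: c_def P_def J_def)
          qed
          then show ?thesis by (simp add: simplicial_bd_def)
        next
          case vS: False
          then have SE: "S \<in> E" using S uS by (auto simp: E_def J_def)
          have V: "V - S = insert u (insert v (J - S))" "u \<notin> insert v (J - S)" "v \<notin> J - S"
            using uS vS uv neq by (auto simp: J_def)
          have cv: "c (insert v S) = 0" using uS neq by (auto simp: c_def P_def J_def)
          have "(\<Sum>x\<in>J - S. koszul_sign r x S * c (insert x S))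
            = - (\<Sum>x\<in>J - S. koszul_sign r x S * (if insert x S \<in> P then w (insert x S) else 0))"
            unfolding sum_negf[symmetric]
            by (rule sum.cong) (use uS in \<open>auto simp: c_def J_def\<close>)
          moreover have "c (insert u S) = z (insert u S)" by (simp add: c_def)
          ultimately show ?thesis
            unfolding simplicial_bd_def V(1) using V(2,3) finJ cv w[OF SE] by (simp add: y_def)
        qed
      qed
    qed
    then show False using zu by (simp add: c_def)
  qed
  then obtain \<alpha> where \<alpha>: "\<And>F. F \<in> P \<Longrightarrow> (\<Sum>S\<in>E. \<alpha> S * M S F) = 0" "(\<Sum>S\<in>E. \<alpha> S * y S) = 1"
    using fredholm_alternative[OF finP finE, of y M] by blast
  define \<alpha>' where "\<alpha>' S = (if S \<in> E then \<alpha> S else 0)" for S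
  have "(\<Sum>x\<in>F. koszul_sign r x (F - {x}) * \<alpha>' (F - {x})) = 0" if F: "F \<in> P" for F
  proof -
    have finF: "finite F" using F finite_face by (auto simp: P_def)
    have FJ: "F \<subseteq> J" "card F = Suc d" using F by (auto simp: P_def)
    have "0 = (\<Sum>S\<in>E. \<alpha> S * M S F)" using \<alpha>(1)[OF F] by simp
    also have "\<dots> = (\<Sum>S\<in>(\<lambda>x. F - {x}) ` F. \<alpha> S * M S F)"
    proof (rule sum.mono_neutral_right[OF finE])
      show "(\<lambda>x. F - {x}) ` F \<subseteq> E" using FJ finF by (auto simp: E_def)
      show "\<forall>S\<in>E - (\<lambda>x. F - {x}) ` F. \<alpha> S * M S F = 0"
      proof
        fix S assume S: "S \<in> E - (\<lambda>x. F - {x}) ` F"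
        have "\<not> (\<exists>x\<in>J - S. F = insert x S)"
        proof
          assume "\<exists>x\<in>J - S. F = insert x S"
          then obtain x where "x \<in> F" "S = F - {x}" by auto
          then show False using S by blast
        qed
        then show "\<alpha> S * M S F = 0" by (simp add: M_def)
      qed
    qed
    also have "\<dots> = (\<Sum>x\<in>F. \<alpha> (F - {x}) * M (F - {x}) F)"
      by (subst sum.reindex) (auto simp: inj_on_def)
    also have "\<dots> = (\<Sum>x\<in>F. koszul_sign r x (F - {x}) * \<alpha>' (F - {x}))"
    proof (rule sum.cong[OF refl])
      fix x assume x: "x \<in> F"
      then have "F - {x} \<in> E" using FJ finF by (auto simp: E_def)
      moreover have "M (F - {x}) F = koszul_sign r x (F - {x})"
        using M_ins[of x "F - {x}"] x FJ by (auto simp: insert_absorb)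
      ultimately show "\<alpha> (F - {x}) * M (F - {x}) F = koszul_sign r x (F - {x}) * \<alpha>' (F - {x})"
        by (simp add: \<alpha>'_def mult.commute)
    qed
    finally show ?thesis ..
  qed
  moreover have "(\<Sum>S\<in>E. koszul_sign r u S * z (insert u S) * \<alpha>' S) = 1"
    using \<alpha>(2) by (simp add: y_def \<alpha>'_def mult_ac cong: sum.cong)
  moreover have "\<alpha>' S \<noteq> 0 \<longrightarrow> S \<subseteq> J \<and> card S = d" for S by (auto simp: \<alpha>'_def E_def)
  ultimately show ?thesis unfolding J_def[symmetric] E_def[symmetric]
    by (intro exI[of _ \<alpha>']) (auto simp: P_def)
qed

end

context sr_resolution
begin

text \<open>Under Hochster's correspondence the component of \<open>c\<close> of multidegree \<open>\<Prod>\<^sub>v X\<^sub>v\<close> is a simplicial cochain; the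
  sum is its value on \<open>z\<close>.\<close>

lemma cycle_evaluation_boundary:
  assumes z: "z \<in> simplicial_chains d" "\<And>F. F \<subseteq> V \<Longrightarrow> card F = d \<Longrightarrow> simplicial_bd r V z F = 0"
    and c: "\<And>F. F \<subseteq> V \<Longrightarrow> V - F \<in> \<Delta> \<Longrightarrow> card (V - F) = Suc d \<Longrightarrow> c F - kd t F \<in> nonfaces \<Delta>"
  shows "(\<Sum>F | F \<in> \<Delta> \<and> card F = Suc d. z F * (\<Prod>y\<in>F. koszul_sign r y V) *
      Poly_Mapping.lookup (c (V - F)) (\<Sum>v\<in>F. Poly_Mapping.single v (Suc 0))) = 0"
proof -
  define Z where "Z = {F \<in> \<Delta>. card F = Suc d}"
  define E where "E = {S. S \<subseteq> V \<and> card S = d}"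
  define m where "m F = (\<Sum>v\<in>F. Poly_Mapping.single v (Suc 0))" for F :: "'v set"
  define p where "p F = (\<Prod>y\<in>F. koszul_sign r y V :: 'k)" for F
  define f where "f S x = z (insert x S) * p (insert x S) * koszul_sign r x (V - insert x S)
     * Poly_Mapping.lookup (t (V - S)) (m S)" for S x
  have finZ: "finite Z" using finite_complex by (simp add: Z_def)
  have finE: "finite E" using finite_V by (simp add: E_def)
  have finF: "finite F" if "F \<in> Z" for F using that finite_face by (simp add: Z_def)
  have FV: "F \<subseteq> V" if "F \<in> Z" for F using that by (auto simp: Z_def)
  have lc: "Poly_Mapping.lookup (c (V - F)) (m F) = (\<Sum>x\<in>F. koszul_sign r x (V - F) *
      Poly_Mapping.lookup (t (V - (F - {x}))) (m (F - {x})))" if F: "F \<in> Z" for F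
  proof -
    have VF: "V - (V - F) = F" using FV[OF F] by blast
    have "c (V - F) - kd t (V - F) \<in> nonfaces \<Delta>" using F VF by (intro c) (auto simp: Z_def)
    then have "Poly_Mapping.lookup (c (V - F) - kd t (V - F)) (m F) = 0"
      using F finF[OF F] by (intro nonfaces_lookup) (auto simp: m_def keys_sum_single Z_def)
    then have "Poly_Mapping.lookup (c (V - F)) (m F) = Poly_Mapping.lookup (kd t (V - F)) (m F)"
      by (simp add: lookup_minus)
    also have "\<dots> = (\<Sum>x\<in>F. koszul_sign r x (V - F) * Poly_Mapping.lookup (t (insert x (V - F))) (m (F - {x})))"
      unfolding kd_def VF lookup_sum
      by (rule sum.cong) (simp_all add: mult.assoc lookup_koszul_sign_mult m_def lookup_Var_mult_mono finF[OF F])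
    also have "\<dots> = (\<Sum>x\<in>F. koszul_sign r x (V - F) * Poly_Mapping.lookup (t (V - (F - {x}))) (m (F - {x})))"
    proof (rule sum.cong[OF refl])
      fix x assume "x \<in> F"
      then have "insert x (V - F) = V - (F - {x})" using FV[OF F] by auto
      then show "koszul_sign r x (V - F) * Poly_Mapping.lookup (t (insert x (V - F))) (m (F - {x})) =
        koszul_sign r x (V - F) * Poly_Mapping.lookup (t (V - (F - {x}))) (m (F - {x}))" by simp
    qed
    finally show ?thesis .
  qed
  have "(\<Sum>F\<in>Z. z F * p F * Poly_Mapping.lookup (c (V - F)) (m F))
      = (\<Sum>F\<in>Z. \<Sum>x\<in>F. f (F - {x}) x)"
    by (rule sum.cong) (auto simp: lc f_def sum_distrib_left mult.assoc insert_absorb intro!: sum.cong)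
  also have "\<dots> = (\<Sum>(F, x)\<in>Sigma Z (\<lambda>F. F). f (F - {x}) x)"
    using finZ finF by (simp add: sum.Sigma)
  \<comment> \<open>Pairs of a face and one of its vertices are regrouped by the face
    \<open>S\<close> that remains, so that the boundary of \<open>z\<close> at \<open>S\<close>
    appears.\<close>
  also have "\<dots> = (\<Sum>(S, x)\<in>Sigma E (\<lambda>S. {x \<in> V - S. insert x S \<in> Z}). f S x)"
  proof (rule sum.reindex_bij_witness[where i = "\<lambda>(S, x). (insert x S, x)" and j = "\<lambda>(F, x). (F - {x}, x)"])
    fix a assume "a \<in> Sigma Z (\<lambda>F. F)"
    then obtain F x where a: "a = (F, x)" "F \<in> Z" "x \<in> F" by auto
    then show "(case case a of (F, x) \<Rightarrow> (F - {x}, x) of (S, x) \<Rightarrow> (insert x S, x)) = a"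
      by (simp add: insert_absorb)
    show "(case a of (F, x) \<Rightarrow> (F - {x}, x)) \<in> Sigma E (\<lambda>S. {x \<in> V - S. insert x S \<in> Z})"
      using a FV[OF a(2)] finF[OF a(2)] by (auto simp: E_def Z_def insert_absorb)
    show "(case case a of (F, x) \<Rightarrow> (F - {x}, x) of (S, x) \<Rightarrow> f S x) = (case a of (F, x) \<Rightarrow> f (F - {x}) x)"
      by (simp add: a)
  next
    fix b assume "b \<in> Sigma E (\<lambda>S. {x \<in> V - S. insert x S \<in> Z})"
    then obtain S x where b: "b = (S, x)" "S \<in> E" "x \<in> V" "x \<notin> S" "insert x S \<in> Z" by auto
    show "(case case b of (S, x) \<Rightarrow> (insert x S, x) of (F, x) \<Rightarrow> (F - {x}, x)) = b"
      using b by simp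
    show "(case b of (S, x) \<Rightarrow> (insert x S, x)) \<in> Sigma Z (\<lambda>F. F)"
      using b by auto
  qed
  also have "\<dots> = (\<Sum>S\<in>E. \<Sum>x\<in>{x \<in> V - S. insert x S \<in> Z}. f S x)"
  proof -
    have "\<forall>S\<in>E. finite {x \<in> V - S. insert x S \<in> Z}"
      by (intro ballI finite_subset[OF _ finite_V]) auto
    then show ?thesis by (rule sum.Sigma[OF finE, symmetric])
  qed
  also have "\<dots> = 0"
  proof (rule sum.neutral, rule ballI)
    fix S assume S: "S \<in> E"
    have finS: "finite S" using S finite_V finite_subset by (auto simp: E_def)
    have "(\<Sum>x\<in>{x \<in> V - S. insert x S \<in> Z}. f S x) = (\<Sum>x\<in>V - S. f S x)"
    proof (rule sum.mono_neutral_left)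
      show "\<forall>x\<in>V - S - {x \<in> V - S. insert x S \<in> Z}. f S x = 0"
        using z(1) by (auto simp: f_def simplicial_chains_def Z_def)
    qed (use finite_V in auto)
    also have "\<dots> = (\<Sum>x\<in>V - S. p S * Poly_Mapping.lookup (t (V - S)) (m S) * (koszul_sign r x S * z (insert x S)))"
    proof (rule sum.cong[OF refl])
      fix x assume x: "x \<in> V - S"
      have "insert x S \<subseteq> V" using x S by (auto simp: E_def)
      \<comment> \<open>The sign at the complement splits into a factor depending on
        \<open>x\<close> alone, which cancels against \<open>p (insert x S)\<close>, and the sign in
        the simplicial boundary.\<close>
      then have "koszul_sign r x (V - insert x S) = (koszul_sign r x V * koszul_sign r x (insert x S) :: 'k)"
        by (rule koszul_sign_Diff[OF finite_V])
      also have "\<dots> = koszul_sign r x V * koszul_sign r x S" by (simp add: koszul_sign_insert_self[OF finS])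
      finally have "koszul_sign r x (V - insert x S) = (koszul_sign r x V * koszul_sign r x S :: 'k)" .
      moreover have "p (insert x S) = koszul_sign r x V * p S" using x finS by (simp add: p_def)
      ultimately show "f S x = p S * Poly_Mapping.lookup (t (V - S)) (m S) * (koszul_sign r x S * z (insert x S))"
        by (simp add: f_def mult_ac)
    qed
    also have "\<dots> = p S * Poly_Mapping.lookup (t (V - S)) (m S) * simplicial_bd r V z S"
      by (simp add: simplicial_bd_def sum_distrib_left)
    also have "\<dots> = 0" using z(2)[of S] S by (simp add: E_def)
    finally show "(\<Sum>x\<in>{x \<in> V - S. insert x S \<in> Z}. f S x) = 0" .
  qed
  finally show ?thesis unfolding Z_def p_def m_def .
qed

text \<open>The cocycle of \<open>link_cocycle\<close> is turned into a Koszul cycle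
  \<open>b\<close>. The product of X_u e_v with \<open>b\<close> must bound, hence has value 0 on
  \<open>z\<close>; but only the faces \<open>insert u S\<close> with \<open>S\<close> in
  \<open>E\<close> contribute to this value, and they add up to the sign \<open>k\<close>.\<close>

lemma golod_contradiction:
  fixes z :: "'v set \<Rightarrow> 'k"
  assumes h: "\<And>i. 1 \<le> i \<Longrightarrow> kos.basis_mod (Zk i) (Bk i) (h i) (\<zeta> i)"
    and T: "\<And>s. tor.basis_mod (Zt s) (Bt s) (T s) (\<xi> s)"
    and eq: "\<And>N. T N = (card V choose N) + (\<Sum>q=2..N. h (q - 1) * T (N - q))"
    and uv: "u \<in> V" "v \<in> V" "{u, v} \<notin> \<Delta>" and d: "1 \<le> d"
    and z: "z \<in> simplicial_chains d" "\<And>F. F \<subseteq> V \<Longrightarrow> card F = d \<Longrightarrow> simplicial_bd r V z F = 0"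
    and zu: "u \<in> F0" "z F0 \<noteq> 0"
    and uniq: "\<And>c :: 'v set \<Rightarrow> 'k. c \<in> simplicial_chains d \<Longrightarrow> (\<And>F. F \<subseteq> V \<Longrightarrow> card F = d \<Longrightarrow> simplicial_bd r V c F = 0)
        \<Longrightarrow> (\<And>F. v \<in> F \<Longrightarrow> c F = 0) \<Longrightarrow> c F0 = 0"
  shows False
proof -
  define J where "J = V - {u, v}"
  define E where "E = {S. S \<subseteq> J \<and> card S = d}"
  have finJ: "finite J" using finite_V by (simp add: J_def)
  have neq: "u \<noteq> v" using uv vertex_face[of u] by auto
  obtain \<alpha> :: "'v set \<Rightarrow> 'k" where \<alpha>: "\<And>S. \<alpha> S \<noteq> 0 \<Longrightarrow> S \<subseteq> J \<and> card S = d"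
    "\<And>F. F \<in> \<Delta> \<Longrightarrow> F \<subseteq> J \<Longrightarrow> card F = Suc d \<Longrightarrow> (\<Sum>x\<in>F. koszul_sign r x (F - {x}) * \<alpha> (F - {x})) = 0"
    "(\<Sum>S\<in>E. koszul_sign r u S * z (insert u S) * \<alpha> S) = 1"
  proof -
    have "\<exists>\<alpha> :: 'v set \<Rightarrow> 'k. (\<forall>S. \<alpha> S \<noteq> 0 \<longrightarrow> S \<subseteq> J \<and> card S = d) \<and>
      (\<forall>F\<in>\<Delta>. F \<subseteq> J \<longrightarrow> card F = Suc d \<longrightarrow> (\<Sum>x\<in>F. koszul_sign r x (F - {x}) * \<alpha> (F - {x})) = 0) \<and>
      (\<Sum>S\<in>E. koszul_sign r u S * z (insert u S) * \<alpha> S) = 1"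
      unfolding J_def E_def by (rule link_cocycle[of r u v z d F0]) (fact injr uv z zu uniq)+
    then obtain \<alpha> :: "'v set \<Rightarrow> 'k" where a: "\<forall>S. \<alpha> S \<noteq> 0 \<longrightarrow> S \<subseteq> J \<and> card S = d"
      "\<forall>F\<in>\<Delta>. F \<subseteq> J \<longrightarrow> card F = Suc d \<longrightarrow> (\<Sum>x\<in>F. koszul_sign r x (F - {x}) * \<alpha> (F - {x})) = 0"
      "(\<Sum>S\<in>E. koszul_sign r u S * z (insert u S) * \<alpha> S) = 1"
      by (elim exE conjE)
    show thesis
    proof (rule that)
      show "\<alpha> S \<noteq> 0 \<Longrightarrow> S \<subseteq> J \<and> card S = d" for S using a(1) by blast
      show "F \<in> \<Delta> \<Longrightarrow> F \<subseteq> J \<Longrightarrow> card F = Suc d \<Longrightarrow> (\<Sum>x\<in>F. koszul_sign r x (F - {x}) * \<alpha> (F - {x})) = 0" for F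
        using a(2) by blast
    qed (rule a(3))
  qed
  have "E \<noteq> {}" using \<alpha>(3) by auto
  then have dJ: "d \<le> card J" using card_mono[OF finJ] by (auto simp: E_def)
  have cardV: "card V = card J + 2"
  proof -
    have "V = insert u (insert v J)" "u \<notin> insert v J" "v \<notin> J" using uv neq by (auto simp: J_def)
    then show ?thesis using finJ by simp
  qed
  define q where "q = card J - d"
  \<comment> \<open>Hochster's correspondence on \<open>J\<close>: the value at \<open>S\<close>
    becomes the coefficient of the squarefree monomial of \<open>S\<close> times the basis element
    of \<open>J - S\<close>. The sign factor matches the simplicial coboundary with the Koszul
    differential.\<close>
  define \<alpha>' where "\<alpha>' S = \<alpha> S * (\<Prod>y\<in>S. koszul_sign r y J)" for S
  define b :: "'v set \<Rightarrow> ('v, 'k) mpoly"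
    where "b F = (if F \<subseteq> J then Const (\<alpha>' (J - F)) * sqfree_mono (J - F) else 0)" for F
  \<comment> \<open>Here \<open>1 \<le> d\<close> enters: the monomials in \<open>b\<close> are
    different from 1.\<close>
  have cb: "const_coeff (b F) = 0" for F
  proof (cases "F \<subseteq> J \<and> \<alpha>' (J - F) \<noteq> 0")
    case True
    then have "card (J - F) = d" using \<alpha>(1)[of "J - F"] by (auto simp: \<alpha>'_def)
    then have "J - F \<noteq> {}" using d by (metis card.empty not_one_le_zero)
    then show ?thesis using finJ True by (simp add: b_def const_coeff_mult const_coeff_mono)
  qed (auto simp: b_def const_coeff_def Const_def)
  have bZ: "b \<in> Zk q"
    unfolding Zk_def
  proof (intro CollectI allI impI)
    fix G assume G: "G \<subseteq> V" "Suc (card G) = q"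
    show "kd b G \<in> nonfaces \<Delta>"
    proof (cases "G \<subseteq> J")
      case False
      then have "b (insert x G) = 0" for x by (auto simp: b_def)
      then show ?thesis by (simp add: kd_def nonfaces_0)
    next
      case True
      define F where "F = J - G"
      have finF: "finite F" using finJ by (simp add: F_def)
      have FJ: "F \<subseteq> J" by (auto simp: F_def)
      have GF: "G = J - F" using True by (auto simp: F_def)
      have cF: "card F = Suc d"
        using card_Diff_subset[OF finite_subset[OF True finJ] True] G dJ by (simp add: F_def q_def)
      have "kd b G = (\<Sum>x\<in>F. sg x G * Var x * b (insert x G))"
        unfolding kd_def
      proof (rule sum.mono_neutral_right)
        show "F \<subseteq> V - G" by (auto simp: F_def J_def)
        show "\<forall>x\<in>V - G - F. sg x G * Var x * b (insert x G) = 0" by (auto simp: b_def F_def)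
      qed (use finite_V in simp)
      also have "\<dots> = (\<Sum>x\<in>F. Const ((\<Prod>y\<in>F. koszul_sign r y J) * (koszul_sign r x (F - {x}) * \<alpha> (F - {x}))) * sqfree_mono F)"
      proof (rule sum.cong[OF refl])
        fix x assume x: "x \<in> F"
        have i: "insert x G \<subseteq> J" "J - insert x G = F - {x}" using x True by (auto simp: F_def)
        have "koszul_sign r x G = (koszul_sign r x J * koszul_sign r x F :: 'k)"
          unfolding GF by (rule koszul_sign_Diff[OF finJ FJ])
        also have "koszul_sign r x F = (koszul_sign r x (F - {x}) :: 'k)"
          using koszul_sign_insert_self[of "F - {x}" r x] finF x by (simp add: insert_absorb)
        finally have s: "koszul_sign r x G = (koszul_sign r x J * koszul_sign r x (F - {x}) :: 'k)" .
        have p: "(\<Prod>y\<in>F. koszul_sign r y J :: 'k) = koszul_sign r x J * (\<Prod>y\<in>F - {x}. koszul_sign r y J)"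
          by (rule prod.remove[OF finF x])
        have "sg x G * Var x * b (insert x G) = Const (koszul_sign r x G * \<alpha>' (F - {x})) * (Var x * sqfree_mono (F - {x}))"
          using i by (simp add: b_def Const_mult Const_koszul_sign mult_ac)
        also have "Var x * sqfree_mono (F - {x}) = sqfree_mono F"
          using Var_mono[of "F - {x}" x] finF x by (simp add: insert_absorb)
        also have "koszul_sign r x G * \<alpha>' (F - {x})
            = (\<Prod>y\<in>F. koszul_sign r y J) * (koszul_sign r x (F - {x}) * \<alpha> (F - {x}))"
          unfolding s p \<alpha>'_def by (simp add: mult_ac)
        finally show "sg x G * Var x * b (insert x G) =
          Const ((\<Prod>y\<in>F. koszul_sign r y J) * (koszul_sign r x (F - {x}) * \<alpha> (F - {x}))) * sqfree_mono F" .
      qed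
      also have "\<dots> = Const ((\<Prod>y\<in>F. koszul_sign r y J) * (\<Sum>x\<in>F. koszul_sign r x (F - {x}) * \<alpha> (F - {x}))) * sqfree_mono F"
        by (simp add: K_sum sum_distrib_left sum_distrib_right)
      also have "\<dots> \<in> nonfaces \<Delta>"
      proof (cases "F \<in> \<Delta>")
        case True
        then show ?thesis using \<alpha>(2)[OF True FJ cF] by (simp add: K0 nonfaces_0)
      next
        case False
        then show ?thesis using mono_nonfaces[OF finF] by (intro nonfaces_mult)
      qed
      finally show ?thesis .
    qed
  qed
  define \<eta> where "\<eta> = (\<lambda>F. Var u * wedge v b F)"
  have uvI: "(Var u * Var v :: ('v, 'k) mpoly) \<in> nonfaces \<Delta>"
  proof -
    have "Poly_Mapping.keys (Poly_Mapping.single u (Suc 0) + Poly_Mapping.single v (Suc 0)) = {u, v}"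
      by (auto simp: keys_add_nat)
    then show ?thesis using uv(3) by (simp add: Var_def mult_single nonfaces_def)
  qed
  have "\<eta> \<in> Bk (q + 1)"
    unfolding \<eta>_def by (rule golod_imp_product_boundary[OF h T eq uv(2) uvI bZ cb])
  then obtain t where t: "\<And>F. F \<subseteq> V \<Longrightarrow> card F = q + 1 \<Longrightarrow> \<eta> F - kd t F \<in> nonfaces \<Delta>"
    unfolding Bk_def by blast
  define m where "m F = (\<Sum>v\<in>F. Poly_Mapping.single v (Suc 0))" for F :: "'v set"
  have zero: "(\<Sum>F | F \<in> \<Delta> \<and> card F = Suc d. z F * (\<Prod>y\<in>F. koszul_sign r y V) *
      Poly_Mapping.lookup (\<eta> (V - F)) (m F)) = 0"
    unfolding m_def
  proof (rule cycle_evaluation_boundary[OF z])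
    fix F assume F: "F \<subseteq> V" "card (V - F) = Suc d"
    have "card (V - F) = card V - card F" "card F \<le> card V"
      using F finite_V by (simp_all add: card_Diff_subset finite_subset card_mono)
    then have "card F = q + 1" using F dJ cardV by (simp add: q_def)
    then show "\<eta> F - kd t F \<in> nonfaces \<Delta>" using t F by blast
  qed
  define k :: 'k where "k = koszul_sign r u V * koszul_sign r v J"
  have term_eq: "z F * (\<Prod>y\<in>F. koszul_sign r y V) * Poly_Mapping.lookup (\<eta> (V - F)) (m F)
      = k * (koszul_sign r u S * z (insert u S) * \<alpha> S)" if F: "F = insert u S" and S: "S \<in> E" for F S
  proof -
    have SJ: "S \<subseteq> J" "u \<notin> S" "v \<notin> S" using S by (auto simp: E_def J_def)
    have finS: "finite S" using SJ finJ finite_subset by blast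
    have vF: "v \<notin> F" using SJ F neq by auto
    have G: "V - F - {v} = J - S" using F by (auto simp: J_def)
    have JG: "J - (J - S) = S" using SJ by auto
    have "\<eta> (V - F) = Var u * (koszul_sign r v (V - F) * (Const (\<alpha>' S) * sqfree_mono S))"
      using vF uv by (simp add: \<eta>_def wedge_def G b_def JG)
    also have "\<dots> = koszul_sign r v (V - F) * (Const (\<alpha>' S) * (Var u * sqfree_mono S))"
      by (simp add: mult_ac)
    also have "Var u * sqfree_mono S = sqfree_mono F" using Var_mono[OF finS SJ(2)] F by simp
    finally have "Poly_Mapping.lookup (\<eta> (V - F)) (m F) = koszul_sign r v (V - F) * \<alpha>' S"
      by (simp add: lookup_koszul_sign_mult lookup_Const_mult sqfree_mono_def m_def)
    moreover have "koszul_sign r v (V - F) = (koszul_sign r v J * koszul_sign r v S :: 'k)"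
    proof -
      have "V - F = insert v (J - S)" using vF uv F neq by (auto simp: J_def)
      then have "koszul_sign r v (V - F) = (koszul_sign r v (J - S) :: 'k)"
        using finJ by (simp add: koszul_sign_insert_self)
      then show ?thesis using koszul_sign_Diff[OF finJ SJ(1)] by simp
    qed
    moreover have "(\<Prod>y\<in>F. koszul_sign r y V) = (koszul_sign r u V * (\<Prod>y\<in>S. koszul_sign r y V) :: 'k)"
      using F SJ finS by simp
    \<comment> \<open>For \<open>y\<close> in \<open>S\<close>, the signs relative to
      \<open>V\<close> and \<open>J\<close> differ only through the places of \<open>u\<close> and
      \<open>v\<close>.\<close>
    moreover have "(\<Prod>y\<in>S. koszul_sign r y V) * (\<Prod>y\<in>S. koszul_sign r y J) = (koszul_sign r u S * koszul_sign r v S :: 'k)"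
    proof -
      have "koszul_sign r y V * koszul_sign r y J
          = ((if r y < r u then - 1 else 1) * (if r y < r v then - 1 else 1) :: 'k)" if y: "y \<in> S" for y
      proof -
        have "V = insert u (insert v J)" "u \<notin> insert v J" "v \<notin> J" using uv neq by (auto simp: J_def)
        then have "koszul_sign r y V = (if r u < r y then - koszul_sign r y (insert v J)
              else (koszul_sign r y (insert v J) :: 'k))"
          and "koszul_sign r y (insert v J) = (if r v < r y then - koszul_sign r y J else (koszul_sign r y J :: 'k))"
          using finJ by (simp_all add: koszul_sign_insert)
        moreover have "y \<in> V" "y \<noteq> u" "y \<noteq> v" using y SJ by (auto simp: J_def)
        then have "r u < r y \<longleftrightarrow> \<not> r y < r u" "r v < r y \<longleftrightarrow> \<not> r y < r v"
          using r_neq[of y u] r_neq[of y v] uv by auto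
        ultimately show ?thesis by (auto simp: mult_ac)
      qed
      then show ?thesis
        unfolding prod.distrib[symmetric] koszul_sign_prod[OF finS] by (intro prod.cong) auto
    qed
    ultimately have "z F * (\<Prod>y\<in>F. koszul_sign r y V) * Poly_Mapping.lookup (\<eta> (V - F)) (m F)
      = k * z F * \<alpha> S * (koszul_sign r v S * (koszul_sign r u S * koszul_sign r v S))"
      unfolding k_def \<alpha>'_def by (simp add: mult_ac)
    then show ?thesis by (simp add: F mult_ac)
  qed
  have "(\<Sum>F | F \<in> \<Delta> \<and> card F = Suc d. z F * (\<Prod>y\<in>F. koszul_sign r y V) * Poly_Mapping.lookup (\<eta> (V - F)) (m F))
     = (\<Sum>F\<in>insert u ` E. z F * (\<Prod>y\<in>F. koszul_sign r y V) * Poly_Mapping.lookup (\<eta> (V - F)) (m F))"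
  proof (rule sum.mono_neutral_cong)
    show "finite {F \<in> \<Delta>. card F = Suc d}" using finite_complex by simp
    show "finite (insert u ` E)" using finJ by (simp add: E_def)
  next
    fix F assume "F \<in> insert u ` E - {F \<in> \<Delta>. card F = Suc d}"
    then have "z F = 0" using z(1) by (auto simp: simplicial_chains_def)
    then show "z F * (\<Prod>y\<in>F. koszul_sign r y V) * Poly_Mapping.lookup (\<eta> (V - F)) (m F) = 0" by simp
  next
    fix F assume F: "F \<in> {F \<in> \<Delta>. card F = Suc d} - insert u ` E"
    have "\<eta> (V - F) = 0"
    proof (cases "v \<in> F \<or> u \<notin> F")
      case True
      then show ?thesis
      proof (cases "v \<in> F")
        case True
        then show ?thesis by (simp add: \<eta>_def wedge_def)
      next
        case False
        then have "u \<notin> F" using True by simp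
        then have "\<not> V - F - {v} \<subseteq> J" using uv neq by (auto simp: J_def)
        then show ?thesis by (simp add: \<eta>_def wedge_def b_def)
      qed
    next
      case False
      then have "F = insert u (F - {u})" "F - {u} \<in> E" using F finite_face[of F] by (auto simp: E_def J_def)
      then show ?thesis using F by blast
    qed
    then show "z F * (\<Prod>y\<in>F. koszul_sign r y V) * Poly_Mapping.lookup (\<eta> (V - F)) (m F) = 0" by simp
  qed simp
  also have "\<dots> = (\<Sum>S\<in>E. k * (koszul_sign r u S * z (insert u S) * \<alpha> S))"
  proof -
    have "inj_on (insert u) E" by (rule inj_onI) (auto simp: E_def J_def)
    then show ?thesis by (simp add: sum.reindex term_eq)
  qed
  also have "\<dots> = k" using \<alpha>(3) by (simp add: sum_distrib_left[symmetric])
  finally have "k = 0" using zero by simp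
  moreover have "k * k = 1" by (simp add: k_def mult_ac)
  ultimately show False by simp
qed

end

section \<open>Nonvanishing of local homology classes\<close>

definition lin_eval :: "('b \<Rightarrow> 'r) \<Rightarrow> ('b \<Rightarrow>\<^sub>0 'r) \<Rightarrow> 'r::comm_ring_1" where
  "lin_eval \<phi> c = (\<Sum>f\<in>Poly_Mapping.keys c. Poly_Mapping.lookup c f * \<phi> f)"

lemma lin_eval_superset:
  assumes "finite A" "Poly_Mapping.keys c \<subseteq> A"
  shows "lin_eval \<phi> c = (\<Sum>f\<in>A. Poly_Mapping.lookup c f * \<phi> f)"
  unfolding lin_eval_def using assms by (intro sum.mono_neutral_left) (auto simp: in_keys_iff)

lemma lin_eval_0 [simp]: "lin_eval \<phi> 0 = 0"
  by (simp add: lin_eval_def)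

lemma lin_eval_add: "lin_eval \<phi> (a + b) = lin_eval \<phi> a + lin_eval \<phi> b"
proof -
  let ?A = "Poly_Mapping.keys a \<union> Poly_Mapping.keys b"
  have "lin_eval \<phi> (a + b) = (\<Sum>f\<in>?A. Poly_Mapping.lookup (a + b) f * \<phi> f)"
    using keys_add[of a b] by (intro lin_eval_superset) auto
  also have "\<dots> = lin_eval \<phi> a + lin_eval \<phi> b"
    by (simp add: lin_eval_superset[of ?A a] lin_eval_superset[of ?A b] lookup_add distrib_right sum.distrib)
  finally show ?thesis .
qed

lemma lin_eval_uminus: "lin_eval \<phi> (- a) = - lin_eval \<phi> a"
  using lin_eval_add[of \<phi> a "- a"] by (simp add: eq_neg_iff_add_eq_0 add.commute)

lemma lin_eval_diff: "lin_eval \<phi> (a - b) = lin_eval \<phi> a - lin_eval \<phi> b"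
  using lin_eval_add[of \<phi> a "- b"] by (simp add: lin_eval_uminus)

lemma lin_eval_single: "lin_eval \<phi> (Poly_Mapping.single f a) = a * \<phi> f"
  by (subst lin_eval_superset[of "{f}"]) auto

lemma lin_eval_sum: "lin_eval \<phi> (sum f A) = (\<Sum>i\<in>A. lin_eval \<phi> (f i))"
  by (induction A rule: infinite_finite_induct) (auto simp: lin_eval_add)

lemma lin_eval_frag_cmul: "lin_eval \<phi> (frag_cmul k c) = k * lin_eval \<phi> c"
  by (subst lin_eval_superset[of "Poly_Mapping.keys c"]) (auto simp: keys_cmul lin_eval_def sum_distrib_left mult.assoc)

lemma lin_eval_zero: "(\<And>f. f \<in> Poly_Mapping.keys c \<Longrightarrow> \<phi> f = 0) \<Longrightarrow> lin_eval \<phi> c = 0"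
  unfolding lin_eval_def by (intro sum.neutral) auto

section \<open>An alternating cochain defined by labels of vertices\<close>

definition simplex_vertex :: "nat \<Rightarrow> nat \<Rightarrow> real" where
  "simplex_vertex i = (\<lambda>j. if j = i then 1 else 0)"

lemma simplex_vertex_in: "i \<le> p \<Longrightarrow> simplex_vertex i \<in> standard_simplex p"
  by (simp add: simplex_vertex_def)

lemma singular_face_vertex:
  assumes "i \<le> p"
  shows "singular_face (Suc p) k f (simplex_vertex i) = f (simplex_vertex (if i < k then i else Suc i))"
proof -
  have "simplical_face k (simplex_vertex i) = simplex_vertex (if i < k then i else Suc i)"
    by (auto simp: simplical_face_def simplex_vertex_def fun_eq_iff)
  then show ?thesis using simplex_vertex_in[OF assms] by (simp add: singular_face_def)
qed

text \<open>The alternating top-dimensional cochain of the simplex with vertices \<open>0, \<dots>, d\<close>, pulled back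
  along a labelling of the points.\<close>

definition label_det :: "('a \<Rightarrow> nat) \<Rightarrow> nat \<Rightarrow> ((nat \<Rightarrow> real) \<Rightarrow> 'a) \<Rightarrow> int" where
  "label_det l d f = det (mat (Suc d) (Suc d) (\<lambda>(i, j). if l (f (simplex_vertex i)) = j then 1 else 0))"

lemma det_zero_sum_column:
  fixes a :: "nat \<Rightarrow> nat \<Rightarrow> int" and w :: "nat \<Rightarrow> int"
  assumes "\<And>i. i < n \<Longrightarrow> (\<Sum>j<n. a i j * w j) = 0" "k < n" "w k \<noteq> 0"
  shows "det (mat n n (\<lambda>(i, j). a i j)) = 0"
proof -
  let ?A = "mat n n (\<lambda>(i, j). a i j)"
  have "?A *\<^sub>v vec n w = 0\<^sub>v n"
    by (rule eq_vecI) (auto simp: scalar_prod_def assms(1) lessThan_atLeast0[symmetric])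
  moreover have "vec n w \<noteq> 0\<^sub>v n"
    using assms(2,3) by (metis index_vec index_zero_vec(1))
  ultimately show ?thesis
    using det_0_iff_vec_prod_zero[of ?A n] by (intro iffD2[OF det_0_iff_vec_prod_zero]) (auto intro!: exI[of _ "vec n w"])
qed

lemma label_det_missing:
  assumes "k \<le> d" "\<And>i. i \<le> d \<Longrightarrow> l (f (simplex_vertex i)) \<noteq> k"
  shows "label_det l d f = 0"
  unfolding label_det_def
proof (rule det_zero_sum_column[where w = "\<lambda>j. if j = k then 1 else 0" and k = k])
  fix i assume i: "i < Suc d"
  show "(\<Sum>j<Suc d. (if l (f (simplex_vertex i)) = j then 1 else 0) * (if j = k then 1 else 0 :: int)) = 0"
    by (rule sum.neutral) (use assms(2)[of i] i in auto)
qed (use assms in auto)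

lemma label_det_standard:
  assumes "\<And>i. i \<le> d \<Longrightarrow> l (f (simplex_vertex i)) = i"
  shows "label_det l d f = 1"
proof -
  have "mat (Suc d) (Suc d) (\<lambda>(i, j). if l (f (simplex_vertex i)) = j then 1 else 0) = (1\<^sub>m (Suc d) :: int mat)"
    by (rule eq_matI) (use assms in auto)
  then show ?thesis by (simp add: label_det_def)
qed

text \<open>If a label \<open>k \<le> d\<close> is missing, every face misses it. If
  \<open>d + 1\<close> is missing, adjoin a column of ones to the label matrix of the
  \<open>d + 2\<close> vertices: it is the sum of the label columns, so the determinant is zero, and
  its expansion along the new column is the alternating sum over the faces.\<close>

lemma label_det_boundary:
  assumes lab: "\<And>i. i \<le> Suc d \<Longrightarrow> l (f (simplex_vertex i)) \<le> Suc d"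
    and miss: "k \<le> Suc d" "\<And>i. i \<le> Suc d \<Longrightarrow> l (f (simplex_vertex i)) \<noteq> k"
  shows "lin_eval (label_det l d) (chain_boundary (Suc d) (frag_of f)) = 0"
proof -
  have expand: "lin_eval (label_det l d) (chain_boundary (Suc d) (frag_of f))
     = (\<Sum>i\<le>Suc d. (-1) ^ i * label_det l d (singular_face (Suc d) i f))"
    by (simp add: chain_boundary_of lin_eval_sum lin_eval_frag_cmul lin_eval_single del: sum.atMost_Suc)
  show ?thesis
  proof (cases "k \<le> d")
    case True
    have "label_det l d (singular_face (Suc d) i f) = 0" for i
      by (rule label_det_missing[OF True]) (auto simp: singular_face_vertex miss(2))
    then show ?thesis unfolding expand by simp
  next
    case False
    then have labd: "l (f (simplex_vertex i)) \<le> d" if "i \<le> Suc d" for i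
      using lab[OF that] miss(2)[OF that] miss(1) by simp
    define a :: "nat \<Rightarrow> nat \<Rightarrow> int" where
      "a i j = (if j = 0 then 1 else if Suc (l (f (simplex_vertex i))) = j then 1 else 0)" for i j
    let ?N = "mat (Suc (Suc d)) (Suc (Suc d)) (\<lambda>(i, j). a i j)"
    have "det ?N = 0"
    proof (rule det_zero_sum_column[where w = "\<lambda>j. if j = 0 then 1 else - 1" and k = 0])
      fix i assume i: "i < Suc (Suc d)"
      have "(\<Sum>j<Suc (Suc d). a i j * (if j = 0 then 1 else - 1))
         = 1 + (\<Sum>j<Suc d. if j = l (f (simplex_vertex i)) then - 1 else 0)"
      proof -
        have "(\<Sum>j<Suc d. a i (Suc j) * (if Suc j = 0 then 1 else - 1))
          = (\<Sum>j<Suc d. if j = l (f (simplex_vertex i)) then - 1 else 0)"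
          by (rule sum.cong) (auto simp: a_def)
        then show ?thesis unfolding sum.lessThan_Suc_shift[of _ "Suc d"] by (simp add: a_def)
      qed
      also have "(\<Sum>j<Suc d. if j = l (f (simplex_vertex i)) then - 1 else 0) = (- 1 :: int)"
        using labd[of i] i by (subst sum.delta) auto
      finally show "(\<Sum>j<Suc (Suc d). a i j * (if j = 0 then 1 else - 1)) = 0" by simp
    qed auto
    also have "det ?N = (\<Sum>i<Suc (Suc d). ?N $$ (i, 0) * cofactor ?N i 0)"
      by (rule laplace_expansion_column) auto
    also have "\<dots> = (\<Sum>i\<le>Suc d. (-1) ^ i * label_det l d (singular_face (Suc d) i f))"
    proof (rule sum.cong)
      fix i assume "i \<in> {..Suc d}"
      then have i: "i < Suc (Suc d)" by simp
      have "mat_delete ?N i 0 = mat (Suc d) (Suc d)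
         (\<lambda>(i', j). if l (singular_face (Suc d) i f (simplex_vertex i')) = j then 1 else 0)"
        by (rule eq_matI) (auto simp: mat_delete_def a_def singular_face_vertex)
      then have "cofactor ?N i 0 = (-1) ^ i * label_det l d (singular_face (Suc d) i f)"
        by (simp add: cofactor_def label_det_def)
      then show "?N $$ (i, 0) * cofactor ?N i 0 = (-1) ^ i * label_det l d (singular_face (Suc d) i f)"
        using i by (simp add: a_def)
    qed auto
    finally show ?thesis unfolding expand by simp
  qed
qed

section \<open>Evaluation on iterated subdivisions\<close>

lemma chain_boundary_expand:
  "lin_eval \<phi> (chain_boundary p c) = (\<Sum>f\<in>Poly_Mapping.keys c. Poly_Mapping.lookup c f * lin_eval \<phi> (chain_boundary p (frag_of f)))"
proof -
  have "chain_boundary p c = (\<Sum>f\<in>Poly_Mapping.keys c. frag_cmul (Poly_Mapping.lookup c f) (chain_boundary p (frag_of f)))"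
    by (cases "p = 0") (simp_all add: chain_boundary_def frag_extend_def)
  then show ?thesis by (simp add: lin_eval_sum lin_eval_frag_cmul)
qed

lemma chain_boundary_iterated_subdivision:
  "singular_chain p X c \<Longrightarrow> chain_boundary p ((singular_subdivision p ^^ n) c)
     = (singular_subdivision (p - Suc 0) ^^ n) (chain_boundary p c)"
proof (induction n)
  case (Suc n)
  have "singular_chain p X ((singular_subdivision p ^^ n) c)"
    using Suc.prems by (induction n) (auto simp: singular_chain_singular_subdivision)
  then show ?case using Suc by (simp add: chain_boundary_singular_subdivision)
qed auto

lemma singular_chain_iterated_subdivision:
  "singular_chain p X c \<Longrightarrow> singular_chain p X ((singular_subdivision p ^^ n) c)"
  by (induction n) (auto simp: singular_chain_singular_subdivision)

lemma keys_vertex_in: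
  assumes "singular_chain p X c" "f \<in> Poly_Mapping.keys c" "i \<le> p"
  shows "f (simplex_vertex i) \<in> topspace X"
proof -
  have "singular_simplex p X f" using assms by (auto simp: singular_chain_def)
  then have "f \<in> standard_simplex p \<rightarrow> topspace X"
    unfolding singular_simplex_def using continuous_map_funspace by fastforce
  then show ?thesis using simplex_vertex_in[OF assms(3)] by blast
qed

lemma iterated_subdivision_linear:
  "(singular_subdivision p ^^ n) 0 = 0"
  "(singular_subdivision p ^^ n) (a + b) = (singular_subdivision p ^^ n) a + (singular_subdivision p ^^ n) b"
  by (induction n) (auto simp: singular_subdivision_add)

text \<open>The right-hand side is the coboundary, at \<open>f\<close>, of the cochain pulled back
  along the subdivision.\<close>

lemma lin_eval_subdivision_boundary:
  assumes f: "singular_simplex (Suc d) X f"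
  shows "lin_eval \<phi> ((singular_subdivision d ^^ n) (chain_boundary (Suc d) (frag_of f)))
    = (\<Sum>i\<le>Suc d. (-1) ^ i * lin_eval \<phi> ((singular_subdivision d ^^ n) (frag_of (singular_face (Suc d) i f))))"
proof -
  let ?S = "singular_subdivision d ^^ n"
  have neg: "?S (- a) = - ?S a" for a :: "'a chain"
    using iterated_subdivision_linear(2)[where n = n and a = a and b = "- a"]
    by (simp add: iterated_subdivision_linear(1) eq_neg_iff_add_eq_0 add.commute)
  have pow: "?S (frag_cmul ((-1) ^ i) a) = frag_cmul ((-1) ^ i) (?S a)" for a :: "'a chain" and i
    by (cases "even i") (simp_all add: neg)
  have sum: "?S (sum g A) = (\<Sum>i\<in>A. ?S (g i))" for g :: "nat \<Rightarrow> 'a chain" and A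
    by (induction A rule: infinite_finite_induct) (auto simp: iterated_subdivision_linear)
  show ?thesis by (simp add: chain_boundary_of sum pow lin_eval_sum lin_eval_frag_cmul del: sum.atMost_Suc)
qed

lemma small_subdivision:
  assumes "singular_simplex p X f" "\<And>w. w \<in> topspace X \<Longrightarrow> \<exists>U. openin X U \<and> w \<in> U \<and> P U"
  shows "\<exists>n. \<forall>m\<ge>n. \<forall>g\<in>Poly_Mapping.keys ((singular_subdivision p ^^ m) (frag_of f)).
      \<exists>U. P U \<and> g \<in> standard_simplex p \<rightarrow> U"
proof -
  have "topspace X \<subseteq> \<Union>{U. openin X U \<and> P U}" using assms(2) by blast
  from sufficient_iterated_singular_subdivision_exists[OF _ this, of p "frag_of f"]
  obtain n where "\<And>m g. n \<le> m \<Longrightarrow> g \<in> Poly_Mapping.keys ((singular_subdivision p ^^ m) (frag_of f)) \<Longrightarrow>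
     \<exists>U\<in>{U. openin X U \<and> P U}. g \<in> standard_simplex p \<rightarrow> U"
    using assms(1) by (auto simp: singular_chain_of)
  then show ?thesis by blast
qed

text \<open>The subdivision of \<open>\<sigma>\<close> differs from \<open>\<sigma>\<close> by the
  two terms of a chain homotopy. As the same homotopy \<open>h\<close> works in every space, it can
  be applied inside the image of \<open>\<sigma>\<close>, where label \<open>d + 1\<close> does not
  occur, and inside the image of the face opposite to vertex \<open>i\<close>, where label
  \<open>i\<close> does not occur. So both terms evaluate to zero.\<close>

lemma sperner:
  assumes \<sigma>: "singular_simplex d X \<sigma>"
    and vert: "\<And>i. i \<le> d \<Longrightarrow> l (\<sigma> (simplex_vertex i)) = i"
    and lab: "\<And>p. p \<in> standard_simplex d \<Longrightarrow> l (\<sigma> p) \<le> d"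
    and face: "\<And>p i. p \<in> standard_simplex d \<Longrightarrow> i \<le> d \<Longrightarrow> p i = 0 \<Longrightarrow> l (\<sigma> p) \<noteq> i"
  shows "lin_eval (label_det l d) ((singular_subdivision d ^^ n) (frag_of \<sigma>)) = 1"
proof -
  obtain h where h0: "\<And>p. h p 0 = (0 :: 'a chain)"
    and hdiff: "\<And>p c1 c2. h p (c1 - c2) = h p c1 - h p c2"
    and hch: "\<And>p X c. singular_chain p X c \<Longrightarrow> singular_chain (Suc p) X (h p c)"
    and hb: "\<And>p X c. singular_chain p X c \<Longrightarrow> chain_boundary (Suc p) (h p c) + h (p - Suc 0) (chain_boundary p c)
                   = (singular_subdivision p ^^ n) c - c"
    using chain_homotopic_iterated_singular_subdivision[of n] by blast
  have hneg: "h p (- c) = - h p c" for p c using hdiff[of p 0 c] by (simp add: h0)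
  have hadd: "h p (c + c') = h p c + h p c'" for p c c' using hdiff[of p c "- c'"] by (simp add: hneg)
  have hsum: "h p (sum g A) = (\<Sum>i\<in>A. h p (g i))" for p and g :: "nat \<Rightarrow> 'a chain" and A
    by (induction A rule: infinite_finite_induct) (auto simp: hadd h0)
  have hpow: "h p (frag_cmul ((-1) ^ i) c) = frag_cmul ((-1) ^ i) (h p c)" for p i c
    by (cases "even i") (simp_all add: hneg)
  let ?\<phi> = "lin_eval (label_det l d)"
  have ch: "singular_chain d X (frag_of \<sigma>)" using \<sigma> by (simp add: singular_chain_of)
  have 1: "?\<phi> (chain_boundary (Suc d) (h d (frag_of \<sigma>))) = 0"
  proof -
    let ?Y = "subtopology X (\<sigma> ` standard_simplex d)"
    have "singular_chain d ?Y (frag_of \<sigma>)"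
      using \<sigma> by (simp add: singular_chain_of singular_simplex_subtopology)
    then have "singular_chain (Suc d) ?Y (h d (frag_of \<sigma>))" by (rule hch)
    then have v: "g (simplex_vertex i) \<in> \<sigma> ` standard_simplex d"
      if "g \<in> Poly_Mapping.keys (h d (frag_of \<sigma>))" "i \<le> Suc d" for g i
      using keys_vertex_in that by fastforce
    have "?\<phi> (chain_boundary (Suc d) (frag_of g)) = 0" if g: "g \<in> Poly_Mapping.keys (h d (frag_of \<sigma>))" for g
    proof (rule label_det_boundary[where k = "Suc d"])
      fix i assume "i \<le> Suc d"
      then have "l (g (simplex_vertex i)) \<le> d" using v[OF g] lab by fastforce
      then show "l (g (simplex_vertex i)) \<le> Suc d" "l (g (simplex_vertex i)) \<noteq> Suc d" by auto
    qed simp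
    then show ?thesis by (simp add: chain_boundary_expand[of _ _ "h d (frag_of \<sigma>)"])
  qed
  have 2: "?\<phi> (h (d - Suc 0) (chain_boundary d (frag_of \<sigma>))) = 0"
  proof (cases "d = 0")
    case True
    then show ?thesis by (simp add: chain_boundary_def h0)
  next
    case False
    have "?\<phi> (h (d - Suc 0) (frag_of (singular_face d i \<sigma>))) = 0" if i: "i \<le> d" for i
    proof (rule lin_eval_zero)
      fix g assume g: "g \<in> Poly_Mapping.keys (h (d - Suc 0) (frag_of (singular_face d i \<sigma>)))"
      let ?Y = "subtopology X (\<sigma> ` {p \<in> standard_simplex d. p i = 0})"
      have "singular_simplex (d - Suc 0) ?Y (singular_face d i \<sigma>)"
        unfolding singular_simplex_subtopology
      proof
        show "singular_simplex (d - Suc 0) X (singular_face d i \<sigma>)"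
          using singular_simplex_singular_face[OF \<sigma>] False i by simp
        show "singular_face d i \<sigma> ` standard_simplex (d - Suc 0) \<subseteq> \<sigma> ` {p \<in> standard_simplex d. p i = 0}"
        proof
          fix y assume "y \<in> singular_face d i \<sigma> ` standard_simplex (d - Suc 0)"
          then obtain p where p: "p \<in> standard_simplex (d - Suc 0)" "y = \<sigma> (simplical_face i p)"
            by (auto simp: singular_face_def)
          moreover have "simplical_face i p \<in> standard_simplex d"
            using simplical_face_in_standard_simplex[of d i p] False i p by simp
          moreover have "simplical_face i p i = 0" by (simp add: simplical_face_def)
          ultimately show "y \<in> \<sigma> ` {p \<in> standard_simplex d. p i = 0}" by blast
        qed
      qed
      then have "singular_chain (Suc (d - Suc 0)) ?Y (h (d - Suc 0) (frag_of (singular_face d i \<sigma>)))"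
        by (intro hch) (simp add: singular_chain_of)
      then have c: "singular_chain d ?Y (h (d - Suc 0) (frag_of (singular_face d i \<sigma>)))" using False by simp
      show "label_det l d g = 0"
      proof (rule label_det_missing[OF i])
        fix j assume "j \<le> d"
        then have "g (simplex_vertex j) \<in> topspace ?Y" by (rule keys_vertex_in[OF c g])
        then obtain p where "p \<in> standard_simplex d" "p i = 0" "g (simplex_vertex j) = \<sigma> p" by auto
        then show "l (g (simplex_vertex j)) \<noteq> i" using face i by metis
      qed
    qed
    then show ?thesis using False
      by (simp add: chain_boundary_of hsum hpow lin_eval_sum lin_eval_frag_cmul)
  qed
  have "?\<phi> ((singular_subdivision d ^^ n) (frag_of \<sigma>)) - ?\<phi> (frag_of \<sigma>) = 0"
    unfolding lin_eval_diff[symmetric] hb[OF ch, symmetric] lin_eval_add 1 2 by simp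
  moreover have "?\<phi> (frag_of \<sigma>) = 1" by (simp add: lin_eval_single label_det_standard vert)
  ultimately show ?thesis by simp
qed

subsection \<open>Singular chains with coefficients in a field\<close>

lemma lookup_fscale: "Poly_Mapping.lookup (fscale a c) f = a * Poly_Mapping.lookup c f"
  by (simp add: fscale_def Poly_Mapping.map.rep_eq when_def)

lemma fscale_simps:
  "fscale a 0 = 0" "fscale 0 c = 0" "fscale 1 c = c" "fscale a (fscale b c) = fscale (a * b) c"
  "fscale a (c + d) = fscale a c + fscale a d" "fscale a (c - d) = fscale a c - fscale a d"
  "fscale (a + b) c = fscale a c + fscale b c" "fscale (a - b) c = fscale a c - fscale b c"
  "fscale a (Poly_Mapping.single f b) = Poly_Mapping.single f (a * b)"
  by (auto intro!: poly_mapping_eqI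
      simp: lookup_fscale lookup_add lookup_minus lookup_single when_def algebra_simps)

lemma fchains_0: "0 \<in> fchains p X" by (simp add: fchains_def)

lemma fchains_add: "a \<in> fchains p X \<Longrightarrow> b \<in> fchains p X \<Longrightarrow> a + b \<in> fchains p X"
  using keys_add[of a b] by (auto simp: fchains_def)

lemma fchains_scale: "a \<in> fchains p X \<Longrightarrow> fscale k a \<in> fchains p X"
  unfolding fchains_def by (auto simp: in_keys_iff lookup_fscale)

lemma fchains_sum: "(\<And>i. i \<in> A \<Longrightarrow> f i \<in> fchains p X) \<Longrightarrow> sum f A \<in> fchains p X"
  by (induction A rule: infinite_finite_induct) (auto simp: fchains_0 fchains_add)

lemma fchains_single: "singular_simplex p X f \<Longrightarrow> Poly_Mapping.single f a \<in> fchains p X"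
  by (auto simp: fchains_def)

lemma fboundary_superset:
  assumes "finite A" "Poly_Mapping.keys c \<subseteq> A" "p \<noteq> 0"
  shows "fboundary p c = (\<Sum>f\<in>A. \<Sum>i\<le>p.
        Poly_Mapping.single (singular_face p i f) ((- 1) ^ i * Poly_Mapping.lookup c f))"
proof -
  have "fboundary p c = (\<Sum>f\<in>Poly_Mapping.keys c. \<Sum>i\<le>p.
        Poly_Mapping.single (singular_face p i f) ((- 1) ^ i * Poly_Mapping.lookup c f))"
    using assms(3) by (simp add: fboundary_def)
  also have "\<dots> = (\<Sum>f\<in>A. \<Sum>i\<le>p.
        Poly_Mapping.single (singular_face p i f) ((- 1) ^ i * Poly_Mapping.lookup c f))"
    using assms by (intro sum.mono_neutral_left) (auto simp: in_keys_iff)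
  finally show ?thesis .
qed

lemma fboundary_add: "fboundary p (a + b) = fboundary p a + fboundary p b"
proof (cases "p = 0")
  case True
  then show ?thesis by (simp add: fboundary_def)
next
  case False
  let ?A = "Poly_Mapping.keys a \<union> Poly_Mapping.keys b"
  have "fboundary p (a + b) = (\<Sum>f\<in>?A. \<Sum>i\<le>p.
        Poly_Mapping.single (singular_face p i f) ((- 1) ^ i * Poly_Mapping.lookup (a + b) f))"
    using keys_add[of a b] False by (intro fboundary_superset) auto
  also have "\<dots> = fboundary p a + fboundary p b"
    by (simp add: fboundary_superset[of ?A a, OF _ _ False] fboundary_superset[of ?A b, OF _ _ False]
        lookup_add distrib_left single_add sum.distrib)
  finally show ?thesis .
qed

lemma fboundary_single:
  "p \<noteq> 0 \<Longrightarrow> fboundary p (Poly_Mapping.single f a) =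
     (\<Sum>i\<le>p. Poly_Mapping.single (singular_face p i f) ((- 1) ^ i * a))"
  by (subst fboundary_superset[of "{f}"]) auto

lemma fboundary_sum: "fboundary p (sum f A) = (\<Sum>i\<in>A. fboundary p (f i))"
proof (induction A rule: infinite_finite_induct)
  case (insert x F)
  then show ?case by (simp add: fboundary_add)
qed (simp_all add: fboundary_def)

lemma fboundary_scale: "fboundary p (fscale k c) = fscale k (fboundary p c)"
proof (cases "p = 0")
  case True
  then show ?thesis by (simp add: fboundary_def fscale_simps)
next
  case False
  have scale_sum: "fscale k (sum g A) = (\<Sum>i\<in>A. fscale k (g i))" for g :: "'i \<Rightarrow> ('a, 'b) fchain" and A
    by (induction A rule: infinite_finite_induct) (auto simp: fscale_simps)
  have "fboundary p (fscale k c) = (\<Sum>f\<in>Poly_Mapping.keys c. \<Sum>i\<le>p.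
        Poly_Mapping.single (singular_face p i f) ((- 1) ^ i * Poly_Mapping.lookup (fscale k c) f))"
    using False by (intro fboundary_superset) (auto simp: in_keys_iff lookup_fscale)
  also have "\<dots> = fscale k (fboundary p c)"
    using False by (simp add: fboundary_def scale_sum fscale_simps lookup_fscale mult_ac)
  finally show ?thesis .
qed

lemma frelboundaries_chains: "c \<in> fchains p (subtopology X S) \<Longrightarrow> c \<in> frelboundaries p X S"
proof -
  assume "c \<in> fchains p (subtopology X S)"
  then have "fscale (- 1) c \<in> fchains p (subtopology X S)" by (rule fchains_scale)
  moreover have "fscale (- 1) c = fboundary (Suc p) 0 - c"
    by (rule poly_mapping_eqI) (simp add: lookup_fscale lookup_minus fboundary_def)
  ultimately show ?thesis unfolding frelboundaries_def
    by (intro CollectI bexI[of _ 0]) (simp_all add: fchains_0)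
qed

lemma frelboundaries_add:
  assumes "a \<in> frelboundaries p X S" "b \<in> frelboundaries p X S"
  shows "a + b \<in> frelboundaries p X S"
proof -
  obtain d e where de: "d \<in> fchains (Suc p) X" "fboundary (Suc p) d - a \<in> fchains p (subtopology X S)"
    "e \<in> fchains (Suc p) X" "fboundary (Suc p) e - b \<in> fchains p (subtopology X S)"
    using assms unfolding frelboundaries_def by blast
  have "fboundary (Suc p) (d + e) - (a + b) \<in> fchains p (subtopology X S)"
    using fchains_add[OF de(2,4)] by (simp add: fboundary_add algebra_simps)
  then show ?thesis unfolding frelboundaries_def using fchains_add[OF de(1,3)] by blast
qed

lemma frelboundaries_scale:
  assumes "a \<in> frelboundaries p X S"
  shows "fscale k a \<in> frelboundaries p X S"
proof -
  obtain d where d: "d \<in> fchains (Suc p) X" "fboundary (Suc p) d - a \<in> fchains p (subtopology X S)"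
    using assms unfolding frelboundaries_def by blast
  have "fboundary (Suc p) (fscale k d) - fscale k a \<in> fchains p (subtopology X S)"
    using fchains_scale[OF d(2), of k] by (simp add: fboundary_scale fscale_simps)
  then show ?thesis unfolding frelboundaries_def using fchains_scale[OF d(1)] by blast
qed

lemma frelboundaries_diff:
  assumes "a \<in> frelboundaries p X S" "b \<in> frelboundaries p X S"
  shows "a - b \<in> frelboundaries p X S"
proof -
  have "a - b = a + fscale (- 1) b"
    by (rule poly_mapping_eqI) (simp add: lookup_fscale lookup_minus lookup_add)
  then show ?thesis using frelboundaries_add frelboundaries_scale assms by metis
qed

lemma singular_simplex_image_closed:
  assumes "Hausdorff_space X" "singular_simplex p X f"
  shows "closedin X (f ` standard_simplex p)"
proof -
  have "compactin (subtopology (powertop_real UNIV) (standard_simplex p)) (standard_simplex p)"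
    using compactin_standard_simplex[of p] by (simp add: compactin_subtopology)
  then have "compactin X (f ` standard_simplex p)"
    using assms(2) unfolding singular_simplex_def by (blast intro: image_compactin)
  then show ?thesis using assms(1) by (rule compactin_imp_closedin[rotated])
qed

text \<open>The reason is that singular chains have compact support.\<close>

lemma frelboundaries_open:
  assumes X: "Hausdorff_space X" and y: "y \<in> topspace X"
    and c: "c \<in> frelboundaries p X (topspace X - {y})"
  shows "\<exists>U. openin X U \<and> y \<in> U \<and> (\<forall>y'\<in>U. c \<in> frelboundaries p X (topspace X - {y'}))"
proof -
  obtain e where e: "e \<in> fchains (Suc p) X"
    and g: "fboundary (Suc p) e - c \<in> fchains p (subtopology X (topspace X - {y}))"
    using c unfolding frelboundaries_def by blast
  define G where "G = fboundary (Suc p) e - c"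
  \<comment> \<open>\<open>C\<close> is the closed set covered by the remainder. The same bounding
    chain \<open>e\<close> works at every point outside it.\<close>
  define C where "C = (\<Union>f\<in>Poly_Mapping.keys G. f ` standard_simplex p)"
  have simp: "singular_simplex p X f" "f ` standard_simplex p \<subseteq> topspace X - {y}"
    if "f \<in> Poly_Mapping.keys G" for f
  proof -
    have "singular_simplex p (subtopology X (topspace X - {y})) f"
      using g that by (auto simp: G_def[symmetric] fchains_def)
    then show "singular_simplex p X f" "f ` standard_simplex p \<subseteq> topspace X - {y}"
      unfolding singular_simplex_subtopology by blast+
  qed
  have "closedin X C" unfolding C_def
    by (intro closedin_Union) (auto intro: singular_simplex_image_closed[OF X] simp)
  then have "openin X (topspace X - C)" by blast
  moreover have "y \<in> topspace X - C" using y simp(2) by (auto simp: C_def)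
  moreover have "c \<in> frelboundaries p X (topspace X - {y'})" if "y' \<in> topspace X - C" for y'
  proof -
    have "singular_simplex p (subtopology X (topspace X - {y'})) f" if f: "f \<in> Poly_Mapping.keys G" for f
      using simp[OF f] \<open>y' \<in> topspace X - C\<close> f by (auto simp: singular_simplex_subtopology C_def)
    then have "G \<in> fchains p (subtopology X (topspace X - {y'}))" by (auto simp: fchains_def)
    then show ?thesis using e unfolding frelboundaries_def G_def by blast
  qed
  ultimately show ?thesis by blast
qed

text \<open>Integral cochains extend linearly to all coefficient fields, so Sperner's lemma shows that the
  simplex \<open>\<sigma>\<close> is not a relative boundary at \<open>y\<close>, provided that the labelling has all labels
  \<open>0, \<dots>, d\<close> near \<open>y\<close> only. The additional label \<open>d + 1\<close> is used away from the image of \<open>\<sigma>\<close>.\<close>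

lemma local_class_nonzero:
  fixes a :: "'k::field"
  assumes \<sigma>: "singular_simplex d M \<sigma>"
    and vert: "\<And>i. i \<le> d \<Longrightarrow> l (\<sigma> (simplex_vertex i)) = i"
    and labs: "\<And>p. p \<in> standard_simplex d \<Longrightarrow> l (\<sigma> p) \<le> d"
    and face: "\<And>p i. p \<in> standard_simplex d \<Longrightarrow> i \<le> d \<Longrightarrow> p i = 0 \<Longrightarrow> l (\<sigma> p) \<noteq> i"
    and lab: "\<And>w. w \<in> topspace M \<Longrightarrow> l w \<le> Suc d"
    and miss: "\<And>w. w \<in> topspace M \<Longrightarrow> \<exists>U. openin M U \<and> w \<in> U \<and> (\<exists>k\<le>Suc d. \<forall>w'\<in>U. l w' \<noteq> k)"
    and miss': "\<And>w. w \<in> topspace M - {y} \<Longrightarrow> \<exists>U. openin M U \<and> w \<in> U \<and> (\<exists>k\<le>d. \<forall>w'\<in>U. l w' \<noteq> k)"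
    and bd: "Poly_Mapping.single \<sigma> a \<in> frelboundaries d M (topspace M - {y})"
  shows "a = 0"
proof -
  let ?Y = "subtopology M (topspace M - {y})"
  obtain e where e: "e \<in> fchains (Suc d) M"
    and g: "fboundary (Suc d) e - Poly_Mapping.single \<sigma> a \<in> fchains d ?Y"
    using bd unfolding frelboundaries_def by blast
  define G where "G = fboundary (Suc d) e - Poly_Mapping.single \<sigma> a"
  define \<psi> where "\<psi> m f = lin_eval (label_det l d) ((singular_subdivision d ^^ m) (frag_of f))" for m f
  \<comment> \<open>After enough subdivisions each piece of \<open>f\<close> misses one label, so
    the cochain \<open>\<psi> m\<close> has zero coboundary at \<open>f\<close>.\<close>
  have ev1: "\<forall>\<^sub>F m in sequentially. (\<Sum>i\<le>Suc d. (-1) ^ i * \<psi> m (singular_face (Suc d) i f)) = 0"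
    if f: "f \<in> Poly_Mapping.keys e" for f
  proof -
    have sf: "singular_simplex (Suc d) M f" using e f by (auto simp: fchains_def)
    then have cf: "singular_chain (Suc d) M (frag_of f)" by (simp add: singular_chain_of)
    obtain n where n: "\<And>m q. n \<le> m \<Longrightarrow> q \<in> Poly_Mapping.keys ((singular_subdivision (Suc d) ^^ m) (frag_of f)) \<Longrightarrow>
        \<exists>U. (\<exists>k\<le>Suc d. \<forall>w'\<in>U. l w' \<noteq> k) \<and> q \<in> standard_simplex (Suc d) \<rightarrow> U"
      using small_subdivision[OF sf miss] by blast
    have "(\<Sum>i\<le>Suc d. (-1) ^ i * \<psi> m (singular_face (Suc d) i f)) = 0" if m: "n \<le> m" for m
    proof -
      let ?S = "(singular_subdivision (Suc d) ^^ m) (frag_of f)"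
      have cS: "singular_chain (Suc d) M ?S" by (rule singular_chain_iterated_subdivision[OF cf])
      have "lin_eval (label_det l d) (chain_boundary (Suc d) (frag_of q)) = 0" if q: "q \<in> Poly_Mapping.keys ?S" for q
      proof -
        obtain U k where U: "k \<le> Suc d" "\<forall>w'\<in>U. l w' \<noteq> k" "q \<in> standard_simplex (Suc d) \<rightarrow> U"
          using n[OF m q] by blast
        show ?thesis
        proof (rule label_det_boundary[where k = k])
          fix i assume i: "i \<le> Suc d"
          show "l (q (simplex_vertex i)) \<le> Suc d" by (rule lab[OF keys_vertex_in[OF cS q i]])
          show "l (q (simplex_vertex i)) \<noteq> k" using U simplex_vertex_in[OF i] by blast
        qed (rule U)
      qed
      then have "lin_eval (label_det l d) (chain_boundary (Suc d) ?S) = 0"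
        by (subst chain_boundary_expand) simp
      then show ?thesis
        unfolding \<psi>_def lin_eval_subdivision_boundary[OF sf, symmetric]
        using chain_boundary_iterated_subdivision[OF cf, of m] by simp
    qed
    then show ?thesis unfolding eventually_sequentially by blast
  qed
  \<comment> \<open>Away from \<open>y\<close> the small pieces miss a label up to \<open>d\<close>,
    and there the cochain itself vanishes.\<close>
  have ev2: "\<forall>\<^sub>F m in sequentially. \<psi> m f = 0" if f: "f \<in> Poly_Mapping.keys G" for f
  proof -
    have sf: "singular_simplex d ?Y f" using g f by (auto simp: fchains_def G_def)
    then have cf: "singular_chain d ?Y (frag_of f)" by (simp add: singular_chain_of)
    have "\<exists>U. openin ?Y U \<and> w \<in> U \<and> (\<exists>k\<le>d. \<forall>w'\<in>U. l w' \<noteq> k)" if w: "w \<in> topspace ?Y" for w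
    proof -
      have "w \<in> topspace M - {y}" using w by simp
      from miss'[OF this] obtain U k where "openin M U" "w \<in> U" "k \<le> d" "\<forall>w'\<in>U. l w' \<noteq> k" by blast
      then show ?thesis using w
        by (intro exI[of _ "U \<inter> (topspace M - {y})"]) (auto simp: openin_subtopology_Int)
    qed
    from small_subdivision[OF sf this] obtain n where n: "\<And>m q. n \<le> m \<Longrightarrow>
        q \<in> Poly_Mapping.keys ((singular_subdivision d ^^ m) (frag_of f)) \<Longrightarrow>
        \<exists>U. (\<exists>k\<le>d. \<forall>w'\<in>U. l w' \<noteq> k) \<and> q \<in> standard_simplex d \<rightarrow> U" by blast
    have "\<psi> m f = 0" if m: "n \<le> m" for m
      unfolding \<psi>_def
    proof (rule lin_eval_zero)
      fix q assume q: "q \<in> Poly_Mapping.keys ((singular_subdivision d ^^ m) (frag_of f))"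
      obtain U k where U: "k \<le> d" "\<forall>w'\<in>U. l w' \<noteq> k" "q \<in> standard_simplex d \<rightarrow> U"
        using n[OF m q] by blast
      show "label_det l d q = 0"
        by (rule label_det_missing[OF U(1)]) (use U simplex_vertex_in in blast)
    qed
    then show ?thesis unfolding eventually_sequentially by blast
  qed
  \<comment> \<open>Only finitely many simplices occur, so one number of subdivisions serves all of
    them.\<close>
  have "\<forall>\<^sub>F m in sequentially. (\<forall>f\<in>Poly_Mapping.keys e. (\<Sum>i\<le>Suc d. (-1) ^ i * \<psi> m (singular_face (Suc d) i f)) = 0)
     \<and> (\<forall>f\<in>Poly_Mapping.keys G. \<psi> m f = 0)"
    by (intro eventually_conj eventually_ball_finite) (auto intro: ev1 ev2 simp del: sum.atMost_Suc)
  then obtain m where m1: "\<And>f. f \<in> Poly_Mapping.keys e \<Longrightarrow> (\<Sum>i\<le>Suc d. (-1) ^ i * \<psi> m (singular_face (Suc d) i f)) = 0"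
    and m2: "\<And>f. f \<in> Poly_Mapping.keys G \<Longrightarrow> \<psi> m f = 0"
    unfolding eventually_sequentially by blast
  define \<Psi> :: "('a, 'k) fchain \<Rightarrow> 'k" where "\<Psi> = lin_eval (\<lambda>f. of_int (\<psi> m f))"
  have "\<Psi> (fboundary (Suc d) e) = (\<Sum>f\<in>Poly_Mapping.keys e. Poly_Mapping.lookup e f *
      of_int (\<Sum>i\<le>Suc d. (-1) ^ i * \<psi> m (singular_face (Suc d) i f)))"
    unfolding fboundary_def \<Psi>_def
    by (simp add: lin_eval_sum lin_eval_single sum_distrib_left mult_ac del: sum.atMost_Suc)
  also have "\<dots> = 0" using m1 by (simp del: sum.atMost_Suc)
  finally have 1: "\<Psi> (fboundary (Suc d) e) = 0" .
  have 2: "\<Psi> G = 0" unfolding \<Psi>_def by (rule lin_eval_zero) (simp add: m2)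
  have "\<psi> m \<sigma> = 1" unfolding \<psi>_def using sperner[OF \<sigma> vert labs face] by blast
  then have 3: "\<Psi> (Poly_Mapping.single \<sigma> a) = a" by (simp add: \<Psi>_def lin_eval_single)
  have "\<Psi> G = \<Psi> (fboundary (Suc d) e) - \<Psi> (Poly_Mapping.single \<sigma> a)"
    unfolding G_def \<Psi>_def by (rule lin_eval_diff)
  then show ?thesis using 1 2 3 by simp
qed

section \<open>Invariance of domain in manifolds\<close>

lemma continuous_map_Euclidean_space_iff:
  "continuous_map X (Euclidean_space m) f \<longleftrightarrow>
     (\<forall>i. continuous_map X euclideanreal (\<lambda>x. f x i)) \<and> (\<forall>x\<in>topspace X. \<forall>i\<ge>m. f x i = 0)"
  unfolding Euclidean_space_def
  by (auto simp: continuous_map_in_subtopology continuous_map_componentwise_UNIV Pi_iff)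

text \<open>To contradict openness of an image on which some coordinate is constant or has a
  sign.\<close>

lemma Euclidean_space_open_line:
  assumes S: "openin (Euclidean_space m) S" and x: "x \<in> S" and i: "i < m"
  obtains \<epsilon> where "\<epsilon> > 0" "\<And>s. \<bar>s\<bar> < \<epsilon> \<Longrightarrow> x(i := x i + s) \<in> S"
proof -
  have xm: "\<forall>j\<ge>m. x j = 0" using openin_subset[OF S] x by (auto simp: topspace_Euclidean_space)
  have "continuous_map euclideanreal euclideanreal (\<lambda>s. (x(i := x i + s)) j)" for j
    by (cases "j = i") (auto intro!: continuous_intros)
  then have "continuous_map euclideanreal (Euclidean_space m) (\<lambda>s. x(i := x i + s))"
    using xm i by (auto simp: continuous_map_Euclidean_space_iff)
  from openin_continuous_map_preimage[OF this S]
  have "open {s. x(i := x i + s) \<in> S}" by simp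
  moreover have "0 \<in> {s. x(i := x i + s) \<in> S}" using x by simp
  ultimately obtain e where "e > 0" "\<forall>s. dist s 0 < e \<longrightarrow> s \<in> {s. x(i := x i + s) \<in> S}"
    unfolding open_dist by blast
  then show thesis using that[of e] by (simp add: dist_real_def)
qed

lemma topological_manifold_chart:
  assumes "topological_manifold d M" "x \<in> topspace M"
  obtains U W \<phi> \<phi>' where "openin M U" "x \<in> U" "openin (Euclidean_space d) W"
    "continuous_map (subtopology M U) (subtopology (Euclidean_space d) W) \<phi>"
    "continuous_map (subtopology (Euclidean_space d) W) (subtopology M U) \<phi>'"
    "\<And>y. y \<in> U \<Longrightarrow> \<phi>' (\<phi> y) = y" "\<And>w. w \<in> W \<Longrightarrow> \<phi> (\<phi>' w) = w"
proof -
  obtain U W where UW: "openin M U" "x \<in> U" "openin (Euclidean_space d) W"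
    "subtopology M U homeomorphic_space subtopology (Euclidean_space d) W"
    using assms unfolding topological_manifold_def by blast
  then obtain \<phi> \<phi>' where h: "homeomorphic_maps (subtopology M U) (subtopology (Euclidean_space d) W) \<phi> \<phi>'"
    unfolding homeomorphic_space_def by blast
  have "topspace (subtopology M U) = U" "topspace (subtopology (Euclidean_space d) W) = W"
    using UW openin_subset by (auto simp: topspace_subtopology)
  then show thesis using that[of U W \<phi> \<phi>'] UW h unfolding homeomorphic_maps_def by blast
qed

text \<open>Near each point, \<open>\<psi>\<close> composed with an inverse chart is an injection
  between Euclidean spaces of equal dimension.\<close>

lemma manifold_invariance_of_domain:
  assumes M: "topological_manifold d M" and T: "openin M T"
    and \<psi>: "continuous_map (subtopology M T) (Euclidean_space d) \<psi>" and inj: "inj_on \<psi> T"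
  shows "openin (Euclidean_space d) (\<psi> ` T)"
proof (subst openin_subopen, rule ballI)
  fix z assume "z \<in> \<psi> ` T"
  then obtain x where x: "x \<in> T" "z = \<psi> x" by blast
  have "x \<in> topspace M" using T x openin_subset by blast
  from topological_manifold_chart[OF M this] obtain U W \<phi> \<phi>' where UW:
    "openin M U" "x \<in> U" "openin (Euclidean_space d) W"
    and c1: "continuous_map (subtopology M U) (subtopology (Euclidean_space d) W) \<phi>"
    and c2: "continuous_map (subtopology (Euclidean_space d) W) (subtopology M U) \<phi>'"
    and inv: "\<And>y. y \<in> U \<Longrightarrow> \<phi>' (\<phi> y) = y" "\<And>w. w \<in> W \<Longrightarrow> \<phi> (\<phi>' w) = w" by blast
  have tU: "topspace (subtopology M U) = U" and tW: "topspace (subtopology (Euclidean_space d) W) = W"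
    using UW openin_subset by (auto simp: topspace_subtopology)
  define N where "N = {w \<in> W. \<phi>' w \<in> T}"
  have "continuous_map (subtopology (Euclidean_space d) W) M \<phi>'"
    using c2 by (simp add: continuous_map_in_subtopology)
  from openin_continuous_map_preimage[OF this T]
  have "openin (subtopology (Euclidean_space d) W) N" by (simp only: tW N_def)
  then have N: "openin (Euclidean_space d) N" using UW(3) openin_open_subtopology by blast
  have "continuous_map (subtopology (Euclidean_space d) N) (subtopology M T) \<phi>'"
  proof -
    have "continuous_map (subtopology (subtopology (Euclidean_space d) W) N) M \<phi>'"
      using c2 by (simp add: continuous_map_in_subtopology continuous_map_from_subtopology)
    moreover have "subtopology (subtopology (Euclidean_space d) W) N = subtopology (Euclidean_space d) N"
      by (simp add: subtopology_subtopology N_def Int_absorb1 Int_commute Collect_conj_eq Int_left_absorb)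
    ultimately show ?thesis by (auto simp: continuous_map_in_subtopology N_def)
  qed
  from continuous_map_compose[OF this \<psi>]
  have "continuous_map (subtopology (Euclidean_space d) N) (Euclidean_space d) (\<psi> \<circ> \<phi>')" .
  moreover have "inj_on (\<psi> \<circ> \<phi>') N"
    using inj inv(2) unfolding inj_on_def N_def by (auto, metis)
  ultimately have "openin (Euclidean_space d) ((\<psi> \<circ> \<phi>') ` N)"
    by (rule invariance_of_domain_Euclidean_space[OF N])
  moreover have "z \<in> (\<psi> \<circ> \<phi>') ` N"
  proof -
    have "\<phi> x \<in> W" using c1 UW(2) tU tW continuous_map_funspace by fastforce
    then have "\<phi> x \<in> N" using inv(1)[OF UW(2)] x by (simp add: N_def)
    then show ?thesis using inv(1)[OF UW(2)] x by (auto simp: image_iff intro!: bexI[of _ "\<phi> x"])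
  qed
  moreover have "(\<psi> \<circ> \<phi>') ` N \<subseteq> \<psi> ` T" by (auto simp: N_def)
  ultimately show "\<exists>S. openin (Euclidean_space d) S \<and> z \<in> S \<and> S \<subseteq> \<psi> ` T" by blast
qed

text \<open>If \<open>n < d\<close>, then \<open>\<psi>\<close>, regarded as a map into dimension
  \<open>d\<close>, would have an open image on which coordinate \<open>n\<close> is zero.\<close>

lemma manifold_dim_le:
  assumes M: "topological_manifold d M" and T: "openin M T" "T \<noteq> {}"
    and \<psi>: "continuous_map (subtopology M T) (Euclidean_space n) \<psi>" and inj: "inj_on \<psi> T"
  shows "d \<le> n"
proof (rule ccontr)
  assume n: "\<not> d \<le> n"
  have tT: "topspace (subtopology M T) = T" using T openin_subset by (auto simp: topspace_subtopology)
  have z: "\<psi> x i = 0" if "x \<in> T" "n \<le> i" for x i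
    using \<psi> that unfolding continuous_map_Euclidean_space_iff tT by blast
  have "continuous_map (subtopology M T) (Euclidean_space d) \<psi>"
    using \<psi> n by (auto simp: continuous_map_Euclidean_space_iff)
  then have op: "openin (Euclidean_space d) (\<psi> ` T)" using manifold_invariance_of_domain[OF M T(1)] inj by blast
  obtain x where x: "x \<in> T" using T by blast
  obtain \<epsilon> where e: "\<epsilon> > 0" "\<And>s. \<bar>s\<bar> < \<epsilon> \<Longrightarrow> (\<psi> x)(n := \<psi> x n + s) \<in> \<psi> ` T"
    using Euclidean_space_open_line[OF op, of "\<psi> x" n] x n by auto
  have "\<bar>\<epsilon> / 2\<bar> < \<epsilon>" using e(1) by simp
  then obtain x' where x': "x' \<in> T" "(\<psi> x)(n := \<psi> x n + \<epsilon> / 2) = \<psi> x'" using e(2) by blast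
  have "((\<psi> x)(n := \<psi> x n + \<epsilon> / 2)) n = 0" unfolding x'(2) using z[OF x'(1)] by simp
  then show False using z[OF x, of n] e(1) by simp
qed

text \<open>If \<open>d < n\<close>, then \<open>\<pi>\<close> followed by a chart, regarded as a
  map into dimension \<open>n\<close>, would have an open image on which coordinate \<open>d\<close>
  is zero.\<close>

lemma manifold_dim_ge:
  assumes M: "topological_manifold d M" and N: "openin (Euclidean_space n) N" "N \<noteq> {}"
    and \<pi>: "continuous_map (subtopology (Euclidean_space n) N) M \<pi>" and inj: "inj_on \<pi> N"
  shows "n \<le> d"
proof (rule ccontr)
  assume n: "\<not> n \<le> d"
  obtain p where p: "p \<in> N" using N by blast
  have tN: "topspace (subtopology (Euclidean_space n) N) = N"
    using N openin_subset by (auto simp: topspace_subtopology)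
  have "\<pi> p \<in> topspace M" using Pi_mem[OF continuous_map_funspace[OF \<pi>], of p] p by (simp only: tN)
  from topological_manifold_chart[OF M this] obtain U W \<phi> \<phi>' where UW:
    "openin M U" "\<pi> p \<in> U" "openin (Euclidean_space d) W"
    and c1: "continuous_map (subtopology M U) (subtopology (Euclidean_space d) W) \<phi>"
    and "continuous_map (subtopology (Euclidean_space d) W) (subtopology M U) \<phi>'"
    and inv: "\<And>y. y \<in> U \<Longrightarrow> \<phi>' (\<phi> y) = y" "\<And>w. w \<in> W \<Longrightarrow> \<phi> (\<phi>' w) = w" by blast
  define N' where "N' = {x \<in> N. \<pi> x \<in> U}"
  have "openin (subtopology (Euclidean_space n) N) N'"
    using openin_continuous_map_preimage[OF \<pi> UW(1)] by (simp only: tN N'_def)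
  then have N': "openin (Euclidean_space n) N'" using N(1) openin_open_subtopology by blast
  have pN': "p \<in> N'" using p UW by (simp add: N'_def)
  have tN': "topspace (subtopology (Euclidean_space n) N') = N'"
    using N' openin_subset by (auto simp: topspace_subtopology)
  have "continuous_map (subtopology (Euclidean_space n) N') (subtopology M U) \<pi>"
  proof -
    have "continuous_map (subtopology (subtopology (Euclidean_space n) N) N') M \<pi>"
      using \<pi> by (simp add: continuous_map_from_subtopology)
    moreover have "subtopology (subtopology (Euclidean_space n) N) N' = subtopology (Euclidean_space n) N'"
      by (simp add: subtopology_subtopology N'_def Int_absorb1 Int_commute Collect_conj_eq Int_left_absorb)
    ultimately show ?thesis by (auto simp: continuous_map_in_subtopology N'_def)
  qed
  moreover have c1': "continuous_map (subtopology M U) (Euclidean_space d) \<phi>"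
    using c1 by (simp add: continuous_map_in_subtopology)
  ultimately have gd: "continuous_map (subtopology (Euclidean_space n) N') (Euclidean_space d) (\<phi> \<circ> \<pi>)"
    by (rule continuous_map_compose)
  then have g: "continuous_map (subtopology (Euclidean_space n) N') (Euclidean_space n) (\<phi> \<circ> \<pi>)"
    using n unfolding continuous_map_Euclidean_space_iff by auto
  have z: "(\<phi> \<circ> \<pi>) x d = 0" if "x \<in> N'" for x
    using gd that unfolding continuous_map_Euclidean_space_iff tN' by blast
  have "inj_on (\<phi> \<circ> \<pi>) N'"
    using inj inv(1) unfolding inj_on_def N'_def by (auto, metis)
  then have op: "openin (Euclidean_space n) ((\<phi> \<circ> \<pi>) ` N')"
    using invariance_of_domain_Euclidean_space[OF N' g] by blast
  define q where "q = (\<phi> \<circ> \<pi>) p"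
  have q: "q \<in> (\<phi> \<circ> \<pi>) ` N'" using pN' by (auto simp: q_def)
  obtain \<epsilon> where e: "\<epsilon> > 0" "\<And>s. \<bar>s\<bar> < \<epsilon> \<Longrightarrow> q(d := q d + s) \<in> (\<phi> \<circ> \<pi>) ` N'"
    using Euclidean_space_open_line[OF op q, of d] n by auto
  have "\<bar>\<epsilon> / 2\<bar> < \<epsilon>" using e(1) by simp
  then obtain x' where x': "x' \<in> N'" "q(d := q d + \<epsilon> / 2) = (\<phi> \<circ> \<pi>) x'" using e(2) by blast
  have "(q(d := q d + \<epsilon> / 2)) d = 0" unfolding x'(2) by (rule z[OF x'(1)])
  then show False using z[OF pN'] e(1) by (simp add: q_def)
qed

section \<open>Triangulated manifolds\<close>

definition realization_points :: "'v set set \<Rightarrow> ('v \<Rightarrow> real) set" where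
  "realization_points \<Delta> = {a. (\<forall>v. 0 \<le> a v) \<and> {v. a v \<noteq> 0} \<in> \<Delta> \<and> (\<Sum>v\<in>\<Union>\<Delta>. a v) = 1}"

text \<open>Singular faces are numbered by coordinates; this translates vertices into such numbers.
  Its parity gives the Koszul sign.\<close>

definition position :: "('v \<Rightarrow> nat) \<Rightarrow> 'v set \<Rightarrow> 'v \<Rightarrow> nat" where
  "position r F v = card {u \<in> F. r u < r v}"

definition simplex_point :: "('v \<Rightarrow> nat) \<Rightarrow> 'v set \<Rightarrow> (nat \<Rightarrow> real) \<Rightarrow> 'v \<Rightarrow> real" where
  "simplex_point r F p v = (if v \<in> F then p (position r F v) else 0)"

lemma position_mono:
  assumes "finite F" "v \<in> F" "r v < r w" shows "position r F v < position r F w"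
  unfolding position_def
proof (rule psubset_card_mono)
  show "finite {u \<in> F. r u < r w}" using assms(1) by simp
  show "{u \<in> F. r u < r v} \<subset> {u \<in> F. r u < r w}" using assms by force
qed

lemma position_bij:
  assumes F: "finite F" and r: "inj_on r F"
  shows "bij_betw (position r F) F {..<card F}"
proof -
  have inj: "inj_on (position r F) F"
  proof (rule inj_onI)
    fix u v assume uv: "u \<in> F" "v \<in> F" "position r F u = position r F v"
    then have "\<not> r u < r v" "\<not> r v < r u" using position_mono[OF F, of u r v] position_mono[OF F, of v r u] by auto
    then show "u = v" using inj_onD[OF r _ uv(1,2)] by simp
  qed
  moreover have "position r F ` F \<subseteq> {..<card F}"
  proof clarify
    fix v assume "v \<in> F"
    then have "{u \<in> F. r u < r v} \<subset> F" by auto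
    then show "position r F v < card F" unfolding position_def by (rule psubset_card_mono[OF F])
  qed
  ultimately have "position r F ` F = {..<card F}" by (intro card_subset_eq) (auto simp: card_image)
  then show ?thesis using inj by (simp add: bij_betw_def)
qed

lemma position_Diff:
  assumes "finite F" "x \<in> F" "v \<noteq> x" "inj_on r F" "v \<in> F"
  shows "position r (F - {x}) v = (if position r F x < position r F v then position r F v - 1 else position r F v)"
proof -
  have iff: "r x < r v \<longleftrightarrow> position r F x < position r F v"
  proof
    show "r x < r v \<Longrightarrow> position r F x < position r F v" using position_mono[OF assms(1,2)] .
    assume *: "position r F x < position r F v"
    show "r x < r v"
    proof (rule ccontr)
      assume "\<not> r x < r v"
      then have "r v < r x" using inj_onD[OF assms(4) _ assms(5,2)] assms(3) by (metis linorder_neqE_nat)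
      then show False using position_mono[OF assms(1,5), of r x] * by simp
    qed
  qed
  have "{u \<in> F - {x}. r u < r v} = {u \<in> F. r u < r v} - {x}" by auto
  then show ?thesis unfolding iff[symmetric] using assms(1,2) by (auto simp: position_def)
qed

locale triangulation = simplicial_complex \<Delta> for \<Delta> :: "'v set set" +
  fixes M :: "'a topology" and h :: "('v \<Rightarrow> real) \<Rightarrow> 'a" and g :: "'a \<Rightarrow> 'v \<Rightarrow> real" and r :: "'v \<Rightarrow> nat"
  assumes homeo: "homeomorphic_maps (geometric_realization \<Delta>) M h g"
    and injr: "inj_on r (\<Union>\<Delta>)"
begin

abbreviation "P \<equiv> realization_points \<Delta>"

lemma geometric_realization_eq: "geometric_realization \<Delta> = subtopology (powertop_real UNIV) P"
  by (simp add: geometric_realization_def realization_points_def)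

lemma topspace_realization: "topspace (geometric_realization \<Delta>) = P"
  by (simp add: geometric_realization_eq)

lemma g_in: "y \<in> topspace M \<Longrightarrow> g y \<in> P"
  and h_in: "a \<in> P \<Longrightarrow> h a \<in> topspace M"
  and gh: "a \<in> P \<Longrightarrow> g (h a) = a"
  and hg: "y \<in> topspace M \<Longrightarrow> h (g y) = y"
proof -
  have c: "continuous_map (geometric_realization \<Delta>) M h" "continuous_map M (geometric_realization \<Delta>) g"
    and i: "\<forall>x\<in>topspace (geometric_realization \<Delta>). g (h x) = x" "\<forall>y\<in>topspace M. h (g y) = y"
    using homeo unfolding homeomorphic_maps_def by blast+
  show "y \<in> topspace M \<Longrightarrow> g y \<in> P" using Pi_mem[OF continuous_map_funspace[OF c(2)]] by (simp only: topspace_realization)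
  show "a \<in> P \<Longrightarrow> h a \<in> topspace M" using Pi_mem[OF continuous_map_funspace[OF c(1)]] by (simp only: topspace_realization)
  show "a \<in> P \<Longrightarrow> g (h a) = a" using i(1) by (simp only: topspace_realization)
  show "y \<in> topspace M \<Longrightarrow> h (g y) = y" using i(2) by blast
qed

lemma continuous_coord: "continuous_map M euclideanreal (\<lambda>y. g y v)"
proof -
  have "continuous_map M (powertop_real UNIV) g"
    using homeo unfolding homeomorphic_maps_def geometric_realization_eq
    by (auto simp: continuous_map_in_subtopology)
  then show ?thesis by (simp add: continuous_map_componentwise_UNIV)
qed

lemma continuous_h:
  assumes "\<And>v. continuous_map X euclideanreal (\<lambda>x. f x v)" "\<And>x. x \<in> topspace X \<Longrightarrow> f x \<in> P"
  shows "continuous_map X M (\<lambda>x. h (f x))"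
proof -
  have "continuous_map X (geometric_realization \<Delta>) f"
    unfolding geometric_realization_eq continuous_map_in_subtopology continuous_map_componentwise_UNIV
    using assms by auto
  moreover have "continuous_map (geometric_realization \<Delta>) M h"
    using homeo unfolding homeomorphic_maps_def by blast
  ultimately show ?thesis using continuous_map_compose by (fastforce simp: comp_def)
qed

text \<open>The carrier of \<open>y\<close>: the face whose open simplex contains it.\<close>

definition supp :: "'a \<Rightarrow> 'v set" where "supp y = {v. g y v \<noteq> 0}"

lemma coord_nonneg: "y \<in> topspace M \<Longrightarrow> 0 \<le> g y v"
  using g_in unfolding realization_points_def by blast

lemma supp_face: "y \<in> topspace M \<Longrightarrow> supp y \<in> \<Delta>"
  using g_in unfolding realization_points_def supp_def by blast

lemma sum_coord:
  assumes "y \<in> topspace M" "supp y \<subseteq> F" "F \<in> \<Delta>"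
  shows "(\<Sum>v\<in>F. g y v) = 1"
proof -
  have "(\<Sum>v\<in>V. g y v) = 1" using g_in[OF assms(1)] unfolding realization_points_def by blast
  moreover have "(\<Sum>v\<in>V. g y v) = (\<Sum>v\<in>F. g y v)"
    by (rule sum.mono_neutral_right) (use finite_V assms in \<open>auto simp: supp_def\<close>)
  ultimately show ?thesis by simp
qed

lemma in_P:
  assumes "F \<in> \<Delta>" "\<And>v. 0 \<le> a v" "\<And>v. a v \<noteq> 0 \<Longrightarrow> v \<in> F" "(\<Sum>v\<in>F. a v) = 1"
  shows "a \<in> P"
proof -
  have "{v. a v \<noteq> 0} \<in> \<Delta>" by (rule face_subset[OF assms(1)]) (use assms(3) in auto)
  moreover have "(\<Sum>v\<in>V. a v) = (\<Sum>v\<in>F. a v)"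
    by (rule sum.mono_neutral_right) (use finite_V assms in auto)
  ultimately show ?thesis using assms by (simp add: realization_points_def)
qed

lemma open_coord_gt: "openin M {y \<in> topspace M. c < g y v}"
  using openin_continuous_map_preimage[OF continuous_coord[of v], of "{c<..}"] by simp

lemma open_coord_lt: "openin M {y \<in> topspace M. g y v < c}"
  using openin_continuous_map_preimage[OF continuous_coord[of v], of "{..<c}"] by simp

lemma open_star:
  assumes "finite F" shows "openin M {y \<in> topspace M. \<forall>v\<in>F. 0 < g y v}"
  using assms
proof (induction F rule: finite_induct)
  case (insert v F)
  have "{y \<in> topspace M. \<forall>w\<in>insert v F. 0 < g y w} =
     {y \<in> topspace M. 0 < g y v} \<inter> {y \<in> topspace M. \<forall>w\<in>F. 0 < g y w}" by auto
  then show ?case by (simp only: openin_Int[OF open_coord_gt insert.IH])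
qed auto

lemma supp_pos: "y \<in> topspace M \<Longrightarrow> v \<in> supp y \<longleftrightarrow> 0 < g y v"
  using coord_nonneg[of y v] by (auto simp: supp_def)

lemma star_supp: "y \<in> topspace M \<Longrightarrow> (\<forall>v\<in>F. 0 < g y v) \<longleftrightarrow> F \<subseteq> supp y"
  using supp_pos by blast

definition bary :: "'v set \<Rightarrow> 'a" where
  "bary F = h (\<lambda>v. if v \<in> F then 1 / card F else 0)"

lemma bary:
  assumes "F \<in> \<Delta>" "F \<noteq> {}"
  shows "bary F \<in> topspace M" "g (bary F) = (\<lambda>v. if v \<in> F then 1 / card F else 0)" "supp (bary F) = F"
proof -
  have c: "0 < card F" using assms finite_face by (simp add: card_gt_0_iff)
  have "(\<lambda>v. if v \<in> F then 1 / card F else 0) \<in> P"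
  proof (rule in_P[OF assms(1)])
    show "(\<Sum>v\<in>F. if v \<in> F then 1 / real (card F) else 0) = 1" using c by simp
  qed (simp_all split: if_splits)
  then show "bary F \<in> topspace M" "g (bary F) = (\<lambda>v. if v \<in> F then 1 / card F else 0)"
    unfolding bary_def by (rule h_in, rule gh)
  then show "supp (bary F) = F" using c by (auto simp: supp_def)
qed

text \<open>Any positive step from \<open>y\<close> straight towards the barycentre of
  \<open>F\<close> lands in the open simplex of \<open>F\<close>.\<close>

lemma interior_dense:
  assumes y: "y \<in> topspace M" and U: "openin M U" "y \<in> U" and F: "F \<in> \<Delta>" "F \<noteq> {}" "supp y \<subseteq> F"
  shows "\<exists>y'\<in>U. supp y' = F"
proof -
  define q where "q s = (\<lambda>v. (1 - s) * g y v + s * g (bary F) v)" for s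
  have b: "bary F \<in> topspace M" using bary F by blast
  have qP: "q s \<in> P" if "s \<in> {0..1}" for s
  proof (rule in_P[OF F(1)])
    show "0 \<le> q s v" for v using that coord_nonneg[OF y] coord_nonneg[OF b] by (simp add: q_def)
    show "q s v \<noteq> 0 \<Longrightarrow> v \<in> F" for v
    proof (rule ccontr)
      assume "q s v \<noteq> 0" "v \<notin> F"
      then have "g y v = 0" "g (bary F) v = 0" using F(3) bary(3)[OF F(1,2)] by (auto simp: supp_def)
      then show False using \<open>q s v \<noteq> 0\<close> by (simp add: q_def)
    qed
    show "(\<Sum>v\<in>F. q s v) = 1"
      using sum_coord[OF y F(3,1)] sum_coord[OF b _ F(1)] bary(3)[OF F(1,2)]
      by (simp add: q_def sum.distrib sum_distrib_left[symmetric])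
  qed
  have "continuous_map (top_of_set {0..1}) euclideanreal (\<lambda>s. q s v)" for v
    by (auto simp: q_def intro!: continuous_intros)
  then have "continuous_map (top_of_set {0..1}) M (\<lambda>s. h (q s))"
    by (rule continuous_h) (use qP in auto)
  from openin_continuous_map_preimage[OF this U(1)]
  have op: "openin (top_of_set {0..1}) {s \<in> {0..1}. h (q s) \<in> U}" by simp
  have "q 0 = g y" by (simp add: q_def)
  then have "h (q 0) \<in> U" using hg[OF y] U(2) by simp
  then have "0 \<in> {s \<in> {0..1::real}. h (q s) \<in> U}" by simp
  then obtain e where e: "e > 0" "\<And>s. s \<in> {0..1} \<Longrightarrow> dist s 0 < e \<Longrightarrow> h (q s) \<in> U"
    using op unfolding openin_euclidean_subtopology_iff by blast
  define s where "s = min 1 (e / 2)"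
  have s: "0 < s" "s \<le> 1" "dist s 0 < e" using e(1) by (auto simp: s_def dist_real_def)
  have "supp (h (q s)) = F"
  proof -
    have "g (h (q s)) = q s" using qP s by (intro gh) simp
    moreover have "q s v \<noteq> 0 \<longleftrightarrow> v \<in> F" for v
    proof
      assume "v \<in> F"
      then have "0 < g (bary F) v" using bary[OF F(1,2)] supp_pos[OF b] by blast
      then have "0 < s * g (bary F) v" using s by simp
      moreover have "0 \<le> (1 - s) * g y v" using s coord_nonneg[OF y] by simp
      ultimately show "q s v \<noteq> 0" by (simp add: q_def)
    next
      assume "q s v \<noteq> 0"
      then have "g y v \<noteq> 0 \<or> g (bary F) v \<noteq> 0" by (auto simp: q_def)
      then show "v \<in> F" using F(3) bary(3)[OF F(1,2)] by (auto simp: supp_def)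
    qed
    ultimately show ?thesis by (auto simp: supp_def)
  qed
  moreover have "h (q s) \<in> U" using e(2) s by simp
  ultimately show ?thesis by blast
qed

text \<open>In barycentric coordinates the open simplex is convex.\<close>

lemma connected_interior:
  assumes F: "F \<in> \<Delta>"
  shows "connectedin M {y \<in> topspace M. supp y = F}"
proof (rule path_connectedin_imp_connectedin, unfold path_connectedin, intro conjI ballI)
  show "{y \<in> topspace M. supp y = F} \<subseteq> topspace M" by auto
  fix y z assume yz: "y \<in> {y \<in> topspace M. supp y = F}" "z \<in> {y \<in> topspace M. supp y = F}"
  define q where "q s = (\<lambda>v. (1 - s) * g y v + s * g z v)" for s :: real
  have pos: "0 < q s v \<longleftrightarrow> v \<in> F" "0 \<le> q s v" "v \<notin> F \<Longrightarrow> q s v = 0" if s: "s \<in> {0..1}" for s v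
  proof -
    have n: "0 \<le> g y v" "0 \<le> g z v" using yz coord_nonneg by auto
    have out: "q s v = 0" if "v \<notin> F"
    proof -
      have "g y v = 0" "g z v = 0" using yz that unfolding supp_def by blast+
      then show ?thesis by (simp add: q_def)
    qed
    then show "v \<notin> F \<Longrightarrow> q s v = 0" .
    show "0 \<le> q s v" using n s by (simp add: q_def)
    have "v \<in> F \<Longrightarrow> 0 < q s v"
    proof -
      assume "v \<in> F"
      then have "0 < g y v" "0 < g z v" using yz supp_pos by auto
      then show "0 < q s v" using s
        by (cases "s = 1") (auto simp: q_def intro!: add_pos_nonneg mult_pos_pos)
    qed
    then show "0 < q s v \<longleftrightarrow> v \<in> F" using out by force
  qed
  have qP: "q s \<in> P" if s: "s \<in> {0..1}" for s
  proof (rule in_P[OF F])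
    show "(\<Sum>v\<in>F. q s v) = 1"
      using sum_coord[of y F] sum_coord[of z F] yz F
      by (simp add: q_def sum.distrib sum_distrib_left[symmetric])
  qed (use pos[OF s] in auto)
  have "continuous_map (top_of_set {0..1}) euclideanreal (\<lambda>s. q s v)" for v
    by (auto simp: q_def intro!: continuous_intros)
  then have c: "continuous_map (top_of_set {0..1}) M (\<lambda>s. h (q s))"
    by (rule continuous_h) (use qP in auto)
  have "supp (h (q s)) = F" if "s \<in> {0..1}" for s
  proof -
    have "g (h (q s)) = q s" using qP that by (intro gh) simp
    then show ?thesis using pos[OF that] by (auto simp: supp_def) (metis less_irrefl)
  qed
  then have im: "(\<lambda>s. h (q s)) \<in> {0..1} \<rightarrow> {y \<in> topspace M. supp y = F}"
    using h_in qP by auto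
  have "q 0 = g y" "q 1 = g z" by (simp_all add: q_def)
  then have "h (q 0) = y" "h (q 1) = z" using hg yz by auto
  then show "\<exists>f. pathin M f \<and> f \<in> {0..1} \<rightarrow> {y \<in> topspace M. supp y = F} \<and> f 0 = y \<and> f 1 = z"
    using c im unfolding pathin_def by (intro exI[of _ "\<lambda>s. h (q s)"]) simp
qed

subsection \<open>Simplices as singular simplices\<close>

lemma inj_face: "F \<in> \<Delta> \<Longrightarrow> inj_on r F"
  using injr face_V inj_on_subset by blast

lemma position_bij_face: "F \<in> \<Delta> \<Longrightarrow> bij_betw (position r F) F {..<card F}"
  using position_bij[OF finite_face inj_face] by blast

lemma simplex_point_in:
  assumes F: "F \<in> \<Delta>" "card F = Suc n" and p: "p \<in> standard_simplex n"
  shows "simplex_point r F p \<in> P"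
proof (rule in_P[OF F(1)])
  have "(\<Sum>v\<in>F. simplex_point r F p v) = (\<Sum>v\<in>F. p (position r F v))"
    by (rule sum.cong) (auto simp: simplex_point_def)
  also have "\<dots> = (\<Sum>i<card F. p i)" by (rule sum.reindex_bij_betw[OF position_bij_face[OF F(1)]])
  also have "\<dots> = 1" using p F(2) by (simp add: standard_simplex_def lessThan_Suc_atMost)
  finally show "(\<Sum>v\<in>F. simplex_point r F p v) = 1" .
qed (use p in \<open>auto simp: simplex_point_def standard_simplex_def split: if_splits\<close>)

text \<open>The restriction is there because singular simplices are extensional on the standard
  simplex.\<close>

definition face_simplex :: "'v set \<Rightarrow> (nat \<Rightarrow> real) \<Rightarrow> 'a" where
  "face_simplex F = restrict (\<lambda>p. h (simplex_point r F p)) (standard_simplex (card F - 1))"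

lemma face_simplex_coord:
  assumes "F \<in> \<Delta>" "card F = Suc n" "p \<in> standard_simplex n"
  shows "g (face_simplex F p) = simplex_point r F p" "face_simplex F p \<in> topspace M"
  using simplex_point_in[OF assms] assms gh h_in by (simp_all add: face_simplex_def)

lemma face_simplex_supp:
  assumes "F \<in> \<Delta>" "card F = Suc n" "p \<in> standard_simplex n"
  shows "supp (face_simplex F p) \<subseteq> F"
  unfolding supp_def face_simplex_coord[OF assms] by (auto simp: simplex_point_def)

lemma singular_face_simplex:
  assumes F: "F \<in> \<Delta>" "card F = Suc n"
  shows "singular_simplex n M (face_simplex F)"
proof -
  have "continuous_map (subtopology (powertop_real UNIV) (standard_simplex n)) M (\<lambda>p. h (simplex_point r F p))"
  proof (rule continuous_h)
    fix v
    show "continuous_map (subtopology (powertop_real UNIV) (standard_simplex n)) euclideanreal (\<lambda>p. simplex_point r F p v)"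
      unfolding simplex_point_def
      by (auto intro!: continuous_map_from_subtopology continuous_map_product_projection)
  qed (use simplex_point_in[OF F] in simp)
  then have "continuous_map (subtopology (powertop_real UNIV) (standard_simplex n)) M (face_simplex F)"
    by (rule continuous_map_eq) (simp add: face_simplex_def F)
  then show ?thesis unfolding singular_simplex_def by (simp add: face_simplex_def F)
qed

lemma face_of_face_simplex:
  assumes F: "F \<in> \<Delta>" "card F = Suc (Suc n)" and x: "x \<in> F"
  shows "singular_face (Suc n) (position r F x) (face_simplex F) = face_simplex (F - {x})"
proof -
  have fin: "finite F" using F finite_face by blast
  have cF: "card (F - {x}) = Suc n" using F x fin by simp
  have kle: "position r F x \<le> Suc n"
    using bij_betwE[OF position_bij_face[OF F(1)]] x F(2) by fastforce
  show ?thesis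
  proof
    fix p
    show "singular_face (Suc n) (position r F x) (face_simplex F) p = face_simplex (F - {x}) p"
    proof (cases "p \<in> standard_simplex n")
      case True
      have "simplex_point r F (simplical_face (position r F x) p) v = simplex_point r (F - {x}) p v" for v
      proof (cases "v \<in> F \<and> v \<noteq> x")
        case True
        have "position r F v \<noteq> position r F x"
          using True x position_bij_face[OF F(1)] by (meson bij_betw_imp_inj_on inj_onD)
        then show ?thesis using True position_Diff[OF fin x _ inj_face[OF F(1)], of v]
          by (auto simp: simplex_point_def simplical_face_def)
      next
        case False
        then show ?thesis by (auto simp: simplex_point_def simplical_face_def)
      qed
      then have "simplex_point r F (simplical_face (position r F x) p) = simplex_point r (F - {x}) p" by blast
      moreover have "simplical_face (position r F x) p \<in> standard_simplex (Suc n)"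
        using simplical_face_in_standard_simplex[of "Suc n" "position r F x" p] kle True by simp
      ultimately show ?thesis using True F cF by (simp add: singular_face_def face_simplex_def)
    next
      case False
      then show ?thesis using cF by (simp add: singular_face_def face_simplex_def)
    qed
  qed
qed

text \<open>In the labelling for Sperner's lemma, the label of a point \<open>w\<close> is a vertex of \<open>F\<close> whose barycentric coordinate does not decrease
  from \<open>y\<close> to \<open>w\<close>.\<close>

lemma face_class_nonzero:
  fixes a :: "'k::field"
  assumes F: "F \<in> \<Delta>" "card F = Suc d" and max: "\<And>G. G \<in> \<Delta> \<Longrightarrow> F \<subseteq> G \<Longrightarrow> G = F"
    and y: "y \<in> topspace M" "supp y = F"
    and bd: "Poly_Mapping.single (face_simplex F) a \<in> frelboundaries d M (topspace M - {y})"
  shows "a = 0"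
proof -
  have fin: "finite F" using F finite_face by blast
  have bij: "bij_betw (position r F) F {..<Suc d}" using position_bij_face[OF F(1)] F(2) by simp
  have posi: "position r F v \<le> d" if "v \<in> F" for v using bij_betwE[OF bij] that by fastforce
  have pinj: "position r F u = position r F v \<Longrightarrow> u = v" if "u \<in> F" "v \<in> F" for u v
    using bij that by (meson bij_betw_imp_inj_on inj_onD)
  have yF: "0 < g y v" if "v \<in> F" for v using that y supp_pos by blast
  have ysum: "(\<Sum>v\<in>F. g y v) = 1" using sum_coord[OF y(1) _ F(1)] y(2) by simp
  have y1: "g y v \<le> 1" if "v \<in> F" for v
    using member_le_sum[OF that _ fin, of "g y"] ysum coord_nonneg[OF y(1)] by simp
  define A where "A w v \<longleftrightarrow> v \<in> F \<and> g y v \<le> g w v" for w v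
  define l where "l w = (if \<exists>v. A w v then position r F (SOME v. A w v) else Suc d)" for w
  \<comment> \<open>Labels up to \<open>d\<close> come from \<open>A\<close>, so a label occurs only
    where its coordinate is at least that of \<open>y\<close>. A strict decrease is an open
    condition, hence labels are missing on open sets.\<close>
  have lA: "\<exists>v. A w v \<and> l w = position r F v" if "\<exists>v. A w v" for w
    using that someI_ex[OF that] by (auto simp: l_def)
  have lneq: "l w \<noteq> position r F v" if v: "v \<in> F" "g w v < g y v" for w v
  proof
    assume lw: "l w = position r F v"
    show False
    proof (cases "\<exists>v. A w v")
      case True
      then obtain u where "A w u" "l w = position r F u" using lA by blast
      then have "u \<in> F" "position r F u = position r F v" using lw by (simp_all add: A_def)
      then have "u = v" using pinj v(1) by blast
      then show False using \<open>A w u\<close> v by (simp add: A_def)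
    next
      case False
      then show False using lw posi[OF v(1)] by (simp add: l_def)
    qed
  qed
  \<comment> \<open>The coordinates on \<open>F\<close> sum to 1 at both points, so they cannot all
    decrease.\<close>
  have lle: "l w \<le> d" if w: "w \<in> topspace M" "supp w \<subseteq> F" for w
  proof -
    have "\<exists>v. A w v"
    proof (rule ccontr)
      assume "\<not> (\<exists>v. A w v)"
      then have "g w v < g y v" if "v \<in> F" for v using that by (auto simp: A_def)
      moreover have "F \<noteq> {}" using F(2) by auto
      ultimately have "(\<Sum>v\<in>F. g w v) < (\<Sum>v\<in>F. g y v)" using fin by (intro sum_strict_mono)
      then show False using sum_coord[OF w F(1)] ysum by simp
    qed
    then obtain v where "A w v" "l w = position r F v" using lA by blast
    then show ?thesis using posi by (simp add: A_def)
  qed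
  have lab: "l w \<le> Suc d" if "w \<in> topspace M" for w
  proof (cases "\<exists>v. A w v")
    case True
    then obtain v where "A w v" "l w = position r F v" using lA by blast
    then show ?thesis using posi[of v] by (simp add: A_def)
  qed (simp add: l_def)
  have nbhd: "\<exists>U. openin M U \<and> w \<in> U \<and> (\<exists>k\<le>d. \<forall>w'\<in>U. l w' \<noteq> k)"
    if w: "w \<in> topspace M" and v: "v \<in> F" "g w v < g y v" for w v
    using w v posi[OF v(1)] lneq[OF v(1)]
    by (intro exI[of _ "{w' \<in> topspace M. g w' v < g y v}"]) (auto simp: open_coord_lt)
  show ?thesis
  proof (rule local_class_nonzero[where l = l, OF singular_face_simplex[OF F]])
    fix i assume i: "i \<le> d"
    then obtain u where u: "u \<in> F" "position r F u = i" using bij_betw_imp_surj_on[OF bij] by (metis imageE lessThan_iff less_Suc_eq_le)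
    let ?w = "face_simplex F (simplex_vertex i)"
    have coord: "g ?w v = (if v = u then 1 else 0)" if "v \<in> F" for v
    proof -
      have "position r F v = i \<longleftrightarrow> v = u" using pinj[OF that u(1)] u(2) by auto
      then show ?thesis
        unfolding face_simplex_coord(1)[OF F simplex_vertex_in[OF i]]
        using that by (simp add: simplex_point_def simplex_vertex_def)
    qed
    have "A ?w u" using u coord y1 by (simp add: A_def)
    moreover have "v = u" if "A ?w v" for v
    proof (rule ccontr)
      assume "v \<noteq> u"
      then have "g ?w v = 0" using that coord by (simp add: A_def)
      then show False using that yF[of v] by (simp add: A_def)
    qed
    ultimately show "l ?w = i" using lA[of ?w] u by blast
  next
    fix p assume "p \<in> standard_simplex d"
    then show "l (face_simplex F p) \<le> d"
      using face_simplex_supp[OF F] face_simplex_coord(2)[OF F] by (intro lle) auto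
  next
    fix p i assume p: "p \<in> standard_simplex d" and i: "i \<le> d" "p i = 0"
    obtain u where u: "u \<in> F" "position r F u = i" using i bij_betw_imp_surj_on[OF bij] by (metis imageE lessThan_iff less_Suc_eq_le)
    have "g (face_simplex F p) u = 0" unfolding face_simplex_coord(1)[OF F p] using u i by (simp add: simplex_point_def)
    then show "l (face_simplex F p) \<noteq> i" using lneq[of u "face_simplex F p"] u yF by simp
  next
    fix w assume w: "w \<in> topspace M"
    show "l w \<le> Suc d" by (rule lab[OF w])
    \<comment> \<open>In the open simplex of \<open>F\<close>, which is open in \<open>M\<close> by
      maximality, label \<open>d + 1\<close> is missing. Elsewhere some coordinate on
      \<open>F\<close> is 0 and thus smaller than that of \<open>y\<close>.\<close>
    show "\<exists>U. openin M U \<and> w \<in> U \<and> (\<exists>k\<le>Suc d. \<forall>w'\<in>U. l w' \<noteq> k)"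
    proof (cases "\<forall>v\<in>F. 0 < g w v")
      case True
      let ?U = "{w' \<in> topspace M. \<forall>v\<in>F. 0 < g w' v}"
      have "l w' \<noteq> Suc d" if w': "w' \<in> ?U" for w'
      proof -
        have "F \<subseteq> supp w'" using star_supp w' by blast
        then have "supp w' = F" using max supp_face w' by blast
        then show ?thesis using lle[of w'] w' by auto
      qed
      then show ?thesis using w True open_star[OF fin] by (intro exI[of _ ?U]) blast
    next
      case False
      then obtain v where v: "v \<in> F" "g w v = 0" using coord_nonneg[OF w] by (metis less_eq_real_def)
      then have "g w v < g y v" using yF by simp
      from nbhd[OF w v(1) this] show ?thesis by (meson le_SucI)
    qed
  next
    fix w assume w: "w \<in> topspace M - {y}"
    \<comment> \<open>If no coordinate decreased, maximality of \<open>F\<close> and the sum 1 would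
      make all coordinates agree, so that \<open>w = y\<close>.\<close>
    have "\<exists>v\<in>F. g w v < g y v"
    proof (rule ccontr)
      assume "\<not> (\<exists>v\<in>F. g w v < g y v)"
      then have ge: "\<And>v. v \<in> F \<Longrightarrow> g y v \<le> g w v" by force
      then have "F \<subseteq> supp w" using yF star_supp[of w F] w by force
      then have sw: "supp w = F" using max supp_face w by blast
      have "(\<Sum>v\<in>F. g w v) = 1" using sum_coord[of w F] w sw F(1) by simp
      then have "(\<Sum>v\<in>F. g w v - g y v) = 0" using ysum by (simp add: sum_subtractf)
      then have "\<forall>v\<in>F. g w v - g y v = 0" using sum_nonneg_eq_0_iff[OF fin, of "\<lambda>v. g w v - g y v"] ge by simp
      moreover have "g w v = g y v" if "v \<notin> F" for v
      proof -
        have "v \<notin> supp w" "v \<notin> supp y" using that sw y(2) by simp_all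
        then show ?thesis by (simp add: supp_def)
      qed
      ultimately have "g w = g y" by fastforce
      then show False using hg w y by (metis DiffE insertI1)
    qed
    then show "\<exists>U. openin M U \<and> w \<in> U \<and> (\<exists>k\<le>d. \<forall>w'\<in>U. l w' \<noteq> k)" using nbhd w by blast
  qed (rule bd)
qed

end

lemma openin_finite_pos:
  assumes "finite A" "\<And>i. i \<in> A \<Longrightarrow> continuous_map X euclideanreal (f i)"
  shows "openin X {x \<in> topspace X. \<forall>i\<in>A. 0 < f i x}"
  using assms
proof (induction A rule: finite_induct)
  case (insert i A)
  have e: "{x \<in> topspace X. \<forall>j\<in>insert i A. 0 < f j x} =
     {x \<in> topspace X. f i x \<in> {0<..}} \<inter> {x \<in> topspace X. \<forall>j\<in>A. 0 < f j x}" by auto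
  have "openin X {x \<in> topspace X. f i x \<in> {0<..}}"
    using insert.prems by (intro openin_continuous_map_preimage[where Y = euclideanreal]) auto
  then show ?case unfolding e using insert by (intro openin_Int) auto
qed auto

lemma single_sum: "Poly_Mapping.single k (sum f A) = (\<Sum>i\<in>A. Poly_Mapping.single k (f i))"
  by (induction A rule: infinite_finite_induct) (auto simp: single_add)

section \<open>Facets and ridges of a triangulated manifold\<close>

locale triangulated_manifold = triangulation \<Delta> M h g r
  for \<Delta> :: "'v set set" and M :: "'a topology" and h g r +
  fixes d :: nat
  assumes manifold: "topological_manifold d M"
begin

lemma Hausdorff: "Hausdorff_space M"
  using manifold by (simp add: topological_manifold_def)

text \<open>Barycentric coordinates at all vertices of a face but one, the last being determined by
  the sum 1.\<close>

definition face_coords :: "nat \<Rightarrow> (nat \<Rightarrow> 'v) \<Rightarrow> 'a \<Rightarrow> nat \<Rightarrow> real" where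
  "face_coords n en y = (\<lambda>i. if i < n then g y (en i) else 0)"

lemma continuous_face_coords:
  "continuous_map (subtopology M T) (Euclidean_space n) (face_coords n en)"
  unfolding continuous_map_Euclidean_space_iff
proof (intro conjI allI ballI impI)
  fix i
  show "continuous_map (subtopology M T) euclideanreal (\<lambda>y. face_coords n en y i)"
    by (cases "i < n") (simp_all add: face_coords_def continuous_map_from_subtopology continuous_coord)
qed (simp add: face_coords_def)

lemma face_coords_inj:
  assumes F: "F \<in> \<Delta>" "w \<in> F" and en: "bij_betw en {..<n} (F - {w})"
    and T: "\<And>y. y \<in> T \<Longrightarrow> y \<in> topspace M \<and> supp y \<subseteq> F"
  shows "inj_on (face_coords n en) T"
proof (rule inj_onI)
  fix y y' assume y: "y \<in> T" "y' \<in> T" and eq: "face_coords n en y = face_coords n en y'"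
  have 1: "g y v = g y' v" if "v \<in> F - {w}" for v
  proof -
    obtain i where "i < n" "en i = v" using en \<open>v \<in> F - {w}\<close> by (metis bij_betw_imp_surj_on imageE lessThan_iff)
    then show ?thesis using fun_cong[OF eq, of i] by (simp add: face_coords_def)
  qed
  have fin: "finite F" using F finite_face by blast
  have "(\<Sum>v\<in>F. g y v) = (\<Sum>v\<in>F. g y' v)" using T[OF y(1)] T[OF y(2)] sum_coord F(1) by simp
  moreover have "(\<Sum>v\<in>F - {w}. g y v) = (\<Sum>v\<in>F - {w}. g y' v)" using 1 by (rule sum.cong[OF refl])
  ultimately have 2: "g y w = g y' w" using sum.remove[OF fin F(2), of "g y"] sum.remove[OF fin F(2), of "g y'"] by simp
  have "g y v = g y' v" for v
  proof (cases "v \<in> F")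
    case True
    then show ?thesis using 1[of v] 2 by (cases "v = w") auto
  next
    case False
    then have "v \<notin> supp y" "v \<notin> supp y'" using T[OF y(1)] T[OF y(2)] by blast+
    then show ?thesis by (simp add: supp_def)
  qed
  then have "g y = g y'" by blast
  then show "y = y'" using hg T[OF y(1)] T[OF y(2)] by metis
qed

lemma face_enum:
  assumes "F \<in> \<Delta>" "card F = Suc n" "w \<in> F"
  obtains en where "bij_betw en {..<n} (F - {w})"
proof -
  have "card (F - {w}) = n" "finite (F - {w})" using assms finite_face by auto
  then show thesis using that ex_bij_betw_nat_finite[of "F - {w}"] by (auto simp: lessThan_atLeast0)
qed

text \<open>The open simplex of a maximal face is open in \<open>M\<close>. It embeds into Euclidean
  space of dimension \<open>n\<close>, which gives \<open>d \<le> n\<close>; parametrising it by the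
  open simplex \<open>N\<close> of that space gives \<open>n \<le> d\<close>.\<close>

lemma card_maximal_face:
  assumes F: "F \<in> \<Delta>" "F \<noteq> {}" and max: "\<And>G. G \<in> \<Delta> \<Longrightarrow> F \<subseteq> G \<Longrightarrow> G = F"
  shows "card F = Suc d"
proof -
  have fin: "finite F" using F finite_face by blast
  obtain n where n: "card F = Suc n" using F fin by (metis card_eq_0_iff old.nat.exhaust)
  obtain w where w: "w \<in> F" using F by blast
  obtain en where en: "bij_betw en {..<n} (F - {w})" using face_enum[OF F(1) n w] by blast
  have enF: "en i \<in> F" "en i \<noteq> w" if "i < n" for i using bij_betwE[OF en] that by auto
  have "d \<le> n"
  proof (rule manifold_dim_le[OF manifold open_star[OF fin] _ continuous_face_coords])
    show "{y \<in> topspace M. \<forall>v\<in>F. 0 < g y v} \<noteq> {}"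
      using bary[OF F] star_supp[of "bary F" F] by auto
    show "inj_on (face_coords n en) {y \<in> topspace M. \<forall>v\<in>F. 0 < g y v}"
    proof (rule face_coords_inj[OF F(1) w en])
      fix y assume y: "y \<in> {y \<in> topspace M. \<forall>v\<in>F. 0 < g y v}"
      then have "F \<subseteq> supp y" using star_supp by blast
      then have "supp y = F" using max supp_face y by blast
      then show "y \<in> topspace M \<and> supp y \<subseteq> F" using y by simp
    qed
  qed
  moreover have "n \<le> d"
  proof -
    define N where "N = {x \<in> topspace (Euclidean_space n). \<forall>i\<in>{..n}. 0 < (if i < n then x i else 1 - (\<Sum>j<n. x j))}"
    have ci: "continuous_map (Euclidean_space n) euclideanreal (\<lambda>x. x i)" for i
      using continuous_map_id[of "Euclidean_space n"] unfolding continuous_map_Euclidean_space_iff by simp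
    have cs: "continuous_map (Euclidean_space n) euclideanreal (\<lambda>x. 1 - (\<Sum>j<n. x j))"
      by (intro continuous_map_diff continuous_map_sum continuous_map_const[THEN iffD2]) (auto intro: ci)
    have N: "openin (Euclidean_space n) N"
      unfolding N_def
    proof (rule openin_finite_pos)
      fix i
      show "continuous_map (Euclidean_space n) euclideanreal (\<lambda>x. if i < n then x i else 1 - (\<Sum>j<n. x j))"
        using ci cs by (cases "i < n") simp_all
    qed simp
    define idx where "idx = the_inv_into {..<n} en"
    have idx: "idx (en i) = i" if "i < n" for i
      using the_inv_into_f_f[of en "{..<n}" i] en that by (simp add: idx_def bij_betw_def)
    define q where "q x = (\<lambda>v. if v = w then 1 - (\<Sum>j<n. x j) else if v \<in> F then x (idx v) else 0)" for x :: "nat \<Rightarrow> real"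
    have qe: "q x (en i) = x i" if "i < n" for x i using enF[OF that] idx[OF that] by (simp add: q_def)
    have Ncoord: "0 < x i" if "x \<in> N" "i < n" for x i
    proof -
      have "\<forall>i\<in>{..n}. 0 < (if i < n then x i else 1 - (\<Sum>j<n. x j))" using that(1) unfolding N_def by blast
      from bspec[OF this, of i] show ?thesis using that(2) by simp
    qed
    have Nsum: "0 < 1 - (\<Sum>j<n. x j)" if "x \<in> N" for x
    proof -
      have "\<forall>i\<in>{..n}. 0 < (if i < n then x i else 1 - (\<Sum>j<n. x j))" using that(1) unfolding N_def by blast
      from bspec[OF this, of n] show ?thesis by simp
    qed
    have inF: "\<exists>i<n. en i = v" if "v \<in> F" "v \<noteq> w" for v
      using en that by (metis DiffI bij_betw_imp_surj_on imageE lessThan_iff singletonD)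
    have qP: "q x \<in> P" if x: "x \<in> N" for x
    proof (rule in_P[OF F(1)])
      show "0 \<le> q x v" for v
      proof (cases "v \<in> F \<and> v \<noteq> w")
        case True
        then obtain i where "i < n" "en i = v" using inF by blast
        then show ?thesis using qe[of i x] Ncoord[OF x, of i] by simp
      next
        case False
        then show ?thesis using Nsum[OF x] w by (auto simp: q_def)
      qed
      show "q x v \<noteq> 0 \<Longrightarrow> v \<in> F" for v using w by (auto simp: q_def split: if_splits)
      have "(\<Sum>v\<in>F - {w}. q x v) = (\<Sum>i<n. q x (en i))" by (rule sum.reindex_bij_betw[OF en, symmetric])
      also have "\<dots> = (\<Sum>i<n. x i)" by (rule sum.cong) (auto simp: qe)
      finally show "(\<Sum>v\<in>F. q x v) = 1" using sum.remove[OF fin w, of "q x"] by (simp add: q_def)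
    qed
    have tN: "topspace (subtopology (Euclidean_space n) N) = N"
      using N openin_subset by (auto simp: topspace_subtopology)
    have "continuous_map (Euclidean_space n) euclideanreal (\<lambda>x. q x v)" for v
    proof -
      consider "v = w" | "v \<noteq> w" "v \<in> F" | "v \<noteq> w" "v \<notin> F" by blast
      then show ?thesis by cases (use cs ci in \<open>simp_all add: q_def\<close>)
    qed
    then have cont: "continuous_map (subtopology (Euclidean_space n) N) M (\<lambda>x. h (q x))"
      by (intro continuous_h continuous_map_from_subtopology) (use qP in \<open>simp only: tN\<close>)+
    show ?thesis
    proof (rule manifold_dim_ge[OF manifold N _ cont])
      define x0 where "x0 = (\<lambda>i. if i < n then 1 / (real n + 1) else 0)"
      have "x0 \<in> N"
        unfolding N_def x0_def by (auto simp: topspace_Euclidean_space field_simps)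
      then show "N \<noteq> {}" by blast
      show "inj_on (\<lambda>x. h (q x)) N"
      proof (rule inj_onI)
        fix x x' assume x: "x \<in> N" "x' \<in> N" and eq: "h (q x) = h (q x')"
        have "q x = q x'" by (rule trans[OF gh[OF qP[OF x(1)], symmetric] trans[OF arg_cong[OF eq, of g] gh[OF qP[OF x(2)]]]])
        then have "x i = x' i" if "i < n" for i using qe[OF that, of x] qe[OF that, of x'] by simp
        moreover have "x i = 0 \<and> x' i = 0" if "\<not> i < n" for i
          using x that by (simp add: N_def topspace_Euclidean_space)
        ultimately have "x i = x' i" for i by (cases "i < n") simp_all
        then show "x = x'" by (rule ext)
      qed
    qed
  qed
  ultimately show ?thesis using n by simp
qed

lemma maximal_superface:
  assumes "F \<in> \<Delta>"
  obtains G where "G \<in> \<Delta>" "F \<subseteq> G" "\<And>G'. G' \<in> \<Delta> \<Longrightarrow> G \<subseteq> G' \<Longrightarrow> G' = G"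
  using finite_has_maximal2[OF finite_complex assms] by metis

lemma card_face_le: "F \<in> \<Delta> \<Longrightarrow> card F \<le> Suc d"
proof -
  assume F: "F \<in> \<Delta>"
  obtain G where G: "G \<in> \<Delta>" "F \<subseteq> G" "\<And>G'. G' \<in> \<Delta> \<Longrightarrow> G \<subseteq> G' \<Longrightarrow> G' = G" using maximal_superface[OF F] by blast
  show ?thesis
  proof (cases "G = {}")
    case False
    then show ?thesis using card_maximal_face[OF G(1) False G(3)] card_mono[OF finite_face[OF G(1)] G(2)] by simp
  qed (use G in simp)
qed

definition facets :: "'v set set" where "facets = {F \<in> \<Delta>. card F = Suc d}"

lemma facet_maximal: "F \<in> facets \<Longrightarrow> G \<in> \<Delta> \<Longrightarrow> F \<subseteq> G \<Longrightarrow> G = F"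
  using card_face_le[of G] card_seteq[of G F] finite_face[of G] by (auto simp: facets_def)

lemma facet_superface:
  assumes "F \<in> \<Delta>" "F \<noteq> {}"
  obtains G where "G \<in> facets" "F \<subseteq> G"
proof -
  obtain G where G: "G \<in> \<Delta>" "F \<subseteq> G" "\<And>G'. G' \<in> \<Delta> \<Longrightarrow> G \<subseteq> G' \<Longrightarrow> G' = G"
    using maximal_superface[OF assms(1)] by blast
  then have "G \<noteq> {}" using assms(2) by blast
  then have "G \<in> facets" using card_maximal_face[OF G(1) _ G(3)] G(1) by (simp add: facets_def)
  then show thesis using that G(2) by blast
qed

text \<open>A codimension-one face contained in a single facet would give a chart whose image lies in a
  closed half space and meets its boundary.\<close>

lemma two_cofacets:
  assumes S: "S \<in> \<Delta>" "card S = d" "d \<ge> 1"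
  obtains x1 x2 where "x1 \<noteq> x2" "x1 \<in> V - S" "x2 \<in> V - S" "insert x1 S \<in> \<Delta>" "insert x2 S \<in> \<Delta>"
proof -
  have fin: "finite S" using S finite_face by blast
  have S0: "S \<noteq> {}" using S by auto
  have ext: "\<exists>x\<in>V - S. insert x S = G" if "G \<in> facets" "S \<subseteq> G" for G
  proof -
    have "card (G - S) = 1" using that S(2) fin by (simp add: facets_def card_Diff_subset)
    then obtain x where "G - S = {x}" by (meson card_1_singletonE)
    then have "G = insert x S" "x \<notin> S" using that(2) by auto
    then show ?thesis using that(1) by (auto simp: facets_def)
  qed
  obtain G where G: "G \<in> facets" "S \<subseteq> G" using facet_superface[OF S(1) S0] by blast
  obtain x1 where x1: "x1 \<in> V - S" "insert x1 S = G" using ext[OF G] by blast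
  have G\<Delta>: "G \<in> \<Delta>" "card G = Suc d" using G by (auto simp: facets_def)
  have "\<exists>x2\<in>V - S. x2 \<noteq> x1 \<and> insert x2 S \<in> \<Delta>"
  proof (rule ccontr)
    assume no: "\<not> (\<exists>x2\<in>V - S. x2 \<noteq> x1 \<and> insert x2 S \<in> \<Delta>)"
    define T where "T = {y \<in> topspace M. \<forall>v\<in>S. 0 < g y v}"
    have T: "openin M T" unfolding T_def by (rule open_star[OF fin])
    have TG: "y \<in> topspace M \<and> supp y \<subseteq> G" if y: "y \<in> T" for y
    proof
      show yM: "y \<in> topspace M" using y by (simp add: T_def)
      have Sy: "S \<subseteq> supp y" using y star_supp[OF yM] by (simp add: T_def)
      obtain G' where G': "G' \<in> facets" "supp y \<subseteq> G'" using facet_superface[OF supp_face[OF yM]] S0 Sy by blast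
      obtain x where x: "x \<in> V - S" "insert x S = G'" using ext[of G'] G' Sy by blast
      then have "insert x S \<in> \<Delta>" using G'(1) by (simp add: facets_def)
      then have "x = x1" using no x(1) by blast
      then show "supp y \<subseteq> G" using G'(2) x x1 by simp
    qed
    \<comment> \<open>The omitted coordinate belongs to a vertex of \<open>S\<close>, so that the
      coordinate of \<open>x1\<close> is among those kept.\<close>
    obtain w where w: "w \<in> S" using S0 by blast
    then have wG: "w \<in> G" using G(2) by blast
    obtain en where en: "bij_betw en {..<d} (G - {w})" using face_enum[OF G\<Delta> wG] by blast
    have op: "openin (Euclidean_space d) (face_coords d en ` T)"
      by (rule manifold_invariance_of_domain[OF manifold T continuous_face_coords
            face_coords_inj[OF G\<Delta>(1) wG en TG]])
    have "x1 \<in> G - {w}" using x1 w by auto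
    then obtain i where i: "i < d" "en i = x1" using en by (metis bij_betw_imp_surj_on imageE lessThan_iff)
    have b: "bary S \<in> T" using bary[OF S(1) S0] star_supp[of "bary S" S] by (simp add: T_def)
    obtain \<epsilon> where e: "\<epsilon> > 0" "\<And>s. \<bar>s\<bar> < \<epsilon> \<Longrightarrow>
        (face_coords d en (bary S))(i := face_coords d en (bary S) i + s) \<in> face_coords d en ` T"
      using Euclidean_space_open_line[OF op imageI[OF b] i(1)] by blast
    have z: "face_coords d en (bary S) i = 0"
      using i x1 bary[OF S(1) S0] by (simp add: face_coords_def)
    have "\<bar>- \<epsilon> / 2\<bar> < \<epsilon>" using e(1) by simp
    then obtain y where y: "y \<in> T" "(face_coords d en (bary S))(i := face_coords d en (bary S) i + (- \<epsilon> / 2)) = face_coords d en y"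
      using e(2) by blast
    have "face_coords d en y i = - \<epsilon> / 2" using fun_cong[OF y(2), of i] z by simp
    then have "g y x1 < 0" using i e(1) by (simp add: face_coords_def)
    moreover have "0 \<le> g y x1" using coord_nonneg TG[OF y(1)] by blast
    ultimately show False by simp
  qed
  then show thesis using that x1 G\<Delta>(1) by metis
qed

subsection \<open>Simplicial chains as singular chains\<close>

definition realize :: "('v set \<Rightarrow> 'k::field) \<Rightarrow> ('a, 'k) fchain" where
  "realize c = (\<Sum>F\<in>facets. Poly_Mapping.single (face_simplex F) (c F))"

lemma finite_facets: "finite facets"
  using finite_complex by (simp add: facets_def)

lemma facet_simplex: "F \<in> facets \<Longrightarrow> singular_simplex d M (face_simplex F)"
  using singular_face_simplex by (simp add: facets_def)

lemma realize_chain: "realize c \<in> fchains d M"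
  unfolding realize_def by (intro fchains_sum fchains_single facet_simplex)

text \<open>The number of a singular face is the \<open>position\<close> of the removed vertex,
  whose parity is the Koszul sign. Pairs of a facet and a vertex are then regrouped by
  ridges.\<close>

lemma fboundary_realize:
  assumes d: "d \<ge> 1" and c: "c \<in> simplicial_chains d"
  shows "fboundary d (realize c) = (\<Sum>S | S \<in> \<Delta> \<and> card S = d.
      Poly_Mapping.single (face_simplex S) (simplicial_bd r V c S))"
proof -
  define E where "E = {S \<in> \<Delta>. card S = d}"
  have finE: "finite E" using finite_complex by (simp add: E_def)
  have finF: "finite F" if "F \<in> facets" for F using that finite_face by (simp add: facets_def)
  define f where "f S x = Poly_Mapping.single (face_simplex S) (koszul_sign r x S * c (insert x S))" for S x
  have "fboundary d (realize c) = (\<Sum>F\<in>facets. \<Sum>i\<le>d.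
      Poly_Mapping.single (singular_face d i (face_simplex F)) ((- 1) ^ i * c F))"
    unfolding realize_def fboundary_sum using d by (simp add: fboundary_single)
  also have "\<dots> = (\<Sum>F\<in>facets. \<Sum>x\<in>F. f (F - {x}) x)"
  proof (rule sum.cong[OF refl])
    fix F assume F: "F \<in> facets"
    have F': "F \<in> \<Delta>" "card F = Suc d" using F by (auto simp: facets_def)
    have bij: "bij_betw (position r F) F {..d}"
      using position_bij_face[OF F'(1)] F'(2) by (simp add: lessThan_Suc_atMost)
    have "(\<Sum>i\<le>d. Poly_Mapping.single (singular_face d i (face_simplex F)) ((- 1) ^ i * c F))
      = (\<Sum>x\<in>F. Poly_Mapping.single (singular_face d (position r F x) (face_simplex F)) ((- 1) ^ position r F x * c F))"
      by (rule sum.reindex_bij_betw[OF bij, symmetric])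
    also have "\<dots> = (\<Sum>x\<in>F. f (F - {x}) x)"
    proof (rule sum.cong[OF refl])
      fix x assume x: "x \<in> F"
      obtain n where n: "d = Suc n" using d by (cases d) auto
      have "singular_face d (position r F x) (face_simplex F) = face_simplex (F - {x})"
        using face_of_face_simplex[OF F'(1) _ x, of n] F'(2) n by simp
      moreover have "(- 1) ^ position r F x = (koszul_sign r x F :: 'b)" by (simp add: position_def koszul_sign_def)
      moreover have "koszul_sign r x F = (koszul_sign r x (F - {x}) :: 'b)"
        using koszul_sign_insert_self[of "F - {x}" r x] finF[OF F] x by (simp add: insert_absorb)
      ultimately show "Poly_Mapping.single (singular_face d (position r F x) (face_simplex F)) ((- 1) ^ position r F x * c F)
         = f (F - {x}) x" using x by (simp add: f_def insert_absorb)
    qed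
    finally show "(\<Sum>i\<le>d. Poly_Mapping.single (singular_face d i (face_simplex F)) ((- 1) ^ i * c F))
      = (\<Sum>x\<in>F. f (F - {x}) x)" .
  qed
  also have "\<dots> = (\<Sum>(F, x)\<in>Sigma facets (\<lambda>F. F). f (F - {x}) x)"
    using finite_facets finF by (simp add: sum.Sigma)
  also have "\<dots> = (\<Sum>(S, x)\<in>Sigma E (\<lambda>S. {x \<in> V - S. insert x S \<in> facets}). f S x)"
  proof (rule sum.reindex_bij_witness[where i = "\<lambda>(S, x). (insert x S, x)" and j = "\<lambda>(F, x). (F - {x}, x)"])
    fix a assume "a \<in> Sigma facets (\<lambda>F. F)"
    then obtain F x where a: "a = (F, x)" "F \<in> facets" "x \<in> F" by auto
    then show "(case case a of (F, x) \<Rightarrow> (F - {x}, x) of (S, x) \<Rightarrow> (insert x S, x)) = a"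
      by (simp add: insert_absorb)
    have "F - {x} \<in> \<Delta>" using a face_subset[of F "F - {x}"] by (auto simp: facets_def)
    then show "(case a of (F, x) \<Rightarrow> (F - {x}, x)) \<in> Sigma E (\<lambda>S. {x \<in> V - S. insert x S \<in> facets})"
      using a finF[OF a(2)] by (auto simp: E_def facets_def insert_absorb)
    show "(case case a of (F, x) \<Rightarrow> (F - {x}, x) of (S, x) \<Rightarrow> f S x) = (case a of (F, x) \<Rightarrow> f (F - {x}) x)"
      by (simp add: a)
  next
    fix b assume "b \<in> Sigma E (\<lambda>S. {x \<in> V - S. insert x S \<in> facets})"
    then obtain S x where b: "b = (S, x)" "S \<in> E" "x \<in> V" "x \<notin> S" "insert x S \<in> facets" by auto
    show "(case case b of (S, x) \<Rightarrow> (insert x S, x) of (F, x) \<Rightarrow> (F - {x}, x)) = b" using b by simp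
    show "(case b of (S, x) \<Rightarrow> (insert x S, x)) \<in> Sigma facets (\<lambda>F. F)" using b by auto
  qed
  also have "\<dots> = (\<Sum>S\<in>E. \<Sum>x\<in>{x \<in> V - S. insert x S \<in> facets}. f S x)"
  proof -
    have "\<forall>S\<in>E. finite {x \<in> V - S. insert x S \<in> facets}"
      by (intro ballI finite_subset[OF _ finite_V]) auto
    then show ?thesis by (rule sum.Sigma[OF finE, symmetric])
  qed
  also have "\<dots> = (\<Sum>S\<in>E. Poly_Mapping.single (face_simplex S) (simplicial_bd r V c S))"
  proof (rule sum.cong[OF refl])
    fix S assume "S \<in> E"
    have c0: "f S x = 0" if "insert x S \<notin> facets" for x
    proof -
      have "c (insert x S) = 0" using c that by (auto simp: facets_def simplicial_chains_def)
      then show ?thesis by (simp add: f_def)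
    qed
    have "(\<Sum>x\<in>{x \<in> V - S. insert x S \<in> facets}. f S x) = (\<Sum>x\<in>V - S. f S x)"
      by (rule sum.mono_neutral_left)
        (use finite_V c0 in \<open>auto simp del: UN_iff\<close>)
    then show "(\<Sum>x\<in>{x \<in> V - S. insert x S \<in> facets}. f S x)
        = Poly_Mapping.single (face_simplex S) (simplicial_bd r V c S)"
      by (simp add: f_def simplicial_bd_def single_sum)
  qed
  finally show ?thesis unfolding E_def .
qed

abbreviation Bd :: "'a \<Rightarrow> ('a, 'k::field) fchain set" where
  "Bd y \<equiv> frelboundaries d M (topspace M - {y})"

lemma face_simplex_avoids:
  assumes "F \<in> \<Delta>" "card F = Suc n" "\<not> supp y \<subseteq> F"
  shows "Poly_Mapping.single (face_simplex F) a \<in> fchains n (subtopology M (topspace M - {y}))"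
proof (rule fchains_single)
  have "face_simplex F p \<in> topspace M - {y}" if p: "p \<in> standard_simplex n" for p
    using face_simplex_coord(2)[OF assms(1,2) p] face_simplex_supp[OF assms(1,2) p] assms(3) by auto
  then show "singular_simplex n (subtopology M (topspace M - {y})) (face_simplex F)"
    using singular_face_simplex[OF assms(1,2)] by (auto simp: singular_simplex_subtopology)
qed

text \<open>A boundary at ridges whose closed simplex does not contain \<open>y\<close> stays away
  from \<open>y\<close>, so \<open>realize c\<close> is a relative cycle there. This admits single
  facets and pairs of adjacent facets.\<close>

definition cycle_at :: "('v set \<Rightarrow> 'k::field) \<Rightarrow> 'a \<Rightarrow> bool" where
  "cycle_at c y \<longleftrightarrow> c \<in> simplicial_chains d \<and>
     (d \<ge> 1 \<longrightarrow> (\<forall>S\<in>\<Delta>. card S = d \<longrightarrow> supp y \<subseteq> S \<longrightarrow> simplicial_bd r V c S = 0))"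

lemma realize_relcycle:
  assumes "cycle_at c y"
  shows "realize c \<in> frelcycles d M (topspace M - {y})"
proof (cases "d = 0")
  case True
  then have "fboundary d (realize c) = 0" by (simp add: fboundary_def)
  then show ?thesis by (simp add: frelcycles_def realize_chain fchains_0)
next
  case False
  then have d: "d \<ge> 1" by simp
  have "fboundary d (realize c) \<in> fchains (d - 1) (subtopology M (topspace M - {y}))"
    unfolding fboundary_realize[OF d conjunct1[OF assms[unfolded cycle_at_def]]]
  proof (rule fchains_sum)
    fix S assume S: "S \<in> {S \<in> \<Delta>. card S = d}"
    show "Poly_Mapping.single (face_simplex S) (simplicial_bd r V c S) \<in> fchains (d - 1) (subtopology M (topspace M - {y}))"
    proof (cases "supp y \<subseteq> S")
      case True
      then have "simplicial_bd r V c S = 0" using assms d S by (auto simp: cycle_at_def)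
      then show ?thesis by (simp add: fchains_0)
    next
      case False
      then show ?thesis using S d by (intro face_simplex_avoids) auto
    qed
  qed
  then show ?thesis using realize_chain by (simp add: frelcycles_def)
qed

lemma realize_at_interior:
  assumes F: "F \<in> facets" and y: "supp y = F"
  shows "realize c - Poly_Mapping.single (face_simplex F) (c F) \<in> Bd y"
proof (rule frelboundaries_chains)
  have "realize c - Poly_Mapping.single (face_simplex F) (c F)
     = (\<Sum>G\<in>facets - {F}. Poly_Mapping.single (face_simplex G) (c G))"
    unfolding realize_def sum.remove[OF finite_facets F, of "\<lambda>F. Poly_Mapping.single (face_simplex F) (c F)"] by simp
  also have "\<dots> \<in> fchains d (subtopology M (topspace M - {y}))"
  proof (rule fchains_sum)
    fix G assume G: "G \<in> facets - {F}"
    then have "\<not> supp y \<subseteq> G" using facet_maximal[OF F, of G] y by (auto simp: facets_def)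
    then show "Poly_Mapping.single (face_simplex G) (c G) \<in> fchains d (subtopology M (topspace M - {y}))"
      using G by (intro face_simplex_avoids) (auto simp: facets_def)
  qed
  finally show "realize c - Poly_Mapping.single (face_simplex F) (c F) \<in> fchains d (subtopology M (topspace M - {y}))" .
qed

lemma facet_class_nonzero:
  fixes a :: "'k::field"
  assumes "F \<in> facets" "y \<in> topspace M" "supp y = F" "Poly_Mapping.single (face_simplex F) a \<in> Bd y"
  shows "a = 0"
  using face_class_nonzero[of F d y a] assms facet_maximal[OF assms(1)] by (simp add: facets_def)

lemma facet_nonempty: "F \<in> facets \<Longrightarrow> F \<in> \<Delta> \<and> F \<noteq> {}"
  by (auto simp: facets_def)

end

subsection \<open>Cycles on oriented manifolds\<close>

lemma connectedin_locally_constant: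
  assumes S: "connectedin X S"
    and loc: "\<And>y. y \<in> S \<Longrightarrow> \<exists>U. openin X U \<and> y \<in> U \<and> (\<forall>y'\<in>U \<inter> S. f y' = f y)"
    and yz: "y \<in> S" "z \<in> S"
  shows "f y = f z"
proof (rule ccontr)
  assume neq: "f y \<noteq> f z"
  define A where "A = \<Union>{U. openin X U \<and> (\<forall>y'\<in>U \<inter> S. f y' = f z)}"
  define B where "B = \<Union>{U. openin X U \<and> (\<forall>y'\<in>U \<inter> S. f y' \<noteq> f z)}"
  have AB: "openin X A" "openin X B" unfolding A_def B_def by blast+
  have A: "x \<in> A" if x: "x \<in> S" "f x = f z" for x
  proof -
    obtain U where "openin X U" "x \<in> U" "\<forall>y'\<in>U \<inter> S. f y' = f x" using loc[OF x(1)] by blast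
    then show ?thesis unfolding A_def using x(2) by (intro UnionI[of U]) simp_all
  qed
  have B: "x \<in> B" if x: "x \<in> S" "f x \<noteq> f z" for x
  proof -
    obtain U where "openin X U" "x \<in> U" "\<forall>y'\<in>U \<inter> S. f y' = f x" using loc[OF x(1)] by blast
    then show ?thesis unfolding B_def using x(2) by (intro UnionI[of U]) simp_all
  qed
  have "S \<subseteq> A \<union> B" using A B by blast
  moreover have "A \<inter> B \<inter> S = {}" unfolding A_def B_def by blast
  moreover have "A \<inter> S \<noteq> {}" "B \<inter> S \<noteq> {}" using A[OF yz(2) refl] B[OF yz(1) neq] yz by blast+
  ultimately show False using S AB unfolding connectedin by blast
qed

locale oriented_triangulation = triangulated_manifold \<Delta> M h g r d
  for \<Delta> :: "'v set set" and M :: "'a topology" and h g r d +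
  fixes \<mu> :: "'a \<Rightarrow> ('a, 'k::field) fchain"
  assumes orientation: "orientation d M \<mu>"
begin

text \<open>At \<open>y\<close> the class is a multiple \<open>a\<close> of the generator. The chain
  \<open>c0\<close> represents the orientation at all points near \<open>y\<close>, and its
  comparison with \<open>realize c\<close> persists near \<open>y\<close> by
  \<open>frelboundaries_open\<close>.\<close>

lemma realize_locally_oriented:
  fixes c :: "'v set \<Rightarrow> 'k"
  assumes c: "cycle_at c y" and y: "y \<in> topspace M"
  shows "\<exists>a U. openin M U \<and> y \<in> U \<and> (\<forall>y'\<in>U. realize c - fscale a (\<mu> y') \<in> Bd y')"
proof -
  obtain U c0 where U: "openin M U" "y \<in> U" and c0: "\<And>y'. y' \<in> U \<Longrightarrow> c0 - \<mu> y' \<in> Bd y'"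
    using orientation y unfolding orientation_def by blast
  have "local_orientation d M y (\<mu> y)" using orientation y unfolding orientation_def by blast
  then obtain a where a: "realize c - fscale a (\<mu> y) \<in> Bd y"
    using realize_relcycle[OF c] unfolding local_orientation_def by blast
  have "realize c - fscale a c0 = (realize c - fscale a (\<mu> y)) - fscale a (c0 - \<mu> y)"
    by (simp add: fscale_simps)
  also have "\<dots> \<in> Bd y" by (intro frelboundaries_diff frelboundaries_scale a c0 U)
  finally have "\<exists>W. openin M W \<and> y \<in> W \<and> (\<forall>y'\<in>W. realize c - fscale a c0 \<in> Bd y')"
    by (rule frelboundaries_open[OF Hausdorff y])
  then obtain W where W: "openin M W" "y \<in> W" "\<And>y'. y' \<in> W \<Longrightarrow> realize c - fscale a c0 \<in> Bd y'" by blast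
  have "realize c - fscale a (\<mu> y') \<in> Bd y'" if y': "y' \<in> U \<inter> W" for y'
  proof -
    have "realize c - fscale a (\<mu> y') = (realize c - fscale a c0) + fscale a (c0 - \<mu> y')"
      by (simp add: fscale_simps)
    also have "\<dots> \<in> Bd y'" using y' by (intro frelboundaries_add frelboundaries_scale W c0) auto
    finally show ?thesis .
  qed
  then show ?thesis using U W by (intro exI[of _ a] exI[of _ "U \<inter> W"]) auto
qed

lemma cycle_at_facet:
  assumes "F \<in> facets" "supp y = F"
  shows "cycle_at (\<lambda>G. if G = F then 1 else 0) y"
proof -
  have "\<not> F \<subseteq> S" if "S \<in> \<Delta>" "card S = d" for S
    using that assms(1) card_mono[OF finite_face, of S F] by (auto simp: facets_def)
  then show ?thesis using assms by (auto simp: cycle_at_def simplicial_chains_def facets_def)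
qed

lemma facet_locally_oriented:
  assumes F: "F \<in> facets" and y: "y \<in> topspace M" "supp y = F"
  shows "\<exists>a U. openin M U \<and> y \<in> U \<and>
    (\<forall>y'\<in>U. supp y' = F \<longrightarrow> Poly_Mapping.single (face_simplex F) 1 - fscale a (\<mu> y') \<in> Bd y')"
proof -
  let ?c = "\<lambda>G. if G = F then 1 else 0"
  obtain a U where U: "openin M U" "y \<in> U" "\<And>y'. y' \<in> U \<Longrightarrow> realize ?c - fscale a (\<mu> y') \<in> Bd y'"
    using realize_locally_oriented[OF cycle_at_facet[OF F y(2)] y(1)] by blast
  have "Poly_Mapping.single (face_simplex F) 1 - fscale a (\<mu> y') \<in> Bd y'" if y': "y' \<in> U" "supp y' = F" for y'
    using frelboundaries_diff[OF U(3)[OF y'(1)] realize_at_interior[OF F y'(2), of ?c]] by simp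
  then show ?thesis using U by blast
qed

text \<open>The class of the facet is a multiple of the orientation and is nonzero, so the
  orientation cannot vanish at \<open>y\<close>.\<close>

lemma orientation_nonzero:
  assumes F: "F \<in> facets" and y: "y \<in> topspace M" "supp y = F" and b: "fscale b (\<mu> y) \<in> Bd y"
  shows "b = 0"
proof (rule ccontr)
  assume "b \<noteq> 0"
  then have \<mu>: "\<mu> y \<in> Bd y" using frelboundaries_scale[OF b, of "inverse b"] by (simp add: fscale_simps)
  obtain a where a: "Poly_Mapping.single (face_simplex F) 1 - fscale a (\<mu> y) \<in> Bd y"
    using facet_locally_oriented[OF F y] y by blast
  have "Poly_Mapping.single (face_simplex F) (1 :: 'k) \<in> Bd y"
    using frelboundaries_add[OF a frelboundaries_scale[OF \<mu>, of a]] by simp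
  then show False using facet_class_nonzero[OF F y] by fastforce
qed

definition coefficient :: "'v set \<Rightarrow> 'a \<Rightarrow> 'k" where
  "coefficient F y = (THE a. Poly_Mapping.single (face_simplex F) 1 - fscale a (\<mu> y) \<in> Bd y)"

lemma coefficient_eq:
  assumes F: "F \<in> facets" and y: "y \<in> topspace M" "supp y = F"
    and a: "Poly_Mapping.single (face_simplex F) 1 - fscale a (\<mu> y) \<in> Bd y"
  shows "coefficient F y = a"
  unfolding coefficient_def
proof (rule the_equality[where P = "\<lambda>a. Poly_Mapping.single (face_simplex F) 1 - fscale a (\<mu> y) \<in> Bd y", OF a])
  fix b assume b: "Poly_Mapping.single (face_simplex F) 1 - fscale b (\<mu> y) \<in> Bd y"
  have "fscale (a - b) (\<mu> y) = (Poly_Mapping.single (face_simplex F) 1 - fscale b (\<mu> y))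
     - (Poly_Mapping.single (face_simplex F) 1 - fscale a (\<mu> y))"
    by (simp add: fscale_simps)
  also have "\<dots> \<in> Bd y" by (rule frelboundaries_diff[OF b a])
  finally show "b = a" using orientation_nonzero[OF F y] by fastforce
qed

definition facet_coefficient :: "'v set \<Rightarrow> 'k" where
  "facet_coefficient F = coefficient F (bary F)"

text \<open>The scalar is unique and locally constant on the open simplex of \<open>F\<close>, which
  is connected; its value at the barycentre serves everywhere.\<close>

lemma facet_coefficient:
  assumes F: "F \<in> facets" and y: "y \<in> topspace M" "supp y = F"
  shows "Poly_Mapping.single (face_simplex F) 1 - fscale (facet_coefficient F) (\<mu> y) \<in> Bd y"
proof -
  have F': "F \<in> \<Delta>" "F \<noteq> {}" using facet_nonempty[OF F] by auto
  have "coefficient F y = coefficient F (bary F)"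
  proof (rule connectedin_locally_constant[OF connected_interior[OF F'(1)]])
    fix y assume "y \<in> {y \<in> topspace M. supp y = F}"
    then have y: "y \<in> topspace M" "supp y = F" by auto
    obtain a U where U: "openin M U" "y \<in> U"
      "\<And>y'. y' \<in> U \<Longrightarrow> supp y' = F \<Longrightarrow> Poly_Mapping.single (face_simplex F) 1 - fscale a (\<mu> y') \<in> Bd y'"
      using facet_locally_oriented[OF F y] by blast
    have "coefficient F y' = a" if "y' \<in> U" "y' \<in> topspace M" "supp y' = F" for y'
      by (rule coefficient_eq[OF F that(2,3) U(3)[OF that(1,3)]])
    then show "\<exists>U. openin M U \<and> y \<in> U \<and> (\<forall>y'\<in>U \<inter> {y \<in> topspace M. supp y = F}. coefficient F y' = coefficient F y)"
      using U(1,2) y by (intro exI[of _ U]) simp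
  qed (use y bary[OF F'] in auto)
  moreover obtain a where "Poly_Mapping.single (face_simplex F) 1 - fscale a (\<mu> y) \<in> Bd y"
    using facet_locally_oriented[OF F y] y by blast
  ultimately show ?thesis using coefficient_eq[OF F y] by (simp add: facet_coefficient_def)
qed

lemma facet_coefficient_nonzero:
  assumes F: "F \<in> facets" shows "facet_coefficient F \<noteq> 0"
proof
  assume "facet_coefficient F = 0"
  have y: "bary F \<in> topspace M" "supp (bary F) = F" using bary facet_nonempty[OF F] by blast+
  have "Poly_Mapping.single (face_simplex F) (1 :: 'k) \<in> Bd (bary F)"
    using facet_coefficient[OF F y] \<open>facet_coefficient F = 0\<close> by (simp add: fscale_simps)
  then show False using facet_class_nonzero[OF F y] by fastforce
qed

text \<open>Near \<open>y\<close> the chain is \<open>a\<close> times the orientation. At a point in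
  the open simplex of \<open>F\<close> it is \<open>c F\<close> times the facet, that is,
  \<open>c F * facet_coefficient F\<close> times the orientation.\<close>

lemma cycle_locally_proportional:
  fixes c :: "'v set \<Rightarrow> 'k"
  assumes c: "cycle_at c y" and y: "y \<in> topspace M"
  shows "\<exists>a U. openin M U \<and> y \<in> U \<and>
    (\<forall>F\<in>facets. \<forall>y'\<in>U. supp y' = F \<longrightarrow> c F * facet_coefficient F = a)"
proof -
  obtain a U where U: "openin M U" "y \<in> U" and a: "\<And>y'. y' \<in> U \<Longrightarrow> realize c - fscale a (\<mu> y') \<in> Bd y'"
    using realize_locally_oriented[OF c y] by blast
  have "c F * facet_coefficient F = a" if F: "F \<in> facets" and y': "y' \<in> U" "supp y' = F" for F y'
  proof -
    have yM: "y' \<in> topspace M" using y'(1) openin_subset[OF U(1)] by blast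
    have "fscale (a - c F * facet_coefficient F) (\<mu> y') =
       ((realize c - Poly_Mapping.single (face_simplex F) (c F)) - (realize c - fscale a (\<mu> y')))
       + fscale (c F) (Poly_Mapping.single (face_simplex F) 1 - fscale (facet_coefficient F) (\<mu> y'))"
      by (simp add: fscale_simps)
    also have "\<dots> \<in> Bd y'"
      by (intro frelboundaries_add frelboundaries_diff frelboundaries_scale
          realize_at_interior[OF F y'(2)] a[OF y'(1)] facet_coefficient[OF F yM y'(2)])
    finally show ?thesis using orientation_nonzero[OF F yM y'(2)] by fastforce
  qed
  then show ?thesis using U by (intro exI[of _ a] exI[of _ U]) simp
qed

text \<open>Near each point one scalar \<open>a\<close> governs all facets. It is zero near
  \<open>v\<close>, and its vanishing is locally constant because every open set meets the open
  simplex of some facet; connectedness spreads it over \<open>M\<close>.\<close>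

lemma cycle_vanishes:
  fixes c :: "'v set \<Rightarrow> 'k"
  assumes conn: "connected_space M"
    and c: "c \<in> simplicial_chains d" "d \<ge> 1 \<Longrightarrow> (\<And>S. S \<subseteq> V \<Longrightarrow> card S = d \<Longrightarrow> simplicial_bd r V c S = 0)"
    and v: "v \<in> V" "\<And>F. v \<in> F \<Longrightarrow> c F = 0"
  shows "c F = 0"
proof (cases "F \<in> facets")
  case F: True
  have cyc: "cycle_at c y" for y using c face_V by (auto simp: cycle_at_def)
  define \<phi> where "\<phi> y \<longleftrightarrow> (\<exists>U. openin M U \<and> y \<in> U \<and> (\<forall>F\<in>facets. \<forall>y'\<in>U. supp y' = F \<longrightarrow> c F = 0))" for y
  have "\<phi> (bary {v}) = \<phi> (bary F)"
  proof (rule connectedin_locally_constant[where X = M and S = "topspace M"])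
    show "connectedin M (topspace M)" using conn by (simp add: connectedin_topspace)
    show "bary {v} \<in> topspace M" "bary F \<in> topspace M"
      using bary(1)[of "{v}"] vertex_face[OF v(1)] bary(1)[of F] facet_nonempty[OF F] by auto
    fix y assume y: "y \<in> topspace M"
    obtain U a where U: "openin M U" "y \<in> U"
      and a: "\<And>F y'. F \<in> facets \<Longrightarrow> y' \<in> U \<Longrightarrow> supp y' = F \<Longrightarrow> c F * facet_coefficient F = a"
      using cycle_locally_proportional[OF cyc y] by blast
    have "\<phi> y' \<longleftrightarrow> a = 0" if y': "y' \<in> U" for y'
    proof
      assume "a = 0"
      then have "\<forall>F\<in>facets. \<forall>y'\<in>U. supp y' = F \<longrightarrow> c F = 0" using a facet_coefficient_nonzero by fastforce
      then show "\<phi> y'" using U y' unfolding \<phi>_def by blast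
    next
      assume "\<phi> y'"
      then obtain W where W: "openin M W" "y' \<in> W" "\<And>F y'. F \<in> facets \<Longrightarrow> y' \<in> W \<Longrightarrow> supp y' = F \<Longrightarrow> c F = 0"
        unfolding \<phi>_def by blast
      have yM: "y' \<in> topspace M" using y' openin_subset[OF U(1)] by blast
      have ne: "supp y' \<noteq> {}"
      proof
        assume "supp y' = {}"
        then show False using sum_coord[OF yM _ supp_face[OF yM]] by simp
      qed
      obtain G where G: "G \<in> facets" "supp y' \<subseteq> G" using facet_superface[OF supp_face[OF yM] ne] by blast
      obtain y'' where "y'' \<in> U \<inter> W" "supp y'' = G"
        using interior_dense[OF yM openin_Int[OF U(1) W(1)], of G] y' W(2) G facet_nonempty[OF G(1)] by blast
      then show "a = 0" using a[OF G(1), of y''] W(3)[OF G(1), of y''] by simp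
    qed
    then show "\<exists>U. openin M U \<and> y \<in> U \<and> (\<forall>y'\<in>U \<inter> topspace M. \<phi> y' = \<phi> y)" using U by blast
  qed
  moreover have "\<phi> (bary {v})"
    unfolding \<phi>_def
  proof (intro exI conjI ballI impI)
    show "openin M {y \<in> topspace M. 0 < g y v}" by (rule open_coord_gt)
    have b: "bary {v} \<in> topspace M" "v \<in> supp (bary {v})" using bary[of "{v}"] vertex_face[OF v(1)] by auto
    then show "bary {v} \<in> {y \<in> topspace M. 0 < g y v}" using supp_pos by blast
    fix F y' assume "y' \<in> {y \<in> topspace M. 0 < g y v}" "supp y' = F"
    then have "v \<in> F" using supp_pos by blast
    then show "c F = 0" by (rule v(2))
  qed
  ultimately have "\<phi> (bary F)" by simp
  moreover have "supp (bary F) = F" using bary facet_nonempty[OF F] by blast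
  ultimately show ?thesis using F unfolding \<phi>_def by blast
next
  case False
  then show ?thesis using c(1) by (auto simp: simplicial_chains_def facets_def)
qed

text \<open>For a cycle on a connected manifold the product of its value and
  \<open>facet_coefficient\<close> should be constant; the constant is taken to be 1.\<close>

definition fundamental_cycle :: "'v set \<Rightarrow> 'k" where
  "fundamental_cycle F = (if F \<in> facets then 1 / facet_coefficient F else 0)"

lemma fundamental_cycle:
  assumes d: "d \<ge> 1" and S: "S \<subseteq> V" "card S = d"
  shows "simplicial_bd r V fundamental_cycle S = 0"
proof (cases "S \<in> \<Delta>")
  case False
  then have "insert x S \<notin> facets" for x using face_subset[of "insert x S" S] by (auto simp: facets_def)
  then show ?thesis by (simp add: simplicial_bd_def fundamental_cycle_def)
next
  case True
  have finS: "finite S" and S0: "S \<noteq> {}" using finite_face[OF True] S(2) d by auto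
  obtain x1 x2 where neq: "x1 \<noteq> x2" and x: "x1 \<in> V - S" "x2 \<in> V - S" and ins: "insert x1 S \<in> \<Delta>" "insert x2 S \<in> \<Delta>"
    by (rule two_cofacets[OF True S(2) d])
  define s where "s x = (koszul_sign r x S :: 'k)" for x
  have ss: "s x * s x = 1" for x by (simp add: s_def)
  \<comment> \<open>Two cofacets of \<open>S\<close> with signs that cancel at \<open>S\<close>: a
    relative cycle at the barycentre of \<open>S\<close>, whatever other cofacets there may
    be.\<close>
  define c where "c F = (if F = insert x1 S then s x1 else if F = insert x2 S then - s x2 else 0)" for F
  have facet: "insert x S \<in> facets" if "x \<in> V - S" "insert x S \<in> \<Delta>" for x
    using that finS S(2) by (simp add: facets_def)
  have ineq: "insert x S = insert x' S \<longleftrightarrow> x = x'" if "x \<in> V - S" for x x'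
    using that by auto
  have cyc: "cycle_at c (bary S)"
    unfolding cycle_at_def
  proof (intro conjI impI ballI)
    show "c \<in> simplicial_chains d"
      using facet x ins by (auto simp: simplicial_chains_def c_def facets_def)
    fix S' assume "S' \<in> \<Delta>" "card S' = d" "supp (bary S) \<subseteq> S'"
    then have S': "S' = S" using bary(3)[OF True S0] card_seteq[OF finite_face, of S' S] S(2) by simp
    have "simplicial_bd r V c S = (\<Sum>x\<in>V - S. (if x = x1 then 1 else 0) + (if x = x2 then - 1 else 0))"
      unfolding simplicial_bd_def
    proof (rule sum.cong[OF refl])
      fix x assume x: "x \<in> V - S"
      show "koszul_sign r x S * c (insert x S) = (if x = x1 then 1 else 0) + (if x = x2 then - 1 else 0)"
        unfolding c_def ineq[OF x] s_def[symmetric] using neq ss by auto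
    qed
    also have "\<dots> = 0" using x finite_V by (simp add: sum.distrib)
    finally show "simplicial_bd r V c S' = 0" using S' by simp
  qed
  obtain U a where U: "openin M U" "bary S \<in> U"
    and a: "\<And>F y'. F \<in> facets \<Longrightarrow> y' \<in> U \<Longrightarrow> supp y' = F \<Longrightarrow> c F * facet_coefficient F = a"
    using cycle_locally_proportional[OF cyc bary(1)[OF True S0]] by blast
  have ca: "c (insert x S) * facet_coefficient (insert x S) = a" if "x \<in> V - S" "insert x S \<in> \<Delta>" for x
  proof -
    have "\<exists>y'\<in>U. supp y' = insert x S"
      using bary(3)[OF True S0] by (intro interior_dense[OF bary(1)[OF True S0] U that(2)]) auto
    then show ?thesis using a[OF facet[OF that]] by blast
  qed
  have 1: "s x1 * facet_coefficient (insert x1 S) = a" using ca[OF x(1) ins(1)] by (simp add: c_def)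
  have 2: "- s x2 * facet_coefficient (insert x2 S) = a" using ca[OF x(2) ins(2)] neq ineq[OF x(2)] by (simp add: c_def)
  have "s x1 \<noteq> 0" using ss[of x1] by auto
  then have a0: "a \<noteq> 0" using 1 facet_coefficient_nonzero[OF facet[OF x(1) ins(1)]] by auto
  have "facet_coefficient (insert x1 S) = s x1 * a" unfolding 1[symmetric] by (simp add: mult.assoc[symmetric] ss)
  then have z1: "s x1 * fundamental_cycle (insert x1 S) = 1 / a"
    using facet[OF x(1) ins(1)] \<open>s x1 \<noteq> 0\<close> by (simp add: fundamental_cycle_def)
  have s2: "s x2 \<noteq> 0" using ss[of x2] by auto
  have "facet_coefficient (insert x2 S) = - s x2 * a" unfolding 2[symmetric] by (simp add: mult.assoc[symmetric] ss)
  then have z2: "s x2 * fundamental_cycle (insert x2 S) = - 1 / a"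
    using facet[OF x(2) ins(2)] s2 by (simp add: fundamental_cycle_def)
  \<comment> \<open>At a third cofacet \<open>c\<close> is zero, which would force
    \<open>a = 0\<close>; so only the two chosen cofacets contribute.\<close>
  have z: "s x * fundamental_cycle (insert x S) = 0" if "x \<in> V - S" "x \<noteq> x1" "x \<noteq> x2" for x
  proof -
    have "insert x S \<notin> \<Delta>"
    proof
      assume "insert x S \<in> \<Delta>"
      from ca[OF that(1) this] show False using that ineq[OF that(1)] a0 by (simp add: c_def)
    qed
    then show ?thesis by (simp add: fundamental_cycle_def facets_def)
  qed
  have "simplicial_bd r V fundamental_cycle S
      = (\<Sum>x\<in>V - S. (if x = x1 then 1 / a else 0) + (if x = x2 then - 1 / a else 0))"
    unfolding simplicial_bd_def s_def[symmetric] by (rule sum.cong) (use z z1 z2 neq in auto)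
  also have "\<dots> = 0" using x finite_V by (simp add: sum.distrib)
  finally show ?thesis .
qed

lemma fundamental_cycle_at_vertex:
  assumes "v \<in> V"
  obtains F where "v \<in> F" "fundamental_cycle F \<noteq> 0"
proof -
  obtain F where F: "F \<in> facets" "{v} \<subseteq> F" using facet_superface[OF vertex_face[OF assms]] by blast
  then show thesis using that facet_coefficient_nonzero by (simp add: fundamental_cycle_def)
qed

lemma fundamental_cycle_chain: "fundamental_cycle \<in> simplicial_chains d"
  by (simp add: simplicial_chains_def fundamental_cycle_def facets_def)

end

theorem theorem4p5:
  fixes \<Delta> :: "'v set set" and M :: "'a topology" and d :: nat
  assumes "topological_manifold d M"
    and "connected_space M"
    and "orientable_over TYPE('k::field) d M"
    and "triangulates \<Delta> M"
    and "golod (\<Union>\<Delta>) (stanley_reisner_ideal \<Delta> :: ('v, 'k) mpoly set)"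
  shows "two_neighborly \<Delta>"
proof -
  interpret simplicial_complex \<Delta> using assms(4) by unfold_locales (simp add: triangulates_def)
  obtain h g where homeo: "homeomorphic_maps (geometric_realization \<Delta>) M h g"
    using assms(4) unfolding triangulates_def homeomorphic_space_def by blast
  obtain \<mu> :: "'a \<Rightarrow> ('a, 'k) fchain" where \<mu>: "orientation d M \<mu>"
    using assms(3) unfolding orientable_over_def by blast
  interpret oriented_triangulation \<Delta> M h g "to_nat_on V" d \<mu>
    by unfold_locales (use homeo assms(1) \<mu> finite_V in \<open>auto intro: inj_on_to_nat_on countable_finite\<close>)
  show ?thesis
    unfolding two_neighborly_def
  proof (intro ballI, rule ccontr)
    fix u v assume uv: "u \<in> V" "v \<in> V" "{u, v} \<notin> \<Delta>"
    then have neq: "u \<noteq> v" using vertex_face[of u] by auto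
    show False
    proof (cases "d \<ge> 1")
      case False
      \<comment> \<open>In dimension 0 a single point is already a cycle; it vanishes at
        \<open>v\<close>, which connectedness forbids.\<close>
      define c where "c F = (if F = {u} then 1 else 0 :: 'k)" for F
      have "c {u} = 0"
      proof (rule cycle_vanishes[OF assms(2) _ _ uv(2)])
        show "c \<in> simplicial_chains d"
          using False vertex_face[OF uv(1)] by (auto simp: simplicial_chains_def c_def)
        show "c F = 0" if "v \<in> F" for F using that neq by (auto simp: c_def)
      qed (use False in simp)
      then show False by (simp add: c_def)
    next
      case d: True
      obtain \<beta> D e T \<xi> h' \<zeta> where sr: "sr_resolution \<Delta> (to_nat_on V) \<beta> D (e :: nat \<Rightarrow> 'k)"
        and T: "\<And>s. field_space.basis_mod (\<lambda>a (x :: nat \<Rightarrow> 'k) b. a * x b)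
          (koszul_resolution.Zt const_coeff \<beta> D s) (koszul_resolution.Bt const_coeff \<beta> D s) (T s) (\<xi> s)"
        and h': "\<And>i. field_space.basis_mod (\<lambda>a (c :: 'v set \<Rightarrow> ('v, 'k) mpoly) F. Const a * c F)
          (koszul_resolution.Zk V (to_nat_on V) (nonfaces \<Delta>) Var i)
          (koszul_resolution.Bk V (to_nat_on V) (nonfaces \<Delta>) Var i) (h' i) (\<zeta> i)"
        and eq: "\<And>N. T N = (card V choose N) + (\<Sum>q=2..N. h' (q - 1) * T (N - q))"
        using golod_data[OF assms(5)] by blast
      interpret R: sr_resolution \<Delta> "to_nat_on V" \<beta> D e by (rule sr)
      obtain F0 where F0: "u \<in> F0" "fundamental_cycle F0 \<noteq> 0" using fundamental_cycle_at_vertex[OF uv(1)] by blast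
      show False
      proof (rule R.golod_contradiction[where h = h' and T = T, OF h' T _ uv d fundamental_cycle_chain _ F0])
        show "T N = (card V choose N) + (\<Sum>q=2..N. h' (q - 1) * T (N - q))" for N by (rule eq)
        show "simplicial_bd (to_nat_on V) V fundamental_cycle F = 0" if "F \<subseteq> V" "card F = d" for F
          by (rule fundamental_cycle[OF d that])
        show "c F0 = 0" if "c \<in> simplicial_chains d"
          "\<And>F. F \<subseteq> V \<Longrightarrow> card F = d \<Longrightarrow> simplicial_bd (to_nat_on V) V c F = 0"
          "\<And>F. v \<in> F \<Longrightarrow> c F = 0" for c :: "'v set \<Rightarrow> 'k"
          by (rule cycle_vanishes[OF assms(2) that(1) that(2) uv(2) that(3)])
      qed
    qed
  qed
qed

end
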